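(* Let $(\mathcal X,\Gamma)$ be a topological local diffusion space, and let $\mu$ be a probability measure on $(\Upsilon,\Sigma_{\mathrm v})$, concentrated on configurations with infinitely many points, which is marginally absolutely continuous and satisfies the closability assumption. Let $\mathfrak l$ be a fixed labeling map and $\mu^{[\infty]}=\mathfrak l_\#\mu$. Then $$\Gamma^{\Upsilon,\mu}(u)\circ\mathfrak L=\Gamma^{[\infty]}(\mathfrak L^*u)\qquad \mu^{[\infty]}\text{-a.e.}$$ for every strong lifting $\ell$ and all $u\in\mathscr D(\Gamma^{\Upsilon,\mu})=\mathscr D(\mathcal E^{\Upsilon,\mu})\cap L^\infty(\mu)$, and $$\mathcal E^{\Upsilon,\mu}(u)=\mathcal E^{[\infty]}(\mathfrak L^*u)\qquad\text{for all }u\in\mathscr D(\mathcal E^{\Upsilon,\mu}).$$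
   Context: A topological local structure $\mathcal X=(X,\tau,\Sigma,\mathsf m,\mathscr E)$ consists of a non-empty completely regular Hausdorff Luzin space $(X,\tau)$ (a continuous bijective image of a Polish space), a $\sigma$-algebra $\Sigma$ with $\mathscr B_\tau\subset\Sigma\subset\mathscr B_\tau^{\mathsf m}$ (Borel $\sigma$-algebra and its $\mathsf m$-completion) that contains all singletons and is, up to $\mathsf m$-null sets, countably generated, a $\sigma$-finite atomless Radon measure $\mathsf m$ on $\Sigma$ with full $\tau$-support, and a localizing ring $\mathscr E$: a family $\mathscr E\subset\{A\in\Sigma:\mathsf mA<\infty\}$ closed under finite unions and intersections, with $A\cap E\in\mathscr E$ for $A\in\Sigma$, $E\in\mathscr E$, such that $\mathscr E=\bigcup_h\{A\cap E_h:A\in\Sigma\}$ for some sequence $E_h\uparrow X$ in $\Sigma$ with $\mathsf mE_h<\infty$, and such that every $x\in X$ has a $\tau$-neighbourhood in $\mathscr E$. $\mathcal C_0(\mathscr E)$ (resp. $\Sigma_b(\mathscr E)$) is the space of bounded $\tau$-continuous (resp. bounded $\Sigma$-measurable) real functions vanishing outside some $E\in\mathscr E$. $\mathcal C_b^\infty(\mathbb R^k)$ is the space of bounded smooth functions with bounded derivatives of all orders. A topological local diffusion space $(\mathcal X,\Gamma)$ is a topological local structure with a square field operator $(\Gamma,\mathcal D)$: $\mathcal D\subset\mathcal C_0(\mathscr E)$ is an algebra generating $\tau$ (functions identified with their $\mathsf m$-classes) with $\varphi\circ\mathbf f-\varphi(0)\in\mathcal D$ for $\mathbf f\in\mathcal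 D^k$, $\varphi\in\mathcal C_b^\infty(\mathbb R^k)$; $\Gamma:\mathcal D\times\mathcal D\to L^\infty(\mathsf m)$ is symmetric, bilinear, non-negative definite, takes values in $\mathsf m$-classes of functions in $\Sigma_b(\mathscr E)$, and satisfies $\Gamma(\varphi\circ\mathbf f-\varphi(0),\psi\circ\mathbf g-\psi(0))=\sum_{i,j}(\partial_i\varphi)(\mathbf f)(\partial_j\psi)(\mathbf g)\Gamma(f_i,g_j)$ $\mathsf m$-a.e.; the form $\int\Gamma(f,g)\,d\mathsf m$ on $\mathcal D$ is closable and densely defined in $L^2(\mathsf m)$, and its closure $\mathcal E^{X,\mathsf m}$ is a quasi-regular Dirichlet form, with square field operator $\Gamma^{X,\mathsf m}$ extending $\Gamma$ (also extended to bounded functions in the extended Dirichlet space). A strong lifting $\ell:L^\infty(\mathsf m)\to\mathcal L^\infty(\mathsf m)$ (bounded $\Sigma$-measurable functions) is a linear, multiplicative, order preserving map with $\ell(1)=1$, $[\ell(f)]_{\mathsf m}=f$, $\ell(\varphi)=\varphi$ for $\varphi\in\mathcal C_b(X)$; such maps exist. $\Upsilon$ is the set of all $\gamma=\sum_{i\le N}\delta_{x_i}$, $N\in\mathbb N_0\cup\{\infty\}$, $x_i\in X$ (repetitions allowed), with $\gamma E<\infty$ for all $E\in\mathscr E$; $\Sigma_{\mathrm v}$ is generated by $\gamma\mapsto\gamma E$, $E\in\mathscr E$. Put $f^\star\gamma=\int f\,d\gamma$. $\mathrm{Cyl}(\mathcal D)$ is the space of functions $u=F(f_1^\star,\dots,f_k^\star)$,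 $F\in\mathcal C_b^\infty(\mathbb R^k)$, $f_i\in\mathcal D$. For $u=F(f_1^\star,\dots,f_k^\star)$, $v=G(g_1^\star,\dots,g_m^\star)$, $\Gamma^\Upsilon(u,v)(\gamma)=\sum_{i,j}\partial_iF(f_1^\star\gamma,\dots)\,\partial_jG(g_1^\star\gamma,\dots)\int\ell(\Gamma(f_i,g_j))\,d\gamma$. Closability assumption on $\mu$: $\int\gamma E\,d\mu<\infty$ for all $E\in\mathscr E$, and the pre-Dirichlet form $\mathcal E^{\Upsilon,\mu}(u,v)=\int\Gamma^\Upsilon(u,v)\,d\mu$ on $\mu$-classes of cylinder functions is closable on $L^2(\mu)$. Its closure is $(\mathcal E^{\Upsilon,\mu},\mathscr D(\mathcal E^{\Upsilon,\mu}))$, with square field operator $\Gamma^{\Upsilon,\mu}$. $\mathbf X_{\mathrm{lcf}}$ is the set of finite or infinite sequences $\mathbf x=(x_i)_{i\le N}$ in $X$ (including the empty one) with $\#\{i:x_i\in E\}<\infty$ for all $E\in\mathscr E$, and $\mathbf X^{[\infty]}_{\mathrm{lcf}}$ its subset of infinite sequences; $\mathfrak L(\mathbf x)=\sum_i\delta_{x_i}$, $\mathfrak L^*u=u\circ\mathfrak L$. A labeling map is a $\Sigma_{\mathrm v}^\mu$/Borel-measurable right inverse $\mathfrak l:\Upsilon\to\mathbf X_{\mathrm{lcf}}$ of $\mathfrak L$ ($\Sigma_{\mathrm v}^\mu$ the $\mu$-completion). $\mathrm{tr}^n$ maps a sequence to its first $n$ entries. $\mu$ is marginally absolutely continuous if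 for every labeling map $\mathfrak l$ and every $n\in\mathbb N$, $(\mathrm{tr}^n\circ\mathfrak l)_\#(\mu|_{\{\gamma X\ge n\}})\ll\mathsf m^{\otimes n}$. For $U:\mathbf X^{[\infty]}_{\mathrm{lcf}}\to\mathbb R$ bounded, measurable w.r.t. $\bigcap_{\mathfrak l}$ (completion of the Borel $\sigma$-algebra of $X^\infty$ w.r.t. $\mathfrak l_\#\mu$), let $U_{\mathbf x,p}(z)=U(x_1,\dots,x_{p-1},z,x_{p+1},\dots)$ and, for $N\in\mathbb N\cup\{\infty\}$, $\Gamma^{[N]}(U)(\mathbf x)=\sum_{p\le N}\ell(\Gamma^{X,\mathsf m}(U_{\mathbf x,p}))(x_p)$, whenever this makes sense, with bilinear version by polarization. $U$ is pre-Sobolev if $\|\,|U|+\Gamma^{[\infty]}(U)^{1/2}\|_{L^2(\mathfrak l_\#\mu)}\le M$ for some $M$ and all labeling maps $\mathfrak l$. On $\mu^{[\infty]}$-classes of pre-Sobolev functions set $\mathcal E^{[N]}(U,V)=\int\Gamma^{[N]}(U,V)\,d\mu^{[\infty]}$ (well defined on classes); $K_N$ is the abstract Hilbert completion of this space w.r.t. the norm $(\mathcal E^{[N]}(U)+\|U\|^2_{L^2(\mu^{[\infty]})})^{1/2}$. For $u\in\mathrm{Cyl}(\mathcal D)$ the function $\mathfrak L^*u$ is pre-Sobolev. For $u\in\mathscr D(\mathcal E^{\Upsilon,\mu})$, $\mathfrak L^*u$ is the element of $K_\infty$ obtained by continuous extension of $\mathfrak L^*$ from cylinder functions, and $\Gamma^{[\infty]}$,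 $\mathcal E^{[\infty]}$ denote the continuous extensions to $K_\infty$. *)

theory Defs
  imports "HOL-Probability.Probability"
begin

section \<open>Symmetric forms on \<open>L\<^sup>2\<close>\<close>

text \<open>
  Elements of \<open>L\<^sup>p(M)\<close> are represented by functions; everything below is compatible with
  equality almost everywhere.
\<close>

definition ess_bounded :: "'b measure \<Rightarrow> ('b \<Rightarrow> real) \<Rightarrow> bool" where
  "ess_bounded M f \<longleftrightarrow> (\<exists>C. AE x in M. \<bar>f x\<bar> \<le> C)"

definition Linf :: "'b measure \<Rightarrow> ('b \<Rightarrow> real) set" where
  "Linf M = {f \<in> borel_measurable M. ess_bounded M f}"

definition L2 :: "'b measure \<Rightarrow> ('b \<Rightarrow> real) set" where
  "L2 M = {f \<in> borel_measurable M. integrable M (\<lambda>x. (f x)\<^sup>2)}"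

definition L2_tendsto :: "'b measure \<Rightarrow> (nat \<Rightarrow> 'b \<Rightarrow> real) \<Rightarrow> ('b \<Rightarrow> real) \<Rightarrow> bool" where
  "L2_tendsto M fs f \<longleftrightarrow> (\<lambda>n. LINT x|M. (fs n x - f x)\<^sup>2) \<longlonglongrightarrow> 0"

definition L1_tendsto :: "'b measure \<Rightarrow> (nat \<Rightarrow> 'b \<Rightarrow> real) \<Rightarrow> ('b \<Rightarrow> real) \<Rightarrow> bool" where
  "L1_tendsto M fs f \<longleftrightarrow> (\<lambda>n. LINT x|M. \<bar>fs n x - f x\<bar>) \<longlonglongrightarrow> 0"

definition L2_dense :: "'b measure \<Rightarrow> ('b \<Rightarrow> real) set \<Rightarrow> bool" where
  "L2_dense M C \<longleftrightarrow>
     (\<forall>f\<in>L2 M. \<forall>e>0. \<exists>g\<in>C. (LINT x|M. (f x - g x)\<^sup>2) < e)"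

type_synonym 'b form = "('b \<Rightarrow> real) \<Rightarrow> ('b \<Rightarrow> real) \<Rightarrow> real"

definition form_cauchy :: "'b form \<Rightarrow> (nat \<Rightarrow> 'b \<Rightarrow> real) \<Rightarrow> bool" where
  "form_cauchy Q fs \<longleftrightarrow>
     (\<forall>e>0. \<exists>n0. \<forall>i\<ge>n0. \<forall>j\<ge>n0. Q (fs i - fs j) (fs i - fs j) < e)"

definition approx_seq ::
  "'b measure \<Rightarrow> ('b \<Rightarrow> real) set \<Rightarrow> 'b form \<Rightarrow> ('b \<Rightarrow> real) \<Rightarrow> (nat \<Rightarrow> 'b \<Rightarrow> real) \<Rightarrow> bool" where
  "approx_seq M C Q f fs \<longleftrightarrow> (\<forall>n. fs n \<in> C) \<and> form_cauchy Q fs \<and> L2_tendsto M fs f"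

text \<open>
  Taking constant sequences, closability also says that the form is well defined on
  \<open>M\<close>-classes of functions in \<open>C\<close>.
\<close>

definition closable :: "'b measure \<Rightarrow> ('b \<Rightarrow> real) set \<Rightarrow> 'b form \<Rightarrow> bool" where
  "closable M C Q \<longleftrightarrow>
     (\<forall>fs. approx_seq M C Q (\<lambda>_. 0) fs \<longrightarrow> (\<lambda>n. Q (fs n) (fs n)) \<longlonglongrightarrow> 0)"

definition closure_dom :: "'b measure \<Rightarrow> ('b \<Rightarrow> real) set \<Rightarrow> 'b form \<Rightarrow> ('b \<Rightarrow> real) set" where
  "closure_dom M C Q = {f \<in> L2 M. \<exists>fs. approx_seq M C Q f fs}"

definition closure_form :: "'b measure \<Rightarrow> ('b \<Rightarrow> real) set \<Rightarrow> 'b form \<Rightarrow> 'b form" where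
  "closure_form M C Q f g =
     (THE r. \<forall>fs gs. approx_seq M C Q f fs \<and> approx_seq M C Q g gs \<longrightarrow>
        (\<lambda>n. Q (fs n) (gs n)) \<longlonglongrightarrow> r)"

definition form1 :: "'b measure \<Rightarrow> 'b form \<Rightarrow> ('b \<Rightarrow> real) \<Rightarrow> real" where
  "form1 M Q f = Q f f + (LINT x|M. (f x)\<^sup>2)"

definition dirichlet_form :: "'b measure \<Rightarrow> ('b \<Rightarrow> real) set \<Rightarrow> 'b form \<Rightarrow> bool" where
  "dirichlet_form M Dom Q \<longleftrightarrow>
     Dom \<subseteq> L2 M \<and> L2_dense M Dom \<and>
     (\<forall>f\<in>Dom. \<forall>g\<in>Dom. (\<lambda>x. f x + g x) \<in> Dom) \<and> (\<forall>f\<in>Dom. \<forall>c. (\<lambda>x. c * f x) \<in> Dom) \<and>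
     (\<forall>f\<in>Dom. \<forall>g\<in>Dom. Q f g = Q g f) \<and>
     (\<forall>f\<in>Dom. \<forall>g\<in>Dom. \<forall>h\<in>Dom. Q (\<lambda>x. f x + g x) h = Q f h + Q g h) \<and>
     (\<forall>f\<in>Dom. \<forall>g\<in>Dom. \<forall>c. Q (\<lambda>x. c * f x) g = c * Q f g) \<and>
     (\<forall>f\<in>Dom. 0 \<le> Q f f) \<and>
     (\<forall>fs. \<forall>f\<in>L2 M. approx_seq M Dom Q f fs \<longrightarrow>
        f \<in> Dom \<and> (\<lambda>n. Q (fs n - f) (fs n - f)) \<longlonglongrightarrow> 0) \<and>
     (\<forall>f\<in>Dom. (\<lambda>x. max 0 (min (f x) 1)) \<in> Dom \<and>
        Q (\<lambda>x. max 0 (min (f x) 1)) (\<lambda>x. max 0 (min (f x) 1)) \<le> Q f f)"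

text \<open>
  The square field operator (carre du champ) of a Dirichlet form, on \<open>Dom \<inter> L\<^sup>\<infinity>(M)\<close>, normalized
  so that \<open>Q f f\<close> is the integral of \<open>\<Gamma>(f)\<close>; the value is a version of the \<open>M\<close>-class.
\<close>

definition is_square_field ::
  "'b measure \<Rightarrow> ('b \<Rightarrow> real) set \<Rightarrow> 'b form \<Rightarrow> ('b \<Rightarrow> real) \<Rightarrow> ('b \<Rightarrow> real) \<Rightarrow> bool" where
  "is_square_field M Dom Q f g \<longleftrightarrow> integrable M g \<and>
     (\<forall>h\<in>Dom. ess_bounded M h \<longrightarrow>
        Q (\<lambda>x. f x * h x) f - Q (\<lambda>x. (f x)\<^sup>2) h / 2 = (LINT x|M. h x * g x))"

definition square_field ::
  "'b measure \<Rightarrow> ('b \<Rightarrow> real) set \<Rightarrow> 'b form \<Rightarrow> ('b \<Rightarrow> real) \<Rightarrow> 'b \<Rightarrow> real" where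
  "square_field M Dom Q f = (SOME g. is_square_field M Dom Q f g)"

definition extended_space :: "'b measure \<Rightarrow> ('b \<Rightarrow> real) set \<Rightarrow> 'b form \<Rightarrow> ('b \<Rightarrow> real) set" where
  "extended_space M Dom Q =
     {f. \<exists>fs. (\<forall>n. fs n \<in> Dom) \<and> form_cauchy Q fs \<and>
        (AE x in M. (\<lambda>n. fs n x) \<longlonglongrightarrow> f x)}"

text \<open>
  The square field operator on bounded functions in the extended Dirichlet space, together with
  the convention \<open>\<Gamma>(f + c) = \<Gamma>(f)\<close> for real constants \<open>c\<close>.  Constants need not lie in the
  extended Dirichlet space (transient case), but they do occur below: fixing all but one of
  the points in a cylinder function yields \<open>\<phi> \<circ> f = (\<phi> \<circ> f - \<phi>(0)) + \<phi>(0)\<close>, of which only the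
  first summand is in the domain of the form.
\<close>

definition ext_square_field_dom ::
  "'b measure \<Rightarrow> ('b \<Rightarrow> real) set \<Rightarrow> 'b form \<Rightarrow> ('b \<Rightarrow> real) set" where
  "ext_square_field_dom M Dom Q =
     {f. ess_bounded M f \<and> (\<exists>c. (\<lambda>x. f x - c) \<in> extended_space M Dom Q)}"

definition ext_square_field ::
  "'b measure \<Rightarrow> ('b \<Rightarrow> real) set \<Rightarrow> 'b form \<Rightarrow> ('b \<Rightarrow> real) \<Rightarrow> 'b \<Rightarrow> real" where
  "ext_square_field M Dom Q f =
     (SOME g. integrable M g \<and>
        (\<exists>c fs. (\<forall>n. fs n \<in> Dom \<and> ess_bounded M (fs n)) \<and> form_cauchy Q fs \<and>
           (AE x in M. (\<lambda>n. fs n x) \<longlonglongrightarrow> f x - c) \<and>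
           L1_tendsto M (\<lambda>n. square_field M Dom Q (fs n)) g))"

subsection \<open>Quasi-regularity\<close>

definition form_nest ::
  "'b topology \<Rightarrow> 'b measure \<Rightarrow> ('b \<Rightarrow> real) set \<Rightarrow> 'b form \<Rightarrow> (nat \<Rightarrow> 'b set) \<Rightarrow> bool" where
  "form_nest T M Dom Q F \<longleftrightarrow>
     (\<forall>k. closedin T (F k)) \<and> incseq F \<and>
     (\<forall>f\<in>Dom. \<forall>e>0. \<exists>k. \<exists>g\<in>Dom.
        (AE x in M. x \<notin> F k \<longrightarrow> g x = 0) \<and> form1 M Q (f - g) < e)"

definition exceptional ::
  "'b topology \<Rightarrow> 'b measure \<Rightarrow> ('b \<Rightarrow> real) set \<Rightarrow> 'b form \<Rightarrow> 'b set \<Rightarrow> bool" where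
  "exceptional T M Dom Q A \<longleftrightarrow>
     (\<exists>F. form_nest T M Dom Q F \<and> A \<subseteq> (\<Inter>k. topspace T - F k))"

definition quasi_continuous ::
  "'b topology \<Rightarrow> 'b measure \<Rightarrow> ('b \<Rightarrow> real) set \<Rightarrow> 'b form \<Rightarrow> ('b \<Rightarrow> real) \<Rightarrow> bool" where
  "quasi_continuous T M Dom Q f \<longleftrightarrow>
     (\<exists>F. form_nest T M Dom Q F \<and>
        (\<forall>k. continuous_map (subtopology T (F k)) euclideanreal f))"

definition quasi_regular ::
  "'b topology \<Rightarrow> 'b measure \<Rightarrow> ('b \<Rightarrow> real) set \<Rightarrow> 'b form \<Rightarrow> bool" where
  "quasi_regular T M Dom Q \<longleftrightarrow>
     (\<exists>F. form_nest T M Dom Q F \<and> (\<forall>k. compactin T (F k))) \<and>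
     (\<exists>S\<subseteq>Dom. (\<forall>f\<in>Dom. \<forall>e>0. \<exists>g\<in>S. form1 M Q (f - g) < e) \<and>
        (\<forall>f\<in>S. \<exists>f'. quasi_continuous T M Dom Q f' \<and> (AE x in M. f' x = f x))) \<and>
     (\<exists>u u' A. (\<forall>n::nat. u n \<in> Dom \<and> quasi_continuous T M Dom Q (u' n) \<and>
                 (AE x in M. u' n x = u n x)) \<and>
        exceptional T M Dom Q A \<and>
        (\<forall>x\<in>topspace T - A. \<forall>y\<in>topspace T - A. x \<noteq> y \<longrightarrow> (\<exists>n. u' n x \<noteq> u' n y)))"

section \<open>Bounded smooth functions\<close>

text \<open>
  Functions on \<open>\<real>\<^sup>k\<close> are functions of a sequence that depend on its first \<open>k\<close> entries only;
  for these, continuity in the product topology is continuity on \<open>\<real>\<^sup>k\<close>.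
\<close>

definition pd :: "nat \<Rightarrow> ((nat \<Rightarrow> real) \<Rightarrow> real) \<Rightarrow> (nat \<Rightarrow> real) \<Rightarrow> real" where
  "pd i F = (\<lambda>y. deriv (\<lambda>t. F (y(i := t))) (y i))"

definition Cb_smooth :: "nat \<Rightarrow> ((nat \<Rightarrow> real) \<Rightarrow> real) set" where
  "Cb_smooth k = {F. (\<forall>y z. (\<forall>i<k. y i = z i) \<longrightarrow> F y = F z) \<and>
     (\<forall>is. set is \<subseteq> {..<k} \<longrightarrow>
        continuous_on UNIV (foldr pd is F) \<and> bounded (range (foldr pd is F)) \<and>
        (\<forall>i<k. \<forall>y. (\<lambda>t. foldr pd is F (y(i := t))) differentiable (at (y i))))}"

section \<open>Topological local structures and diffusion spaces\<close>

definition borel_of :: "'b topology \<Rightarrow> 'b measure" where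
  "borel_of T = sigma (topspace T) {U. openin T U}"

text \<open>
  A Luzin space is a continuous bijective image of a Polish space; up to a bijection the
  Polish space may be taken on the same type.
\<close>

definition luzin_space :: "'b topology \<Rightarrow> bool" where
  "luzin_space T \<longleftrightarrow>
     (\<exists>(P :: 'b topology) h. completely_metrizable_space P \<and> second_countable P \<and>
        continuous_map P T h \<and> bij_betw h (topspace P) (topspace T))"

definition radon_measure :: "'b topology \<Rightarrow> 'b measure \<Rightarrow> bool" where
  "radon_measure T M \<longleftrightarrow>
     (\<forall>x\<in>topspace T. \<exists>U. openin T U \<and> x \<in> U \<and> emeasure M U < \<infinity>) \<and>
     (\<forall>A\<in>sets M. emeasure M A = (SUP K\<in>{K. compactin T K \<and> K \<subseteq> A}. emeasure M K))"

definition atomless :: "'b measure \<Rightarrow> bool" where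
  "atomless M \<longleftrightarrow>
     (\<forall>A\<in>sets M. 0 < emeasure M A \<longrightarrow>
        (\<exists>B\<in>sets M. B \<subseteq> A \<and> 0 < emeasure M B \<and> 0 < emeasure M (A - B)))"

record 'a local_structure =
  topo :: "'a topology"
  refm :: "'a measure"
  lring :: "'a set set"

abbreviation pts :: "('a, 'z) local_structure_scheme \<Rightarrow> 'a set" where
  "pts X \<equiv> topspace (topo X)"

definition localizing_ring :: "('a, 'z) local_structure_scheme \<Rightarrow> bool" where
  "localizing_ring X \<longleftrightarrow>
     lring X \<subseteq> {A \<in> sets (refm X). emeasure (refm X) A < \<infinity>} \<and>
     (\<forall>A\<in>lring X. \<forall>B\<in>lring X. A \<union> B \<in> lring X \<and> A \<inter> B \<in> lring X) \<and>
     (\<forall>A\<in>sets (refm X). \<forall>E\<in>lring X. A \<inter> E \<in> lring X) \<and>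
     (\<exists>Eh :: nat \<Rightarrow> 'a set. incseq Eh \<and> (\<Union>h. Eh h) = pts X \<and>
        (\<forall>h. Eh h \<in> sets (refm X) \<and> emeasure (refm X) (Eh h) < \<infinity>) \<and>
        lring X = (\<Union>h. {A \<inter> Eh h | A. A \<in> sets (refm X)})) \<and>
     (\<forall>x\<in>pts X. \<exists>E\<in>lring X. \<exists>U. openin (topo X) U \<and> x \<in> U \<and> U \<subseteq> E)"

definition topological_local_structure :: "('a, 'z) local_structure_scheme \<Rightarrow> bool" where
  "topological_local_structure X \<longleftrightarrow>
     pts X \<noteq> {} \<and> completely_regular_space (topo X) \<and> Hausdorff_space (topo X) \<and>
     luzin_space (topo X) \<and>
     space (refm X) = pts X \<and>
     sets (borel_of (topo X)) \<subseteq> sets (refm X) \<and>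
     sets (refm X) \<subseteq> sets (completion (restr_to_subalg (refm X) (borel_of (topo X)))) \<and>
     (\<forall>x\<in>pts X. {x} \<in> sets (refm X)) \<and>
     (\<exists>\<A>\<subseteq>sets (refm X). countable \<A> \<and>
        (\<forall>A\<in>sets (refm X). \<exists>B\<in>sigma_sets (pts X) \<A>.
           (A - B) \<union> (B - A) \<in> null_sets (refm X))) \<and>
     sigma_finite_measure (refm X) \<and> atomless (refm X) \<and> radon_measure (topo X) (refm X) \<and>
     (\<forall>U. openin (topo X) U \<and> U \<noteq> {} \<longrightarrow> 0 < emeasure (refm X) U) \<and>
     localizing_ring X"

definition C0_ring :: "('a, 'z) local_structure_scheme \<Rightarrow> ('a \<Rightarrow> real) set" where
  "C0_ring X = {f. continuous_map (topo X) euclideanreal f \<and> bounded (range f) \<and>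
     (\<exists>E\<in>lring X. \<forall>x. x \<notin> E \<longrightarrow> f x = 0)}"

definition Sb_ring :: "('a, 'z) local_structure_scheme \<Rightarrow> ('a \<Rightarrow> real) set" where
  "Sb_ring X = {f \<in> borel_measurable (refm X). bounded (range f) \<and>
     (\<exists>E\<in>lring X. \<forall>x. x \<notin> E \<longrightarrow> f x = 0)}"

record 'a diffusion_space = "'a local_structure" +
  core :: "('a \<Rightarrow> real) set"
  sqf :: "('a \<Rightarrow> real) \<Rightarrow> ('a \<Rightarrow> real) \<Rightarrow> 'a \<Rightarrow> real"

definition square_field_operator :: "'a diffusion_space \<Rightarrow> bool" where
  "square_field_operator X \<longleftrightarrow>
     core X \<subseteq> C0_ring X \<and> (\<lambda>_. 0) \<in> core X \<and>
     (\<forall>f\<in>core X. \<forall>g\<in>core X. (\<lambda>x. f x + g x) \<in> core X \<and> (\<lambda>x. f x * g x) \<in> core X) \<and>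
     (\<forall>f\<in>core X. \<forall>c. (\<lambda>x. c * f x) \<in> core X) \<and>
     topo X = topology_generated_by {{x \<in> pts X. f x \<in> U} | f U. f \<in> core X \<and> open U} \<and>
     (\<forall>k. \<forall>\<phi>\<in>Cb_smooth k. \<forall>f. (\<forall>i<k. f i \<in> core X) \<longrightarrow>
        (\<lambda>x. \<phi> (\<lambda>i. f i x) - \<phi> (\<lambda>_. 0)) \<in> core X) \<and>
     (\<forall>f\<in>core X. \<forall>g\<in>core X. sqf X f g \<in> borel_measurable (refm X) \<and>
        (\<exists>h\<in>Sb_ring X. AE x in refm X. sqf X f g x = h x)) \<and>
     (\<forall>f\<in>core X. \<forall>g\<in>core X. AE x in refm X. sqf X f g x = sqf X g f x) \<and>
     (\<forall>f\<in>core X. \<forall>g\<in>core X. \<forall>h\<in>core X.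
        AE x in refm X. sqf X (\<lambda>x. f x + g x) h x = sqf X f h x + sqf X g h x) \<and>
     (\<forall>f\<in>core X. \<forall>g\<in>core X. \<forall>c.
        AE x in refm X. sqf X (\<lambda>x. c * f x) g x = c * sqf X f g x) \<and>
     (\<forall>f\<in>core X. AE x in refm X. 0 \<le> sqf X f f x) \<and>
     (\<forall>k l. \<forall>\<phi>\<in>Cb_smooth k. \<forall>\<psi>\<in>Cb_smooth l. \<forall>f g.
        (\<forall>i<k. f i \<in> core X) \<and> (\<forall>j<l. g j \<in> core X) \<longrightarrow>
        (AE x in refm X.
           sqf X (\<lambda>x. \<phi> (\<lambda>i. f i x) - \<phi> (\<lambda>_. 0)) (\<lambda>x. \<psi> (\<lambda>j. g j x) - \<psi> (\<lambda>_. 0)) x =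
           (\<Sum>i<k. \<Sum>j<l. pd i \<phi> (\<lambda>i. f i x) * pd j \<psi> (\<lambda>j. g j x) * sqf X (f i) (g j) x)))"

definition pre_form :: "'a diffusion_space \<Rightarrow> 'a form" where
  "pre_form X f g = (LINT x|refm X. sqf X f g x)"

definition X_dom :: "'a diffusion_space \<Rightarrow> ('a \<Rightarrow> real) set" where
  "X_dom X = closure_dom (refm X) (core X) (pre_form X)"

definition X_form :: "'a diffusion_space \<Rightarrow> 'a form" where
  "X_form X = closure_form (refm X) (core X) (pre_form X)"

definition topological_local_diffusion_space :: "'a diffusion_space \<Rightarrow> bool" where
  "topological_local_diffusion_space X \<longleftrightarrow>
     topological_local_structure X \<and> square_field_operator X \<and>
     closable (refm X) (core X) (pre_form X) \<and> L2_dense (refm X) (core X) \<and>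
     dirichlet_form (refm X) (X_dom X) (X_form X) \<and>
     quasi_regular (topo X) (refm X) (X_dom X) (X_form X)"

definition X_gamma_dom :: "'a diffusion_space \<Rightarrow> ('a \<Rightarrow> real) set" where
  "X_gamma_dom X = ext_square_field_dom (refm X) (X_dom X) (X_form X)"

definition X_gamma :: "'a diffusion_space \<Rightarrow> ('a \<Rightarrow> real) \<Rightarrow> 'a \<Rightarrow> real" where
  "X_gamma X = ext_square_field (refm X) (X_dom X) (X_form X)"

text \<open>
  A lifting acts on representatives of classes in \<open>L\<^sup>\<infinity>\<close> and depends on the class only; its
  values matter only on the points of the space.
\<close>

definition strong_lifting ::
  "('a, 'z) local_structure_scheme \<Rightarrow> (('a \<Rightarrow> real) \<Rightarrow> 'a \<Rightarrow> real) \<Rightarrow> bool" where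
  "strong_lifting X L \<longleftrightarrow>
     (\<forall>f\<in>Linf (refm X). L f \<in> borel_measurable (refm X) \<and> bounded (L f ` pts X) \<and>
        (AE x in refm X. L f x = f x)) \<and>
     (\<forall>f\<in>Linf (refm X). \<forall>g\<in>Linf (refm X). (AE x in refm X. f x = g x) \<longrightarrow>
        (\<forall>x\<in>pts X. L f x = L g x)) \<and>
     (\<forall>f\<in>Linf (refm X). \<forall>g\<in>Linf (refm X). \<forall>x\<in>pts X.
        L (\<lambda>y. f y + g y) x = L f x + L g x \<and> L (\<lambda>y. f y * g y) x = L f x * L g x) \<and>
     (\<forall>f\<in>Linf (refm X). \<forall>c. \<forall>x\<in>pts X. L (\<lambda>y. c * f y) x = c * L f x) \<and>
     (\<forall>f\<in>Linf (refm X). \<forall>g\<in>Linf (refm X). (AE x in refm X. f x \<le> g x) \<longrightarrow>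
        (\<forall>x\<in>pts X. L f x \<le> L g x)) \<and>
     (\<forall>x\<in>pts X. L (\<lambda>_. 1) x = 1) \<and>
     (\<forall>\<phi>. continuous_map (topo X) euclideanreal \<phi> \<and> bounded (\<phi> ` pts X) \<longrightarrow>
        (\<forall>x\<in>pts X. L \<phi> x = \<phi> x))"

section \<open>Configurations and labeled configurations\<close>

text \<open>
  A finite or infinite sequence is a pair of its length \<open>N\<close> and a function on
  \<open>{i. i < N}\<close> (indices start at 0).  The measure \<open>\<Sum>\<^sub>i \<delta>(x\<^sub>i)\<close> on \<open>\<Sigma>\<close> is the image of the
  counting measure on the index set.
\<close>

definition idx :: "enat \<Rightarrow> nat set" where
  "idx N = {i. enat i < N}"

definition unlabel :: "('a, 'z) local_structure_scheme \<Rightarrow> enat \<times> (nat \<Rightarrow> 'a) \<Rightarrow> 'a measure" where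
  "unlabel X s = distr (count_space (idx (fst s))) (refm X) (snd s)"

definition Configs :: "('a, 'z) local_structure_scheme \<Rightarrow> 'a measure set" where
  "Configs X = {unlabel X (N, x) | N x. x \<in> idx N \<rightarrow>\<^sub>E pts X \<and>
     (\<forall>E\<in>lring X. emeasure (unlabel X (N, x)) E < \<infinity>)}"

definition config_algebra :: "('a, 'z) local_structure_scheme \<Rightarrow> 'a measure measure" where
  "config_algebra X = sigma (Configs X)
     {{\<gamma> \<in> Configs X. emeasure \<gamma> E \<in> B} | E B. E \<in> lring X \<and> B \<in> sets borel}"

definition lcf :: "('a, 'z) local_structure_scheme \<Rightarrow> (enat \<times> (nat \<Rightarrow> 'a)) set" where
  "lcf X = {(N, x). x \<in> idx N \<rightarrow>\<^sub>E pts X \<and> (\<forall>E\<in>lring X. finite {i \<in> idx N. x i \<in> E})}"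

definition lcf_inf :: "('a, 'z) local_structure_scheme \<Rightarrow> (nat \<Rightarrow> 'a) set" where
  "lcf_inf X = {x. (\<infinity>, x) \<in> lcf X}"

definition seq_topology ::
  "('a, 'z) local_structure_scheme \<Rightarrow> enat \<Rightarrow> (nat \<Rightarrow> 'a) topology" where
  "seq_topology X N = product_topology (\<lambda>_. topo X) (idx N)"

definition lcf_topology ::
  "('a, 'z) local_structure_scheme \<Rightarrow> (enat \<times> (nat \<Rightarrow> 'a)) topology" where
  "lcf_topology X = subtopology (sum_topology (seq_topology X) UNIV) (lcf X)"

type_synonym 'a labeling = "'a measure \<Rightarrow> enat \<times> (nat \<Rightarrow> 'a)"

definition labeling_map ::
  "('a, 'z) local_structure_scheme \<Rightarrow> 'a measure measure \<Rightarrow> 'a labeling \<Rightarrow> bool" where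
  "labeling_map X \<mu> l \<longleftrightarrow>
     l \<in> completion \<mu> \<rightarrow>\<^sub>M borel_of (lcf_topology X) \<and>
     (\<forall>\<gamma>\<in>Configs X. unlabel X (l \<gamma>) = \<gamma>)"

text \<open>
  The image under \<open>tr\<^sup>N \<circ> l\<close> of \<open>\<mu>\<close> restricted to configurations with at least \<open>N\<close> points.
  If \<open>\<mu>\<close>-a.e. configuration is infinite, then \<open>N = \<infinity>\<close> gives the image of \<open>\<mu>\<close> under \<open>l\<close>
  as a measure on the space of infinite sequences.
\<close>

definition label_law ::
  "('a, 'z) local_structure_scheme \<Rightarrow> 'a measure measure \<Rightarrow> 'a labeling \<Rightarrow> enat \<Rightarrow>
    (nat \<Rightarrow> 'a) measure" where
  "label_law X \<mu> l N =
     distr (restrict_space (completion \<mu>) {\<gamma>. ennreal_of_enat N \<le> emeasure \<gamma> (pts X)})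
       (borel_of (seq_topology X N)) (\<lambda>\<gamma>. restrict (snd (l \<gamma>)) (idx N))"

definition marginally_ac ::
  "('a, 'z) local_structure_scheme \<Rightarrow> 'a measure measure \<Rightarrow> bool" where
  "marginally_ac X \<mu> \<longleftrightarrow>
     (\<forall>l n. labeling_map X \<mu> l \<longrightarrow>
        (\<forall>B\<in>sets (borel_of (seq_topology X (enat n))).
           B \<in> null_sets (PiM (idx (enat n)) (\<lambda>_. refm X)) \<longrightarrow>
           B \<in> null_sets (label_law X \<mu> l (enat n))))"

section \<open>Cylinder functions and the form on configurations\<close>

definition star :: "('a \<Rightarrow> real) \<Rightarrow> 'a measure \<Rightarrow> real" where
  "star f \<gamma> = (LINT z|\<gamma>. f z)"

type_synonym 'a cyl_data = "nat \<times> ((nat \<Rightarrow> real) \<Rightarrow> real) \<times> (nat \<Rightarrow> 'a \<Rightarrow> real)"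

definition cyl_rep :: "'a diffusion_space \<Rightarrow> ('a measure \<Rightarrow> real) \<Rightarrow> 'a cyl_data \<Rightarrow> bool" where
  "cyl_rep X u = (\<lambda>(k, F, f). F \<in> Cb_smooth k \<and> (\<forall>i<k. f i \<in> core X) \<and>
     (\<forall>\<gamma>\<in>Configs X. u \<gamma> = F (\<lambda>i. star (f i) \<gamma>)))"

definition Cyl :: "'a diffusion_space \<Rightarrow> ('a measure \<Rightarrow> real) set" where
  "Cyl X = {u. \<exists>d. cyl_rep X u d}"

definition cyl_gamma_rep ::
  "'a diffusion_space \<Rightarrow> (('a \<Rightarrow> real) \<Rightarrow> 'a \<Rightarrow> real) \<Rightarrow> 'a cyl_data \<Rightarrow> 'a cyl_data \<Rightarrow>
    'a measure \<Rightarrow> real" where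
  "cyl_gamma_rep X L = (\<lambda>(k, F, f) (n, G, g) \<gamma>.
     \<Sum>i<k. \<Sum>j<n. pd i F (\<lambda>i. star (f i) \<gamma>) * pd j G (\<lambda>j. star (g j) \<gamma>) *
       star (L (sqf X (f i) (g j))) \<gamma>)"

text \<open>
  By the diffusion property and multiplicativity of strong liftings, the value does not depend on
  the chosen representations (up to a null set of configurations for the measures considered).
\<close>

definition cyl_gamma ::
  "'a diffusion_space \<Rightarrow> (('a \<Rightarrow> real) \<Rightarrow> 'a \<Rightarrow> real) \<Rightarrow> ('a measure \<Rightarrow> real) \<Rightarrow>
    ('a measure \<Rightarrow> real) \<Rightarrow> 'a measure \<Rightarrow> real" where
  "cyl_gamma X L u v =
     cyl_gamma_rep X L (SOME d. cyl_rep X u d) (SOME d. cyl_rep X v d)"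

definition cyl_form ::
  "'a diffusion_space \<Rightarrow> (('a \<Rightarrow> real) \<Rightarrow> 'a \<Rightarrow> real) \<Rightarrow> 'a measure measure \<Rightarrow> 'a measure form" where
  "cyl_form X L \<mu> u v = (LINT \<gamma>|\<mu>. cyl_gamma X L u v \<gamma>)"

definition closability_assumption ::
  "'a diffusion_space \<Rightarrow> (('a \<Rightarrow> real) \<Rightarrow> 'a \<Rightarrow> real) \<Rightarrow> 'a measure measure \<Rightarrow> bool" where
  "closability_assumption X L \<mu> \<longleftrightarrow>
     (\<forall>E\<in>lring X. (\<integral>\<^sup>+\<gamma>. emeasure \<gamma> E \<partial>\<mu>) < \<infinity>) \<and> closable \<mu> (Cyl X) (cyl_form X L \<mu>)"

definition U_dom ::
  "'a diffusion_space \<Rightarrow> (('a \<Rightarrow> real) \<Rightarrow> 'a \<Rightarrow> real) \<Rightarrow> 'a measure measure \<Rightarrow>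
    ('a measure \<Rightarrow> real) set" where
  "U_dom X L \<mu> = closure_dom \<mu> (Cyl X) (cyl_form X L \<mu>)"

definition U_form ::
  "'a diffusion_space \<Rightarrow> (('a \<Rightarrow> real) \<Rightarrow> 'a \<Rightarrow> real) \<Rightarrow> 'a measure measure \<Rightarrow> 'a measure form" where
  "U_form X L \<mu> = closure_form \<mu> (Cyl X) (cyl_form X L \<mu>)"

definition U_gamma ::
  "'a diffusion_space \<Rightarrow> (('a \<Rightarrow> real) \<Rightarrow> 'a \<Rightarrow> real) \<Rightarrow> 'a measure measure \<Rightarrow>
    ('a measure \<Rightarrow> real) \<Rightarrow> 'a measure \<Rightarrow> real" where
  "U_gamma X L \<mu> = square_field \<mu> (U_dom X L \<mu>) (U_form X L \<mu>)"

section \<open>Forms on infinite labeled configurations\<close>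

text \<open>
  The expression \<open>\<Gamma>\<^sup>[\<^sup>\<infinity>\<^sup>](U)(x)\<close> makes sense if every section of \<open>U\<close> is in the (extended) domain of
  the square field operator with value in \<open>L\<^sup>\<infinity>\<close>, so that the lifting applies, and the sum
  is finite.
\<close>

definition lab_gamma_defined ::
  "'a diffusion_space \<Rightarrow> (('a \<Rightarrow> real) \<Rightarrow> 'a \<Rightarrow> real) \<Rightarrow> ((nat \<Rightarrow> 'a) \<Rightarrow> real) \<Rightarrow>
    (nat \<Rightarrow> 'a) \<Rightarrow> bool" where
  "lab_gamma_defined X L U x \<longleftrightarrow>
     (\<forall>p. (\<lambda>z. U (x(p := z))) \<in> X_gamma_dom X \<and>
        ess_bounded (refm X) (X_gamma X (\<lambda>z. U (x(p := z))))) \<and>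
     summable (\<lambda>p. L (X_gamma X (\<lambda>z. U (x(p := z)))) (x p))"

definition lab_gamma ::
  "'a diffusion_space \<Rightarrow> (('a \<Rightarrow> real) \<Rightarrow> 'a \<Rightarrow> real) \<Rightarrow> ((nat \<Rightarrow> 'a) \<Rightarrow> real) \<Rightarrow>
    (nat \<Rightarrow> 'a) \<Rightarrow> real" where
  "lab_gamma X L U x = (\<Sum>p. L (X_gamma X (\<lambda>z. U (x(p := z)))) (x p))"

abbreviation lab_meas ::
  "'a diffusion_space \<Rightarrow> 'a measure measure \<Rightarrow> 'a labeling \<Rightarrow> (nat \<Rightarrow> 'a) measure" where
  "lab_meas X \<mu> l \<equiv> completion (label_law X \<mu> l \<infinity>)"

definition pre_sobolev ::
  "'a diffusion_space \<Rightarrow> 'a measure measure \<Rightarrow> (('a \<Rightarrow> real) \<Rightarrow> 'a \<Rightarrow> real) \<Rightarrow>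
    ((nat \<Rightarrow> 'a) \<Rightarrow> real) \<Rightarrow> bool" where
  "pre_sobolev X \<mu> L U \<longleftrightarrow>
     bounded (U ` lcf_inf X) \<and>
     (\<forall>l. labeling_map X \<mu> l \<longrightarrow>
        U \<in> borel_measurable (restrict_space (lab_meas X \<mu> l) (lcf_inf X))) \<and>
     (\<exists>M. \<forall>l. labeling_map X \<mu> l \<longrightarrow>
        (AE x in label_law X \<mu> l \<infinity>. lab_gamma_defined X L U x) \<and>
        (\<lambda>x. \<bar>U x\<bar> + sqrt (lab_gamma X L U x)) \<in> L2 (lab_meas X \<mu> l) \<and>
        sqrt (LINT x|lab_meas X \<mu> l. (\<bar>U x\<bar> + sqrt (lab_gamma X L U x))\<^sup>2) \<le> M)"

text \<open>
  The (upper) integral of \<open>\<Gamma>\<^sup>[\<^sup>\<infinity>\<^sup>](U)\<close>.  For pre-Sobolev \<open>U\<close> the integrand is measurable and this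
  is the ordinary integral; for differences of pre-Sobolev functions the upper integral gives the
  triangle inequality for the norm without a proof of measurability.
\<close>

definition upper_integral :: "'b measure \<Rightarrow> ('b \<Rightarrow> ennreal) \<Rightarrow> ennreal" where
  "upper_integral M f =
     (INF g\<in>{g \<in> borel_measurable M. AE x in M. f x \<le> g x}. \<integral>\<^sup>+x. g x \<partial>M)"

definition lab_form ::
  "'a diffusion_space \<Rightarrow> 'a measure measure \<Rightarrow> (('a \<Rightarrow> real) \<Rightarrow> 'a \<Rightarrow> real) \<Rightarrow> 'a labeling \<Rightarrow>
    ((nat \<Rightarrow> 'a) \<Rightarrow> real) \<Rightarrow> real" where
  "lab_form X \<mu> L l U =
     enn2real (upper_integral (lab_meas X \<mu> l) (\<lambda>x. ennreal (lab_gamma X L U x)))"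

definition lab_norm ::
  "'a diffusion_space \<Rightarrow> 'a measure measure \<Rightarrow> (('a \<Rightarrow> real) \<Rightarrow> 'a \<Rightarrow> real) \<Rightarrow> 'a labeling \<Rightarrow>
    ((nat \<Rightarrow> 'a) \<Rightarrow> real) \<Rightarrow> real" where
  "lab_norm X \<mu> L l U = sqrt (lab_form X \<mu> L l U + (LINT x|lab_meas X \<mu> l. (U x)\<^sup>2))"

text \<open>
  The abstract completion \<open>K\<^sub>\<infinity>\<close>: Cauchy sequences of pre-Sobolev functions modulo null
  sequences.  This identifies functions at distance zero, so that no separate passage to classes
  is made.
\<close>

definition lab_cauchy ::
  "'a diffusion_space \<Rightarrow> 'a measure measure \<Rightarrow> (('a \<Rightarrow> real) \<Rightarrow> 'a \<Rightarrow> real) \<Rightarrow> 'a labeling \<Rightarrow>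
    (nat \<Rightarrow> (nat \<Rightarrow> 'a) \<Rightarrow> real) set" where
  "lab_cauchy X \<mu> L l = {Us. (\<forall>n. pre_sobolev X \<mu> L (Us n)) \<and>
     (\<forall>e>0. \<exists>n0. \<forall>i\<ge>n0. \<forall>j\<ge>n0. lab_norm X \<mu> L l (Us i - Us j) < e)}"

definition K_inf ::
  "'a diffusion_space \<Rightarrow> 'a measure measure \<Rightarrow> (('a \<Rightarrow> real) \<Rightarrow> 'a \<Rightarrow> real) \<Rightarrow> 'a labeling \<Rightarrow>
    (nat \<Rightarrow> (nat \<Rightarrow> 'a) \<Rightarrow> real) set set" where
  "K_inf X \<mu> L l = lab_cauchy X \<mu> L l //
     {(Us, Vs). Us \<in> lab_cauchy X \<mu> L l \<and> Vs \<in> lab_cauchy X \<mu> L l \<and>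
        (\<lambda>n. lab_norm X \<mu> L l (Us n - Vs n)) \<longlonglongrightarrow> 0}"

definition K_gamma ::
  "'a diffusion_space \<Rightarrow> 'a measure measure \<Rightarrow> (('a \<Rightarrow> real) \<Rightarrow> 'a \<Rightarrow> real) \<Rightarrow> 'a labeling \<Rightarrow>
    (nat \<Rightarrow> (nat \<Rightarrow> 'a) \<Rightarrow> real) set \<Rightarrow> (nat \<Rightarrow> 'a) \<Rightarrow> real" where
  "K_gamma X \<mu> L l \<kappa> = (SOME g. integrable (lab_meas X \<mu> l) g \<and>
     (\<forall>Us\<in>\<kappa>. L1_tendsto (lab_meas X \<mu> l) (\<lambda>n. lab_gamma X L (Us n)) g))"

definition K_form ::
  "'a diffusion_space \<Rightarrow> 'a measure measure \<Rightarrow> (('a \<Rightarrow> real) \<Rightarrow> 'a \<Rightarrow> real) \<Rightarrow> 'a labeling \<Rightarrow>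
    (nat \<Rightarrow> (nat \<Rightarrow> 'a) \<Rightarrow> real) set \<Rightarrow> real" where
  "K_form X \<mu> L l \<kappa> = (THE r. \<forall>Us\<in>\<kappa>. (\<lambda>n. lab_form X \<mu> L l (Us n)) \<longlonglongrightarrow> r)"

definition pull_back ::
  "('a, 'z) local_structure_scheme \<Rightarrow> ('a measure \<Rightarrow> real) \<Rightarrow> (nat \<Rightarrow> 'a) \<Rightarrow> real" where
  "pull_back X u x = u (unlabel X (\<infinity>, x))"

text \<open>
  The continuous extension of \<open>pull_back\<close> from cylinder functions to the domain of the closed
  form; \<open>L0\<close> is the lifting used in the form on configurations, \<open>L\<close> the one used on labeled
  configurations.
\<close>

definition lift_star ::
  "'a diffusion_space \<Rightarrow> 'a measure measure \<Rightarrow> (('a \<Rightarrow> real) \<Rightarrow> 'a \<Rightarrow> real) \<Rightarrow>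
    (('a \<Rightarrow> real) \<Rightarrow> 'a \<Rightarrow> real) \<Rightarrow> 'a labeling \<Rightarrow> ('a measure \<Rightarrow> real) \<Rightarrow>
    (nat \<Rightarrow> (nat \<Rightarrow> 'a) \<Rightarrow> real) set" where
  "lift_star X \<mu> L0 L l u = (THE \<kappa>. \<kappa> \<in> K_inf X \<mu> L l \<and>
     (\<forall>us. approx_seq \<mu> (Cyl X) (cyl_form X L0 \<mu>) u us \<longrightarrow>
        (\<lambda>n. pull_back X (us n)) \<in> \<kappa>))"

end

theory Submission
  imports Defs
begin

text \<open>
  For a cylinder function \<open>u = F(f\<^sub>1\<^sup>\<star>, \<dots>, f\<^sub>k\<^sup>\<star>)\<close> the identity holds pointwise: if all points of the
  sequence \<open>x\<close> but the \<open>p\<close>-th are frozen, then \<open>u \<circ> \<LL>\<close> becomes, in the free variable, a smooth function of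
  \<open>f\<^sub>1, \<dots>, f\<^sub>k\<close> up to an additive constant.  By the diffusion property and by multiplicativity of the
  lifting, its lifted square field at \<open>x\<^sub>p\<close> is \<open>\<Sum> \<partial>\<^sub>iF \<partial>\<^sub>jF \<ell>(\<Gamma>(f\<^sub>i, f\<^sub>j))(x\<^sub>p)\<close>, and summation over \<open>p\<close> turns
  \<open>\<ell>(\<Gamma>(f\<^sub>i, f\<^sub>j))\<close> into its integral against the configuration (\<open>lab_gamma_cyl\<close>).  The exceptional sets are
  null because marginal absolute continuity implies that an \<open>\<m>\<close>-null set carries no point of almost
  every configuration (\<open>AE_no_point_in_null_set\<close>).  Hence the square field of cylinder functions
  depends neither on their representation nor on the lifting.

  The rest is passage to the limit.  On the side of configurations one has to know that the square
  field operator of the closed form, which is defined by a weak identity, is the \<open>L\<^sup>1\<close>-limit of the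
  square fields along approximating sequences.  This is shown for an abstract closable form with a
  pointwise square field (\<open>square_field_eq\<close>), and applied both to the base space and to the
  configurations.  It needs bounded approximants, which are obtained by smooth truncation, and
  that the algebra of cylinder functions separates integrable functions (\<open>Cyl_separating\<close>).

  On the side of sequences, \<open>(\<Gamma>\<^sup>[\<^sup>\<infinity>\<^sup>])\<^sup>1\<^sup>/\<^sup>2\<close> is a seminorm at every sequence at which it is defined.  This
  rests on the corresponding triangle inequality for the square field operator on the extended
  space, where closability enters through the fact that a Cauchy sequence converging almost
  everywhere to a constant has vanishing energy (\<open>cauchy_const_limit\<close>).  Consequently \<open>\<Gamma>\<^sup>[\<^sup>\<infinity>\<^sup>]\<close> is
  continuous from the Sobolev norm to \<open>L\<^sup>1\<close>.  As \<open>u \<mapsto> u \<circ> \<LL>\<close> is isometric on cylinder functions, the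
  limits on both sides agree (\<open>lift_star_gamma\<close>).
\<close>

section \<open>Smooth functions with bounded derivatives\<close>

text \<open>Bounded smooth functions of one real variable with bounded derivatives of all orders.\<close>

definition smooth1 :: "(real \<Rightarrow> real) \<Rightarrow> bool" where
  "smooth1 \<phi> \<longleftrightarrow> (\<forall>n. bounded (range ((deriv ^^ n) \<phi>)) \<and> (\<forall>t. (deriv ^^ n) \<phi> differentiable (at t)))"

text \<open>
  Coinduction: bounded functions forming a class that is closed under differentiation are smooth
  with bounded derivatives.
\<close>

lemma smooth1_coinduct:
  assumes "\<phi> \<in> S"
    and step: "\<And>\<psi>. \<psi> \<in> S \<Longrightarrow> bounded (range \<psi>) \<and> (\<exists>\<psi>'\<in>S. \<forall>t. (\<psi> has_real_derivative \<psi>' t) (at t))"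
  shows "smooth1 \<phi>"
proof -
  have "(deriv ^^ n) \<phi> \<in> S" for n
  proof (induction n)
    case (Suc n)
    from step[OF this] obtain \<psi>' where "\<psi>' \<in> S" "\<forall>t. ((deriv ^^ n) \<phi> has_real_derivative \<psi>' t) (at t)"
      by blast
    moreover from this have "deriv ((deriv ^^ n) \<phi>) = \<psi>'"
      by (auto intro: DERIV_imp_deriv)
    ultimately show ?case by simp
  qed (use assms in simp)
  from step[OF this] show ?thesis
    unfolding smooth1_def real_differentiable_def by blast
qed

lemma smooth1_bounded: "smooth1 \<phi> \<Longrightarrow> bounded (range \<phi>)"
  and smooth1_differentiable: "smooth1 \<phi> \<Longrightarrow> \<phi> differentiable (at t)"
  unfolding smooth1_def by (metis funpow_0)+

lemma smooth1_DERIV: "smooth1 \<phi> \<Longrightarrow> (\<phi> has_real_derivative deriv \<phi> t) (at t)"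
  using smooth1_differentiable DERIV_deriv_iff_real_differentiable by blast

lemma smooth1_deriv: "smooth1 \<phi> \<Longrightarrow> smooth1 (deriv \<phi>)"
  unfolding smooth1_def by (metis funpow_Suc_right o_apply)

lemma smooth1_continuous: "smooth1 \<phi> \<Longrightarrow> continuous_on UNIV \<phi>"
  by (meson DERIV_isCont continuous_at_imp_continuous_on smooth1_DERIV)

lemma smooth1_bound:
  assumes "smooth1 \<phi>" obtains B where "B > 0" "\<And>t. \<bar>\<phi> t\<bar> \<le> B"
  using smooth1_bounded[OF assms] unfolding bounded_pos by auto

lemma smooth1_const [intro]: "smooth1 (\<lambda>_. c)"
proof (rule smooth1_coinduct[where S = "range (\<lambda>c _. c)"])
  fix \<psi> :: "real \<Rightarrow> real" assume "\<psi> \<in> range (\<lambda>c _. c)"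
  then obtain c where [simp]: "\<psi> = (\<lambda>_. c)" by auto
  have "(\<lambda>_. 0) \<in> range (\<lambda>c _. c :: real)" by auto
  then show "bounded (range \<psi>) \<and> (\<exists>\<psi>'\<in>range (\<lambda>c _. c). \<forall>t. (\<psi> has_real_derivative \<psi>' t) (at t))"
    by (intro conjI bexI[of _ "\<lambda>_. 0"]) auto
qed auto

lemma bounded_range_mult_real:
  fixes f g :: "'x \<Rightarrow> real"
  assumes "bounded (range f)" "bounded (range g)"
  shows "bounded (range (\<lambda>x. f x * g x))"
proof -
  obtain a b where "\<And>x. \<bar>f x\<bar> \<le> a" "\<And>x. \<bar>g x\<bar> \<le> b"
    using assms unfolding bounded_iff by auto
  then have "\<bar>f x * g x\<bar> \<le> a * b" for x
    by (simp add: abs_mult mult_mono' )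
  then show ?thesis unfolding bounded_iff by auto
qed

lemma bounded_range_add_real:
  fixes f g :: "'x \<Rightarrow> real"
  assumes "bounded (range f)" "bounded (range g)"
  shows "bounded (range (\<lambda>x. f x + g x))"
proof -
  obtain a b where "\<And>x. \<bar>f x\<bar> \<le> a" "\<And>x. \<bar>g x\<bar> \<le> b"
    using assms unfolding bounded_iff by auto
  then have "\<bar>f x + g x\<bar> \<le> a + b" for x
    by (meson abs_triangle_ineq add_mono order_trans)
  then show ?thesis unfolding bounded_iff by auto
qed

lemma smooth1_add [intro]:
  assumes "smooth1 \<phi>" "smooth1 \<psi>" shows "smooth1 (\<lambda>t. \<phi> t + \<psi> t)"
proof (rule smooth1_coinduct[where S = "{\<lambda>t. \<phi> t + \<psi> t | \<phi> \<psi>. smooth1 \<phi> \<and> smooth1 \<psi>}"])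
  fix \<xi> assume "\<xi> \<in> {\<lambda>t. \<phi> t + \<psi> t | \<phi> \<psi>. smooth1 \<phi> \<and> smooth1 \<psi>}"
  then obtain \<phi> \<psi> where x: "\<xi> = (\<lambda>t. \<phi> t + \<psi> t)" "smooth1 \<phi>" "smooth1 \<psi>" by auto
  have "\<forall>t. (\<xi> has_real_derivative deriv \<phi> t + deriv \<psi> t) (at t)"
    unfolding x using x by (auto intro!: derivative_eq_intros smooth1_DERIV)
  moreover have "(\<lambda>t. deriv \<phi> t + deriv \<psi> t) \<in> {\<lambda>t. \<phi> t + \<psi> t | \<phi> \<psi>. smooth1 \<phi> \<and> smooth1 \<psi>}"
    using x smooth1_deriv by blast
  moreover have "bounded (range \<xi>)"
    unfolding x by (intro bounded_range_add_real smooth1_bounded x)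
  ultimately show "bounded (range \<xi>) \<and> (\<exists>\<psi>'\<in>{\<lambda>t. \<phi> t + \<psi> t | \<phi> \<psi>. smooth1 \<phi> \<and> smooth1 \<psi>}. \<forall>t. (\<xi> has_real_derivative \<psi>' t) (at t))"
    by (auto intro!: bexI[of _ "\<lambda>t. deriv \<phi> t + deriv \<psi> t"])
qed (use assms in auto)

text \<open>Smoothness of a product: the span of products is closed under differentiation.\<close>

inductive_set prod_span :: "(real \<Rightarrow> real) set" where
  prod: "smooth1 \<phi> \<Longrightarrow> smooth1 \<psi> \<Longrightarrow> (\<lambda>t. \<phi> t * \<psi> t) \<in> prod_span"
| add: "\<phi> \<in> prod_span \<Longrightarrow> \<psi> \<in> prod_span \<Longrightarrow> (\<lambda>t. \<phi> t + \<psi> t) \<in> prod_span"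

lemma smooth1_mult [intro]:
  assumes "smooth1 \<phi>" "smooth1 \<psi>" shows "smooth1 (\<lambda>t. \<phi> t * \<psi> t)"
proof (rule smooth1_coinduct[where S = prod_span])
  fix \<xi> assume "\<xi> \<in> prod_span"
  then show "bounded (range \<xi>) \<and> (\<exists>\<psi>'\<in>prod_span. \<forall>t. (\<xi> has_real_derivative \<psi>' t) (at t))"
  proof induction
    case (prod \<phi> \<psi>)
    have "\<forall>t. ((\<lambda>t. \<phi> t * \<psi> t) has_real_derivative (deriv \<phi> t * \<psi> t + \<phi> t * deriv \<psi> t)) (at t)"
      using prod by (auto intro!: derivative_eq_intros smooth1_DERIV)
    moreover have "(\<lambda>t. deriv \<phi> t * \<psi> t + \<phi> t * deriv \<psi> t) \<in> prod_span"
      by (intro prod_span.intros smooth1_deriv prod)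
    ultimately show ?case
      using prod by (intro conjI bounded_range_mult_real smooth1_bounded
        bexI[of _ "\<lambda>t. deriv \<phi> t * \<psi> t + \<phi> t * deriv \<psi> t"])
  next
    case (add \<phi> \<psi>)
    then obtain \<phi>' \<psi>' where *: "\<phi>' \<in> prod_span" "\<psi>' \<in> prod_span"
      "\<And>t. (\<phi> has_real_derivative \<phi>' t) (at t)" "\<And>t. (\<psi> has_real_derivative \<psi>' t) (at t)" by blast
    then have "\<forall>t. ((\<lambda>t. \<phi> t + \<psi> t) has_real_derivative \<phi>' t + \<psi>' t) (at t)"
      by (intro allI DERIV_add)
    then show ?case
      using add by (intro conjI bounded_range_add_real bexI[of _ "\<lambda>t. \<phi>' t + \<psi>' t"] prod_span.add *) blast+
  qed
qed (use assms prod_span.prod in auto)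

lemma smooth1_cmult [intro]: "smooth1 \<phi> \<Longrightarrow> smooth1 (\<lambda>t. c * \<phi> t)"
  by (intro smooth1_mult smooth1_const)

lemma smooth1_affine [intro]:
  assumes "smooth1 \<phi>" shows "smooth1 (\<lambda>t. \<phi> (a * t + b))"
proof (rule smooth1_coinduct[where S = "{\<lambda>t. c * \<phi> (a * t + b) | c \<phi>. smooth1 \<phi>}"])
  fix \<xi> assume "\<xi> \<in> {\<lambda>t. c * \<phi> (a * t + b) | c \<phi>. smooth1 \<phi>}"
  then obtain c \<phi> where x: "\<xi> = (\<lambda>t. c * \<phi> (a * t + b))" "smooth1 \<phi>" by auto
  have "\<forall>t. (\<xi> has_real_derivative (c * a) * deriv \<phi> (a * t + b)) (at t)"
  proof
    fix t
    have "((\<lambda>t. \<phi> (a * t + b)) has_real_derivative deriv \<phi> (a * t + b) * a) (at t)"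
      by (rule DERIV_chain2[where g = "\<lambda>t. a * t + b", OF smooth1_DERIV[OF x(2)]])
        (auto intro!: derivative_eq_intros)
    from DERIV_cmult[OF this, of c]
    show "(\<xi> has_real_derivative (c * a) * deriv \<phi> (a * t + b)) (at t)"
      by (simp add: x ac_simps)
  qed
  moreover have "bounded (range \<xi>)"
  proof -
    obtain B where B: "\<And>t. \<bar>\<phi> t\<bar> \<le> B" using smooth1_bound[OF x(2)] by auto
    then have "\<bar>\<xi> t\<bar> \<le> \<bar>c\<bar> * B" for t unfolding x by (simp add: abs_mult mult_left_mono)
    then show ?thesis unfolding bounded_iff by auto
  qed
  moreover have "(\<lambda>t. (c * a) * deriv \<phi> (a * t + b)) \<in> {\<lambda>t. c * \<phi> (a * t + b) | c \<phi>. smooth1 \<phi>}"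
    using x smooth1_deriv by blast
  ultimately show "bounded (range \<xi>) \<and> (\<exists>\<psi>'\<in>{\<lambda>t. c * \<phi> (a * t + b) | c \<phi>. smooth1 \<phi>}. \<forall>t. (\<xi> has_real_derivative \<psi>' t) (at t))"
    by (intro conjI bexI[of _ "\<lambda>t. (c * a) * deriv \<phi> (a * t + b)"])
next
  have "(\<lambda>t. \<phi> (a * t + b)) = (\<lambda>t. 1 * \<phi> (a * t + b))" by simp
  then show "(\<lambda>t. \<phi> (a * t + b)) \<in> {\<lambda>t. c * \<phi> (a * t + b) | c \<phi>. smooth1 \<phi>}"
    using assms by blast
qed

lemma smooth1_sin: "smooth1 (\<lambda>t. sin (t + b))"
proof (rule smooth1_coinduct[where S = "range (\<lambda>b t. sin (t + b))"])
  fix \<xi> :: "real \<Rightarrow> real" assume "\<xi> \<in> range (\<lambda>b t. sin (t + b))"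
  then obtain b where x: "\<xi> = (\<lambda>t. sin (t + b))" by auto
  have "\<forall>t. (\<xi> has_real_derivative sin (t + (b + pi / 2))) (at t)"
  proof
    fix t
    have "sin (t + (b + pi / 2)) = cos (t + b)"
      by (simp add: sin_add cos_add)
    then show "(\<xi> has_real_derivative sin (t + (b + pi / 2))) (at t)"
      unfolding x by (auto intro!: derivative_eq_intros)
  qed
  moreover have "bounded (range \<xi>)" unfolding x bounded_iff by (auto intro!: exI[of _ 1])
  ultimately show "bounded (range \<xi>) \<and> (\<exists>\<psi>'\<in>range (\<lambda>b t. sin (t + b)). \<forall>t. (\<xi> has_real_derivative \<psi>' t) (at t))"
    by (intro conjI bexI[of _ "\<lambda>t. sin (t + (b + pi / 2))"]) auto
qed auto

lemma smooth1_inverse: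
  assumes h: "smooth1 h" and c: "c > 0" "\<And>t. h t \<ge> c"
  shows "smooth1 (\<lambda>t. inverse (h t))"
proof (rule smooth1_coinduct[where S = "{\<lambda>t. \<phi> t * inverse (h t) ^ n | \<phi> n. smooth1 \<phi>}"])
  fix \<xi> assume "\<xi> \<in> {\<lambda>t. \<phi> t * inverse (h t) ^ n | \<phi> n. smooth1 \<phi>}"
  then obtain \<phi> n where x: "\<xi> = (\<lambda>t. \<phi> t * inverse (h t) ^ n)" "smooth1 \<phi>" by auto
  have h0: "h t \<noteq> 0" for t using c(1) c(2)[of t] by auto
  let ?\<psi> = "\<lambda>t. deriv \<phi> t * h t + (- real n) * (\<phi> t * deriv h t)"
  have "\<forall>t. (\<xi> has_real_derivative ?\<psi> t * inverse (h t) ^ Suc n) (at t)"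
  proof
    fix t
    have "((\<lambda>t. inverse (h t)) has_real_derivative - (inverse (h t) * deriv h t * inverse (h t))) (at t)"
      by (intro DERIV_inverse' smooth1_DERIV h h0)
    from DERIV_power[OF this, of n]
    have "((\<lambda>t. inverse (h t) ^ n) has_real_derivative - real n * deriv h t * inverse (h t) ^ Suc n) (at t)"
      by (rule DERIV_cong) (cases n; simp add: algebra_simps)
    from DERIV_mult[OF smooth1_DERIV[OF x(2)] this]
    have "(\<xi> has_real_derivative deriv \<phi> t * inverse (h t) ^ n +
        (- real n * deriv h t * inverse (h t) ^ Suc n) * \<phi> t) (at t)" unfolding x .
    moreover have "deriv \<phi> t * inverse (h t) ^ n +
        (- real n * deriv h t * inverse (h t) ^ Suc n) * \<phi> t = ?\<psi> t * inverse (h t) ^ Suc n"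
      using h0[of t] by (simp add: field_simps)
    ultimately show "(\<xi> has_real_derivative ?\<psi> t * inverse (h t) ^ Suc n) (at t)" by metis
  qed
  moreover have "smooth1 ?\<psi>"
    by (intro smooth1_add smooth1_mult smooth1_cmult smooth1_deriv h x)
  moreover have "bounded (range \<xi>)"
  proof -
    obtain B where B: "B > 0" "\<And>t. \<bar>\<phi> t\<bar> \<le> B" using smooth1_bound[OF x(2)] by auto
    have "\<bar>\<xi> t\<bar> \<le> B * inverse c ^ n" for t
    proof -
      have "\<bar>inverse (h t)\<bar> \<le> inverse c"
        using c(1) c(2)[of t] by (auto intro!: le_imp_inverse_le)
      then have "\<bar>inverse (h t)\<bar> ^ n \<le> inverse c ^ n" by (intro power_mono) auto
      then show ?thesis
        unfolding x abs_mult power_abs using B by (intro mult_mono) auto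
    qed
    then show ?thesis unfolding bounded_iff by auto
  qed
  ultimately show "bounded (range \<xi>) \<and> (\<exists>\<psi>'\<in>{\<lambda>t. \<phi> t * inverse (h t) ^ n | \<phi> n. smooth1 \<phi>}. \<forall>t. (\<xi> has_real_derivative \<psi>' t) (at t))"
    by (intro conjI bexI[of _ "\<lambda>t. ?\<psi> t * inverse (h t) ^ Suc n"] CollectI exI[of _ ?\<psi>] exI[of _ "Suc n"] refl)
next
  have "(\<lambda>t. inverse (h t)) = (\<lambda>t. 1 * inverse (h t) ^ 1)" by simp
  then show "(\<lambda>t. inverse (h t)) \<in> {\<lambda>t. \<phi> t * inverse (h t) ^ n | \<phi> n. smooth1 \<phi>}"
    using smooth1_const[of 1] by (intro CollectI exI[of _ "\<lambda>_. 1"] exI[of _ 1]) simp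
qed

subsection \<open>A smooth cutoff\<close>

text \<open>
  The functions \<open>p(1/t) e\<^sup>-\<^sup>1\<^sup>/\<^sup>t\<close> on the positive half line, extended by zero; derivatives of such
  functions are again of this form.
\<close>

definition flat :: "real poly \<Rightarrow> real \<Rightarrow> real" where
  "flat p t = (if t > 0 then poly p (1 / t) * exp (- (1 / t)) else 0)"

lemma poly_exp_tendsto_0: "((\<lambda>s. poly p s * exp (- s)) \<longlongrightarrow> (0::real)) at_top"
proof -
  have "((\<lambda>s. \<Sum>i\<le>degree p. coeff p i * (s ^ i / exp s)) \<longlongrightarrow> (\<Sum>i\<le>degree p. coeff p i * 0)) at_top"
    by (intro tendsto_intros tendsto_power_div_exp_0)
  then show ?thesis
    by (simp add: poly_altdef sum_distrib_right exp_minus field_simps sum_divide_distrib)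
qed

lemma flat_tendsto_0: "((\<lambda>t. flat p t) \<longlongrightarrow> 0) (at 0)"
proof -
  have "((\<lambda>t. flat p t) \<longlongrightarrow> 0) (at_right 0)"
  proof (rule Lim_transform_eventually)
    show "((\<lambda>t. poly p (1 / t) * exp (- (1 / t))) \<longlongrightarrow> 0) (at_right 0)"
      using filterlim_compose[OF poly_exp_tendsto_0 filterlim_inverse_at_top_right]
      by (simp add: inverse_eq_divide)
    show "eventually (\<lambda>t. poly p (1 / t) * exp (- (1 / t)) = flat p t) (at_right 0)"
      by (auto simp: flat_def eventually_at_filter)
  qed
  moreover have "((\<lambda>t. flat p t) \<longlongrightarrow> 0) (at_left 0)"
    by (rule Lim_transform_eventually[OF tendsto_const]) (auto simp: flat_def eventually_at_filter)
  ultimately show ?thesis by (simp add: filterlim_at_split)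
qed

lemma flat_DERIV: "(flat p has_real_derivative flat ([:0, 0, 1:] * (p - pderiv p)) t) (at t)"
proof (cases t "0 :: real" rule: linorder_cases)
  case less
  have "eventually (\<lambda>t. 0 = flat p t) (nhds t)"
    using eventually_nhds_in_open[of "{..<0}" t] less
    by (auto simp: flat_def elim!: eventually_mono)
  then show ?thesis
    using DERIV_cong_ev[OF refl _ refl, of "\<lambda>_. 0" "flat p" t 0] less by (simp add: flat_def)
next
  case equal
  have "((\<lambda>h. (flat p (0 + h) - flat p 0) / h) \<longlongrightarrow> 0) (at 0)"
  proof (rule Lim_transform_eventually[OF flat_tendsto_0[of "[:0, 1:] * p"]])
    show "eventually (\<lambda>h. flat ([:0, 1:] * p) h = (flat p (0 + h) - flat p 0) / h) (at 0)"
      by (auto simp: flat_def eventually_at_filter)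
  qed
  then show ?thesis using equal by (simp add: DERIV_def flat_def)
next
  case greater
  have "((\<lambda>t. poly p (1 / t) * exp (- (1 / t))) has_real_derivative
      (poly (pderiv p) (1 / t) * (- 1 / t\<^sup>2)) * exp (- (1 / t)) +
      poly p (1 / t) * (exp (- (1 / t)) * (1 / t\<^sup>2))) (at t)"
    using greater
    by (auto intro!: derivative_eq_intros DERIV_chain2[OF poly_DERIV] simp: power2_eq_square)
  then have "((\<lambda>t. poly p (1 / t) * exp (- (1 / t))) has_real_derivative
      flat ([:0, 0, 1:] * (p - pderiv p)) t) (at t)"
    by (rule DERIV_cong) (use greater in \<open>simp add: flat_def field_simps power2_eq_square\<close>)
  moreover have "eventually (\<lambda>t. poly p (1 / t) * exp (- (1 / t)) = flat p t) (nhds t)"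
    using eventually_nhds_in_open[of "{0<..}" t] greater
    by (auto simp: flat_def elim!: eventually_mono)
  ultimately show ?thesis using DERIV_cong_ev[OF refl _ refl] by (metis (no_types))
qed

lemma flat_bounded: "bounded (range (flat p))"
proof -
  have "eventually (\<lambda>s. \<bar>poly p s * exp (- s)\<bar> < 1) at_top"
    using poly_exp_tendsto_0[of p, THEN tendstoD, of 1] by simp
  then obtain S where S: "\<And>s. s \<ge> S \<Longrightarrow> \<bar>poly p s * exp (- s)\<bar> < 1"
    by (auto simp: eventually_at_top_linorder)
  have "compact ((\<lambda>s. poly p s * exp (- s)) ` {0..max 0 S})"
    by (intro compact_continuous_image) (auto intro!: continuous_intros)
  from compact_imp_bounded[OF this]
  obtain B where "\<forall>y\<in>(\<lambda>s. poly p s * exp (- s)) ` {0..max 0 S}. \<bar>y\<bar> \<le> B"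
    unfolding bounded_iff by auto
  then have B: "\<bar>poly p s * exp (- s)\<bar> \<le> B" if "0 \<le> s" "s \<le> max 0 S" for s
    using that by (meson atLeastAtMost_iff imageI)
  have "\<bar>flat p t\<bar> \<le> max B 1" for t
  proof (cases "t > 0")
    case True
    then show ?thesis
      using S[of "1 / t"] B[of "1 / t"]
      by (cases "1 / t \<le> S") (simp_all add: flat_def le_max_iff_disj less_imp_le)
  qed (auto simp: flat_def)
  then show ?thesis unfolding bounded_iff by auto
qed

lemma smooth1_flat: "smooth1 (flat p)"
proof (rule smooth1_coinduct[where S = "range flat"])
  fix \<xi> assume "\<xi> \<in> range flat"
  then obtain p where x: "\<xi> = flat p" by auto
  show "bounded (range \<xi>) \<and> (\<exists>\<psi>'\<in>range flat. \<forall>t. (\<xi> has_real_derivative \<psi>' t) (at t))"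
    unfolding x using flat_bounded
    by (intro conjI bexI[of _ "flat ([:0, 0, 1:] * (p - pderiv p))"] allI flat_DERIV rangeI)
qed simp

lemma smooth_step_exists:
  "\<exists>\<theta>. smooth1 \<theta> \<and> (\<forall>t\<le>0. \<theta> t = 0) \<and> (\<forall>t\<ge>1. \<theta> t = 1)"
proof -
  define e where "e = flat 1"
  have e: "smooth1 e" "\<And>t. e t \<ge> 0" "\<And>t. t \<ge> 1/2 \<Longrightarrow> e t \<ge> exp (-2)" "\<And>t. t \<le> 0 \<Longrightarrow> e t = 0"
    unfolding e_def by (simp_all add: smooth1_flat) (simp_all add: flat_def divide_le_eq)
  define h where "h = (\<lambda>t. e t + e ((-1) * t + 1))"
  have h: "smooth1 h" unfolding h_def by (intro smooth1_add smooth1_affine e)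
  have h0: "h t \<ge> exp (-2)" for t
  proof (cases "t \<ge> 1/2")
    case True
    then show ?thesis unfolding h_def using e(2)[of "(-1) * t + 1"] e(3)[of t] by linarith
  next
    case False
    then show ?thesis unfolding h_def using e(2)[of t] e(3)[of "(-1) * t + 1"] by simp
  qed
  have "smooth1 (\<lambda>t. e t * inverse (h t))"
    by (intro smooth1_mult e smooth1_inverse[OF h, of "exp (-2)"] h0) auto
  moreover have "e t * inverse (h t) = 1" if "t \<ge> 1" for t
  proof -
    have "e t > 0" using e(3)[of t] that by (smt (verit) exp_gt_zero field_sum_of_halves)
    then show ?thesis using e(4)[of "1 - t"] that unfolding h_def by simp
  qed
  ultimately show ?thesis using e(4) by (intro exI[of _ "\<lambda>t. e t * inverse (h t)"]) auto
qed

text \<open>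
  A smooth truncation of the identity: \<open>t\<close> times a bump function.
\<close>

lemma smooth_cutoff_exists:
  "\<exists>\<kappa>. smooth1 \<kappa> \<and> (\<forall>t. \<bar>t\<bar> \<le> 1 \<longrightarrow> \<kappa> t = t \<and> deriv \<kappa> t = 1)"
proof -
  obtain \<theta> where \<theta>: "smooth1 \<theta>" "\<And>t. t \<le> 0 \<Longrightarrow> \<theta> t = 0" "\<And>t. t \<ge> 1 \<Longrightarrow> \<theta> t = 1"
    using smooth_step_exists by blast
  define ch where "ch = (\<lambda>t. \<theta> (1 * t + 3) * \<theta> ((-1) * t + 3))"
  have ch: "smooth1 ch" unfolding ch_def by (intro smooth1_mult smooth1_affine \<theta>(1))
  have ch0: "ch t = 0" if "\<bar>t\<bar> \<ge> 3" for t
    using that \<theta>(2)[of "t + 3"] \<theta>(2)[of "3 - t"] by (auto simp: ch_def abs_if split: if_splits)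
  have ch1: "ch t = 1" if "\<bar>t\<bar> < 2" for t
    using that by (auto simp: ch_def \<theta>(3))
  let ?S = "{\<lambda>t. t * \<phi> t + \<psi> t | \<phi> \<psi>. smooth1 \<phi> \<and> smooth1 \<psi> \<and> (\<forall>t. \<bar>t\<bar> > 3 \<longrightarrow> \<phi> t = 0)}"
  have "smooth1 (\<lambda>t. t * ch t + 0)"
  proof (rule smooth1_coinduct[where S = ?S])
    fix \<xi> assume "\<xi> \<in> ?S"
    then obtain \<phi> \<psi> where x: "\<xi> = (\<lambda>t. t * \<phi> t + \<psi> t)" "smooth1 \<phi>" "smooth1 \<psi>"
      and supp: "\<And>t. \<bar>t\<bar> > 3 \<Longrightarrow> \<phi> t = 0" by auto
    have "\<forall>t. (\<xi> has_real_derivative t * deriv \<phi> t + (\<phi> t + deriv \<psi> t)) (at t)"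
      unfolding x using x
      by (auto intro!: derivative_eq_intros smooth1_DERIV)
    moreover have "deriv \<phi> t = 0" if "\<bar>t\<bar> > 3" for t
    proof (rule DERIV_imp_deriv)
      have "open {t::real. \<bar>t\<bar> > 3}" by (intro open_Collect_less continuous_intros)
      then have "eventually (\<lambda>t. 0 = \<phi> t) (nhds t)"
        using eventually_nhds_in_open[of "{t::real. \<bar>t\<bar> > 3}" t] that supp
        by (auto elim!: eventually_mono)
      then show "(\<phi> has_real_derivative 0) (at t)"
        using DERIV_cong_ev[OF refl _ refl, of "\<lambda>_. 0" \<phi> t 0] by simp
    qed
    moreover have "bounded (range \<xi>)"
    proof -
      obtain B C where B: "B > 0" "\<And>t. \<bar>\<phi> t\<bar> \<le> B" and C: "\<And>t. \<bar>\<psi> t\<bar> \<le> C"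
        using smooth1_bound[OF x(2)] smooth1_bound[OF x(3)] by metis
      have "\<bar>t * \<phi> t\<bar> \<le> 3 * B" for t
      proof (cases "\<bar>t\<bar> > 3")
        case False
        then show ?thesis unfolding abs_mult using B by (intro mult_mono) auto
      qed (use supp B in auto)
      then have "\<bar>\<xi> t\<bar> \<le> 3 * B + C" for t
        unfolding x using C[of t] by (intro order_trans[OF abs_triangle_ineq] add_mono)
      then show ?thesis unfolding bounded_iff by auto
    qed
    moreover have "smooth1 (\<lambda>t. \<phi> t + deriv \<psi> t)"
      using x smooth1_deriv by blast
    ultimately show "bounded (range \<xi>) \<and> (\<exists>\<psi>'\<in>?S. \<forall>t. (\<xi> has_real_derivative \<psi>' t) (at t))"
      using smooth1_deriv[OF x(2)]
      by (intro conjI bexI[of _ "\<lambda>t. t * deriv \<phi> t + (\<phi> t + deriv \<psi> t)"] CollectI exI[of _ "deriv \<phi>"]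
          exI[of _ "\<lambda>t. \<phi> t + deriv \<psi> t"]) auto
  next
    show "(\<lambda>t. t * ch t + 0) \<in> ?S" using ch ch0 smooth1_const[of 0]
      by (intro CollectI exI[of _ ch] exI[of _ "\<lambda>_. 0"]) auto
  qed
  moreover have "deriv (\<lambda>t. t * ch t + 0) t = 1" if "\<bar>t\<bar> \<le> 1" for t
  proof (rule DERIV_imp_deriv)
    have "open {t::real. \<bar>t\<bar> < 2}" by (intro open_Collect_less continuous_intros)
    then have "eventually (\<lambda>t. t = t * ch t + 0) (nhds t)"
      using eventually_nhds_in_open[of "{t::real. \<bar>t\<bar> < 2}" t] that ch1
      by (auto elim!: eventually_mono)
    then show "((\<lambda>t. t * ch t + 0) has_real_derivative 1) (at t)"
      using DERIV_cong_ev[OF refl _ refl, of "\<lambda>t. t" "\<lambda>t. t * ch t + 0" t 1] by simp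
  qed
  ultimately show ?thesis using ch1 by (intro exI[of _ "\<lambda>t. t * ch t + 0"]) auto
qed

subsection \<open>Several variables\<close>

text \<open>
  The analogous coinduction principle for functions of several variables.
\<close>

lemma Cb_smooth_coinduct:
  assumes "F \<in> S"
    and step: "\<And>G. G \<in> S \<Longrightarrow> (\<forall>y z. (\<forall>i<k. y i = z i) \<longrightarrow> G y = G z) \<and> continuous_on UNIV G \<and>
      bounded (range G) \<and> (\<forall>i<k. \<exists>G'\<in>S. \<forall>y. ((\<lambda>t. G (y(i := t))) has_real_derivative G' y) (at (y i)))"
  shows "F \<in> Cb_smooth k"
proof -
  have pdS: "pd i G \<in> S" if GS: "G \<in> S" and i: "i < k" for G i
  proof -
    obtain G' where "G' \<in> S" "\<And>y. ((\<lambda>t. G (y(i := t))) has_real_derivative G' y) (at (y i))"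
      using step[OF GS] i by blast
    moreover from this(2) have "pd i G = G'"
      unfolding pd_def by (auto intro!: DERIV_imp_deriv)
    ultimately show ?thesis by simp
  qed
  have S: "foldr pd is F \<in> S" if "set is \<subseteq> {..<k}" for "is"
    using that by (induction "is") (auto intro: pdS assms(1))
  have diff: "(\<lambda>t. G (y(i := t))) differentiable (at (y i))" if "G \<in> S" "i < k" for G i y
    using step[OF that(1)] that(2) unfolding real_differentiable_def by blast
  show ?thesis
    unfolding Cb_smooth_def
    using step[OF assms(1)] step[OF S] diff[OF S] by simp
qed

context
  fixes F :: "(nat \<Rightarrow> real) \<Rightarrow> real" and k :: nat
  assumes F: "F \<in> Cb_smooth k"
begin

lemma Cb_smooth_cong: "(\<And>i. i < k \<Longrightarrow> y i = z i) \<Longrightarrow> F y = F z"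
  using F unfolding Cb_smooth_def by blast

lemma Cb_smooth_continuous: "continuous_on UNIV F"
  and Cb_smooth_bounded: "bounded (range F)"
  and Cb_smooth_differentiable: "i < k \<Longrightarrow> (\<lambda>t. F (y(i := t))) differentiable (at (y i))"
proof -
  have "\<forall>is. set is \<subseteq> {..<k} \<longrightarrow>
        continuous_on UNIV (foldr pd is F) \<and> bounded (range (foldr pd is F)) \<and>
        (\<forall>i<k. \<forall>y. (\<lambda>t. foldr pd is F (y(i := t))) differentiable (at (y i)))"
    using F unfolding Cb_smooth_def by blast
  from this[rule_format, of "[]"] show "continuous_on UNIV F" "bounded (range F)"
    "i < k \<Longrightarrow> (\<lambda>t. F (y(i := t))) differentiable (at (y i))" by auto
qed

lemma Cb_smooth_pd_eq_0: "i \<ge> k \<Longrightarrow> pd i F = (\<lambda>_. 0)"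
proof -
  assume i: "i \<ge> k"
  have "(\<lambda>t. F (y(i := t))) = (\<lambda>_. F y)" for y
    using i by (intro ext Cb_smooth_cong) auto
  then show ?thesis unfolding pd_def by simp
qed

lemma Cb_smooth_DERIV: "((\<lambda>t. F (y(i := t))) has_real_derivative pd i F y) (at (y i))"
proof (cases "i < k")
  case True
  then show ?thesis
    unfolding pd_def using Cb_smooth_differentiable DERIV_deriv_iff_real_differentiable by blast
next
  case False
  then have "(\<lambda>t. F (y(i := t))) = (\<lambda>_. F y)"
    by (intro ext Cb_smooth_cong) auto
  then show ?thesis using False Cb_smooth_pd_eq_0[of i] by simp
qed

lemma Cb_smooth_pd:
  assumes i: "i < k" shows "pd i F \<in> Cb_smooth k"
proof -
  have 1: "pd i F y = pd i F z" if yz: "\<forall>i<k. y i = z i" for y z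
  proof -
    have "(\<lambda>t. F (y(i := t))) = (\<lambda>t. F (z(i := t)))"
      using yz by (intro ext Cb_smooth_cong) auto
    then show ?thesis using yz i unfolding pd_def by simp
  qed
  have 2: "foldr pd is (pd i F) = foldr pd (is @ [i]) F" for "is" by simp
  show ?thesis
    unfolding Cb_smooth_def
  proof (intro CollectI conjI allI impI)
    fix "is" assume "set is \<subseteq> {..<k}"
    then have "set (is @ [i]) \<subseteq> {..<k}" using i by simp
    then have *: "continuous_on UNIV (foldr pd (is @ [i]) F) \<and> bounded (range (foldr pd (is @ [i]) F)) \<and>
        (\<forall>j<k. \<forall>y. (\<lambda>t. foldr pd (is @ [i]) F (y(j := t))) differentiable (at (y j)))"
      using F unfolding Cb_smooth_def by blast
    show "continuous_on UNIV (foldr pd is (pd i F))" "bounded (range (foldr pd is (pd i F)))"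
      "\<And>j y. j < k \<Longrightarrow> (\<lambda>t. foldr pd is (pd i F) (y(j := t))) differentiable (at (y j))"
      using * unfolding 2 by auto
  qed (use 1 in blast)
qed

end

lemma Cb_smooth_bound:
  assumes "F \<in> Cb_smooth k" obtains B where "B > 0" "\<And>y. \<bar>F y\<bar> \<le> B"
  using Cb_smooth_bounded[OF assms] unfolding bounded_pos by auto

lemma pd_eqI:
  assumes "((\<lambda>t. F (y(i := t))) has_real_derivative D) (at (y i))" shows "pd i F y = D"
  unfolding pd_def by (rule DERIV_imp_deriv) (rule assms)

lemma Cb_smooth_coord:
  assumes "smooth1 \<phi>" "i < k" shows "(\<lambda>y. \<phi> (y i)) \<in> Cb_smooth k"
proof (rule Cb_smooth_coinduct[where S = "{\<lambda>y. \<phi> (y i) | \<phi>. smooth1 \<phi>}"])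
  fix G :: "(nat \<Rightarrow> real) \<Rightarrow> real" assume "G \<in> {\<lambda>y. \<phi> (y i) | \<phi>. smooth1 \<phi>}"
  then obtain \<phi> where G: "G = (\<lambda>y. \<phi> (y i))" and \<phi>: "smooth1 \<phi>" by auto
  have "\<exists>G'\<in>{\<lambda>y. \<phi> (y i) | \<phi>. smooth1 \<phi>}. \<forall>y. ((\<lambda>t. G (y(j := t))) has_real_derivative G' y) (at (y j))" for j
  proof (cases "j = i")
    case True
    then show ?thesis unfolding G using smooth1_DERIV[OF \<phi>] smooth1_deriv[OF \<phi>]
      by (intro bexI[of _ "\<lambda>y. deriv \<phi> (y i)"]) auto
  next
    case False
    then show ?thesis unfolding G using smooth1_const[of 0]
      by (intro bexI[of _ "\<lambda>y. (\<lambda>_. 0) (y i)"]) (auto intro!: exI[of _ "\<lambda>_. 0"])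
  qed
  moreover have "\<forall>y z. (\<forall>i<k. y i = z i) \<longrightarrow> G y = G z"
    using assms(2) by (auto simp: G)
  moreover have "continuous_on UNIV G"
    unfolding G by (rule continuous_on_compose2[OF smooth1_continuous[OF \<phi>] continuous_on_product_coordinates]) simp
  moreover have "bounded (range G)"
    using smooth1_bounded[OF \<phi>] by (rule bounded_subset) (auto simp: G)
  ultimately show "(\<forall>y z. (\<forall>i<k. y i = z i) \<longrightarrow> G y = G z) \<and> continuous_on UNIV G \<and>
      bounded (range G) \<and> (\<forall>j<k. \<exists>G'\<in>{\<lambda>y. \<phi> (y i) | \<phi>. smooth1 \<phi>}.
        \<forall>y. ((\<lambda>t. G (y(j := t))) has_real_derivative G' y) (at (y j)))"
    by blast
qed (use assms in auto)

lemma pd_coord: "smooth1 \<phi> \<Longrightarrow> pd j (\<lambda>y. \<phi> (y i)) y = (if j = i then deriv \<phi> (y i) else 0)"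
  by (rule pd_eqI) (auto intro: smooth1_DERIV)

text \<open>
  Sums, products and compositions with smooth functions of one variable: the class generated by
  these operations is closed under differentiation, hence equals \<open>Cb_smooth k\<close>.
\<close>

inductive_set smooth_alg :: "nat \<Rightarrow> ((nat \<Rightarrow> real) \<Rightarrow> real) set" for k where
  base: "F \<in> Cb_smooth k \<Longrightarrow> F \<in> smooth_alg k"
| add: "F \<in> smooth_alg k \<Longrightarrow> G \<in> smooth_alg k \<Longrightarrow> (\<lambda>y. F y + G y) \<in> smooth_alg k"
| mult: "F \<in> smooth_alg k \<Longrightarrow> G \<in> smooth_alg k \<Longrightarrow> (\<lambda>y. F y * G y) \<in> smooth_alg k"
| comp: "F \<in> smooth_alg k \<Longrightarrow> smooth1 \<phi> \<Longrightarrow> (\<lambda>y. \<phi> (F y)) \<in> smooth_alg k"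

lemma smooth_alg_eq: "smooth_alg k = Cb_smooth k"
proof (intro equalityI subsetI)
  fix F assume "F \<in> smooth_alg k"
  then show "F \<in> Cb_smooth k"
  proof (rule Cb_smooth_coinduct)
    fix G assume "G \<in> smooth_alg k"
    then show "(\<forall>y z. (\<forall>i<k. y i = z i) \<longrightarrow> G y = G z) \<and> continuous_on UNIV G \<and> bounded (range G) \<and>
      (\<forall>i<k. \<exists>G'\<in>smooth_alg k. \<forall>y. ((\<lambda>t. G (y(i := t))) has_real_derivative G' y) (at (y i)))"
      (is "?D G \<and> ?C G \<and> ?B G \<and> ?S G")
    proof induction
      case (base F)
      then have "?D F" using Cb_smooth_cong by blast
      moreover have "?S F"
        using Cb_smooth_DERIV[OF base] smooth_alg.base[OF Cb_smooth_pd[OF base]] by blast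
      ultimately show ?case using Cb_smooth_continuous[OF base] Cb_smooth_bounded[OF base] by blast
    next
      case (add F G)
      have "?D (\<lambda>y. F y + G y)" using add.IH by metis
      moreover have "?C (\<lambda>y. F y + G y)" using add.IH by (intro continuous_intros) auto
      moreover have "?B (\<lambda>y. F y + G y)" using add.IH by (intro bounded_range_add_real) auto
      moreover have "?S (\<lambda>y. F y + G y)"
      proof (intro allI impI)
        fix i assume "i < k"
        with add.IH obtain F' G' where *: "F' \<in> smooth_alg k" "G' \<in> smooth_alg k"
          "\<And>y. ((\<lambda>t. F (y(i := t))) has_real_derivative F' y) (at (y i))"
          "\<And>y. ((\<lambda>t. G (y(i := t))) has_real_derivative G' y) (at (y i))" by meson
        show "\<exists>H\<in>smooth_alg k. \<forall>y. ((\<lambda>t. F (y(i := t)) + G (y(i := t))) has_real_derivative H y) (at (y i))"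
          by (intro bexI[of _ "\<lambda>y. F' y + G' y"] allI DERIV_add smooth_alg.add *)
      qed
      ultimately show ?case by blast
    next
      case (mult F G)
      have "?D (\<lambda>y. F y * G y)" using mult.IH by metis
      moreover have "?C (\<lambda>y. F y * G y)" using mult.IH by (intro continuous_intros) auto
      moreover have "?B (\<lambda>y. F y * G y)" using mult.IH by (intro bounded_range_mult_real) auto
      moreover have "?S (\<lambda>y. F y * G y)"
      proof (intro allI impI)
        fix i assume "i < k"
        with mult.IH obtain F' G' where *: "F' \<in> smooth_alg k" "G' \<in> smooth_alg k"
          "\<And>y. ((\<lambda>t. F (y(i := t))) has_real_derivative F' y) (at (y i))"
          "\<And>y. ((\<lambda>t. G (y(i := t))) has_real_derivative G' y) (at (y i))" by meson
        have "((\<lambda>t. F (y(i := t)) * G (y(i := t))) has_real_derivative F' y * G y + G' y * F y) (at (y i))" for y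
          using DERIV_mult[OF *(3,4)[of y]] by simp
        then show "\<exists>H\<in>smooth_alg k. \<forall>y. ((\<lambda>t. F (y(i := t)) * G (y(i := t))) has_real_derivative H y) (at (y i))"
          by (intro bexI[of _ "\<lambda>y. F' y * G y + G' y * F y"] allI smooth_alg.add smooth_alg.mult * mult.hyps)
      qed
      ultimately show ?case by blast
    next
      case (comp F \<phi>)
      have "?D (\<lambda>y. \<phi> (F y))" using comp.IH by metis
      moreover have "?C (\<lambda>y. \<phi> (F y))"
        using comp.IH by (intro continuous_on_compose2[OF smooth1_continuous[OF comp.hyps(2)]]) auto
      moreover have "?B (\<lambda>y. \<phi> (F y))"
        using smooth1_bounded[OF comp.hyps(2)] by (rule bounded_subset) auto
      moreover have "?S (\<lambda>y. \<phi> (F y))"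
      proof (intro allI impI)
        fix i assume "i < k"
        with comp.IH obtain F' where *: "F' \<in> smooth_alg k"
          "\<And>y. ((\<lambda>t. F (y(i := t))) has_real_derivative F' y) (at (y i))" by meson
        have "((\<lambda>t. \<phi> (F (y(i := t)))) has_real_derivative deriv \<phi> (F y) * F' y) (at (y i))" for y
          using DERIV_chain2[OF smooth1_DERIV[OF comp.hyps(2)] *(2)[of y]] by simp
        then show "\<exists>H\<in>smooth_alg k. \<forall>y. ((\<lambda>t. \<phi> (F (y(i := t)))) has_real_derivative H y) (at (y i))"
          using smooth_alg.mult[OF smooth_alg.comp[OF comp.hyps(1) smooth1_deriv[OF comp.hyps(2)]] *(1)]
          by (intro bexI[of _ "\<lambda>y. deriv \<phi> (F y) * F' y"] allI)
      qed
      ultimately show ?case by blast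
    qed
  qed
qed (rule smooth_alg.base)

lemmas Cb_smooth_add = smooth_alg.add[unfolded smooth_alg_eq]
  and Cb_smooth_mult = smooth_alg.mult[unfolded smooth_alg_eq]
  and Cb_smooth_comp = smooth_alg.comp[unfolded smooth_alg_eq]

lemma Cb_smooth_const: "(\<lambda>_. c) \<in> Cb_smooth k"
  by (rule Cb_smooth_coinduct[where S = "range (\<lambda>c _. c)"]) (auto intro!: exI[of _ "0::real"])

lemma Cb_smooth_cmult: "F \<in> Cb_smooth k \<Longrightarrow> (\<lambda>y. c * F y) \<in> Cb_smooth k"
  by (intro Cb_smooth_mult Cb_smooth_const)

lemma pd_add:
  assumes "F \<in> Cb_smooth k" "G \<in> Cb_smooth m"
  shows "pd i (\<lambda>y. F y + G y) y = pd i F y + pd i G y"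
  by (rule pd_eqI) (intro DERIV_add Cb_smooth_DERIV[OF assms(1)] Cb_smooth_DERIV[OF assms(2)])

lemma pd_cmult:
  assumes "F \<in> Cb_smooth k" shows "pd i (\<lambda>y. c * F y) y = c * pd i F y"
  by (rule pd_eqI) (intro DERIV_cmult Cb_smooth_DERIV[OF assms])

lemma pd_mult:
  assumes "F \<in> Cb_smooth k" "G \<in> Cb_smooth m"
  shows "pd i (\<lambda>y. F y * G y) y = pd i F y * G y + F y * pd i G y"
  by (rule pd_eqI)
    (use DERIV_mult[OF Cb_smooth_DERIV[OF assms(1), of y i] Cb_smooth_DERIV[OF assms(2), of y i]]
     in \<open>simp add: mult.commute\<close>)

lemma pd_comp:
  assumes "F \<in> Cb_smooth k" "smooth1 \<phi>"
  shows "pd i (\<lambda>y. \<phi> (F y)) y = deriv \<phi> (F y) * pd i F y"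
  by (rule pd_eqI)
    (use DERIV_chain2[OF smooth1_DERIV[OF assms(2)] Cb_smooth_DERIV[OF assms(1), of y i]] in simp)

text \<open>Injective change of variables combined with a translation.\<close>

lemma has_derivative_subst:
  assumes F: "F \<in> Cb_smooth k" and inj: "inj_on \<sigma> {..<k}" and i: "i < k"
  shows "((\<lambda>t. F (\<lambda>j. (y(\<sigma> i := t)) (\<sigma> j) + s j)) has_real_derivative pd i F (\<lambda>j. y (\<sigma> j) + s j)) (at (y (\<sigma> i)))"
proof -
  have "F (\<lambda>j. (y(\<sigma> i := t)) (\<sigma> j) + s j) = F ((\<lambda>j. y (\<sigma> j) + s j)(i := t + s i))" for t
    using inj i by (intro Cb_smooth_cong[OF F]) (auto simp: inj_on_def)
  moreover have "((\<lambda>t. F ((\<lambda>j. y (\<sigma> j) + s j)(i := t + s i))) has_real_derivative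
      pd i F (\<lambda>j. y (\<sigma> j) + s j) * 1) (at (y (\<sigma> i)))"
    using Cb_smooth_DERIV[OF F, of "\<lambda>j. y (\<sigma> j) + s j" i]
    by (intro DERIV_chain2[where f = "\<lambda>t. F ((\<lambda>j. y (\<sigma> j) + s j)(i := t))" and g = "\<lambda>t. t + s i"])
      (auto intro!: derivative_eq_intros)
  ultimately show ?thesis by simp
qed

lemma Cb_smooth_subst:
  assumes F: "F \<in> Cb_smooth k" and inj: "inj_on \<sigma> {..<k}" and sub: "\<sigma> ` {..<k} \<subseteq> {..<m}"
  shows "(\<lambda>y. F (\<lambda>i. y (\<sigma> i) + s i)) \<in> Cb_smooth m"
proof (rule Cb_smooth_coinduct[where S = "{\<lambda>y. F (\<lambda>i. y (\<sigma> i) + s i) | F. F \<in> Cb_smooth k}"])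
  fix G assume "G \<in> {\<lambda>y. F (\<lambda>i. y (\<sigma> i) + s i) | F. F \<in> Cb_smooth k}"
  then obtain F where G: "G = (\<lambda>y. F (\<lambda>i. y (\<sigma> i) + s i))" and F: "F \<in> Cb_smooth k" by blast
  have "G y = G z" if "\<forall>i<m. y i = z i" for y z
    unfolding G using that sub by (intro Cb_smooth_cong[OF F]) auto
  moreover have "continuous_on UNIV G"
    unfolding G by (intro continuous_on_compose2[OF Cb_smooth_continuous[OF F]] continuous_on_coordinatewise_then_product
      continuous_intros) auto
  moreover have "bounded (range G)"
    using Cb_smooth_bounded[OF F] by (rule bounded_subset) (auto simp: G)
  moreover have "\<exists>G'\<in>{\<lambda>y. F (\<lambda>i. y (\<sigma> i) + s i) | F. F \<in> Cb_smooth k}.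
      \<forall>y. ((\<lambda>t. G (y(j := t))) has_real_derivative G' y) (at (y j))" for j
  proof (cases "j \<in> \<sigma> ` {..<k}")
    case True
    then obtain i where i: "i < k" "j = \<sigma> i" by auto
    show ?thesis
      using has_derivative_subst[OF F inj i(1)] Cb_smooth_pd[OF F i(1)] unfolding G i(2)
      by (intro bexI[of _ "\<lambda>y. pd i F (\<lambda>i. y (\<sigma> i) + s i)"]) blast+
  next
    case False
    then have "(\<lambda>t. G (y(j := t))) = (\<lambda>_. G y)" for y
      unfolding G by (intro ext Cb_smooth_cong[OF F]) auto
    then show ?thesis using Cb_smooth_const[of 0 k]
      by (intro bexI[of _ "\<lambda>y. (\<lambda>_. 0) (\<lambda>i. y (\<sigma> i) + s i)"] CollectI exI[of _ "\<lambda>_. 0"]) auto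
  qed
  ultimately show "(\<forall>y z. (\<forall>i<m. y i = z i) \<longrightarrow> G y = G z) \<and> continuous_on UNIV G \<and> bounded (range G) \<and>
      (\<forall>j<m. \<exists>G'\<in>{\<lambda>y. F (\<lambda>i. y (\<sigma> i) + s i) | F. F \<in> Cb_smooth k}.
        \<forall>y. ((\<lambda>t. G (y(j := t))) has_real_derivative G' y) (at (y j)))"
    by blast
qed (use F in blast)

lemma pd_subst:
  assumes F: "F \<in> Cb_smooth k" and inj: "inj_on \<sigma> {..<k}" and i: "i < k"
  shows "pd (\<sigma> i) (\<lambda>y. F (\<lambda>i. y (\<sigma> i) + s i)) y = pd i F (\<lambda>i. y (\<sigma> i) + s i)"
  by (rule pd_eqI) (rule has_derivative_subst[OF assms])

lemma pd_subst_0: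
  assumes F: "F \<in> Cb_smooth k" and j: "j \<notin> \<sigma> ` {..<k}"
  shows "pd j (\<lambda>y. F (\<lambda>i. y (\<sigma> i) + s i)) y = 0"
proof -
  have "F (\<lambda>i. (y(j := t)) (\<sigma> i) + s i) = F (\<lambda>i. y (\<sigma> i) + s i)" for t
    using j by (intro Cb_smooth_cong[OF F]) auto
  then show ?thesis by (intro pd_eqI) simp
qed

section \<open>Convergence in mean\<close>

lemma quadratic_nonneg_imp:
  fixes a b c :: real
  assumes "\<And>t. 0 \<le> a + 2 * t * b + t\<^sup>2 * c"
  shows "b\<^sup>2 \<le> a * c"
proof -
  have c: "c \<ge> 0"
  proof (rule ccontr)
    assume "\<not> c \<ge> 0"
    define t where "t = (\<bar>a\<bar> + 2 * \<bar>b\<bar> + 1) / (-c) + 1"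
    have t1: "t \<ge> 1" and tc: "t * (-c) > \<bar>a\<bar> + 2 * \<bar>b\<bar>"
      using \<open>\<not> c \<ge> 0\<close> unfolding t_def by (auto simp: field_simps)
    have "t * (t * (-c)) \<ge> t * (\<bar>a\<bar> + 2 * \<bar>b\<bar>)" using t1 tc by (intro mult_left_mono) auto
    moreover have "t * \<bar>a\<bar> \<ge> \<bar>a\<bar>" using t1 mult_right_mono[of 1 t "\<bar>a\<bar>"] by simp
    moreover have "t * (t * (-c)) > t * (\<bar>a\<bar> + 2 * \<bar>b\<bar>)" using t1 tc by (intro mult_strict_left_mono) auto
    moreover have "t * b \<le> t * \<bar>b\<bar>" using t1 by (intro mult_left_mono) auto
    ultimately have "a + 2 * t * b + t\<^sup>2 * c < 0"
      by (simp add: power2_eq_square algebra_simps)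
    with assms[of t] show False by simp
  qed
  show ?thesis
  proof (cases "c = 0")
    case True
    have "b = 0"
    proof (rule ccontr)
      assume "b \<noteq> 0"
      then have "a + 2 * (- (a + 1) / (2 * b)) * b = -1" by (simp add: field_simps)
      with assms[of "- (a + 1) / (2 * b)"] True show False by simp
    qed
    then show ?thesis using True by simp
  next
    case False
    with c have "c > 0" by simp
    have "a + 2 * (- b / c) * b + (- b / c)\<^sup>2 * c = a - b\<^sup>2 / c"
      using False by (simp add: field_simps power2_eq_square)
    then have "b\<^sup>2 / c \<le> a" using assms[of "- b / c"] by linarith
    then show ?thesis using \<open>c > 0\<close> by (simp add: divide_le_eq)
  qed
qed

lemma quadratic_rat_dense:
  fixes a b c :: real
  assumes "\<And>t. t \<in> \<rat> \<Longrightarrow> 0 \<le> a + 2 * t * b + t\<^sup>2 * c"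
  shows "0 \<le> a + 2 * t * b + t\<^sup>2 * c"
proof -
  have "closed {t. 0 \<le> a + 2 * t * b + t\<^sup>2 * c}"
    by (intro closed_Collect_le continuous_intros)
  then have "closure \<rat> \<subseteq> {t. 0 \<le> a + 2 * t * b + t\<^sup>2 * c}"
    using assms by (intro closure_minimal) auto
  then show ?thesis using Rats_closure_real by auto
qed

lemma abs_sqrt_diff_le:
  fixes a b c :: real
  assumes "a \<ge> 0" "c \<ge> 0" "b\<^sup>2 \<le> a * c"
  shows "\<bar>sqrt a - sqrt c\<bar> \<le> sqrt (a - 2 * b + c)"
proof (rule real_le_rsqrt)
  have "b \<le> sqrt a * sqrt c"
    using assms by (metis real_le_rsqrt real_sqrt_mult)
  then show "\<bar>sqrt a - sqrt c\<bar>\<^sup>2 \<le> a - 2 * b + c"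
    using assms by (simp add: power2_diff)
qed

text \<open>
  Here \<open>W\<close> is the value of a nonnegative quadratic form at a combination of four vectors with
  coefficients \<open>a\<^sub>i\<close>, \<open>F\<^sub>i\<close> are its values at these vectors, and \<open>b\<^sub>i\<close> are the mixed terms.
\<close>

lemma quadratic_combination_le:
  fixes W :: real
  assumes W: "W = a1 * b1 + a2 * b2 + a3 * b3 + a4 * b4" "W \<ge> 0"
    and b: "b1\<^sup>2 \<le> F1 * W" "b2\<^sup>2 \<le> F2 * W" "b3\<^sup>2 \<le> F3 * W" "b4\<^sup>2 \<le> F4 * W"
    and F: "F1 \<ge> 0" "F2 \<ge> 0" "F3 \<ge> 0" "F4 \<ge> 0"
  shows "W \<le> 4 * (a1\<^sup>2 * F1 + a2\<^sup>2 * F2 + a3\<^sup>2 * F3 + a4\<^sup>2 * F4)"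
proof (cases "W = 0")
  case False
  have sq: "(p + q + r + s)\<^sup>2 \<le> 4 * (p\<^sup>2 + q\<^sup>2 + r\<^sup>2 + s\<^sup>2)" for p q r s :: real
  proof -
    have "0 \<le> (p - q)\<^sup>2 + (p - r)\<^sup>2 + (p - s)\<^sup>2 + (q - r)\<^sup>2 + (q - s)\<^sup>2 + (r - s)\<^sup>2" by simp
    then show ?thesis by (simp add: power2_eq_square algebra_simps)
  qed
  have "W\<^sup>2 \<le> 4 * ((a1 * b1)\<^sup>2 + (a2 * b2)\<^sup>2 + (a3 * b3)\<^sup>2 + (a4 * b4)\<^sup>2)"
    unfolding W(1) by (rule sq)
  also have "\<dots> \<le> 4 * (a1\<^sup>2 * (F1 * W) + a2\<^sup>2 * (F2 * W) + a3\<^sup>2 * (F3 * W) + a4\<^sup>2 * (F4 * W))"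
    unfolding power_mult_distrib using b by (intro mult_left_mono add_mono) auto
  also have "\<dots> = 4 * (a1\<^sup>2 * F1 + a2\<^sup>2 * F2 + a3\<^sup>2 * F3 + a4\<^sup>2 * F4) * W"
    by (simp add: algebra_simps)
  finally have "W * W \<le> 4 * (a1\<^sup>2 * F1 + a2\<^sup>2 * F2 + a3\<^sup>2 * F3 + a4\<^sup>2 * F4) * W"
    by (simp add: power2_eq_square)
  then show ?thesis using False W(2) by (simp add: mult_le_cancel_right)
qed (use F in auto)

lemma sq_sum_le: "((a::real) + b)\<^sup>2 \<le> 2 * a\<^sup>2 + 2 * b\<^sup>2"
  and sq_diff_le: "(a - b)\<^sup>2 \<le> 2 * a\<^sup>2 + 2 * b\<^sup>2"
  using sum_squares_bound[of a b] sum_squares_bound[of a "-b"] by (simp_all add: power2_sum power2_diff)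

lemma integral_Cauchy_Schwarz:
  fixes f g :: "'b \<Rightarrow> real"
  assumes [measurable]: "f \<in> borel_measurable M" "g \<in> borel_measurable M"
    and f: "integrable M (\<lambda>x. (f x)\<^sup>2)" and g: "integrable M (\<lambda>x. (g x)\<^sup>2)"
  shows "integrable M (\<lambda>x. f x * g x)"
    and "(LINT x|M. \<bar>f x * g x\<bar>)\<^sup>2 \<le> (LINT x|M. (f x)\<^sup>2) * (LINT x|M. (g x)\<^sup>2)"
proof -
  have "\<bar>f x * g x\<bar> \<le> (f x)\<^sup>2 + (g x)\<^sup>2" for x
  proof -
    have "0 \<le> \<bar>f x * g x\<bar>" "2 * \<bar>f x * g x\<bar> \<le> (f x)\<^sup>2 + (g x)\<^sup>2"
      using sum_squares_bound[of "\<bar>f x\<bar>" "\<bar>g x\<bar>"] by (simp_all add: abs_mult)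
    then show ?thesis by linarith
  qed
  then show fg: "integrable M (\<lambda>x. f x * g x)"
    by (intro Bochner_Integration.integrable_bound[OF Bochner_Integration.integrable_add[OF f g]] AE_I2) auto
  show "(LINT x|M. \<bar>f x * g x\<bar>)\<^sup>2 \<le> (LINT x|M. (f x)\<^sup>2) * (LINT x|M. (g x)\<^sup>2)"
  proof (rule quadratic_nonneg_imp)
    fix t :: real
    have "0 \<le> (LINT x|M. (\<bar>f x\<bar> + t * \<bar>g x\<bar>)\<^sup>2)" by simp
    also have "\<dots> = (LINT x|M. (f x)\<^sup>2 + 2 * t * \<bar>f x * g x\<bar> + t\<^sup>2 * (g x)\<^sup>2)"
      by (intro Bochner_Integration.integral_cong) (auto simp: power2_sum power_mult_distrib abs_mult)
    also have "\<dots> = (LINT x|M. (f x)\<^sup>2) + 2 * t * (LINT x|M. \<bar>f x * g x\<bar>) + t\<^sup>2 * (LINT x|M. (g x)\<^sup>2)"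
      using f g fg by simp
    finally show "0 \<le> (LINT x|M. (f x)\<^sup>2) + 2 * t * (LINT x|M. \<bar>f x * g x\<bar>) + t\<^sup>2 * (LINT x|M. (g x)\<^sup>2)" .
  qed
qed

lemma nn_integral_Fatou_AE:
  fixes u :: "nat \<Rightarrow> 'b \<Rightarrow> real"
  assumes [measurable]: "\<And>i. u i \<in> borel_measurable M"
    and lim: "AE x in M. (\<lambda>i. u i x) \<longlonglongrightarrow> v x"
    and le: "eventually (\<lambda>i. (\<integral>\<^sup>+x. ennreal (u i x) \<partial>M) \<le> e) sequentially"
  shows "(\<integral>\<^sup>+x. ennreal (v x) \<partial>M) \<le> e"
proof -
  have "(\<integral>\<^sup>+x. ennreal (v x) \<partial>M) = (\<integral>\<^sup>+x. liminf (\<lambda>i. ennreal (u i x)) \<partial>M)"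
  proof (rule nn_integral_cong_AE)
    show "AE x in M. ennreal (v x) = liminf (\<lambda>i. ennreal (u i x))"
      using lim
    proof eventually_elim
      case (elim x)
      then have "(\<lambda>i. ennreal (u i x)) \<longlonglongrightarrow> ennreal (v x)" by (rule tendsto_ennrealI)
      then show ?case using lim_imp_Liminf[OF sequentially_bot] by metis
    qed
  qed
  also have "\<dots> \<le> liminf (\<lambda>i. \<integral>\<^sup>+x. ennreal (u i x) \<partial>M)"
    by (rule nn_integral_liminf) measurable
  also have "\<dots> \<le> e"
    using le by (simp add: Liminf_le)
  finally show ?thesis .
qed

lemma L1_complete:
  fixes F :: "nat \<Rightarrow> 'b \<Rightarrow> real"
  assumes int: "\<And>n. integrable M (F n)"
    and cauchy: "\<And>e. e > 0 \<Longrightarrow> \<exists>N. \<forall>i\<ge>N. \<forall>j\<ge>N. (LINT x|M. \<bar>F i x - F j x\<bar>) < e"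
  shows "\<exists>g. integrable M g \<and> L1_tendsto M F g"
proof -
  obtain r where r: "strict_mono r" "AE x in M. Cauchy (\<lambda>i. F (r i) x)"
    using cauchy_L1_AE_cauchy_subseq[of M F] int cauchy by auto
  define g where "g x = lim (\<lambda>i. F (r i) x)" for x
  have [measurable]: "F n \<in> borel_measurable M" for n using int by auto
  have [measurable]: "g \<in> borel_measurable M" unfolding g_def by (rule borel_measurable_lim_metric) measurable
  have lim: "AE x in M. (\<lambda>i. F (r i) x) \<longlonglongrightarrow> g x"
    using r(2) unfolding g_def by eventually_elim (metis Cauchy_convergent_iff convergent_LIMSEQ_iff)
  have le: "(\<integral>\<^sup>+x. ennreal \<bar>F j x - g x\<bar> \<partial>M) \<le> ennreal e"
    if N: "\<forall>i\<ge>N. \<forall>j\<ge>N. (LINT x|M. \<bar>F i x - F j x\<bar>) < e" and j: "j \<ge> N" for N j e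
  proof (rule nn_integral_Fatou_AE)
    show "AE x in M. (\<lambda>i. \<bar>F j x - F (r i) x\<bar>) \<longlonglongrightarrow> \<bar>F j x - g x\<bar>"
      using lim by eventually_elim (intro tendsto_intros)
    show "eventually (\<lambda>i. (\<integral>\<^sup>+x. ennreal \<bar>F j x - F (r i) x\<bar> \<partial>M) \<le> ennreal e) sequentially"
      using eventually_ge_at_top[of N]
    proof eventually_elim
      case (elim i)
      then have "(LINT x|M. \<bar>F j x - F (r i) x\<bar>) \<le> e"
        using N j seq_suble[OF r(1), of i] by (meson less_imp_le order_trans)
      then show ?case
        using int by (subst nn_integral_eq_integral) (auto intro!: ennreal_leI)
    qed
  qed simp
  have intd: "integrable M (\<lambda>x. F j x - g x)" if "\<forall>i\<ge>N. \<forall>j\<ge>N. (LINT x|M. \<bar>F i x - F j x\<bar>) < e" "j \<ge> N" for N j e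
    using le[OF that] by (intro integrableI_bounded) (auto simp: le_less_trans)
  obtain N0 where "\<forall>i\<ge>N0. \<forall>j\<ge>N0. (LINT x|M. \<bar>F i x - F j x\<bar>) < 1" using cauchy[of 1] by auto
  then have "integrable M (\<lambda>x. F N0 x - g x)" by (rule intd) simp
  from Bochner_Integration.integrable_diff[OF int[of N0] this] have g: "integrable M g" by simp
  have "(\<lambda>n. LINT x|M. \<bar>F n x - g x\<bar>) \<longlonglongrightarrow> 0"
  proof (rule LIMSEQ_I)
    fix e :: real assume "e > 0"
    then obtain N where N: "\<forall>i\<ge>N. \<forall>j\<ge>N. (LINT x|M. \<bar>F i x - F j x\<bar>) < e / 2" using cauchy[of "e / 2"] by auto
    show "\<exists>N. \<forall>n\<ge>N. norm ((LINT x|M. \<bar>F n x - g x\<bar>) - 0) < e"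
    proof (intro exI[of _ N] allI impI)
      fix n assume "n \<ge> N"
      from le[OF N this] have "ennreal (LINT x|M. \<bar>F n x - g x\<bar>) \<le> ennreal (e / 2)"
        using g int by (subst (asm) nn_integral_eq_integral) auto
      then show "norm ((LINT x|M. \<bar>F n x - g x\<bar>) - 0) < e" using \<open>e > 0\<close> by simp
    qed
  qed
  with g show ?thesis unfolding L1_tendsto_def by blast
qed

lemma L1_tendsto_AE_subseq:
  assumes "\<And>n. integrable M (F n)" "integrable M g" "L1_tendsto M F g"
  shows "\<exists>r. strict_mono r \<and> (AE x in M. (\<lambda>n. F (r n) x) \<longlonglongrightarrow> g x)"
proof -
  have "\<exists>r::nat\<Rightarrow>nat. strict_mono r \<and> (AE x in M. (\<lambda>n. F (r n) x - g x) \<longlonglongrightarrow> 0)"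
    using assms by (intro tendsto_L1_AE_subseq) (auto simp: L1_tendsto_def)
  then show ?thesis by (simp add: LIM_zero_iff)
qed

lemma L1_tendsto_subseq: "L1_tendsto M F g \<Longrightarrow> strict_mono r \<Longrightarrow> L1_tendsto M (\<lambda>n. F (r n)) g"
  unfolding L1_tendsto_def using LIMSEQ_subseq_LIMSEQ[of _ 0 r] by (auto simp: o_def)

lemma L1_tendsto_trans:
  assumes int: "\<And>n. integrable M (F n)" "\<And>n. integrable M (F' n)" "integrable M g"
    and "L1_tendsto M F g" and "(\<lambda>n. LINT x|M. \<bar>F n x - F' n x\<bar>) \<longlonglongrightarrow> 0"
  shows "L1_tendsto M F' g"
  unfolding L1_tendsto_def
proof (rule tendsto_sandwich[OF _ _ tendsto_const])
  show "eventually (\<lambda>n. 0 \<le> (LINT x|M. \<bar>F' n x - g x\<bar>)) sequentially" by simp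
  show "eventually (\<lambda>n. (LINT x|M. \<bar>F' n x - g x\<bar>) \<le>
      (LINT x|M. \<bar>F n x - F' n x\<bar>) + (LINT x|M. \<bar>F n x - g x\<bar>)) sequentially"
  proof (intro always_eventually allI)
    fix n
    have "(LINT x|M. \<bar>F' n x - g x\<bar>) \<le> (LINT x|M. \<bar>F n x - F' n x\<bar> + \<bar>F n x - g x\<bar>)"
      using int by (intro integral_mono) auto
    also have "\<dots> = (LINT x|M. \<bar>F n x - F' n x\<bar>) + (LINT x|M. \<bar>F n x - g x\<bar>)" using int by simp
    finally show "(LINT x|M. \<bar>F' n x - g x\<bar>) \<le>
      (LINT x|M. \<bar>F n x - F' n x\<bar>) + (LINT x|M. \<bar>F n x - g x\<bar>)" .
  qed
  show "(\<lambda>n. (LINT x|M. \<bar>F n x - F' n x\<bar>) + (LINT x|M. \<bar>F n x - g x\<bar>)) \<longlonglongrightarrow> 0"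
    using tendsto_add[OF assms(5) assms(4)[unfolded L1_tendsto_def]] by simp
qed

lemma L1_tendsto_unique:
  assumes int: "\<And>n. integrable M (F n)" "integrable M g" "integrable M h"
    and "L1_tendsto M F g" "L1_tendsto M F h"
  shows "AE x in M. g x = h x"
proof -
  obtain r where r: "strict_mono r" "AE x in M. (\<lambda>n. F (r n) x) \<longlonglongrightarrow> g x"
    using L1_tendsto_AE_subseq[OF int(1,2) assms(4)] by blast
  obtain s where s: "strict_mono s" "AE x in M. (\<lambda>n. F (r (s n)) x) \<longlonglongrightarrow> h x"
    using L1_tendsto_AE_subseq[OF int(1) int(3) L1_tendsto_subseq[OF assms(5) r(1)]] by blast
  from r(2) s(2) show ?thesis
  proof eventually_elim
    case (elim x)
    then have "(\<lambda>n. F (r (s n)) x) \<longlonglongrightarrow> g x" using LIMSEQ_subseq_LIMSEQ[OF _ s(1)] by (fastforce simp: o_def)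
    with elim show ?case using LIMSEQ_unique by blast
  qed
qed

lemma L1_tendsto_integral:
  assumes int: "\<And>n. integrable M (F n)" "integrable M g" and "L1_tendsto M F g"
  shows "(\<lambda>n. LINT x|M. F n x) \<longlonglongrightarrow> (LINT x|M. g x)"
proof (rule LIM_zero_cancel, rule Lim_null_comparison)
  show "eventually (\<lambda>n. norm ((LINT x|M. F n x) - (LINT x|M. g x)) \<le> (LINT x|M. \<bar>F n x - g x\<bar>)) sequentially"
  proof (intro always_eventually allI)
    fix n
    have "(LINT x|M. F n x) - (LINT x|M. g x) = (LINT x|M. F n x - g x)" using int by simp
    then show "norm ((LINT x|M. F n x) - (LINT x|M. g x)) \<le> (LINT x|M. \<bar>F n x - g x\<bar>)"
      using integral_norm_bound[of M "\<lambda>x. F n x - g x"] by simp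
  qed
qed (use assms(3) in \<open>simp add: L1_tendsto_def\<close>)

lemma L1_tendsto_AE_nonneg:
  assumes int: "\<And>n. integrable M (F n)" "integrable M g" and L: "L1_tendsto M F g"
    and "\<And>n. AE x in M. 0 \<le> F n x"
  shows "AE x in M. 0 \<le> g x"
proof -
  obtain r where r: "strict_mono r" "AE x in M. (\<lambda>n. F (r n) x) \<longlonglongrightarrow> g x"
    using L1_tendsto_AE_subseq[OF int L] by blast
  have "AE x in M. \<forall>n. 0 \<le> F n x" using assms(4) by (simp add: AE_all_countable)
  with r(2) show ?thesis by eventually_elim (blast intro: LIMSEQ_le_const)
qed

text \<open>Multiplication of an \<open>L\<^sup>1\<close>-convergent sequence by bounded, almost everywhere convergent ones.\<close>

lemma L1_tendsto_mult_bounded: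
  fixes h :: "nat \<Rightarrow> 'b \<Rightarrow> real"
  assumes int: "\<And>n. integrable M (F n)" "integrable M g" and L: "L1_tendsto M F g"
    and [measurable]: "\<And>n. h n \<in> borel_measurable M" "k \<in> borel_measurable M"
    and hB: "\<And>n. AE x in M. \<bar>h n x\<bar> \<le> B" and lim: "AE x in M. (\<lambda>n. h n x) \<longlonglongrightarrow> k x"
  shows "\<And>n. integrable M (\<lambda>x. h n x * F n x)" "integrable M (\<lambda>x. k x * g x)"
    "L1_tendsto M (\<lambda>n x. h n x * F n x) (\<lambda>x. k x * g x)"
proof -
  have [measurable]: "F n \<in> borel_measurable M" "g \<in> borel_measurable M" for n using int by auto
  have hB': "AE x in M. \<forall>n. \<bar>h n x\<bar> \<le> B" using hB by (simp add: AE_all_countable)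
  have kB: "AE x in M. \<bar>k x\<bar> \<le> B"
    using hB' lim
  proof eventually_elim
    case (elim x)
    then show ?case by (intro LIMSEQ_le_const2[OF tendsto_rabs[OF elim(2)]]) auto
  qed
  have bnd: "integrable M (\<lambda>x. u x * F x)"
    if [measurable]: "u \<in> borel_measurable M" and "AE x in M. \<bar>u x\<bar> \<le> B" "integrable M F" for u F
  proof (rule Bochner_Integration.integrable_bound)
    show "integrable M (\<lambda>x. B * F x)" using that by simp
    show "(\<lambda>x. u x * F x) \<in> borel_measurable M" using that by measurable
    show "AE x in M. norm (u x * F x) \<le> norm (B * F x)"
      using that(2) by eventually_elim (auto simp: abs_mult intro!: mult_right_mono)
  qed
  show int1: "integrable M (\<lambda>x. h n x * F n x)" for n by (rule bnd) (use hB int in auto)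
  show int2: "integrable M (\<lambda>x. k x * g x)" by (rule bnd) (use kB int in auto)
  have intd: "integrable M (\<lambda>x. (h n x - k x) * g x)" for n
  proof -
    have "integrable M (\<lambda>x. h n x * g x)" by (rule bnd) (use hB int in auto)
    then show ?thesis using int2 by (simp add: left_diff_distrib)
  qed
  have "(\<lambda>n. LINT x|M. \<bar>(h n x - k x) * g x\<bar>) \<longlonglongrightarrow> (LINT x|M. 0)"
  proof (rule integral_dominated_convergence)
    show "integrable M (\<lambda>x. 2 * B * \<bar>g x\<bar>)" using int by simp
    show "AE x in M. (\<lambda>n. \<bar>(h n x - k x) * g x\<bar>) \<longlonglongrightarrow> 0"
      using lim
    proof eventually_elim
      case (elim x)
      from LIM_zero[OF this] have "(\<lambda>n. (h n x - k x) * g x) \<longlonglongrightarrow> 0" by (rule tendsto_mult_left_zero)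
      then show ?case by (rule tendsto_rabs_zero)
    qed
    show "AE x in M. norm \<bar>(h n x - k x) * g x\<bar> \<le> 2 * B * \<bar>g x\<bar>" for n
      using hB' kB
    proof eventually_elim
      case (elim x)
      then have "\<bar>h n x - k x\<bar> \<le> 2 * B" using elim(1)[rule_format, of n] by linarith
      then show ?case by (simp add: abs_mult mult_right_mono)
    qed
  qed measurable
  then have 1: "(\<lambda>n. B * (LINT x|M. \<bar>F n x - g x\<bar>) + (LINT x|M. \<bar>(h n x - k x) * g x\<bar>)) \<longlonglongrightarrow> 0"
    using tendsto_add[OF tendsto_mult_left[OF L[unfolded L1_tendsto_def], of B]] by fastforce
  show "L1_tendsto M (\<lambda>n x. h n x * F n x) (\<lambda>x. k x * g x)"
    unfolding L1_tendsto_def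
  proof (rule tendsto_sandwich[OF _ _ tendsto_const 1])
    show "eventually (\<lambda>n. (LINT x|M. \<bar>h n x * F n x - k x * g x\<bar>) \<le>
      B * (LINT x|M. \<bar>F n x - g x\<bar>) + (LINT x|M. \<bar>(h n x - k x) * g x\<bar>)) sequentially"
    proof (intro always_eventually allI)
      fix n
      have "(LINT x|M. \<bar>h n x * F n x - k x * g x\<bar>) \<le> (LINT x|M. B * \<bar>F n x - g x\<bar> + \<bar>(h n x - k x) * g x\<bar>)"
      proof (rule integral_mono_AE)
        show "AE x in M. \<bar>h n x * F n x - k x * g x\<bar> \<le> B * \<bar>F n x - g x\<bar> + \<bar>(h n x - k x) * g x\<bar>"
          using hB[of n]
        proof eventually_elim
          case (elim x)
          have "h n x * F n x - k x * g x = h n x * (F n x - g x) + (h n x - k x) * g x"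
            by (simp add: algebra_simps)
          moreover have "\<bar>h n x * (F n x - g x)\<bar> \<le> B * \<bar>F n x - g x\<bar>"
            using elim by (simp add: abs_mult mult_right_mono)
          ultimately show ?case by linarith
        qed
      qed (use int int1 int2 intd in auto)
      also have "\<dots> = B * (LINT x|M. \<bar>F n x - g x\<bar>) + (LINT x|M. \<bar>(h n x - k x) * g x\<bar>)"
        using int intd by simp
      finally show "(LINT x|M. \<bar>h n x * F n x - k x * g x\<bar>) \<le>
        B * (LINT x|M. \<bar>F n x - g x\<bar>) + (LINT x|M. \<bar>(h n x - k x) * g x\<bar>)" .
    qed
  qed simp
qed

text \<open>The Cauchy version, for differences of a bounded convergent sequence.\<close>

lemma L1_Cauchy_mult_bounded:
  fixes h :: "nat \<Rightarrow> 'b \<Rightarrow> real"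
  assumes int: "\<And>n. integrable M (F n)" "integrable M g" and L: "L1_tendsto M F g"
    and Fnn: "\<And>n. AE x in M. 0 \<le> F n x"
    and [measurable]: "\<And>n. h n \<in> borel_measurable M"
    and hB: "\<And>n. AE x in M. \<bar>h n x\<bar> \<le> B" and conv: "AE x in M. convergent (\<lambda>n. h n x)"
    and e: "e > 0"
  shows "\<exists>N. \<forall>n\<ge>N. \<forall>m\<ge>N. (LINT x|M. (h n x - h m x)\<^sup>2 * F m x) < e"
proof -
  define k where "k x = lim (\<lambda>n. h n x)" for x
  have [measurable]: "k \<in> borel_measurable M" unfolding k_def by (rule borel_measurable_lim_metric) measurable
  have lim: "AE x in M. (\<lambda>n. h n x) \<longlonglongrightarrow> k x"
    using conv unfolding k_def by (simp add: convergent_LIMSEQ_iff)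
  have [measurable]: "F n \<in> borel_measurable M" "g \<in> borel_measurable M" for n using int by auto
  have hB': "AE x in M. \<forall>n. \<bar>h n x\<bar> \<le> B" using hB by (simp add: AE_all_countable)
  have kB: "AE x in M. \<bar>k x\<bar> \<le> B"
    using hB' lim
  proof eventually_elim
    case (elim x)
    then show ?case by (intro LIMSEQ_le_const2[OF tendsto_rabs[OF elim(2)]]) auto
  qed
  have dB: "AE x in M. \<forall>n. (h n x - k x)\<^sup>2 \<le> 4 * B\<^sup>2"
    using hB' kB
  proof (eventually_elim, intro allI)
    fix x n assume *: "\<forall>n. \<bar>h n x\<bar> \<le> B" "\<bar>k x\<bar> \<le> B"
    then have "\<bar>h n x - k x\<bar> \<le> 2 * B" using *(1)[rule_format, of n] by linarith
    from power_mono[OF this abs_ge_zero, of 2]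
    show "(h n x - k x)\<^sup>2 \<le> 4 * B\<^sup>2" by (simp add: power_mult_distrib)
  qed
  have dlim: "AE x in M. (\<lambda>n. (h n x - k x)\<^sup>2) \<longlonglongrightarrow> 0"
    using lim by eventually_elim (use tendsto_power[OF LIM_zero, of _ _ _ 2] in fastforce)
  have dB1: "AE x in M. \<bar>(h n x - k x)\<^sup>2\<bar> \<le> 4 * B\<^sup>2" for n using dB by eventually_elim simp
  have *: "\<And>n. integrable M (\<lambda>x. (h n x - k x)\<^sup>2 * F n x)"
    "L1_tendsto M (\<lambda>n x. (h n x - k x)\<^sup>2 * F n x) (\<lambda>x. 0 * g x)"
    by (rule L1_tendsto_mult_bounded[OF int L _ _ dB1 dlim]; measurable)+
  have c: "L1_tendsto M (\<lambda>_::nat. g) g" unfolding L1_tendsto_def by simp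
  have **: "\<And>n. integrable M (\<lambda>x. (h n x - k x)\<^sup>2 * g x)"
    "L1_tendsto M (\<lambda>n x. (h n x - k x)\<^sup>2 * g x) (\<lambda>x. 0 * g x)"
    by (rule L1_tendsto_mult_bounded[OF int(2) int(2) c _ _ dB1 dlim]; measurable)+
  define a b c where "a m = 2 * (LINT x|M. \<bar>(h m x - k x)\<^sup>2 * F m x\<bar>)"
    and "b n = 2 * (LINT x|M. \<bar>(h n x - k x)\<^sup>2 * g x\<bar>)" and "c m = 8 * B\<^sup>2 * (LINT x|M. \<bar>F m x - g x\<bar>)" for n m
  have a0: "a \<longlonglongrightarrow> 0" unfolding a_def using *(2) unfolding L1_tendsto_def
    by (auto intro!: tendsto_mult_right_zero)
  have b0: "b \<longlonglongrightarrow> 0" unfolding b_def using **(2) unfolding L1_tendsto_def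
    by (auto intro!: tendsto_mult_right_zero)
  have c0: "c \<longlonglongrightarrow> 0" unfolding c_def using L unfolding L1_tendsto_def
    by (auto intro!: tendsto_mult_right_zero)
  have le: "(LINT x|M. (h n x - h m x)\<^sup>2 * F m x) \<le> a m + b n + c m" for n m
  proof -
    have "(LINT x|M. (h n x - h m x)\<^sup>2 * F m x) \<le>
      (LINT x|M. 2 * \<bar>(h m x - k x)\<^sup>2 * F m x\<bar> + 2 * \<bar>(h n x - k x)\<^sup>2 * g x\<bar> + 8 * B\<^sup>2 * \<bar>F m x - g x\<bar>)"
    proof (rule integral_mono_AE')
      show "AE x in M. (h n x - h m x)\<^sup>2 * F m x \<le>
        2 * \<bar>(h m x - k x)\<^sup>2 * F m x\<bar> + 2 * \<bar>(h n x - k x)\<^sup>2 * g x\<bar> + 8 * B\<^sup>2 * \<bar>F m x - g x\<bar>"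
        using Fnn[of m] dB
      proof eventually_elim
        case (elim x)
        have "(h n x - h m x)\<^sup>2 \<le> 2 * (h n x - k x)\<^sup>2 + 2 * (h m x - k x)\<^sup>2"
          using sq_diff_le[of "h n x - k x" "h m x - k x"] by simp
        then have "(h n x - h m x)\<^sup>2 * F m x \<le> (2 * (h n x - k x)\<^sup>2 + 2 * (h m x - k x)\<^sup>2) * F m x"
          using elim by (intro mult_right_mono) auto
        moreover have "(h n x - k x)\<^sup>2 * F m x = (h n x - k x)\<^sup>2 * g x + (h n x - k x)\<^sup>2 * (F m x - g x)"
          by (simp add: algebra_simps)
        moreover have "(h n x - k x)\<^sup>2 * (F m x - g x) \<le> 4 * B\<^sup>2 * \<bar>F m x - g x\<bar>"
          using elim by (intro order_trans[OF mult_left_mono[OF abs_ge_self] mult_right_mono]) auto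
        ultimately show ?case by (simp add: distrib_right)
      qed
    qed (use int * ** in auto)
    also have "\<dots> = a m + b n + c m"
      unfolding a_def b_def c_def using int * ** by simp
    finally show ?thesis .
  qed
  have "eventually (\<lambda>n. a n < e / 3 \<and> b n < e / 3 \<and> c n < e / 3) sequentially"
    using order_tendstoD(2)[OF a0, of "e/3"] order_tendstoD(2)[OF b0, of "e/3"] order_tendstoD(2)[OF c0, of "e/3"] e
    by (simp add: eventually_conj)
  then obtain N where N: "\<And>n. n \<ge> N \<Longrightarrow> a n < e / 3 \<and> b n < e / 3 \<and> c n < e / 3"
    by (auto simp: eventually_sequentially)
  show ?thesis
  proof (intro exI[of _ N] allI impI)
    fix n m assume "n \<ge> N" "m \<ge> N"
    then show "(LINT x|M. (h n x - h m x)\<^sup>2 * F m x) < e"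
      using le[of n m] N[of n] N[of m] by linarith
  qed
qed

subsection \<open>Square-integrable functions\<close>

lemma L2_add: "f \<in> L2 M \<Longrightarrow> g \<in> L2 M \<Longrightarrow> (\<lambda>x. f x + g x) \<in> L2 M"
  and L2_diff: "f \<in> L2 M \<Longrightarrow> g \<in> L2 M \<Longrightarrow> (\<lambda>x. f x - g x) \<in> L2 M"
proof -
  assume fg: "f \<in> L2 M" "g \<in> L2 M"
  then have [measurable]: "f \<in> borel_measurable M" "g \<in> borel_measurable M" by (auto simp: L2_def)
  have i: "integrable M (\<lambda>x. f x * g x)" using fg by (intro integral_Cauchy_Schwarz(1)) (auto simp: L2_def)
  show "(\<lambda>x. f x + g x) \<in> L2 M" "(\<lambda>x. f x - g x) \<in> L2 M"
    using fg i by (auto simp: L2_def power2_sum power2_diff mult.assoc)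
qed

lemma L2_cmult: "f \<in> L2 M \<Longrightarrow> (\<lambda>x. c * f x) \<in> L2 M"
  by (auto simp: L2_def power_mult_distrib)

lemma L2_sq_sum_le:
  assumes "f \<in> L2 M" "g \<in> L2 M"
  shows "(LINT x|M. (f x + g x)\<^sup>2) \<le> 2 * (LINT x|M. (f x)\<^sup>2) + 2 * (LINT x|M. (g x)\<^sup>2)"
proof -
  have "(LINT x|M. (f x + g x)\<^sup>2) \<le> (LINT x|M. 2 * (f x)\<^sup>2 + 2 * (g x)\<^sup>2)"
    using assms L2_add[OF assms] by (intro integral_mono sq_sum_le) (auto simp: L2_def)
  then show ?thesis using assms by (simp add: L2_def)
qed

lemma L2_tendsto_add:
  assumes fs: "\<And>n. fs n \<in> L2 M" "f \<in> L2 M" and gs: "\<And>n. gs n \<in> L2 M" "g \<in> L2 M"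
    and "L2_tendsto M fs f" "L2_tendsto M gs g"
  shows "L2_tendsto M (\<lambda>n x. fs n x + gs n x) (\<lambda>x. f x + g x)"
  unfolding L2_tendsto_def
proof (rule tendsto_sandwich[OF _ _ tendsto_const])
  show "eventually (\<lambda>n. (LINT x|M. (fs n x + gs n x - (f x + g x))\<^sup>2) \<le>
      2 * (LINT x|M. (fs n x - f x)\<^sup>2) + 2 * (LINT x|M. (gs n x - g x)\<^sup>2)) sequentially"
    using L2_sq_sum_le[OF L2_diff[OF fs(1,2)] L2_diff[OF gs(1,2)]] by (simp add: algebra_simps)
  show "(\<lambda>n. 2 * (LINT x|M. (fs n x - f x)\<^sup>2) + 2 * (LINT x|M. (gs n x - g x)\<^sup>2)) \<longlonglongrightarrow> 0"
    using tendsto_add[OF tendsto_mult_left[OF assms(5)[unfolded L2_tendsto_def], of 2]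
        tendsto_mult_left[OF assms(6)[unfolded L2_tendsto_def], of 2]] by simp
qed simp

lemma L2_tendsto_cmult:
  assumes "L2_tendsto M fs f"
  shows "L2_tendsto M (\<lambda>n x. c * fs n x) (\<lambda>x. c * f x)"
proof -
  have "(c * fs n x - c * f x)\<^sup>2 = c\<^sup>2 * (fs n x - f x)\<^sup>2" for n x
    by (metis right_diff_distrib power_mult_distrib)
  then show ?thesis
    using tendsto_mult_left[OF assms[unfolded L2_tendsto_def], of "c\<^sup>2"] by (simp add: L2_tendsto_def)
qed

lemma L2_tendsto_diff:
  assumes fs: "\<And>n. fs n \<in> L2 M" "f \<in> L2 M" and gs: "\<And>n. gs n \<in> L2 M" "g \<in> L2 M"
    and "L2_tendsto M fs f" "L2_tendsto M gs g"
  shows "L2_tendsto M (\<lambda>n x. fs n x - gs n x) (\<lambda>x. f x - g x)"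
  using L2_tendsto_add[OF fs L2_cmult[OF gs(1), of "-1"] L2_cmult[OF gs(2), of "-1"] assms(5)
      L2_tendsto_cmult[OF assms(6), of "-1"]] by simp

lemma L2_tendsto_AE_subseq:
  assumes "\<And>n. fs n \<in> L2 M" "f \<in> L2 M" "L2_tendsto M fs f"
  shows "\<exists>r::nat\<Rightarrow>nat. strict_mono r \<and> (AE x in M. (\<lambda>n. fs (r n) x) \<longlonglongrightarrow> f x)"
proof -
  have "\<exists>r::nat\<Rightarrow>nat. strict_mono r \<and> (AE x in M. (\<lambda>n. (fs (r n) x - f x)\<^sup>2) \<longlonglongrightarrow> 0)"
    using assms L2_diff[OF assms(1,2)] by (intro tendsto_L1_AE_subseq) (auto simp: L2_tendsto_def L2_def)
  moreover have "(\<lambda>n. u n) \<longlonglongrightarrow> v" if "(\<lambda>n. (u n - v)\<^sup>2) \<longlonglongrightarrow> 0" for u and v :: real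
    using tendsto_real_sqrt[OF that] by (simp add: tendsto_rabs_zero_iff LIM_zero_iff)
  ultimately show ?thesis by fastforce
qed

section \<open>Closable square field forms\<close>

text \<open>
  A form \<open>\<integral> G(f, g) dM\<close> on an algebra \<open>C\<close> of bounded functions, with a pointwise square field \<open>G\<close> that
  satisfies the chain and Leibniz rules almost everywhere.  The form is closable, and an integrable
  function that is orthogonal to \<open>C\<close> vanishes.  The core of the base space and the cylinder functions
  are the two instances.
\<close>

locale square_field_form =
  fixes M :: "'b measure" and C :: "('b \<Rightarrow> real) set" and G :: "('b \<Rightarrow> real) \<Rightarrow> ('b \<Rightarrow> real) \<Rightarrow> 'b \<Rightarrow> real"
  assumes C_zero: "(\<lambda>_. 0) \<in> C"
    and C_add: "f \<in> C \<Longrightarrow> g \<in> C \<Longrightarrow> (\<lambda>x. f x + g x) \<in> C"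
    and C_scale: "f \<in> C \<Longrightarrow> (\<lambda>x. c * f x) \<in> C"
    and C_mult: "f \<in> C \<Longrightarrow> g \<in> C \<Longrightarrow> (\<lambda>x. f x * g x) \<in> C"
    and C_comp: "f \<in> C \<Longrightarrow> smooth1 \<phi> \<Longrightarrow> (\<lambda>x. \<phi> (f x) - \<phi> 0) \<in> C"
    and C_L2: "f \<in> C \<Longrightarrow> f \<in> L2 M"
    and C_bounded: "f \<in> C \<Longrightarrow> \<exists>B. \<forall>x\<in>space M. \<bar>f x\<bar> \<le> B"
    and G_int: "f \<in> C \<Longrightarrow> g \<in> C \<Longrightarrow> integrable M (G f g)"
    and G_sym: "f \<in> C \<Longrightarrow> g \<in> C \<Longrightarrow> AE x in M. G f g x = G g f x"
    and G_add: "f \<in> C \<Longrightarrow> g \<in> C \<Longrightarrow> h \<in> C \<Longrightarrow> AE x in M. G (\<lambda>x. f x + g x) h x = G f h x + G g h x"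
    and G_scale: "f \<in> C \<Longrightarrow> g \<in> C \<Longrightarrow> AE x in M. G (\<lambda>x. c * f x) g x = c * G f g x"
    and G_nonneg: "f \<in> C \<Longrightarrow> AE x in M. 0 \<le> G f f x"
    and G_chain: "f \<in> C \<Longrightarrow> g \<in> C \<Longrightarrow> smooth1 \<phi> \<Longrightarrow>
      AE x in M. G (\<lambda>x. \<phi> (f x) - \<phi> 0) g x = deriv \<phi> (f x) * G f g x"
    and G_Leibniz: "f \<in> C \<Longrightarrow> g \<in> C \<Longrightarrow> h \<in> C \<Longrightarrow>
      AE x in M. G (\<lambda>x. f x * g x) h x = f x * G g h x + g x * G f h x"
    and closableC: "closable M C (\<lambda>f g. LINT x|M. G f g x)"
    and separating: "integrable M w \<Longrightarrow> (\<And>h. h \<in> C \<Longrightarrow> (LINT x|M. h x * w x) = 0) \<Longrightarrow> AE x in M. w x = 0"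
begin

abbreviation Q :: "('b \<Rightarrow> real) \<Rightarrow> ('b \<Rightarrow> real) \<Rightarrow> real" where "Q f g \<equiv> LINT x|M. G f g x"
abbreviation D :: "('b \<Rightarrow> real) set" where "D \<equiv> closure_dom M C (\<lambda>f g. Q f g)"
abbreviation E :: "('b \<Rightarrow> real) \<Rightarrow> ('b \<Rightarrow> real) \<Rightarrow> real" where "E \<equiv> closure_form M C (\<lambda>f g. Q f g)"
abbreviation approx where "approx f fs \<equiv> approx_seq M C (\<lambda>f g. Q f g) f fs"
abbreviation cauchy where "cauchy fs \<equiv> form_cauchy (\<lambda>f g. Q f g) fs"

abbreviation fadd (infixl "\<oplus>" 65) where "f \<oplus> g \<equiv> (\<lambda>x. f x + g x)"

subsection \<open>Pointwise and integrated bilinearity\<close>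

lemma diff_alt: "f - g = (\<lambda>x. f x + (-1) * g x)" for f g :: "'b \<Rightarrow> real"
  by (auto simp: fun_eq_iff)

lemma C_diff: "f \<in> C \<Longrightarrow> g \<in> C \<Longrightarrow> f - g \<in> C"
  unfolding diff_alt by (intro C_add C_scale)

lemma C_plus: "f \<in> C \<Longrightarrow> g \<in> C \<Longrightarrow> f \<oplus> g \<in> C"
  using C_add[of f g] .

lemma C_measurable [measurable_dest]: "f \<in> C \<Longrightarrow> f \<in> borel_measurable M"
  using C_L2 by (auto simp: L2_def)

lemma G_measurable: "f \<in> C \<Longrightarrow> g \<in> C \<Longrightarrow> G f g \<in> borel_measurable M"
  using G_int by blast

lemma G_plus: "f \<in> C \<Longrightarrow> g \<in> C \<Longrightarrow> h \<in> C \<Longrightarrow> AE x in M. G (f \<oplus> g) h x = G f h x + G g h x"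
  by (rule G_add)

lemma G_diff: "f \<in> C \<Longrightarrow> g \<in> C \<Longrightarrow> h \<in> C \<Longrightarrow> AE x in M. G (f - g) h x = G f h x - G g h x"
  unfolding diff_alt using G_add[OF _ C_scale[of g "-1"], of f h] G_scale[of g h "-1"]
  by (auto elim!: AE_mp)

lemma G_diff2: 
  assumes "f \<in> C" "g \<in> C" shows "AE x in M. G (f - g) (f - g) x = G f f x - 2 * G f g x + G g g x"
  using G_diff[OF assms C_diff[OF assms]] G_sym[OF assms(1) C_diff[OF assms]] G_sym[OF assms(2) C_diff[OF assms]]
    G_diff[OF assms assms(1)] G_diff[OF assms assms(2)] G_sym[OF assms]
  by eventually_elim simp

lemma G_plus2: 
  assumes "f \<in> C" "g \<in> C" shows "AE x in M. G (f \<oplus> g) (f \<oplus> g) x = G f f x + 2 * G f g x + G g g x"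
  using G_plus[OF assms C_plus[OF assms]] G_sym[OF assms(1) C_plus[OF assms]] G_sym[OF assms(2) C_plus[OF assms]]
    G_plus[OF assms assms(1)] G_plus[OF assms assms(2)] G_sym[OF assms]
  by eventually_elim simp

lemma G_scale2: "f \<in> C \<Longrightarrow> AE x in M. G (\<lambda>x. c * f x) (\<lambda>x. c * f x) x = c\<^sup>2 * G f f x"
  using G_scale[of f "\<lambda>x. c * f x" c] G_sym[of f "\<lambda>x. c * f x"] G_scale[of f f c] C_scale[of f c]
  by (auto elim!: AE_mp simp: power2_eq_square)

lemma G_CS: 
  assumes f: "f \<in> C" and g: "g \<in> C" shows "AE x in M. (G f g x)\<^sup>2 \<le> G f f x * G g g x"
proof -
  have 1: "AE x in M. 0 \<le> G f f x + 2 * t * G f g x + t\<^sup>2 * G g g x" for t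
    using G_nonneg[OF C_plus[OF f C_scale[OF g, of t]]] G_plus2[OF f C_scale[OF g, of t]]
      G_sym[OF f C_scale[OF g, of t]] G_scale[OF g f, of t] G_sym[OF f g] G_scale2[OF g, of t]
    by eventually_elim simp
  have "AE x in M. \<forall>t\<in>\<rat>. 0 \<le> G f f x + 2 * t * G f g x + t\<^sup>2 * G g g x"
    using 1 by (intro AE_ball_countable[THEN iffD2]) (auto simp: countable_rat)
  then show ?thesis
    by eventually_elim (meson quadratic_nonneg_imp quadratic_rat_dense)
qed

lemma G_sqrt_diff:
  assumes "f \<in> C" "g \<in> C"
  shows "AE x in M. \<bar>sqrt (G f f x) - sqrt (G g g x)\<bar> \<le> sqrt (G (f - g) (f - g) x)"
  using G_nonneg[OF assms(1)] G_nonneg[OF assms(2)] G_CS[OF assms] G_diff2[OF assms]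
  by eventually_elim (simp add: abs_sqrt_diff_le)

lemma Q_nonneg: "f \<in> C \<Longrightarrow> 0 \<le> Q f f"
  by (intro integral_nonneg_AE G_nonneg)

lemma Q_diff: "f \<in> C \<Longrightarrow> g \<in> C \<Longrightarrow> h \<in> C \<Longrightarrow> Q (f - g) h = Q f h - Q g h"
  using G_int integral_cong_AE[OF _ _ G_diff[of f g h]] C_diff by auto

lemma Q_plus: "f \<in> C \<Longrightarrow> g \<in> C \<Longrightarrow> h \<in> C \<Longrightarrow> Q (f \<oplus> g) h = Q f h + Q g h"
  using G_int integral_cong_AE[OF _ _ G_plus[of f g h]] C_plus by auto

lemma Q_scale: "f \<in> C \<Longrightarrow> h \<in> C \<Longrightarrow> Q (\<lambda>x. c * f x) h = c * Q f h"
  using G_int integral_cong_AE[OF _ _ G_scale[of f h c]] C_scale by auto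

lemma Q_sym: "f \<in> C \<Longrightarrow> g \<in> C \<Longrightarrow> Q f g = Q g f"
  using G_int integral_cong_AE[OF _ _ G_sym[of f g]] by auto

lemma Q_plus2: "f \<in> C \<Longrightarrow> g \<in> C \<Longrightarrow> Q (f \<oplus> g) (f \<oplus> g) = Q f f + 2 * Q f g + Q g g"
  using Q_plus[of f g "f \<oplus> g"] Q_sym[of f "f \<oplus> g"] Q_sym[of g "f \<oplus> g"] Q_plus[of f g f] Q_plus[of f g g]
    Q_sym[of f g] C_plus[of f g] by simp

lemma Q_diff2: "f \<in> C \<Longrightarrow> g \<in> C \<Longrightarrow> Q (f - g) (f - g) = Q f f - 2 * Q f g + Q g g"
  using Q_diff[of f g "f - g"] Q_sym[of f "f - g"] Q_sym[of g "f - g"] Q_diff[of f g f] Q_diff[of f g g]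
    Q_sym[of f g] C_diff[of f g] by simp

lemma Q_scale2: "f \<in> C \<Longrightarrow> Q (\<lambda>x. c * f x) (\<lambda>x. c * f x) = c\<^sup>2 * Q f f"
  using Q_scale[of f "\<lambda>x. c * f x" c] Q_sym[of f "\<lambda>x. c * f x"] Q_scale[of f f c] C_scale[of f c]
  by (simp add: power2_eq_square)

lemma Q_CS: assumes f: "f \<in> C" and g: "g \<in> C" shows "(Q f g)\<^sup>2 \<le> Q f f * Q g g"
proof (rule quadratic_nonneg_imp)
  fix t
  have "0 \<le> Q (f \<oplus> (\<lambda>x. t * g x)) (f \<oplus> (\<lambda>x. t * g x))" by (intro Q_nonneg C_plus C_scale f g)
  also have "\<dots> = Q f f + 2 * t * Q f g + t\<^sup>2 * Q g g"
    using f g C_scale[OF g, of t] Q_sym[of f "\<lambda>x. t * g x"] Q_scale[of g f t] Q_sym[of f g]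
    by (simp add: Q_plus2 Q_scale2)
  finally show "0 \<le> Q f f + 2 * t * Q f g + t\<^sup>2 * Q g g" .
qed

text \<open>
  The seminorm of the form.
\<close>

definition N :: "('b \<Rightarrow> real) \<Rightarrow> real" where "N f = sqrt (Q f f)"

lemma N_nonneg: "f \<in> C \<Longrightarrow> 0 \<le> N f" unfolding N_def by (simp add: Q_nonneg)

lemma N_sq: "f \<in> C \<Longrightarrow> (N f)\<^sup>2 = Q f f" unfolding N_def by (simp add: Q_nonneg)

lemma Q_le_N: "f \<in> C \<Longrightarrow> g \<in> C \<Longrightarrow> \<bar>Q f g\<bar> \<le> N f * N g"
  unfolding N_def using Q_CS[of f g] by (metis real_sqrt_abs real_sqrt_le_mono real_sqrt_mult)

lemma N_triangle_diff: "f \<in> C \<Longrightarrow> g \<in> C \<Longrightarrow> N (f - g) \<le> N f + N g"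
proof (rule power2_le_imp_le)
  assume fg: "f \<in> C" "g \<in> C"
  show "(N (f - g))\<^sup>2 \<le> (N f + N g)\<^sup>2"
    using fg Q_le_N[OF fg] by (simp add: N_sq C_diff Q_diff2 power2_sum)
qed (simp add: N_nonneg)

lemma N_triangle: "f \<in> C \<Longrightarrow> g \<in> C \<Longrightarrow> N (f \<oplus> g) \<le> N f + N g"
proof (rule power2_le_imp_le)
  assume fg: "f \<in> C" "g \<in> C"
  show "(N (f \<oplus> g))\<^sup>2 \<le> (N f + N g)\<^sup>2"
    using fg Q_le_N[OF fg] by (simp add: N_sq C_plus Q_plus2 power2_sum)
qed (simp add: N_nonneg)

text \<open>
  \<open>G(f) - G(g) = (\<surd>G(f) - \<surd>G(g)) (\<surd>G(f) + \<surd>G(g))\<close>, and the first factor is at most \<open>\<surd>G(f - g)\<close>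
  in absolute value.
\<close>

lemma G_L1_diff:
  assumes f: "f \<in> C" and g: "g \<in> C"
  shows "(LINT x|M. \<bar>G f f x - G g g x\<bar>) \<le> N (f - g) * (N f + N g)"
proof -
  note fg = C_diff[OF f g]
  note [measurable] = G_measurable[OF f f] G_measurable[OF g g] G_measurable[OF fg fg]
  define a b d where "a x = sqrt (G f f x)" and "b x = sqrt (G g g x)" and "d x = sqrt (G (f - g) (f - g) x)" for x
  have [measurable]: "a \<in> borel_measurable M" "b \<in> borel_measurable M" "d \<in> borel_measurable M"
    unfolding a_def b_def d_def by measurable
  have sq: "AE x in M. (a x)\<^sup>2 = G f f x" "AE x in M. (b x)\<^sup>2 = G g g x" "AE x in M. (d x)\<^sup>2 = G (f - g) (f - g) x"
    unfolding a_def b_def d_def using G_nonneg[OF f] G_nonneg[OF g] G_nonneg[OF fg] by auto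
  have int: "integrable M (\<lambda>x. (a x)\<^sup>2)" "integrable M (\<lambda>x. (b x)\<^sup>2)" "integrable M (\<lambda>x. (d x)\<^sup>2)"
    using integrable_cong_AE[OF _ _ sq(1)] integrable_cong_AE[OF _ _ sq(2)] integrable_cong_AE[OF _ _ sq(3)]
      G_int f g fg by auto
  have I: "(LINT x|M. (a x)\<^sup>2) = Q f f" "(LINT x|M. (b x)\<^sup>2) = Q g g" "(LINT x|M. (d x)\<^sup>2) = Q (f - g) (f - g)"
    using sq by (intro integral_cong_AE; simp)+
  have CS: "(LINT x|M. \<bar>d x * a x\<bar>) \<le> N (f - g) * N f" "(LINT x|M. \<bar>d x * b x\<bar>) \<le> N (f - g) * N g"
    using integral_Cauchy_Schwarz(2)[of d M a] integral_Cauchy_Schwarz(2)[of d M b] int I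
    unfolding N_def by (auto simp flip: real_sqrt_mult intro!: real_le_rsqrt)
  have i2: "integrable M (\<lambda>x. d x * a x)" "integrable M (\<lambda>x. d x * b x)"
    using int by (auto intro!: integral_Cauchy_Schwarz(1))
  have "(LINT x|M. \<bar>G f f x - G g g x\<bar>) \<le> (LINT x|M. \<bar>d x * a x\<bar> + \<bar>d x * b x\<bar>)"
  proof (rule integral_mono_AE)
    show "AE x in M. \<bar>G f f x - G g g x\<bar> \<le> \<bar>d x * a x\<bar> + \<bar>d x * b x\<bar>"
      using sq(1,2) G_sqrt_diff[OF f g] G_nonneg[OF f] G_nonneg[OF g] G_nonneg[OF fg]
    proof eventually_elim
      case (elim x)
      have "G f f x - G g g x = (a x - b x) * (a x + b x)"
        unfolding elim(1,2)[symmetric] by (simp add: power2_eq_square algebra_simps)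
      moreover have "\<bar>a x - b x\<bar> \<le> d x" "a x \<ge> 0" "b x \<ge> 0" "d x \<ge> 0"
        using elim unfolding a_def b_def d_def by auto
      moreover from this have "\<bar>(a x - b x) * (a x + b x)\<bar> \<le> d x * (a x + b x)"
        by (simp add: abs_mult mult_right_mono)
      ultimately show ?case by (simp only: distrib_left abs_mult abs_of_nonneg)
    qed
  qed (use i2 G_int f g in auto)
  also have "\<dots> \<le> N (f - g) * (N f + N g)"
    using CS i2 by (simp add: distrib_left)
  finally show ?thesis .
qed

subsection \<open>Cauchy sequences\<close>

lemma cauchyI:
  assumes "\<And>n. fs n \<in> C" "\<And>e. e > 0 \<Longrightarrow> \<exists>n0. \<forall>i\<ge>n0. \<forall>j\<ge>n0. N (fs i - fs j) < e"
  shows "cauchy fs"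
  unfolding form_cauchy_def
proof (intro allI impI)
  fix e :: real assume "e > 0"
  then obtain n0 where n0: "\<forall>i\<ge>n0. \<forall>j\<ge>n0. N (fs i - fs j) < sqrt e" using assms(2)[of "sqrt e"] by auto
  then show "\<exists>n0. \<forall>i\<ge>n0. \<forall>j\<ge>n0. Q (fs i - fs j) (fs i - fs j) < e"
    unfolding N_def by auto
qed

lemma cauchyD: "cauchy fs \<Longrightarrow> e > 0 \<Longrightarrow> \<exists>n0. \<forall>i\<ge>n0. \<forall>j\<ge>n0. N (fs i - fs j) < e"
  unfolding form_cauchy_def N_def
  by (metis zero_less_power real_sqrt_less_mono real_sqrt_abs abs_of_pos)

lemma cauchy_comb:
  assumes fs: "\<And>n. fs n \<in> C" "cauchy fs" and gs: "\<And>n. gs n \<in> C" "cauchy gs"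
    and hs: "\<And>n. hs n \<in> C" and le: "\<And>i j. N (hs i - hs j) \<le> N (fs i - fs j) + N (gs i - gs j)"
  shows "cauchy hs"
proof (rule cauchyI[OF hs])
  fix e :: real assume "e > 0"
  then obtain n1 n2 where "\<forall>i\<ge>n1. \<forall>j\<ge>n1. N (fs i - fs j) < e / 2" "\<forall>i\<ge>n2. \<forall>j\<ge>n2. N (gs i - gs j) < e / 2"
    using cauchyD[OF fs(2), of "e / 2"] cauchyD[OF gs(2), of "e / 2"] by auto
  then show "\<exists>n0. \<forall>i\<ge>n0. \<forall>j\<ge>n0. N (hs i - hs j) < e"
    by (intro exI[of _ "max n1 n2"] allI impI) (smt (verit) le max.bounded_iff field_sum_of_halves)
qed

lemma cauchy_plus:
  assumes fs: "\<And>n. fs n \<in> C" "cauchy fs" and gs: "\<And>n. gs n \<in> C" "cauchy gs"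
  shows "cauchy (\<lambda>n. fs n \<oplus> gs n)"
proof (rule cauchy_comb[OF assms C_add[OF fs(1) gs(1)]])
  fix i j
  have "(fs i \<oplus> gs i) - (fs j \<oplus> gs j) = (fs i - fs j) \<oplus> (gs i - gs j)" by (auto simp: fun_eq_iff)
  then show "N ((fs i \<oplus> gs i) - (fs j \<oplus> gs j)) \<le> N (fs i - fs j) + N (gs i - gs j)"
    using N_triangle[OF C_diff[OF fs(1)[of i] fs(1)[of j]] C_diff[OF gs(1)[of i] gs(1)[of j]]] by metis
qed

lemma cauchy_minus:
  assumes fs: "\<And>n. fs n \<in> C" "cauchy fs" and gs: "\<And>n. gs n \<in> C" "cauchy gs"
  shows "cauchy (\<lambda>n. fs n - gs n)"
proof (rule cauchy_comb[OF assms C_diff[OF fs(1) gs(1)]])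
  fix i j
  have "fs i - gs i - (fs j - gs j) = (fs i - fs j) - (gs i - gs j)" by (auto simp: fun_eq_iff)
  then show "N (fs i - gs i - (fs j - gs j)) \<le> N (fs i - fs j) + N (gs i - gs j)"
    using N_triangle_diff[OF C_diff[OF fs(1)[of i] fs(1)[of j]] C_diff[OF gs(1)[of i] gs(1)[of j]]] by metis
qed

lemma cauchy_subseq: "cauchy fs \<Longrightarrow> strict_mono r \<Longrightarrow> cauchy (\<lambda>n. fs (r n))"
  unfolding form_cauchy_def by (meson order_trans seq_suble)

lemma cauchy_const: "f \<in> C \<Longrightarrow> cauchy (\<lambda>_. f)"
  unfolding form_cauchy_def by (simp add: Q_diff2)

lemma cauchy_N_bounded:
  assumes fs: "\<And>n. fs n \<in> C" "cauchy fs" shows "\<exists>B>0. \<forall>n. N (fs n) \<le> B"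
proof -
  obtain n0 where n0: "\<forall>i\<ge>n0. \<forall>j\<ge>n0. N (fs i - fs j) < 1" using cauchyD[OF fs(2), of 1] by auto
  define B where "B = Max ((\<lambda>n. N (fs n)) ` {..n0})"
  have "N (fs n) \<le> B + 1" for n
  proof (cases "n \<le> n0")
    case True
    then have "N (fs n) \<le> B" unfolding B_def by (intro Max_ge) auto
    then show ?thesis by simp
  next
    case False
    have "N (fs n) \<le> N (fs n - fs n0) + N (fs n0)"
      using N_triangle[OF C_diff[OF fs(1)[of n] fs(1)[of n0]] fs(1)[of n0]] by simp
    moreover have "N (fs n0) \<le> B" unfolding B_def by (intro Max_ge) auto
    moreover have "N (fs n - fs n0) < 1" using False n0 by auto
    ultimately show ?thesis by simp
  qed
  moreover have "0 \<le> B" using N_nonneg[OF fs(1)[of n0]] unfolding B_def by (intro order_trans[OF _ Max_ge]) auto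
  ultimately show ?thesis by (intro exI[of _ "B + 1"]) auto
qed

lemma cauchy_G_limit:
  assumes fs: "\<And>n. fs n \<in> C" "cauchy fs"
  shows "\<exists>g. integrable M g \<and> L1_tendsto M (\<lambda>n. G (fs n) (fs n)) g"
proof (rule L1_complete)
  fix e :: real assume e: "e > 0"
  obtain B where B: "B > 0" "\<And>n. N (fs n) \<le> B" using cauchy_N_bounded[OF fs] by blast
  obtain n0 where n0: "\<forall>i\<ge>n0. \<forall>j\<ge>n0. N (fs i - fs j) < e / (2 * B)" using cauchyD[OF fs(2), of "e / (2 * B)"] e B(1) by auto
  show "\<exists>n0. \<forall>i\<ge>n0. \<forall>j\<ge>n0. (LINT x|M. \<bar>G (fs i) (fs i) x - G (fs j) (fs j) x\<bar>) < e"
  proof (intro exI[of _ n0] allI impI)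
    fix i j assume ij: "n0 \<le> i" "n0 \<le> j"
    have "(LINT x|M. \<bar>G (fs i) (fs i) x - G (fs j) (fs j) x\<bar>) \<le> N (fs i - fs j) * (N (fs i) + N (fs j))"
      by (rule G_L1_diff) (use fs in auto)
    also have "\<dots> \<le> N (fs i - fs j) * (2 * B)"
      using B(2)[of i] B(2)[of j] by (intro mult_left_mono N_nonneg C_diff fs(1)) auto
    also have "\<dots> < e" using n0 ij B(1) by (simp add: pos_less_divide_eq)
    finally show "(LINT x|M. \<bar>G (fs i) (fs i) x - G (fs j) (fs j) x\<bar>) < e" .
  qed
qed (intro G_int fs)

lemma G_limit_transfer:
  assumes fs: "\<And>n. fs n \<in> C" "cauchy fs" and gs: "\<And>n. gs n \<in> C"
    and lim: "integrable M g" "L1_tendsto M (\<lambda>n. G (fs n) (fs n)) g"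
    and 0: "(\<lambda>n. N (fs n - gs n)) \<longlonglongrightarrow> 0"
  shows "L1_tendsto M (\<lambda>n. G (gs n) (gs n)) g"
proof (rule L1_tendsto_trans[OF _ _ lim])
  obtain B where B: "B > 0" "\<And>n. N (fs n) \<le> B" using cauchy_N_bounded[OF fs] by blast
  show "(\<lambda>n. LINT x|M. \<bar>G (fs n) (fs n) x - G (gs n) (gs n) x\<bar>) \<longlonglongrightarrow> 0"
  proof (rule tendsto_sandwich[OF _ _ tendsto_const])
    show "eventually (\<lambda>n. (LINT x|M. \<bar>G (fs n) (fs n) x - G (gs n) (gs n) x\<bar>) \<le> N (fs n - gs n) * (2 * B + N (fs n - gs n))) sequentially"
    proof (intro always_eventually allI)
      fix n
      have "fs n - (fs n - gs n) = gs n" by (auto simp: fun_eq_iff)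
      then have "N (gs n) \<le> N (fs n) + N (fs n - gs n)"
        using N_triangle_diff[OF fs(1)[of n] C_diff[OF fs(1)[of n] gs[of n]]] by simp
      then have "N (fs n) + N (gs n) \<le> 2 * B + N (fs n - gs n)" using B(2)[of n] by linarith
      then show "(LINT x|M. \<bar>G (fs n) (fs n) x - G (gs n) (gs n) x\<bar>) \<le> N (fs n - gs n) * (2 * B + N (fs n - gs n))"
        by (intro order_trans[OF G_L1_diff[OF fs(1) gs]] mult_left_mono N_nonneg C_diff fs(1) gs)
    qed
    show "(\<lambda>n. N (fs n - gs n) * (2 * B + N (fs n - gs n))) \<longlonglongrightarrow> 0"
      using tendsto_mult[OF 0 tendsto_add[OF tendsto_const[of "2 * B"] 0]] by simp
  qed simp
qed (intro G_int fs gs)+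

subsection \<open>The closure\<close>

lemma approxD: "approx f fs \<Longrightarrow> fs n \<in> C" "approx f fs \<Longrightarrow> cauchy fs" "approx f fs \<Longrightarrow> L2_tendsto M fs f"
  by (auto simp: approx_seq_def)

lemma D_L2: "f \<in> D \<Longrightarrow> f \<in> L2 M" by (auto simp: closure_dom_def)

lemma D_approx: "f \<in> D \<Longrightarrow> \<exists>fs. approx f fs" by (auto simp: closure_dom_def)

lemma approx_plus:
  assumes "f \<in> L2 M" "g \<in> L2 M" "approx f fs" "approx g gs"
  shows "approx (\<lambda>x. f x + g x) (\<lambda>n. fs n \<oplus> gs n)"
  using assms L2_tendsto_add[of fs M f gs g] approxD[OF assms(3)] approxD[OF assms(4)]
  unfolding approx_seq_def by (auto intro!: cauchy_plus C_plus C_L2 )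

lemma approx_minus:
  assumes "f \<in> L2 M" "g \<in> L2 M" "approx f fs" "approx g gs"
  shows "approx (\<lambda>x. f x - g x) (\<lambda>n. fs n - gs n)"
  using assms L2_tendsto_diff[of fs M f gs g] approxD[OF assms(3)] approxD[OF assms(4)]
  cauchy_minus[of fs gs] C_diff[of "fs _" "gs _"]
  unfolding approx_seq_def by (auto intro!: C_L2 simp: fun_diff_def)

lemma approx_subseq: "approx f fs \<Longrightarrow> strict_mono r \<Longrightarrow> approx f (\<lambda>n. fs (r n))"
  unfolding approx_seq_def L2_tendsto_def
  using cauchy_subseq[of fs r] LIMSEQ_subseq_LIMSEQ[of "\<lambda>n. LINT x|M. (fs n x - f x)\<^sup>2" 0 r] by (auto simp: o_def)

lemma approx_const: "f \<in> C \<Longrightarrow> approx f (\<lambda>_. f)"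
  unfolding approx_seq_def L2_tendsto_def by (simp add: cauchy_const)

lemma C_subset_D: "f \<in> C \<Longrightarrow> f \<in> D"
  unfolding closure_dom_def using approx_const C_L2 by auto

lemma D_diff': "f \<in> D \<Longrightarrow> g \<in> D \<Longrightarrow> (\<lambda>x. f x - g x) \<in> D"
  using approx_minus L2_diff[of f M g] unfolding closure_dom_def by blast

lemma D_diff: "f \<in> D \<Longrightarrow> g \<in> D \<Longrightarrow> f - g \<in> D"
  using D_diff' by (simp add: fun_diff_def)

lemma approx_0_N:
  assumes "approx (\<lambda>_. 0) fs" shows "(\<lambda>n. N (fs n)) \<longlonglongrightarrow> 0"
proof -
  have "(\<lambda>n. Q (fs n) (fs n)) \<longlonglongrightarrow> 0" using closableC assms unfolding closable_def by blast
  from tendsto_real_sqrt[OF this] show ?thesis unfolding N_def by simp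
qed

lemma approx_unique:
  assumes f: "f \<in> L2 M" and "approx f fs" "approx f gs" shows "(\<lambda>n. N (fs n - gs n)) \<longlonglongrightarrow> 0"
  using approx_0_N[of "\<lambda>n. fs n - gs n"] approx_minus[OF f f assms(2,3)] by simp

lemma approx_Q_convergent:
  assumes "approx f fs" shows "convergent (\<lambda>n. Q (fs n) (fs n))"
proof -
  note fs = approxD[OF assms]
  obtain g where "integrable M g" "L1_tendsto M (\<lambda>n. G (fs n) (fs n)) g" using cauchy_G_limit[OF fs(1,2)] by blast
  then have "(\<lambda>n. Q (fs n) (fs n)) \<longlonglongrightarrow> (LINT x|M. g x)" by (intro L1_tendsto_integral G_int fs)
  then show ?thesis by (auto simp: convergent_def)
qed

lemma E_limit:
  assumes f: "f \<in> L2 M" "approx f fs" and g: "g \<in> L2 M" "approx g gs"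
  shows "(\<lambda>n. Q (fs n) (gs n)) \<longlonglongrightarrow> E f g"
proof -
  have polar: "Q (fs n) (gs n) = (Q (fs n \<oplus> gs n) (fs n \<oplus> gs n) - Q (fs n - gs n) (fs n - gs n)) / 4" for n
    using approxD(1)[OF f(2)] approxD(1)[OF g(2)] by (simp add: Q_plus2 Q_diff2)
  obtain r1 r2 where "(\<lambda>n. Q (fs n \<oplus> gs n) (fs n \<oplus> gs n)) \<longlonglongrightarrow> r1" "(\<lambda>n. Q (fs n - gs n) (fs n - gs n)) \<longlonglongrightarrow> r2"
    using approx_Q_convergent[OF approx_plus[OF f(1) g(1) f(2) g(2)]]
      approx_Q_convergent[OF approx_minus[OF f(1) g(1) f(2) g(2)]] by (auto simp: convergent_def)
  then have lim: "(\<lambda>n. Q (fs n) (gs n)) \<longlonglongrightarrow> (r1 - r2) / 4"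
    unfolding polar by (intro tendsto_intros) auto
  have all: "(\<lambda>n. Q (fs' n) (gs' n)) \<longlonglongrightarrow> (r1 - r2) / 4" if fs': "approx f fs'" and gs': "approx g gs'" for fs' gs'
  proof -
    note C = approxD(1)[OF f(2)] approxD(1)[OF g(2)] approxD(1)[OF fs'] approxD(1)[OF gs']
    obtain B1 B2 where B: "\<And>n. N (fs n) \<le> B1" "\<And>n. N (gs' n) \<le> B2" "B1 > 0" "B2 > 0"
      using cauchy_N_bounded[OF approxD(1,2)[OF f(2)]] cauchy_N_bounded[OF approxD(1,2)[OF gs']] by blast
    have "(\<lambda>n. Q (fs' n) (gs' n) - Q (fs n) (gs n)) \<longlonglongrightarrow> 0"
    proof (rule Lim_null_comparison)
      show "eventually (\<lambda>n. norm (Q (fs' n) (gs' n) - Q (fs n) (gs n)) \<le> N (fs' n - fs n) * B2 + B1 * N (gs' n - gs n)) sequentially"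
      proof (intro always_eventually allI)
        fix n
        have "Q (fs' n) (gs' n) - Q (fs n) (gs n) = Q (fs' n - fs n) (gs' n) + Q (fs n) (gs' n - gs n)"
          using C by (simp add: Q_diff Q_sym[of "fs n" "gs' n - gs n"] Q_sym[of "fs n"] C_diff)
        moreover have "\<bar>Q (fs' n - fs n) (gs' n)\<bar> \<le> N (fs' n - fs n) * B2"
          by (rule order_trans[OF Q_le_N mult_left_mono]) (use C B in \<open>auto intro!: C_diff N_nonneg\<close>)
        moreover have "\<bar>Q (fs n) (gs' n - gs n)\<bar> \<le> B1 * N (gs' n - gs n)"
          by (rule order_trans[OF Q_le_N mult_right_mono]) (use C B in \<open>auto intro!: C_diff N_nonneg\<close>)
        ultimately show "norm (Q (fs' n) (gs' n) - Q (fs n) (gs n)) \<le> N (fs' n - fs n) * B2 + B1 * N (gs' n - gs n)"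
          by simp
      qed
      show "(\<lambda>n. N (fs' n - fs n) * B2 + B1 * N (gs' n - gs n)) \<longlonglongrightarrow> 0"
        using tendsto_add[OF tendsto_mult_right[OF approx_unique[OF f(1) fs' f(2)], of B2]
            tendsto_mult_left[OF approx_unique[OF g(1) gs' g(2)], of B1]] by simp
    qed
    from tendsto_add[OF this lim] show ?thesis by simp
  qed
  have "E f g = (r1 - r2) / 4"
    unfolding closure_form_def
  proof (rule the_equality)
    fix r assume "\<forall>fs gs. approx f fs \<and> approx g gs \<longrightarrow> (\<lambda>n. Q (fs n) (gs n)) \<longlonglongrightarrow> r"
    then show "r = (r1 - r2) / 4" using lim f(2) g(2) LIMSEQ_unique by blast
  qed (use all in blast)
  then show ?thesis using lim by (simp only:)
qed

end

context square_field_form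
begin

text \<open>Limits of the pointwise square field along approximating sequences.\<close>

definition G_value :: "('b \<Rightarrow> real) \<Rightarrow> ('b \<Rightarrow> real) \<Rightarrow> bool" where
  "G_value f g \<longleftrightarrow> integrable M g \<and> (\<exists>fs. approx f fs \<and> L1_tendsto M (\<lambda>n. G (fs n) (fs n)) g)"

lemma G_value_exists: assumes "f \<in> D" shows "\<exists>g. G_value f g"
proof -
  obtain fs where fs: "approx f fs" using D_approx[OF assms] by blast
  then show ?thesis unfolding G_value_def using cauchy_G_limit[OF approxD(1,2)[OF fs]] by blast
qed

lemma G_value_tendsto:
  assumes "f \<in> D" "G_value f g" "approx f fs"
  shows "L1_tendsto M (\<lambda>n. G (fs n) (fs n)) g"
proof -
  obtain gs where gs: "integrable M g" "approx f gs" "L1_tendsto M (\<lambda>n. G (gs n) (gs n)) g"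
    using assms(2) unfolding G_value_def by blast
  show ?thesis
    by (rule G_limit_transfer[OF approxD(1,2)[OF gs(2)] approxD(1)[OF assms(3)] gs(1,3)
        approx_unique[OF D_L2[OF assms(1)] gs(2) assms(3)]])
qed

lemma G_value_integral: "f \<in> D \<Longrightarrow> G_value f g \<Longrightarrow> (LINT x|M. g x) = E f f"
proof -
  assume fg: "f \<in> D" "G_value f g"
  obtain fs where fs: "approx f fs" using D_approx[OF fg(1)] by blast
  have "(\<lambda>n. Q (fs n) (fs n)) \<longlonglongrightarrow> (LINT x|M. g x)"
    using fg G_value_tendsto[OF fg fs] by (intro L1_tendsto_integral G_int approxD(1)[OF fs]) (auto simp: G_value_def)
  then show ?thesis using E_limit[OF D_L2[OF fg(1)] fs D_L2[OF fg(1)] fs] LIMSEQ_unique by blast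
qed

lemma E_eq_Q: "f \<in> C \<Longrightarrow> g \<in> C \<Longrightarrow> E f g = Q f g"
  using LIMSEQ_unique[OF E_limit[OF C_L2 approx_const C_L2 approx_const] tendsto_const] by auto

lemma G_value_C: "f \<in> C \<Longrightarrow> G_value f (G f f)"
  unfolding G_value_def L1_tendsto_def using approx_const[of f] G_int[of f f] by (intro conjI exI[of _ "\<lambda>_. f"]) auto

lemma E_diff_le:
  assumes f: "f \<in> D" and g: "g \<in> D" shows "E (f - g) (f - g) \<le> 2 * E f f + 2 * E g g"
proof -
  obtain fs gs where fs: "approx f fs" and gs: "approx g gs" using D_approx[OF f] D_approx[OF g] by blast
  have fg: "approx (f - g) (\<lambda>n. fs n - gs n)"
    using approx_minus[OF D_L2[OF f] D_L2[OF g] fs gs] by (simp add: fun_diff_def)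
  have L: "f - g \<in> L2 M" using D_diff[OF f g] D_L2 by blast
  have "(\<lambda>n. 2 * Q (fs n) (fs n) + 2 * Q (gs n) (gs n)) \<longlonglongrightarrow> 2 * E f f + 2 * E g g"
    by (intro tendsto_intros E_limit D_L2 f g fs gs)
  moreover have "Q (fs n - gs n) (fs n - gs n) \<le> 2 * Q (fs n) (fs n) + 2 * Q (gs n) (gs n)" for n
  proof -
    have "(N (fs n - gs n))\<^sup>2 \<le> (N (fs n) + N (gs n))\<^sup>2"
      using approxD(1)[OF fs] approxD(1)[OF gs] by (intro power_mono N_triangle_diff N_nonneg C_diff)
    also have "\<dots> \<le> 2 * (N (fs n))\<^sup>2 + 2 * (N (gs n))\<^sup>2" by (rule sq_sum_le)
    finally show ?thesis using approxD(1)[OF fs] approxD(1)[OF gs] by (simp add: N_sq C_diff)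
  qed
  ultimately show ?thesis by (intro LIMSEQ_le[OF E_limit[OF L fg L fg]]) auto
qed

text \<open>Approximants converge in the form norm.\<close>

lemma approx_E_tendsto:
  assumes f: "f \<in> D" and fs: "approx f fs" and e: "e > 0"
  shows "eventually (\<lambda>m. E (f - fs m) (f - fs m) < e) sequentially"
proof -
  obtain n0 where n0: "\<forall>i\<ge>n0. \<forall>j\<ge>n0. Q (fs i - fs j) (fs i - fs j) < e / 2"
    using approxD(2)[OF fs] e unfolding form_cauchy_def by (metis half_gt_zero)
  show ?thesis
    using eventually_ge_at_top[of n0]
  proof eventually_elim
    case (elim m)
    have "approx (f - fs m) (\<lambda>n. fs n - fs m)"
      using approx_minus[OF D_L2[OF f] C_L2[OF approxD(1)[OF fs]] fs approx_const[OF approxD(1)[OF fs]]]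
      by (simp add: fun_diff_def)
    moreover have "f - fs m \<in> L2 M" using D_diff[OF f C_subset_D[OF approxD(1)[OF fs]]] D_L2 by blast
    ultimately have "E (f - fs m) (f - fs m) \<le> e / 2"
      using n0 elim by (intro LIMSEQ_le_const2[OF E_limit]) (auto intro!: exI[of _ n0] less_imp_le)
    then show ?case using e by simp
  qed
qed

subsection \<open>Composition and products along Cauchy sequences\<close>

lemma G_combination_le:
  assumes C: "w \<in> C" "f1 \<in> C" "f2 \<in> C" "f3 \<in> C" "f4 \<in> C"
    and eq: "AE x in M. G w w x = a1 x * G f1 w x + a2 x * G f2 w x + a3 x * G f3 w x + a4 x * G f4 w x"
  shows "AE x in M. G w w x \<le> 4 * ((a1 x)\<^sup>2 * G f1 f1 x + (a2 x)\<^sup>2 * G f2 f2 x + (a3 x)\<^sup>2 * G f3 f3 x + (a4 x)\<^sup>2 * G f4 f4 x)"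
  using eq G_CS[OF C(2,1)] G_CS[OF C(3,1)] G_CS[OF C(4,1)] G_CS[OF C(5,1)] G_nonneg[OF C(1)] G_nonneg[OF C(2)]
    G_nonneg[OF C(3)] G_nonneg[OF C(4)] G_nonneg[OF C(5)]
  by eventually_elim (rule quadratic_combination_le)

lemma AE_bounded_C:
  assumes "f \<in> C" shows "\<exists>B. AE x in M. \<bar>f x\<bar> \<le> B"
  using C_bounded[OF assms] by (auto intro: AE_I2)

lemma cauchy_G_lim:
  assumes fs: "\<And>n. fs n \<in> C" "cauchy fs"
  obtains g where "integrable M g" "L1_tendsto M (\<lambda>n. G (fs n) (fs n)) g" "AE x in M. 0 \<le> g x"
  using cauchy_G_limit[OF assms] L1_tendsto_AE_nonneg[of M "\<lambda>n. G (fs n) (fs n)"] G_int[OF fs(1) fs(1)] G_nonneg[OF fs(1)]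
  by blast

text \<open>
  Composition with a smooth function preserves Cauchy sequences that converge almost everywhere:
  for \<open>w = \<phi>(f\<^sub>n) - \<phi>(f\<^sub>m)\<close> the chain rule bounds \<open>G(w)\<close> by multiples of \<open>\<phi>'(f\<^sub>n)\<^sup>2 G(f\<^sub>n - f\<^sub>m)\<close> and
  \<open>(\<phi>'(f\<^sub>n) - \<phi>'(f\<^sub>m))\<^sup>2 G(f\<^sub>m)\<close>.  The second one is small in \<open>L\<^sup>1\<close> because \<open>G(f\<^sub>m)\<close> converges in \<open>L\<^sup>1\<close> and the
  factor is bounded and tends to zero almost everywhere.
\<close>

lemma comp_cauchy:
  assumes fs: "\<And>n. fs n \<in> C" "cauchy fs" and conv: "AE x in M. convergent (\<lambda>n. fs n x)" and \<phi>: "smooth1 \<phi>"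
  shows "cauchy (\<lambda>n x. \<phi> (fs n x) - \<phi> 0)"
proof -
  define w where "w n m = (\<lambda>x. \<phi> (fs n x) - \<phi> 0) - (\<lambda>x. \<phi> (fs m x) - \<phi> 0)" for n m
  define d where "d n x = deriv \<phi> (fs n x)" for n x
  have wC: "w n m \<in> C" for n m unfolding w_def by (intro C_diff C_comp fs \<phi>)
  have contd: "continuous_on UNIV (deriv \<phi>)" using smooth1_continuous[OF smooth1_deriv[OF \<phi>]] .
  have [measurable]: "fs n \<in> borel_measurable M" for n using fs by measurable
  have [measurable]: "d n \<in> borel_measurable M" for n
    unfolding d_def by (rule measurable_compose[OF _ borel_measurable_continuous_onI[OF contd]]) measurable
  obtain B where B: "B > 0" "\<And>t. \<bar>deriv \<phi> t\<bar> \<le> B" using smooth1_bound[OF smooth1_deriv[OF \<phi>]] by blast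
  obtain g where g: "integrable M g" "L1_tendsto M (\<lambda>n. G (fs n) (fs n)) g" using cauchy_G_limit[OF fs] by blast
  have convd: "AE x in M. convergent (\<lambda>n. d n x)"
    using conv
  proof eventually_elim
    case (elim x)
    then obtain l where "(\<lambda>n. fs n x) \<longlonglongrightarrow> l" by (auto simp: convergent_def)
    then have "(\<lambda>n. deriv \<phi> (fs n x)) \<longlonglongrightarrow> deriv \<phi> l"
      using contd by (intro continuous_on_tendsto_compose[OF contd]) auto
    then show ?case unfolding d_def by (auto simp: convergent_def)
  qed
  have le: "Q (w n m) (w n m) \<le> 4 * B\<^sup>2 * Q (fs n - fs m) (fs n - fs m) + 4 * (LINT x|M. (d n x - d m x)\<^sup>2 * G (fs m) (fs m) x)" for n m
  proof -
    have cb: "fs n - fs m \<in> C" by (intro C_diff fs)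
    have i: "integrable M (\<lambda>x. (d n x - d m x)\<^sup>2 * G (fs m) (fs m) x)"
    proof (rule Bochner_Integration.integrable_bound)
      show "integrable M (\<lambda>x. (4 * B\<^sup>2) * G (fs m) (fs m) x)" using G_int[OF fs(1) fs(1)] by simp
      have "(d n x - d m x)\<^sup>2 \<le> 4 * B\<^sup>2" for x
        using power_mono[of "\<bar>d n x - d m x\<bar>" "2 * B" 2] B(2)[of "fs n x"] B(2)[of "fs m x"]
        by (simp add: d_def power_mult_distrib)
      then show "AE x in M. norm ((d n x - d m x)\<^sup>2 * G (fs m) (fs m) x) \<le> norm ((4 * B\<^sup>2) * G (fs m) (fs m) x)"
        by (intro AE_I2) (auto simp: abs_mult intro!: mult_right_mono)
    qed (use G_measurable[OF fs(1) fs(1)] in measurable)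
    have "AE x in M. G (w n m) (w n m) x \<le> 4 * ((d n x)\<^sup>2 * G (fs n - fs m) (fs n - fs m) x +
        (d n x - d m x)\<^sup>2 * G (fs m) (fs m) x + 0\<^sup>2 * G (fs m) (fs m) x + 0\<^sup>2 * G (fs m) (fs m) x)"
    proof (rule G_combination_le[OF wC cb fs(1) fs(1) fs(1)])
      show "AE x in M. G (w n m) (w n m) x = d n x * G (fs n - fs m) (w n m) x +
        (d n x - d m x) * G (fs m) (w n m) x + 0 * G (fs m) (w n m) x + 0 * G (fs m) (w n m) x"
        using G_diff[OF C_comp[OF fs(1)[of n] \<phi>] C_comp[OF fs(1)[of m] \<phi>] wC[of n m], folded w_def]
          G_chain[OF fs(1)[of n] wC[of n m] \<phi>] G_chain[OF fs(1)[of m] wC[of n m] \<phi>] G_diff[OF fs(1)[of n] fs(1)[of m] wC[of n m]]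
      proof eventually_elim
        case (elim x)
        show ?case unfolding elim by (simp add: d_def algebra_simps)
      qed
    qed
    then have "AE x in M. G (w n m) (w n m) x \<le> 4 * B\<^sup>2 * G (fs n - fs m) (fs n - fs m) x + 4 * ((d n x - d m x)\<^sup>2 * G (fs m) (fs m) x)"
      using G_nonneg[OF cb]
    proof eventually_elim
      case (elim x)
      have "(d n x)\<^sup>2 \<le> B\<^sup>2" using power_mono[OF B(2)[of "fs n x"] abs_ge_zero, of 2] unfolding d_def by simp
      then have "(d n x)\<^sup>2 * G (fs n - fs m) (fs n - fs m) x \<le> B\<^sup>2 * G (fs n - fs m) (fs n - fs m) x"
        using elim by (intro mult_right_mono)
      then show ?case using elim by simp
    qed
    then have "Q (w n m) (w n m) \<le> (LINT x|M. 4 * B\<^sup>2 * G (fs n - fs m) (fs n - fs m) x + 4 * ((d n x - d m x)\<^sup>2 * G (fs m) (fs m) x))"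
      using i by (intro integral_mono_AE G_int wC Bochner_Integration.integrable_add) (auto intro: G_int cb)
    then show ?thesis using i G_int[OF cb cb] by simp
  qed
  show ?thesis
    unfolding form_cauchy_def w_def[symmetric]
  proof (intro allI impI)
    fix e :: real assume e: "e > 0"
    have B8: "e / (8 * B\<^sup>2) > 0" using e B by simp
    obtain n1 where n1: "\<forall>i\<ge>n1. \<forall>j\<ge>n1. Q (fs i - fs j) (fs i - fs j) < e / (8 * B\<^sup>2)"
      using fs(2) B8 unfolding form_cauchy_def by blast
    have "\<exists>n2. \<forall>n\<ge>n2. \<forall>m\<ge>n2. (LINT x|M. (d n x - d m x)\<^sup>2 * G (fs m) (fs m) x) < e / 8"
    proof (rule L1_Cauchy_mult_bounded[OF G_int[OF fs(1) fs(1)] g G_nonneg[OF fs(1)] _ _ convd])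
      show "AE x in M. \<bar>d n x\<bar> \<le> B" for n using B(2) unfolding d_def by simp
    qed (use e in simp_all)
    then obtain n2 where n2: "\<forall>n\<ge>n2. \<forall>m\<ge>n2. (LINT x|M. (d n x - d m x)\<^sup>2 * G (fs m) (fs m) x) < e / 8" by blast
    show "\<exists>n0. \<forall>i\<ge>n0. \<forall>j\<ge>n0. Q (w i j) (w i j) < e"
    proof (intro exI[of _ "max n1 n2"] allI impI)
      fix i j assume ij: "max n1 n2 \<le> i" "max n1 n2 \<le> j"
      have "Q (fs i - fs j) (fs i - fs j) < e / (8 * B\<^sup>2)" using n1 ij by auto
      then have "4 * B\<^sup>2 * Q (fs i - fs j) (fs i - fs j) < e / 2" using B(1) by (simp add: field_simps)
      moreover have "(LINT x|M. (d i x - d j x)\<^sup>2 * G (fs j) (fs j) x) < e / 8" using n2 ij by auto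
      ultimately show "Q (w i j) (w i j) < e" using le[of i j] by linarith
    qed
  qed
qed

text \<open>
  The same argument for products of bounded sequences, with the Leibniz rule.
\<close>

lemma prod_cauchy:
  assumes fs: "\<And>n. fs n \<in> C" "cauchy fs" "AE x in M. convergent (\<lambda>n. fs n x)" "\<And>n. AE x in M. \<bar>fs n x\<bar> \<le> B"
    and hs: "\<And>n. hs n \<in> C" "cauchy hs" "AE x in M. convergent (\<lambda>n. hs n x)" "\<And>n. AE x in M. \<bar>hs n x\<bar> \<le> B"
  shows "cauchy (\<lambda>n x. fs n x * hs n x)"
proof -
  define w where "w n m = (\<lambda>x. fs n x * hs n x) - (\<lambda>x. fs m x * hs m x)" for n m
  have wC: "w n m \<in> C" for n m unfolding w_def by (intro C_diff C_mult fs hs)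
  have [measurable]: "fs n \<in> borel_measurable M" "hs n \<in> borel_measurable M" for n using fs hs by measurable
  define I where "I us vs n m = (LINT x|M. (us n x - us m x :: real)\<^sup>2 * G (vs m) (vs m) x)" for us vs :: "nat \<Rightarrow> 'b \<Rightarrow> real" and n m :: nat
  have int: "integrable M (\<lambda>x. (us n x - us m x)\<^sup>2 * G (vs m) (vs m) x)"
    if us: "\<And>n. us n \<in> C" "\<And>n. AE x in M. \<bar>us n x\<bar> \<le> B" and vs: "\<And>n. vs n \<in> C" for us vs :: "nat \<Rightarrow> 'b \<Rightarrow> real" and n m
  proof (rule Bochner_Integration.integrable_bound)
    show "integrable M (\<lambda>x. (4 * B\<^sup>2) * G (vs m) (vs m) x)" using G_int[OF vs vs] by simp
    show "AE x in M. norm ((us n x - us m x)\<^sup>2 * G (vs m) (vs m) x) \<le> norm ((4 * B\<^sup>2) * G (vs m) (vs m) x)"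
      using us(2)[of n] us(2)[of m]
    proof eventually_elim
      case (elim x)
      then have "(us n x - us m x)\<^sup>2 \<le> 4 * B\<^sup>2"
        using power_mono[of "\<bar>us n x - us m x\<bar>" "2 * B" 2] by (simp add: power_mult_distrib)
      then show ?case by (auto simp: abs_mult intro!: mult_right_mono)
    qed
    have [measurable]: "us n \<in> borel_measurable M" for n using us by measurable
    show "(\<lambda>x. (us n x - us m x)\<^sup>2 * G (vs m) (vs m) x) \<in> borel_measurable M"
      using G_measurable[OF vs vs] by measurable
  qed
  have small: "\<exists>N. \<forall>n\<ge>N. \<forall>m\<ge>N. I us vs n m < e" if e: "e > 0"
    and us: "\<And>n. us n \<in> C" "\<And>n. AE x in M. \<bar>us n x\<bar> \<le> B" "AE x in M. convergent (\<lambda>n. us n x)"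
    and vs: "\<And>n. vs n \<in> C" "cauchy vs" for us vs :: "nat \<Rightarrow> 'b \<Rightarrow> real" and e
  proof -
    obtain g where g: "integrable M g" "L1_tendsto M (\<lambda>n. G (vs n) (vs n)) g" using cauchy_G_limit[OF vs] by blast
    have [measurable]: "us n \<in> borel_measurable M" for n using us by measurable
    show ?thesis unfolding I_def
      by (rule L1_Cauchy_mult_bounded[OF G_int[OF vs(1) vs(1)] g G_nonneg[OF vs(1)] _ us(2) us(3) e]) measurable
  qed
  have le: "Q (w n m) (w n m) \<le> 4 * B\<^sup>2 * Q (hs n - hs m) (hs n - hs m) + 4 * B\<^sup>2 * Q (fs n - fs m) (fs n - fs m)
      + 4 * I fs hs n m + 4 * I hs fs n m" for n m
  proof -
    have cb: "fs n - fs m \<in> C" "hs n - hs m \<in> C" by (intro C_diff fs hs)+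
    have i: "integrable M (\<lambda>x. (fs n x - fs m x)\<^sup>2 * G (hs m) (hs m) x)"
      "integrable M (\<lambda>x. (hs n x - hs m x)\<^sup>2 * G (fs m) (fs m) x)"
      by (rule int; use fs hs in auto)+
    have "AE x in M. G (w n m) (w n m) x \<le> 4 * ((fs n x)\<^sup>2 * G (hs n - hs m) (hs n - hs m) x +
        (fs n x - fs m x)\<^sup>2 * G (hs m) (hs m) x + (hs n x)\<^sup>2 * G (fs n - fs m) (fs n - fs m) x
        + (hs n x - hs m x)\<^sup>2 * G (fs m) (fs m) x)"
    proof (rule G_combination_le[OF wC cb(2) hs(1) cb(1) fs(1)])
      show "AE x in M. G (w n m) (w n m) x = fs n x * G (hs n - hs m) (w n m) x +
        (fs n x - fs m x) * G (hs m) (w n m) x + hs n x * G (fs n - fs m) (w n m) x + (hs n x - hs m x) * G (fs m) (w n m) x"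
        using G_diff[OF C_mult[OF fs(1)[of n] hs(1)[of n]] C_mult[OF fs(1)[of m] hs(1)[of m]] wC[of n m], folded w_def]
          G_Leibniz[OF fs(1)[of n] hs(1)[of n] wC[of n m]] G_Leibniz[OF fs(1)[of m] hs(1)[of m] wC[of n m]]
          G_diff[OF fs(1)[of n] fs(1)[of m] wC[of n m]] G_diff[OF hs(1)[of n] hs(1)[of m] wC[of n m]]
      proof eventually_elim
        case (elim x)
        show ?case unfolding elim by (simp add: algebra_simps)
      qed
    qed
    then have "AE x in M. G (w n m) (w n m) x \<le> 4 * B\<^sup>2 * G (hs n - hs m) (hs n - hs m) x + 4 * B\<^sup>2 * G (fs n - fs m) (fs n - fs m) x
      + 4 * ((fs n x - fs m x)\<^sup>2 * G (hs m) (hs m) x) + 4 * ((hs n x - hs m x)\<^sup>2 * G (fs m) (fs m) x)"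
      using G_nonneg[OF cb(1)] G_nonneg[OF cb(2)] fs(4)[of n] hs(4)[of n]
    proof eventually_elim
      case (elim x)
      have "(fs n x)\<^sup>2 \<le> B\<^sup>2" "(hs n x)\<^sup>2 \<le> B\<^sup>2"
        using power_mono[OF elim(4) abs_ge_zero, of 2] power_mono[OF elim(5) abs_ge_zero, of 2] by auto
      then have "(fs n x)\<^sup>2 * G (hs n - hs m) (hs n - hs m) x \<le> B\<^sup>2 * G (hs n - hs m) (hs n - hs m) x"
        "(hs n x)\<^sup>2 * G (fs n - fs m) (fs n - fs m) x \<le> B\<^sup>2 * G (fs n - fs m) (fs n - fs m) x"
        using elim by (auto intro!: mult_right_mono)
      then show ?case using elim by simp
    qed
    then have "Q (w n m) (w n m) \<le> (LINT x|M. 4 * B\<^sup>2 * G (hs n - hs m) (hs n - hs m) x + 4 * B\<^sup>2 * G (fs n - fs m) (fs n - fs m) x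
      + 4 * ((fs n x - fs m x)\<^sup>2 * G (hs m) (hs m) x) + 4 * ((hs n x - hs m x)\<^sup>2 * G (fs m) (fs m) x))"
      using i by (intro integral_mono_AE G_int wC Bochner_Integration.integrable_add) (auto intro: G_int cb)
    then show ?thesis unfolding I_def using i G_int[OF cb(1) cb(1)] G_int[OF cb(2) cb(2)] by simp
  qed
  show ?thesis
    unfolding form_cauchy_def w_def[symmetric]
  proof (intro allI impI)
    fix e :: real assume e: "e > 0"
    define B' where "B' = B\<^sup>2 + 1"
    have B': "B' > 0" "B\<^sup>2 \<le> B'" unfolding B'_def by (auto simp: add_nonneg_pos)
    have B8: "e / (16 * B') > 0" using e B' by simp
    obtain n1 where n1: "\<forall>i\<ge>n1. \<forall>j\<ge>n1. Q (fs i - fs j) (fs i - fs j) < e / (16 * B')"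
      using fs(2) B8 unfolding form_cauchy_def by blast
    obtain n2 where n2: "\<forall>i\<ge>n2. \<forall>j\<ge>n2. Q (hs i - hs j) (hs i - hs j) < e / (16 * B')"
      using hs(2) B8 unfolding form_cauchy_def by blast
    obtain n3 where n3: "\<forall>n\<ge>n3. \<forall>m\<ge>n3. I fs hs n m < e / 16" using small[of "e / 16" fs hs] fs hs e by auto
    obtain n4 where n4: "\<forall>n\<ge>n4. \<forall>m\<ge>n4. I hs fs n m < e / 16" using small[of "e / 16" hs fs] fs hs e by auto
    have mul: "4 * B\<^sup>2 * q < e / 4" if "q < e / (16 * B')" "0 \<le> q" for q
    proof -
      have "B\<^sup>2 * q \<le> B' * q" using B' that by (intro mult_right_mono) auto
      also have "\<dots> < e / 16" using that B' by (simp add: field_simps)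
      finally show ?thesis by simp
    qed
    show "\<exists>n0. \<forall>i\<ge>n0. \<forall>j\<ge>n0. Q (w i j) (w i j) < e"
    proof (intro exI[of _ "max (max n1 n2) (max n3 n4)"] allI impI)
      fix i j assume ij: "max (max n1 n2) (max n3 n4) \<le> i" "max (max n1 n2) (max n3 n4) \<le> j"
      have "4 * B\<^sup>2 * Q (fs i - fs j) (fs i - fs j) < e / 4" "4 * B\<^sup>2 * Q (hs i - hs j) (hs i - hs j) < e / 4"
        using n1 n2 ij by (intro mul Q_nonneg C_diff fs(1) hs(1); simp)+
      moreover have "I fs hs i j < e / 16" "I hs fs i j < e / 16" using n3 n4 ij by auto
      ultimately show "Q (w i j) (w i j) < e" using le[of i j] e by linarith
    qed
  qed
qed

end

lemma smooth1_Lipschitz: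
  assumes "smooth1 \<phi>" obtains K where "K > 0" "\<And>s t. \<bar>\<phi> s - \<phi> t\<bar> \<le> K * \<bar>s - t\<bar>"
proof -
  obtain K where K: "K > 0" "\<And>t. \<bar>deriv \<phi> t\<bar> \<le> K" using smooth1_bound[OF smooth1_deriv[OF assms]] by blast
  have "\<bar>\<phi> s - \<phi> t\<bar> \<le> K * \<bar>s - t\<bar>" for s t
    using field_differentiable_bound[of UNIV \<phi> "deriv \<phi>" K s t] K smooth1_DERIV[OF assms] by auto
  with K(1) show ?thesis by (rule that)
qed

context square_field_form
begin

subsection \<open>The square field operator of the closure\<close>

text \<open>Truncation: bounded elements of the domain have uniformly bounded approximants.\<close>

lemma bounded_approx:
  assumes f: "f \<in> D" and bd: "ess_bounded M f"
  shows "\<exists>fs B. approx f fs \<and> (\<forall>n. AE x in M. \<bar>fs n x\<bar> \<le> B) \<and> (AE x in M. (\<lambda>n. fs n x) \<longlonglongrightarrow> f x)"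
proof -
  obtain R0 where "AE x in M. \<bar>f x\<bar> \<le> R0" using bd unfolding ess_bounded_def by blast
  then have "AE x in M. \<bar>f x\<bar> \<le> max R0 1" by eventually_elim auto
  then obtain R where R: "R > 0" "AE x in M. \<bar>f x\<bar> \<le> R" by (metis less_max_iff_disj zero_less_one)
  obtain \<kappa> where \<kappa>: "smooth1 \<kappa>" "\<And>t. \<bar>t\<bar> \<le> 1 \<Longrightarrow> \<kappa> t = t" using smooth_cutoff_exists by blast
  define \<phi> where "\<phi> = (\<lambda>t. R * \<kappa> ((1 / R) * t + 0))"
  have \<phi>: "smooth1 \<phi>" unfolding \<phi>_def by (intro smooth1_cmult smooth1_affine \<kappa>)
  have \<phi>0: "\<phi> 0 = 0" using \<kappa>(2)[of 0] unfolding \<phi>_def by simp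
  have \<phi>f: "\<phi> t = t" if "\<bar>t\<bar> \<le> R" for t
    using \<kappa>(2)[of "t / R"] that R(1) unfolding \<phi>_def by simp
  obtain K where K: "K > 0" "\<And>s t. \<bar>\<phi> s - \<phi> t\<bar> \<le> K * \<bar>s - t\<bar>" using smooth1_Lipschitz[OF \<phi>] by blast
  obtain B where B: "B > 0" "\<And>t. \<bar>\<phi> t\<bar> \<le> B" using smooth1_bound[OF \<phi>] by blast
  obtain us0 where us0: "approx f us0" using D_approx[OF f] by blast
  obtain r where r: "strict_mono r" "AE x in M. (\<lambda>n. us0 (r n) x) \<longlonglongrightarrow> f x"
    using L2_tendsto_AE_subseq[OF C_L2[OF approxD(1)[OF us0]] D_L2[OF f] approxD(3)[OF us0]] by blast
  define us where "us n = us0 (r n)" for n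
  have us: "approx f us" "AE x in M. (\<lambda>n. us n x) \<longlonglongrightarrow> f x"
    unfolding us_def using approx_subseq[OF us0 r(1)] r(2) by auto
  define fs where "fs n = (\<lambda>x. \<phi> (us n x) - \<phi> 0)" for n
  have fsC: "fs n \<in> C" for n unfolding fs_def by (intro C_comp approxD(1)[OF us(1)] \<phi>)
  have conv: "AE x in M. convergent (\<lambda>n. us n x)" using us(2) by eventually_elim (auto simp: convergent_def)
  have cf: "cauchy fs" unfolding fs_def by (rule comp_cauchy[OF approxD(1,2)[OF us(1)] conv \<phi>])
  have L2: "L2_tendsto M fs f"
    unfolding L2_tendsto_def
  proof (rule tendsto_sandwich[OF _ _ tendsto_const])
    show "eventually (\<lambda>n. (LINT x|M. (fs n x - f x)\<^sup>2) \<le> K\<^sup>2 * (LINT x|M. (us n x - f x)\<^sup>2)) sequentially"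
    proof (intro always_eventually allI)
      fix n
      have uf: "(\<lambda>x. us n x - f x) \<in> L2 M" "(\<lambda>x. fs n x - f x) \<in> L2 M"
        by (intro L2_diff C_L2 D_L2 f approxD(1)[OF us(1)] fsC)+
      have "(LINT x|M. (fs n x - f x)\<^sup>2) \<le> (LINT x|M. K\<^sup>2 * (us n x - f x)\<^sup>2)"
      proof (rule integral_mono_AE)
        show "AE x in M. (fs n x - f x)\<^sup>2 \<le> K\<^sup>2 * (us n x - f x)\<^sup>2"
          using R(2)
        proof eventually_elim
          case (elim x)
          have "\<bar>fs n x - f x\<bar> \<le> K * \<bar>us n x - f x\<bar>"
            using K(2)[of "us n x" "f x"] \<phi>f[OF elim] \<phi>0 unfolding fs_def by simp
          from power_mono[OF this abs_ge_zero, of 2] show ?case by (simp add: power_mult_distrib)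
        qed
      qed (use uf in \<open>auto simp: L2_def\<close>)
      then show "(LINT x|M. (fs n x - f x)\<^sup>2) \<le> K\<^sup>2 * (LINT x|M. (us n x - f x)\<^sup>2)" by simp
    qed
    show "(\<lambda>n. K\<^sup>2 * (LINT x|M. (us n x - f x)\<^sup>2)) \<longlonglongrightarrow> 0"
      using tendsto_mult_left[OF approxD(3)[OF us(1), unfolded L2_tendsto_def], of "K\<^sup>2"] by simp
  qed simp
  have "AE x in M. (\<lambda>n. fs n x) \<longlonglongrightarrow> f x"
    using us(2) R(2)
  proof eventually_elim
    case (elim x)
    have "(\<lambda>n. \<phi> (us n x)) \<longlonglongrightarrow> \<phi> (f x)"
      by (rule continuous_on_tendsto_compose[OF smooth1_continuous[OF \<phi>] elim(1)]) auto
    then show ?case unfolding fs_def \<phi>0 using \<phi>f[OF elim(2)] by simp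
  qed
  moreover have "AE x in M. \<bar>fs n x\<bar> \<le> B" for n unfolding fs_def \<phi>0 using B by simp
  moreover have "approx f fs" using fsC cf L2 unfolding approx_seq_def by blast
  ultimately show ?thesis by blast
qed

lemma approx_prod:
  assumes f: "f \<in> D" "approx f fs" "\<And>n. AE x in M. \<bar>fs n x\<bar> \<le> B" "AE x in M. (\<lambda>n. fs n x) \<longlonglongrightarrow> f x"
    and h: "h \<in> D" "approx h hs" "\<And>n. AE x in M. \<bar>hs n x\<bar> \<le> B" "AE x in M. (\<lambda>n. hs n x) \<longlonglongrightarrow> h x"
  shows "approx (\<lambda>x. f x * h x) (\<lambda>n x. fs n x * hs n x)" "(\<lambda>x. f x * h x) \<in> L2 M"
proof -
  note fC = approxD(1)[OF f(2)] and hC = approxD(1)[OF h(2)]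
  have [measurable]: "f \<in> borel_measurable M" "h \<in> borel_measurable M" using D_L2[OF f(1)] D_L2[OF h(1)] by (auto simp: L2_def)
  have [measurable]: "fs n \<in> borel_measurable M" "hs n \<in> borel_measurable M" for n using fC hC by measurable
  have fB: "AE x in M. \<bar>f x\<bar> \<le> B"
    using f(4) AE_all_countable[THEN iffD2, rule_format, OF f(3)]
    by eventually_elim (rule LIMSEQ_le_const2[OF tendsto_rabs], auto)
  have hB: "AE x in M. \<bar>h x\<bar> \<le> B"
    using h(4) AE_all_countable[THEN iffD2, rule_format, OF h(3)]
    by eventually_elim (rule LIMSEQ_le_const2[OF tendsto_rabs], auto)
  have L2m: "(\<lambda>x. u x * v x) \<in> L2 M" "(LINT x|M. (u x * v x)\<^sup>2) \<le> B\<^sup>2 * (LINT x|M. (v x)\<^sup>2)"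
    if u: "AE x in M. \<bar>u x\<bar> \<le> B" and [measurable]: "u \<in> borel_measurable M" and v: "v \<in> L2 M" for u v
  proof -
    have [measurable]: "v \<in> borel_measurable M" using v by (auto simp: L2_def)
    have le: "AE x in M. (u x * v x)\<^sup>2 \<le> B\<^sup>2 * (v x)\<^sup>2"
      using u
    proof eventually_elim
      case (elim x)
      from power_mono[OF elim abs_ge_zero, of 2] show ?case by (simp add: power_mult_distrib mult_right_mono)
    qed
    have i: "integrable M (\<lambda>x. B\<^sup>2 * (v x)\<^sup>2)" using v by (simp add: L2_def)
    then have "integrable M (\<lambda>x. (u x * v x)\<^sup>2)"
      by (rule Bochner_Integration.integrable_bound) (use le in auto)
    then show "(\<lambda>x. u x * v x) \<in> L2 M" by (simp add: L2_def)
    from integral_mono_AE[OF \<open>integrable M (\<lambda>x. (u x * v x)\<^sup>2)\<close> i le]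
    show "(LINT x|M. (u x * v x)\<^sup>2) \<le> B\<^sup>2 * (LINT x|M. (v x)\<^sup>2)" by simp
  qed
  show fh: "(\<lambda>x. f x * h x) \<in> L2 M" by (rule L2m(1)[OF fB _ D_L2[OF h(1)]]) simp
  have "L2_tendsto M (\<lambda>n x. fs n x * hs n x) (\<lambda>x. f x * h x)"
    unfolding L2_tendsto_def
  proof (rule tendsto_sandwich[OF _ _ tendsto_const])
    show "eventually (\<lambda>n. (LINT x|M. (fs n x * hs n x - f x * h x)\<^sup>2) \<le>
        2 * (B\<^sup>2 * (LINT x|M. (fs n x - f x)\<^sup>2)) + 2 * (B\<^sup>2 * (LINT x|M. (hs n x - h x)\<^sup>2))) sequentially"
    proof (intro always_eventually allI)
      fix n
      have d: "(\<lambda>x. fs n x - f x) \<in> L2 M" "(\<lambda>x. hs n x - h x) \<in> L2 M" by (intro L2_diff C_L2 D_L2 fC hC f h)+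
      have "(LINT x|M. (fs n x * hs n x - f x * h x)\<^sup>2) = (LINT x|M. (hs n x * (fs n x - f x) + f x * (hs n x - h x))\<^sup>2)"
        by (simp add: algebra_simps)
      also have "\<dots> \<le> 2 * (LINT x|M. (hs n x * (fs n x - f x))\<^sup>2) + 2 * (LINT x|M. (f x * (hs n x - h x))\<^sup>2)"
        by (intro L2_sq_sum_le L2m(1) fB h(3) d) auto
      also have "\<dots> \<le> 2 * (B\<^sup>2 * (LINT x|M. (fs n x - f x)\<^sup>2)) + 2 * (B\<^sup>2 * (LINT x|M. (hs n x - h x)\<^sup>2))"
        by (intro add_mono mult_left_mono L2m(2) fB h(3) d) auto
      finally show "(LINT x|M. (fs n x * hs n x - f x * h x)\<^sup>2) \<le>
        2 * (B\<^sup>2 * (LINT x|M. (fs n x - f x)\<^sup>2)) + 2 * (B\<^sup>2 * (LINT x|M. (hs n x - h x)\<^sup>2))" .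
    qed
    show "(\<lambda>n. 2 * (B\<^sup>2 * (LINT x|M. (fs n x - f x)\<^sup>2)) + 2 * (B\<^sup>2 * (LINT x|M. (hs n x - h x)\<^sup>2))) \<longlonglongrightarrow> 0"
      using tendsto_add[OF tendsto_mult_left[OF tendsto_mult_left[OF approxD(3)[OF f(2), unfolded L2_tendsto_def], of "B\<^sup>2"], of 2]
          tendsto_mult_left[OF tendsto_mult_left[OF approxD(3)[OF h(2), unfolded L2_tendsto_def], of "B\<^sup>2"], of 2]] by simp
  qed simp
  moreover have "cauchy (\<lambda>n x. fs n x * hs n x)"
    by (rule prod_cauchy[OF fC approxD(2)[OF f(2)] _ f(3) hC approxD(2)[OF h(2)] _ h(3)])
      (use f(4) h(4) in \<open>auto simp: convergent_def elim!: AE_mp\<close>)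
  ultimately show "approx (\<lambda>x. f x * h x) (\<lambda>n x. fs n x * hs n x)"
    unfolding approx_seq_def using C_mult[OF fC hC] by blast
qed

text \<open>
  For functions in \<open>C\<close> the defining identity of the square field operator is the Leibniz rule; it
  passes to the limit along uniformly bounded approximants.
\<close>

lemma is_square_field_G_value:
  assumes f: "f \<in> D" "ess_bounded M f" and g: "G_value f g"
  shows "is_square_field M D E f g"
  unfolding is_square_field_def
proof (intro conjI ballI impI)
  show gi: "integrable M g" using g unfolding G_value_def by blast
  fix h assume h: "h \<in> D" "ess_bounded M h"
  obtain fs B1 where fs: "approx f fs" "\<And>n. AE x in M. \<bar>fs n x\<bar> \<le> B1" "AE x in M. (\<lambda>n. fs n x) \<longlonglongrightarrow> f x"
    using bounded_approx[OF f] by blast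
  obtain hs B2 where hs: "approx h hs" "\<And>n. AE x in M. \<bar>hs n x\<bar> \<le> B2" "AE x in M. (\<lambda>n. hs n x) \<longlonglongrightarrow> h x"
    using bounded_approx[OF h] by blast
  note fC = approxD(1)[OF fs(1)] and hC = approxD(1)[OF hs(1)]
  have [measurable]: "h \<in> borel_measurable M" using D_L2[OF h(1)] by (auto simp: L2_def)
  have [measurable]: "hs n \<in> borel_measurable M" for n using hC by measurable
  define B where "B = max B1 B2"
  have fB: "AE x in M. \<bar>fs n x\<bar> \<le> B" for n using fs(2)[of n] by eventually_elim (simp add: B_def)
  have hB: "AE x in M. \<bar>hs n x\<bar> \<le> B" for n using hs(2)[of n] by eventually_elim (simp add: B_def)
  note fh = approx_prod[OF f(1) fs(1) fB fs(3) h(1) hs(1) hB hs(3)]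
  note ff = approx_prod[OF f(1) fs(1) fB fs(3) f(1) fs(1) fB fs(3)]
  have lim: "(\<lambda>n. Q (\<lambda>x. fs n x * hs n x) (fs n) - Q (\<lambda>x. fs n x * fs n x) (hs n) / 2)
      \<longlonglongrightarrow> E (\<lambda>x. f x * h x) f - E (\<lambda>x. f x * f x) h / 2"
    by (intro tendsto_intros E_limit fh ff D_L2 f h fs hs) simp
  have L: "\<And>n. integrable M (\<lambda>x. hs n x * G (fs n) (fs n) x)" "integrable M (\<lambda>x. h x * g x)"
    "L1_tendsto M (\<lambda>n x. hs n x * G (fs n) (fs n) x) (\<lambda>x. h x * g x)"
    by (rule L1_tendsto_mult_bounded[OF G_int[OF fC fC] gi G_value_tendsto[OF f(1) g fs(1)] _ _ hB hs(3)]; simp)+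
  have eq: "Q (\<lambda>x. fs n x * hs n x) (fs n) - Q (\<lambda>x. fs n x * fs n x) (hs n) / 2 = (LINT x|M. hs n x * G (fs n) (fs n) x)" for n
  proof -
    have i: "integrable M (G (\<lambda>x. fs n x * hs n x) (fs n))" "integrable M (G (\<lambda>x. fs n x * fs n x) (hs n))"
      by (intro G_int C_mult fC hC)+
    have "Q (\<lambda>x. fs n x * hs n x) (fs n) - Q (\<lambda>x. fs n x * fs n x) (hs n) / 2 =
        (LINT x|M. G (\<lambda>x. fs n x * hs n x) (fs n) x - G (\<lambda>x. fs n x * fs n x) (hs n) x / 2)"
      using i by simp
    also have "\<dots> = (LINT x|M. hs n x * G (fs n) (fs n) x)"
    proof (rule integral_cong_AE)
      show "AE x in M. G (\<lambda>x. fs n x * hs n x) (fs n) x - G (\<lambda>x. fs n x * fs n x) (hs n) x / 2 = hs n x * G (fs n) (fs n) x"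
        using G_Leibniz[OF fC hC fC, of n n n] G_Leibniz[OF fC fC hC, of n n n] G_sym[OF fC hC, of n n]
      proof eventually_elim
        case (elim x)
        show ?case unfolding elim(1,2,3) by simp
      qed
    qed (use i L(1) in auto)
    finally show ?thesis .
  qed
  have "(\<lambda>n. LINT x|M. hs n x * G (fs n) (fs n) x) \<longlonglongrightarrow> (LINT x|M. h x * g x)"
    by (rule L1_tendsto_integral[OF L])
  with lim show "E (\<lambda>x. f x * h x) f - E (\<lambda>x. (f x)\<^sup>2) h / 2 = (LINT x|M. h x * g x)"
    unfolding eq power2_eq_square using LIMSEQ_unique by blast
qed

lemma is_square_field_unique:
  assumes "is_square_field M D E f g" "is_square_field M D E f g'"
  shows "AE x in M. g x = g' x"
proof -
  have "AE x in M. g x - g' x = 0"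
  proof (rule separating)
    show "integrable M (\<lambda>x. g x - g' x)" using assms unfolding is_square_field_def by simp
    fix h assume h: "h \<in> C"
    then have hb: "ess_bounded M h" unfolding ess_bounded_def using AE_bounded_C by blast
    obtain B where B: "AE x in M. \<bar>h x\<bar> \<le> B" using hb unfolding ess_bounded_def by blast
    have [measurable]: "h \<in> borel_measurable M" using h by measurable
    have i: "integrable M (\<lambda>x. h x * k x)" if "integrable M k" for k :: "'b \<Rightarrow> real"
    proof (rule Bochner_Integration.integrable_bound)
      show "integrable M (\<lambda>x. B * k x)" using that by simp
      show "AE x in M. norm (h x * k x) \<le> norm (B * k x)"
        using B by eventually_elim (auto simp: abs_mult intro!: mult_right_mono)
    qed (use that in measurable)
    have "(LINT x|M. h x * g x) = (LINT x|M. h x * g' x)"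
      using assms(1)[unfolded is_square_field_def, THEN conjunct2, rule_format, OF C_subset_D[OF h] hb]
        assms(2)[unfolded is_square_field_def, THEN conjunct2, rule_format, OF C_subset_D[OF h] hb] by simp
    then show "(LINT x|M. h x * (g x - g' x)) = 0"
      using i assms unfolding is_square_field_def by (simp add: right_diff_distrib)
  qed
  then show ?thesis by simp
qed

lemma square_field_eq:
  assumes f: "f \<in> D" "ess_bounded M f" and g: "G_value f g"
  shows "integrable M (square_field M D E f)" "AE x in M. square_field M D E f x = g x"
proof -
  note g' = is_square_field_G_value[OF assms]
  have s: "is_square_field M D E f (square_field M D E f)"
    unfolding square_field_def by (rule someI[of "is_square_field M D E f", OF g'])
  then show "integrable M (square_field M D E f)" unfolding is_square_field_def by blast
  show "AE x in M. square_field M D E f x = g x" by (rule is_square_field_unique[OF s g'])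
qed

end

lemma L2_fast_AE_tendsto_0:
  assumes d: "\<And>n. d n \<in> L2 M" and le: "\<And>n. (LINT x|M. (d n x)\<^sup>2) < (1 / 2) ^ n"
  shows "AE x in M. (\<lambda>n. d n x) \<longlonglongrightarrow> 0"
proof -
  have [measurable]: "d n \<in> borel_measurable M" for n using d by (auto simp: L2_def)
  have "(\<integral>\<^sup>+x. (\<Sum>n. ennreal ((d n x)\<^sup>2)) \<partial>M) = (\<Sum>n. \<integral>\<^sup>+x. ennreal ((d n x)\<^sup>2) \<partial>M)"
    by (rule nn_integral_suminf) measurable
  also have "\<dots> = (\<Sum>n. ennreal (LINT x|M. (d n x)\<^sup>2))"
    using d by (intro suminf_cong nn_integral_eq_integral) (auto simp: L2_def)
  also have "\<dots> \<le> (\<Sum>n. ennreal ((1 / 2) ^ n))"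
    using le by (intro suminf_le) (auto intro!: ennreal_leI less_imp_le)
  also have "\<dots> = ennreal (\<Sum>n. (1 / 2) ^ n)" by (intro suminf_ennreal2) (auto intro!: summable_geometric)
  finally have "(\<integral>\<^sup>+x. (\<Sum>n. ennreal ((d n x)\<^sup>2)) \<partial>M) \<noteq> \<infinity>" by (auto simp: top_unique)
  then have "AE x in M. (\<Sum>n. ennreal ((d n x)\<^sup>2)) \<noteq> \<infinity>" by (intro nn_integral_PInf_AE) auto
  then show ?thesis
  proof eventually_elim
    case (elim x)
    then have "summable (\<lambda>n. (d n x)\<^sup>2)" by (intro summable_suminf_not_top) auto
    then have "(\<lambda>n. (d n x)\<^sup>2) \<longlonglongrightarrow> 0" by (rule summable_LIMSEQ_zero)
    from tendsto_real_sqrt[OF this] show ?case by (simp add: tendsto_rabs_zero_iff)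
  qed
qed

context square_field_form
begin

subsection \<open>The extended space\<close>

text \<open>
  A Cauchy sequence for the form which converges almost everywhere to a constant is null: no
  energy is lost in the limit.  For \<open>k \<in> C\<close> the functions \<open>k \<cdot> \<kappa>(f\<^sub>n - c)\<close>, with \<open>\<kappa>\<close> a smooth
  truncation of the identity, are Cauchy and tend to \<open>0\<close> in \<open>L\<^sup>2\<close>; by closability their energy
  tends to \<open>0\<close>, but the limit of their square fields is \<open>k\<^sup>2\<close> times the limit of \<open>\<Gamma>(f\<^sub>n)\<close>.
\<close>

lemma cauchy_const_limit:
  assumes fs: "\<And>n. fs n \<in> C" "cauchy fs" and lim: "AE x in M. (\<lambda>n. fs n x) \<longlonglongrightarrow> c"
  shows "(\<lambda>n. N (fs n)) \<longlonglongrightarrow> 0"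
proof -
  obtain g where g: "integrable M g" "L1_tendsto M (\<lambda>n. G (fs n) (fs n)) g" "AE x in M. 0 \<le> g x"
    using cauchy_G_lim[OF fs] by blast
  obtain \<kappa> where \<kappa>: "smooth1 \<kappa>" "\<And>t. \<bar>t\<bar> \<le> 1 \<Longrightarrow> \<kappa> t = t \<and> deriv \<kappa> t = 1" using smooth_cutoff_exists by blast
  define \<phi> where "\<phi> = (\<lambda>t. \<kappa> (1 * t + (- c)))"
  have \<phi>: "smooth1 \<phi>" unfolding \<phi>_def by (intro smooth1_affine \<kappa>)
  have \<phi>c: "\<phi> c = 0" unfolding \<phi>_def using \<kappa>(2)[of 0] by simp
  have d\<phi>c: "deriv \<phi> c = 1"
  proof (rule DERIV_imp_deriv)
    have "(\<kappa> has_real_derivative 1) (at (1 * c + (- c)))" using smooth1_DERIV[OF \<kappa>(1), of 0] \<kappa>(2)[of 0] by simp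
    then have "((\<lambda>t. \<kappa> (1 * t + (- c))) has_real_derivative 1 * 1) (at c)"
      by (rule DERIV_chain2) (auto intro!: derivative_eq_intros)
    then show "(\<phi> has_real_derivative 1) (at c)" unfolding \<phi>_def by simp
  qed
  obtain B1 where B1: "B1 > 0" "\<And>t. \<bar>\<phi> t\<bar> \<le> B1" using smooth1_bound[OF \<phi>] by blast
  obtain B2 where B2: "B2 > 0" "\<And>t. \<bar>deriv \<phi> t\<bar> \<le> B2" using smooth1_bound[OF smooth1_deriv[OF \<phi>]] by blast
  have cont: "continuous_on UNIV \<phi>" "continuous_on UNIV (deriv \<phi>)"
    using smooth1_continuous \<phi> smooth1_deriv by blast+
  have [measurable]: "fs n \<in> borel_measurable M" "g \<in> borel_measurable M" for n using fs g by measurable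
  have [measurable]: "(\<lambda>x. \<phi> (fs n x)) \<in> borel_measurable M" "(\<lambda>x. deriv \<phi> (fs n x)) \<in> borel_measurable M" for n
    by (rule measurable_compose[OF _ borel_measurable_continuous_onI[OF cont(1)]] measurable_compose[OF _ borel_measurable_continuous_onI[OF cont(2)]]; measurable)+
  have lim\<phi>: "AE x in M. (\<lambda>n. \<phi> (fs n x)) \<longlonglongrightarrow> 0"
    using lim by eventually_elim (use continuous_on_tendsto_compose[OF cont(1)] \<phi>c in fastforce)
  have limd: "AE x in M. (\<lambda>n. deriv \<phi> (fs n x)) \<longlonglongrightarrow> 1"
    using lim by eventually_elim (use continuous_on_tendsto_compose[OF cont(2)] d\<phi>c in fastforce)
  have conv: "AE x in M. convergent (\<lambda>n. fs n x)" using lim by eventually_elim (auto simp: convergent_def)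
  have key: "AE x in M. k x * g x = 0" if k: "k \<in> C" for k
  proof -
    have [measurable]: "k \<in> borel_measurable M" using k by measurable
    obtain Bk where Bk: "AE x in M. \<bar>k x\<bar> \<le> Bk" using AE_bounded_C[OF k] by blast
    define v where "v n = (\<lambda>x. \<phi> (fs n x) - \<phi> 0)" for n
    define w where "w n = (\<lambda>x. k x * v n x) \<oplus> (\<lambda>x. \<phi> 0 * k x)" for n
    have vC: "v n \<in> C" for n unfolding v_def by (intro C_comp fs \<phi>)
    have wC: "w n \<in> C" for n unfolding w_def by (intro C_add C_mult C_scale vC k)
    have w_eq: "w n x = k x * \<phi> (fs n x)" for n x unfolding w_def v_def by (simp add: algebra_simps)
    have vcau: "cauchy v" unfolding v_def by (rule comp_cauchy[OF fs conv \<phi>])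
    define B where "B = max Bk (2 * B1)"
    have "cauchy (\<lambda>n x. k x * v n x)"
    proof (rule prod_cauchy[OF k cauchy_const[OF k] _ _ vC vcau, where B = B])
      show "AE x in M. \<bar>v n x\<bar> \<le> B" for n
      proof (rule AE_I2)
        fix x show "\<bar>v n x\<bar> \<le> B" using B1(2)[of "fs n x"] B1(2)[of 0] unfolding v_def B_def by linarith
      qed
      show "AE x in M. \<bar>k x\<bar> \<le> B" using Bk by eventually_elim (simp add: B_def)
      show "AE x in M. convergent (\<lambda>n. v n x)"
        using lim\<phi> unfolding v_def by eventually_elim (intro convergent_diff convergent_const convergentI)
    qed (simp add: convergent_const)
    then have wcau: "cauchy w" unfolding w_def
      by (intro cauchy_plus C_mult C_scale vC k cauchy_const)
    have "L2_tendsto M w (\<lambda>_. 0)"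
      unfolding L2_tendsto_def
    proof -
      have "(\<lambda>n. LINT x|M. (w n x - 0)\<^sup>2) \<longlonglongrightarrow> (LINT x|M. 0)"
      proof (rule integral_dominated_convergence)
        show "integrable M (\<lambda>x. B1\<^sup>2 * (k x)\<^sup>2)" using C_L2[OF k] by (simp add: L2_def)
        show "AE x in M. (\<lambda>n. (w n x - 0)\<^sup>2) \<longlonglongrightarrow> 0"
          using lim\<phi>
        proof eventually_elim
          case (elim x)
          from tendsto_power[OF tendsto_mult_left[OF elim, of "k x"], of 2] show ?case by (simp add: w_eq)
        qed
        show "AE x in M. norm ((w n x - 0)\<^sup>2) \<le> B1\<^sup>2 * (k x)\<^sup>2" for n
        proof (rule AE_I2)
          fix x
          have "(\<phi> (fs n x))\<^sup>2 \<le> B1\<^sup>2" using power_mono[OF B1(2)[of "fs n x"] abs_ge_zero, of 2] by simp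
          from mult_right_mono[OF this, of "(k x)\<^sup>2"]
          show "norm ((w n x - 0)\<^sup>2) \<le> B1\<^sup>2 * (k x)\<^sup>2" by (simp add: w_eq power_mult_distrib mult.commute)
        qed
        show "(\<lambda>x. (w n x - 0)\<^sup>2) \<in> borel_measurable M" for n using C_measurable[OF wC[of n]] by measurable
      qed simp
      then show "(\<lambda>n. LINT x|M. (w n x - 0)\<^sup>2) \<longlonglongrightarrow> 0" by simp
    qed
    then have "approx (\<lambda>_. 0) w" unfolding approx_seq_def using wC wcau by blast
    then have Qw: "(\<lambda>n. Q (w n) (w n)) \<longlonglongrightarrow> 0" using closableC unfolding closable_def by blast
    have c0: "L1_tendsto M (\<lambda>_::nat. G k k) (G k k)" unfolding L1_tendsto_def by simp
    have \<phi>B: "AE x in M. \<bar>(\<phi> (fs n x))\<^sup>2\<bar> \<le> B1\<^sup>2" for n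
      using B1(2) by (intro AE_I2) (metis abs_ge_zero abs_power2 power2_abs power_mono)
    have \<phi>sq: "AE x in M. (\<lambda>n. (\<phi> (fs n x))\<^sup>2) \<longlonglongrightarrow> 0"
      using lim\<phi> by eventually_elim (use tendsto_power[of _ 0 _ 2] in fastforce)
    have K1: "\<And>n. integrable M (\<lambda>x. (\<phi> (fs n x))\<^sup>2 * G k k x)" "integrable M (\<lambda>x. 0 * G k k x)"
      "L1_tendsto M (\<lambda>n x. (\<phi> (fs n x))\<^sup>2 * G k k x) (\<lambda>x. 0 * G k k x)"
      by (rule L1_tendsto_mult_bounded[OF G_int[OF k k] G_int[OF k k] c0 _ _ \<phi>B \<phi>sq]; measurable)+
    have kdB: "AE x in M. \<bar>(k x * deriv \<phi> (fs n x))\<^sup>2\<bar> \<le> (Bk * B2)\<^sup>2" for n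
      using Bk
    proof eventually_elim
      case (elim x)
      have "\<bar>k x * deriv \<phi> (fs n x)\<bar> \<le> Bk * B2"
        unfolding abs_mult using elim B2(1) B2(2)[of "fs n x"] by (intro mult_mono) auto
      from power_mono[OF this abs_ge_zero, of 2] show ?case by simp
    qed
    have kd: "AE x in M. (\<lambda>n. (k x * deriv \<phi> (fs n x))\<^sup>2) \<longlonglongrightarrow> (k x)\<^sup>2"
      using limd
    proof eventually_elim
      case (elim x)
      from tendsto_power[OF tendsto_mult_left[OF elim, of "k x"], of 2] show ?case by simp
    qed
    have K2: "\<And>n. integrable M (\<lambda>x. (k x * deriv \<phi> (fs n x))\<^sup>2 * G (fs n) (fs n) x)" "integrable M (\<lambda>x. (k x)\<^sup>2 * g x)"
      "L1_tendsto M (\<lambda>n x. (k x * deriv \<phi> (fs n x))\<^sup>2 * G (fs n) (fs n) x) (\<lambda>x. (k x)\<^sup>2 * g x)"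
      by (rule L1_tendsto_mult_bounded[OF G_int[OF fs(1) fs(1)] g(1,2) _ _ kdB kd]; measurable)+
    have le: "(LINT x|M. (k x * deriv \<phi> (fs n x))\<^sup>2 * G (fs n) (fs n) x) \<le> 2 * Q (w n) (w n) + 2 * (LINT x|M. (\<phi> (fs n x))\<^sup>2 * G k k x)" for n
    proof -
      have Gw: "AE x in M. G (w n) h x = \<phi> (fs n x) * G k h x + k x * deriv \<phi> (fs n x) * G (fs n) h x" if h: "h \<in> C" for h
        using G_add[OF C_mult[OF k vC[of n]] C_scale[OF k, of "\<phi> 0"] h, folded w_def] G_Leibniz[OF k vC[of n] h]
          G_scale[OF k h, of "\<phi> 0"] G_chain[OF fs(1)[of n] h \<phi>, folded v_def]
      proof eventually_elim
        case (elim x)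
        show ?case unfolding elim by (simp add: v_def algebra_simps)
      qed
      have "AE x in M. (k x * deriv \<phi> (fs n x))\<^sup>2 * G (fs n) (fs n) x \<le> 2 * G (w n) (w n) x + 2 * ((\<phi> (fs n x))\<^sup>2 * G k k x)"
        using Gw[OF wC[of n]] Gw[OF k] Gw[OF fs(1)[of n]] G_sym[OF wC[of n] k] G_sym[OF wC[of n] fs(1)[of n]]
          G_CS[OF k fs(1)[of n]] G_nonneg[OF k] G_nonneg[OF fs(1)[of n]] G_sym[OF k fs(1)[of n]]
      proof eventually_elim
        case (elim x)
        define a b p q r where "a = \<phi> (fs n x)" and "b = k x * deriv \<phi> (fs n x)" and "p = G k k x" and "q = G (fs n) (fs n) x"
          and "r = G k (fs n) x"
        have W: "G (w n) (w n) x = a\<^sup>2 * p + 2 * (a * b * r) + b\<^sup>2 * q"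
          using elim unfolding a_def b_def p_def q_def r_def by (simp add: power2_eq_square algebra_simps)
        have aux: "t \<le> u \<Longrightarrow> 4 * u \<le> 4 * y + v \<Longrightarrow> - z \<le> t \<Longrightarrow> v \<le> 2 * (y + 2 * z + v) + 2 * y" for t u v y z :: real
          by (simp add: distrib_left)
        have "\<bar>r\<bar> \<le> sqrt p * sqrt q"
          using elim(6) unfolding p_def q_def r_def by (metis real_sqrt_abs real_sqrt_le_mono real_sqrt_mult)
        then have "\<bar>a * b\<bar> * \<bar>r\<bar> \<le> \<bar>a * b\<bar> * (sqrt p * sqrt q)" by (intro mult_left_mono) auto
        moreover have "4 * (\<bar>a * b\<bar> * (sqrt p * sqrt q)) \<le> 4 * (a\<^sup>2 * p) + b\<^sup>2 * q"
          using sum_squares_bound[of "2 * (\<bar>a\<bar> * sqrt p)" "\<bar>b\<bar> * sqrt q"] elim unfolding p_def q_def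
          by (simp add: power_mult_distrib abs_mult ac_simps)
        moreover have "- (a * b * r) \<le> \<bar>a * b\<bar> * \<bar>r\<bar>" by (metis abs_ge_minus_self abs_mult)
        ultimately have "b\<^sup>2 * q \<le> 2 * G (w n) (w n) x + 2 * (a\<^sup>2 * p)"
          unfolding W by (rule aux)
        then show ?case unfolding a_def b_def p_def q_def .
      qed
      then have "(LINT x|M. (k x * deriv \<phi> (fs n x))\<^sup>2 * G (fs n) (fs n) x) \<le> (LINT x|M. 2 * G (w n) (w n) x + 2 * ((\<phi> (fs n x))\<^sup>2 * G k k x))"
        using K1(1) K2(1) G_int[OF wC wC] by (intro integral_mono_AE) auto
      then show ?thesis using K1(1) G_int[OF wC wC] by simp
    qed
    have "(\<lambda>n. 2 * Q (w n) (w n) + 2 * (LINT x|M. (\<phi> (fs n x))\<^sup>2 * G k k x)) \<longlonglongrightarrow> 0"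
      using tendsto_add[OF tendsto_mult_left[OF Qw, of 2] tendsto_mult_left[OF L1_tendsto_integral[OF K1], of 2]] by simp
    then have "(LINT x|M. (k x)\<^sup>2 * g x) \<le> 0"
      using LIMSEQ_le[OF L1_tendsto_integral[OF K2]] le by blast
    moreover have nn: "AE x in M. 0 \<le> (k x)\<^sup>2 * g x" using g(3) by eventually_elim simp
    ultimately have "(LINT x|M. (k x)\<^sup>2 * g x) = 0" using integral_nonneg_AE[OF nn] by linarith
    then have "AE x in M. (k x)\<^sup>2 * g x = 0" using integral_nonneg_eq_0_iff_AE[OF K2(2) nn] by blast
    then show ?thesis by eventually_elim simp
  qed
  have "AE x in M. g x = 0"
  proof (rule separating[OF g(1)])
    fix h assume "h \<in> C"
    from integral_cong_AE[OF _ _ key[OF this]] show "(LINT x|M. h x * g x) = 0" using C_measurable[OF \<open>h \<in> C\<close>] by simp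
  qed
  then have "(LINT x|M. g x) = 0" by (subst integral_cong_AE[of _ _ "\<lambda>_. 0"]) auto
  then have "(\<lambda>n. Q (fs n) (fs n)) \<longlonglongrightarrow> 0" using L1_tendsto_integral[OF G_int[OF fs(1) fs(1)] g(1,2)] by simp
  from tendsto_real_sqrt[OF this] show ?thesis unfolding N_def by simp
qed

text \<open>
  Approximation of bounded functions in the extended space, up to an additive constant, by
  elements of \<open>C\<close>, and the square field obtained in the limit.
\<close>

definition ext_approx where
  "ext_approx f fs \<longleftrightarrow> (\<forall>n. fs n \<in> C) \<and> cauchy fs \<and> (\<exists>c. AE x in M. (\<lambda>n. fs n x) \<longlonglongrightarrow> f x - c)"

definition ext_value where
  "ext_value f g \<longleftrightarrow> integrable M g \<and> (\<exists>fs. ext_approx f fs \<and> L1_tendsto M (\<lambda>n. G (fs n) (fs n)) g)"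

lemma ext_approxD: "ext_approx f fs \<Longrightarrow> fs n \<in> C" "ext_approx f fs \<Longrightarrow> cauchy fs"
  unfolding ext_approx_def by auto

lemma ext_value_tendsto:
  assumes "ext_value f g" "ext_approx f hs"
  shows "L1_tendsto M (\<lambda>n. G (hs n) (hs n)) g"
proof -
  obtain fs where fs: "ext_approx f fs" "L1_tendsto M (\<lambda>n. G (fs n) (fs n)) g" and g: "integrable M g"
    using assms(1) unfolding ext_value_def by blast
  obtain c c' where "AE x in M. (\<lambda>n. fs n x) \<longlonglongrightarrow> f x - c" "AE x in M. (\<lambda>n. hs n x) \<longlonglongrightarrow> f x - c'"
    using fs(1) assms(2) unfolding ext_approx_def by blast
  then have "AE x in M. (\<lambda>n. (fs n - hs n) x) \<longlonglongrightarrow> c' - c"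
  proof eventually_elim
    case (elim x)
    from tendsto_diff[OF elim] show ?case by simp
  qed
  then have "(\<lambda>n. N (fs n - hs n)) \<longlonglongrightarrow> 0"
    by (intro cauchy_const_limit C_diff cauchy_minus ext_approxD[OF fs(1)] ext_approxD[OF assms(2)])
  then show ?thesis
    by (rule G_limit_transfer[OF ext_approxD[OF fs(1)] ext_approxD(1)[OF assms(2)] g fs(2)])
qed

lemma ext_value_exists: "ext_approx f fs \<Longrightarrow> \<exists>g. ext_value f g"
proof -
  assume fs: "ext_approx f fs"
  from cauchy_G_limit[OF ext_approxD(1)[OF fs] ext_approxD(2)[OF fs]] fs show ?thesis
    unfolding ext_value_def by blast
qed

lemma ext_value_unique: "ext_value f g \<Longrightarrow> ext_value f h \<Longrightarrow> AE x in M. g x = h x"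
proof -
  assume *: "ext_value f g" "ext_value f h"
  then obtain fs where fs: "ext_approx f fs" "L1_tendsto M (\<lambda>n. G (fs n) (fs n)) g" unfolding ext_value_def by blast
  show ?thesis
    using * by (intro L1_tendsto_unique[OF G_int[OF ext_approxD(1)[OF fs(1)] ext_approxD(1)[OF fs(1)]] _ _ fs(2) ext_value_tendsto[OF *(2) fs(1)]])
      (auto simp: ext_value_def)
qed

lemma ext_value_nonneg: "ext_value f g \<Longrightarrow> AE x in M. 0 \<le> g x"
proof -
  assume g: "ext_value f g"
  then obtain fs where fs: "ext_approx f fs" "L1_tendsto M (\<lambda>n. G (fs n) (fs n)) g" unfolding ext_value_def by blast
  note C = ext_approxD(1)[OF fs(1)]
  show ?thesis
    using g by (intro L1_tendsto_AE_nonneg[OF G_int[OF C C] _ fs(2) G_nonneg[OF C]]) (simp add: ext_value_def)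
qed

lemma ext_value_diff:
  assumes f: "ext_value f g" and h: "ext_value h k"
  shows "\<exists>j. ext_value (\<lambda>x. f x - h x) j \<and>
    (AE x in M. \<bar>sqrt (g x) - sqrt (k x)\<bar> \<le> sqrt (j x) \<and> sqrt (j x) \<le> sqrt (g x) + sqrt (k x))"
proof -
  obtain fs c where fs: "\<And>n. fs n \<in> C" "cauchy fs" "AE x in M. (\<lambda>n. fs n x) \<longlonglongrightarrow> f x - c" "L1_tendsto M (\<lambda>n. G (fs n) (fs n)) g"
    using f unfolding ext_value_def ext_approx_def by blast
  obtain hs c' where hs: "\<And>n. hs n \<in> C" "cauchy hs" "AE x in M. (\<lambda>n. hs n x) \<longlonglongrightarrow> h x - c'" "L1_tendsto M (\<lambda>n. G (hs n) (hs n)) k"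
    using h unfolding ext_value_def ext_approx_def by blast
  have gk: "integrable M g" "integrable M k" using f h unfolding ext_value_def by auto
  have "AE x in M. (\<lambda>n. (fs n - hs n) x) \<longlonglongrightarrow> (f x - h x) - (c - c')"
    using fs(3) hs(3)
  proof eventually_elim
    case (elim x)
    from tendsto_diff[OF elim] show ?case by (simp add: algebra_simps)
  qed
  then have ap: "ext_approx (\<lambda>x. f x - h x) (\<lambda>n. fs n - hs n)"
    unfolding ext_approx_def using C_diff[OF fs(1) hs(1)] cauchy_minus[OF fs(1,2) hs(1,2)] by blast
  obtain j where j: "ext_value (\<lambda>x. f x - h x) j" using ext_value_exists[OF ap] by blast
  have ji: "integrable M j" using j unfolding ext_value_def by auto
  note fh = C_diff[OF fs(1) hs(1)]
  obtain r1 where r1: "strict_mono r1" "AE x in M. (\<lambda>n. G (fs (r1 n)) (fs (r1 n)) x) \<longlonglongrightarrow> g x"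
    using L1_tendsto_AE_subseq[OF G_int[OF fs(1) fs(1)] gk(1) fs(4)] by blast
  obtain r2 where r2: "strict_mono r2" "AE x in M. (\<lambda>n. G (hs (r1 (r2 n))) (hs (r1 (r2 n))) x) \<longlonglongrightarrow> k x"
    using L1_tendsto_AE_subseq[OF G_int[OF hs(1) hs(1)] gk(2) L1_tendsto_subseq[OF hs(4) r1(1)]] by blast
  have r12: "strict_mono (\<lambda>n. r1 (r2 n))" using r1(1) r2(1) unfolding strict_mono_def by blast
  obtain r3 where r3: "strict_mono r3" "AE x in M. (\<lambda>n. G (fs (r1 (r2 (r3 n))) - hs (r1 (r2 (r3 n)))) (fs (r1 (r2 (r3 n))) - hs (r1 (r2 (r3 n)))) x) \<longlonglongrightarrow> j x"
    using L1_tendsto_AE_subseq[OF G_int[OF fh fh] ji L1_tendsto_subseq[OF ext_value_tendsto[OF j ap] r12]] by blast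
  define s where "s n = r1 (r2 (r3 n))" for n
  have g': "AE x in M. (\<lambda>n. G (fs (s n)) (fs (s n)) x) \<longlonglongrightarrow> g x"
    using r1(2)
  proof eventually_elim
    case (elim x)
    have "strict_mono (\<lambda>n. r2 (r3 n))" using r2(1) r3(1) unfolding strict_mono_def by blast
    from LIMSEQ_subseq_LIMSEQ[OF elim this] show ?case by (simp add: o_def s_def)
  qed
  have k': "AE x in M. (\<lambda>n. G (hs (s n)) (hs (s n)) x) \<longlonglongrightarrow> k x"
    using r2(2)
  proof eventually_elim
    case (elim x)
    from LIMSEQ_subseq_LIMSEQ[OF elim r3(1)] show ?case by (simp add: o_def s_def)
  qed
  have j': "AE x in M. (\<lambda>n. G (fs (s n) - hs (s n)) (fs (s n) - hs (s n)) x) \<longlonglongrightarrow> j x"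
    using r3(2) unfolding s_def .
  have "AE x in M. \<forall>n. \<bar>sqrt (G (fs n) (fs n) x) - sqrt (G (hs n) (hs n) x)\<bar> \<le> sqrt (G (fs n - hs n) (fs n - hs n) x)"
    unfolding AE_all_countable using G_sqrt_diff[OF fs(1) hs(1)] by blast
  moreover have "AE x in M. \<forall>n. sqrt (G (fs n - hs n) (fs n - hs n) x) \<le> sqrt (G (fs n) (fs n) x) + sqrt (G (hs n) (hs n) x)"
    unfolding AE_all_countable
  proof
    fix n
    show "AE x in M. sqrt (G (fs n - hs n) (fs n - hs n) x) \<le> sqrt (G (fs n) (fs n) x) + sqrt (G (hs n) (hs n) x)"
      using G_diff2[OF fs(1)[of n] hs(1)[of n]] G_CS[OF fs(1)[of n] hs(1)[of n]] G_nonneg[OF fs(1)[of n]] G_nonneg[OF hs(1)[of n]]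
    proof eventually_elim
      case (elim x)
      have "\<bar>G (fs n) (hs n) x\<bar> \<le> sqrt (G (fs n) (fs n) x) * sqrt (G (hs n) (hs n) x)"
        using elim(2) by (metis real_sqrt_abs real_sqrt_le_mono real_sqrt_mult)
      then show ?case unfolding elim(1) using elim(3,4) by (intro real_le_lsqrt) (auto simp: power2_sum)
    qed
  qed
  ultimately have "AE x in M. \<bar>sqrt (g x) - sqrt (k x)\<bar> \<le> sqrt (j x) \<and> sqrt (j x) \<le> sqrt (g x) + sqrt (k x)"
    using g' k' j'
  proof eventually_elim
    case (elim x)
    note t = tendsto_real_sqrt[OF elim(3)] tendsto_real_sqrt[OF elim(4)] tendsto_real_sqrt[OF elim(5)]
    show ?case
      using LIMSEQ_le[OF tendsto_rabs[OF tendsto_diff[OF t(1,2)]] t(3)] LIMSEQ_le[OF t(3) tendsto_add[OF t(1,2)]] elim(1,2) by blast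
  qed
  with j show ?thesis by blast
qed

lemma core_approx:
  assumes f: "f \<in> D" and e: "e > 0"
  shows "\<exists>h\<in>C. (LINT x|M. (h x - f x)\<^sup>2) < e \<and> E (f - h) (f - h) < e \<and>
    (ess_bounded M f \<longrightarrow> (LINT x|M. \<bar>G h h x - square_field M D E f x\<bar>) < e)"
proof -
  obtain fs where fs: "approx f fs" using D_approx[OF f] by blast
  obtain g where g: "G_value f g" using G_value_exists[OF f] by blast
  have 1: "eventually (\<lambda>n. (LINT x|M. (fs n x - f x)\<^sup>2) < e) sequentially"
    using approxD(3)[OF fs] e unfolding L2_tendsto_def by (auto dest: order_tendstoD)
  have 2: "eventually (\<lambda>n. (LINT x|M. \<bar>G (fs n) (fs n) x - g x\<bar>) < e) sequentially"
    using G_value_tendsto[OF f g fs] e unfolding L1_tendsto_def by (auto dest: order_tendstoD)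
  obtain n where n: "(LINT x|M. (fs n x - f x)\<^sup>2) < e" "(LINT x|M. \<bar>G (fs n) (fs n) x - g x\<bar>) < e" "E (f - fs n) (f - fs n) < e"
    using eventually_happens[OF eventually_conj[OF 1 eventually_conj[OF 2 approx_E_tendsto[OF f fs e]]]] by auto
  show ?thesis
  proof (intro bexI[of _ "fs n"] conjI impI n)
    assume b: "ess_bounded M f"
    have "(LINT x|M. \<bar>G (fs n) (fs n) x - square_field M D E f x\<bar>) = (LINT x|M. \<bar>G (fs n) (fs n) x - g x\<bar>)"
      using square_field_eq[OF f b g] G_measurable[OF approxD(1)[OF fs] approxD(1)[OF fs], of n n] g unfolding G_value_def
      by (intro integral_cong_AE) auto
    then show "(LINT x|M. \<bar>G (fs n) (fs n) x - square_field M D E f x\<bar>) < e" using n by simp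
  qed (rule approxD(1)[OF fs])
qed

text \<open>
  A Cauchy sequence in the domain of the closure may be replaced by one in \<open>C\<close> with the same limits.
\<close>

lemma D_cauchy_core:
  assumes fs: "\<And>n. fs n \<in> D" "form_cauchy E fs"
  shows "\<exists>hs. (\<forall>n. hs n \<in> C) \<and> cauchy hs \<and> (AE x in M. (\<lambda>n. hs n x - fs n x) \<longlonglongrightarrow> 0) \<and>
    ((\<forall>n. ess_bounded M (fs n)) \<longrightarrow> (\<lambda>n. LINT x|M. \<bar>square_field M D E (fs n) x - G (hs n) (hs n) x\<bar>) \<longlonglongrightarrow> 0)"
proof -
  let ?P = "\<lambda>n h. h \<in> C \<and> (LINT x|M. (h x - fs n x)\<^sup>2) < (1 / 2) ^ n \<and> E (fs n - h) (fs n - h) < (1 / 2) ^ n \<and>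
    (ess_bounded M (fs n) \<longrightarrow> (LINT x|M. \<bar>G h h x - square_field M D E (fs n) x\<bar>) < (1 / 2) ^ n)"
  define hs where "hs n = (SOME h. ?P n h)" for n
  have "\<exists>h. ?P n h" for n
    using core_approx[OF fs(1)[of n], of "(1 / 2) ^ n"] by (simp add: Bex_def)
  then have "?P n (hs n)" for n unfolding hs_def by (rule someI_ex)
  then have hs: "hs n \<in> C" "(LINT x|M. (hs n x - fs n x)\<^sup>2) < (1 / 2) ^ n"
    "E (fs n - hs n) (fs n - hs n) < (1 / 2) ^ n"
    "ess_bounded M (fs n) \<Longrightarrow> (LINT x|M. \<bar>G (hs n) (hs n) x - square_field M D E (fs n) x\<bar>) < (1 / 2) ^ n" for n
    by blast+
  have geo: "(\<lambda>n. (1 / 2 :: real) ^ n) \<longlonglongrightarrow> 0" by (rule LIMSEQ_power_zero) simp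
  have "AE x in M. (\<lambda>n. hs n x - fs n x) \<longlonglongrightarrow> 0"
    by (rule L2_fast_AE_tendsto_0[OF L2_diff[OF C_L2[OF hs(1)] D_L2[OF fs(1)]] hs(2)])
  moreover have "cauchy hs"
    unfolding form_cauchy_def
  proof (intro allI impI)
    fix e :: real assume e: "e > 0"
    obtain n1 where n1: "\<forall>i\<ge>n1. \<forall>j\<ge>n1. E (fs i - fs j) (fs i - fs j) < e / 4"
      using fs(2) e unfolding form_cauchy_def by (metis zero_less_divide_iff zero_less_numeral)
    obtain n2 where n2: "\<And>n. n \<ge> n2 \<Longrightarrow> (1 / 2) ^ n < e / 16"
      using order_tendstoD(2)[OF geo, of "e / 16"] e by (auto simp: eventually_sequentially)
    show "\<exists>n0. \<forall>i\<ge>n0. \<forall>j\<ge>n0. Q (hs i - hs j) (hs i - hs j) < e"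
    proof (intro exI[of _ "max n1 n2"] allI impI)
      fix i j assume ij: "max n1 n2 \<le> i" "max n1 n2 \<le> j"
      have d: "fs i - fs j \<in> D" "fs i - hs i \<in> D" "fs j - hs j \<in> D" by (intro D_diff fs C_subset_D hs)+
      have "hs i - hs j = (fs i - fs j) - ((fs i - hs i) - (fs j - hs j))" by (auto simp: fun_eq_iff)
      then have "Q (hs i - hs j) (hs i - hs j) \<le> 2 * E (fs i - fs j) (fs i - fs j) + 2 * E ((fs i - hs i) - (fs j - hs j)) ((fs i - hs i) - (fs j - hs j))"
        using E_diff_le[OF d(1) D_diff[OF d(2,3)]] E_eq_Q[OF C_diff[OF hs(1) hs(1)] C_diff[OF hs(1) hs(1)], of i j i j] by simp
      also have "\<dots> \<le> 2 * E (fs i - fs j) (fs i - fs j) + 2 * (2 * E (fs i - hs i) (fs i - hs i) + 2 * E (fs j - hs j) (fs j - hs j))"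
        using E_diff_le[OF d(2,3)] by simp
      also have "\<dots> < e"
        using n1[rule_format, of i j] n2[of i] n2[of j] hs(3)[of i] hs(3)[of j] ij by simp
      finally show "Q (hs i - hs j) (hs i - hs j) < e" .
    qed
  qed
  moreover have "(\<lambda>n. LINT x|M. \<bar>square_field M D E (fs n) x - G (hs n) (hs n) x\<bar>) \<longlonglongrightarrow> 0" if b: "\<forall>n. ess_bounded M (fs n)"
  proof (rule tendsto_sandwich[OF _ _ tendsto_const geo])
    show "eventually (\<lambda>n. (LINT x|M. \<bar>square_field M D E (fs n) x - G (hs n) (hs n) x\<bar>) \<le> (1 / 2) ^ n) sequentially"
      using hs(4) b by (auto simp: abs_minus_commute intro!: always_eventually less_imp_le)
  qed simp
  ultimately show ?thesis using hs(1) by blast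
qed

lemma ext_dom_approx:
  assumes "f \<in> ext_square_field_dom M D E" shows "\<exists>hs. ext_approx f hs"
proof -
  obtain c fs where fs: "\<And>n. fs n \<in> D" "form_cauchy E fs" "AE x in M. (\<lambda>n. fs n x) \<longlonglongrightarrow> f x - c"
    using assms unfolding ext_square_field_dom_def extended_space_def by blast
  obtain hs where hs: "\<And>n. hs n \<in> C" "cauchy hs" "AE x in M. (\<lambda>n. hs n x - fs n x) \<longlonglongrightarrow> 0" using D_cauchy_core[OF fs(1,2)] by blast
  have "AE x in M. (\<lambda>n. hs n x) \<longlonglongrightarrow> f x - c"
    using hs(3) fs(3)
  proof eventually_elim
    case (elim x)
    from tendsto_add[OF elim] show ?case by simp
  qed
  with hs show ?thesis unfolding ext_approx_def by blast
qed

lemma cauchy_E: "(\<And>n. hs n \<in> C) \<Longrightarrow> cauchy hs \<Longrightarrow> form_cauchy E hs"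
  unfolding form_cauchy_def by (simp add: E_eq_Q C_diff)

lemma ext_domI:
  assumes "ess_bounded M f" "ext_approx f hs" shows "f \<in> ext_square_field_dom M D E"
  using assms cauchy_E[OF ext_approxD[OF assms(2)]] C_subset_D[OF ext_approxD(1)[OF assms(2)]]
  unfolding ext_square_field_dom_def extended_space_def ext_approx_def by blast

lemma ext_value_square_field:
  assumes "ext_approx f fs0" shows "ext_value f (ext_square_field M D E f)"
proof -
  let ?P = "\<lambda>g. integrable M g \<and>
        (\<exists>c fs. (\<forall>n. fs n \<in> D \<and> ess_bounded M (fs n)) \<and> form_cauchy E fs \<and>
           (AE x in M. (\<lambda>n. fs n x) \<longlonglongrightarrow> f x - c) \<and>
           L1_tendsto M (\<lambda>n. square_field M D E (fs n)) g)"
  have b: "ess_bounded M h" if "h \<in> C" for h unfolding ess_bounded_def using AE_bounded_C[OF that] .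
  obtain g0 where g0: "ext_value f g0" using ext_value_exists[OF assms] by blast
  have sf: "integrable M (square_field M D E (fs0 n))" "AE x in M. square_field M D E (fs0 n) x = G (fs0 n) (fs0 n) x" for n
    using square_field_eq[OF C_subset_D[OF ext_approxD(1)[OF assms]] b[OF ext_approxD(1)[OF assms]] G_value_C[OF ext_approxD(1)[OF assms]]] by blast+
  have g0i: "integrable M g0" using g0 unfolding ext_value_def by blast
  have "L1_tendsto M (\<lambda>n. square_field M D E (fs0 n)) g0"
  proof -
    have "(LINT x|M. \<bar>square_field M D E (fs0 n) x - g0 x\<bar>) = (LINT x|M. \<bar>G (fs0 n) (fs0 n) x - g0 x\<bar>)" for n
      using sf[of n] g0i G_measurable[OF ext_approxD(1)[OF assms] ext_approxD(1)[OF assms], of n n] by (intro integral_cong_AE) auto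
    then show ?thesis using ext_value_tendsto[OF g0 assms] unfolding L1_tendsto_def by simp
  qed
  then have "?P g0"
    using g0i assms b cauchy_E[OF ext_approxD[OF assms]] C_subset_D unfolding ext_approx_def by blast
  then have "?P (ext_square_field M D E f)" unfolding ext_square_field_def by (rule someI[of ?P])
  then obtain c fs where fs: "\<And>n. fs n \<in> D" "\<And>n. ess_bounded M (fs n)" "form_cauchy E fs"
      "AE x in M. (\<lambda>n. fs n x) \<longlonglongrightarrow> f x - c" "L1_tendsto M (\<lambda>n. square_field M D E (fs n)) (ext_square_field M D E f)"
    and gi: "integrable M (ext_square_field M D E f)" by blast
  obtain hs where hs: "\<And>n. hs n \<in> C" "cauchy hs" "AE x in M. (\<lambda>n. hs n x - fs n x) \<longlonglongrightarrow> 0"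
    "(\<lambda>n. LINT x|M. \<bar>square_field M D E (fs n) x - G (hs n) (hs n) x\<bar>) \<longlonglongrightarrow> 0"
    using D_cauchy_core[OF fs(1,3)] fs(2) by blast
  have "AE x in M. (\<lambda>n. hs n x) \<longlonglongrightarrow> f x - c"
    using hs(3) fs(4)
  proof eventually_elim
    case (elim x)
    from tendsto_add[OF elim] show ?case by simp
  qed
  then have "ext_approx f hs" using hs unfolding ext_approx_def by blast
  moreover have "L1_tendsto M (\<lambda>n. G (hs n) (hs n)) (ext_square_field M D E f)"
  proof (rule L1_tendsto_trans[OF _ _ gi fs(5) hs(4)])
    show "integrable M (square_field M D E (fs n))" for n
      using G_value_exists[OF fs(1)] square_field_eq(1)[OF fs(1,2)] by blast
  qed (intro G_int hs)
  ultimately show ?thesis unfolding ext_value_def using gi by blast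
qed

lemma ext_value_C:
  assumes f: "f \<in> C" and h: "AE x in M. h x = f x + c"
  shows "ext_value h (G f f)" "ext_approx h (\<lambda>_. f)"
proof -
  have "AE x in M. (\<lambda>_::nat. f x) \<longlonglongrightarrow> h x - c"
    using h by eventually_elim simp
  then show a: "ext_approx h (\<lambda>_. f)" unfolding ext_approx_def using f cauchy_const[OF f] by blast
  then show "ext_value h (G f f)" unfolding ext_value_def using G_int[OF f f] by (auto simp: L1_tendsto_def)
qed

end

section \<open>The base space\<close>

lemma integrable_AE_bounded_support:
  fixes f :: "'b \<Rightarrow> real"
  assumes [measurable]: "f \<in> borel_measurable M" "E \<in> sets M" and fin: "emeasure M E < \<infinity>"
    and B: "AE x in M. \<bar>f x\<bar> \<le> B * indicator E x"
  shows "integrable M f"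
proof (rule Bochner_Integration.integrable_bound)
  show "integrable M (\<lambda>x. B * indicator E x :: real)" using fin by (intro integrable_mult_right integrable_real_indicator) auto
  show "AE x in M. norm (f x) \<le> norm (B * indicator E x :: real)" using B by eventually_elim (auto split: split_indicator_asm)
qed simp

lemma sets_borel_of: "sets (borel_of T) = sigma_sets (topspace T) {U. openin T U}"
  and space_borel_of: "space (borel_of T) = topspace T"
  unfolding borel_of_def by (auto simp: sets_measure_of_conv space_measure_of_conv dest: openin_subset)

lemma openin_borel_of: "openin T U \<Longrightarrow> U \<in> sets (borel_of T)"
  unfolding sets_borel_of by (rule sigma_sets.Basic) simp

lemma measurable_borel_ofI:
  assumes "f \<in> space M \<rightarrow> topspace T" "\<And>U. openin T U \<Longrightarrow> f -` U \<inter> space M \<in> sets M"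
  shows "f \<in> measurable M (borel_of T)"
  unfolding borel_of_def using assms by (intro measurable_measure_of) (auto dest: openin_subset)

lemma continuous_map_measurable:
  assumes f: "continuous_map T S f" and s: "space M = topspace T" "sets (borel_of T) \<subseteq> sets M"
  shows "f \<in> measurable M (borel_of S)"
proof (rule measurable_borel_ofI)
  show "f \<in> space M \<rightarrow> topspace S" using f s(1) by (auto simp: continuous_map_def)
  fix U assume "openin S U"
  then have "openin T {x \<in> topspace T. f x \<in> U}" using f by (rule openin_continuous_map_preimage[rotated])
  then have "{x \<in> topspace T. f x \<in> U} \<in> sets M" using s(2) openin_borel_of by blast
  moreover have "f -` U \<inter> space M = {x \<in> topspace T. f x \<in> U}" using s by auto
  ultimately show "f -` U \<inter> space M \<in> sets M" by simp
qed

lemma measurable_borel_of_euclidean: "measurable M (borel_of euclidean) = measurable M borel"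
  by (rule measurable_cong_sets) (auto simp: sets_borel_of borel_def)

locale diffusion_space =
  fixes X :: "'a diffusion_space"
  assumes X: "topological_local_diffusion_space X"
begin

abbreviation m where "m \<equiv> refm X"

lemma tls: "topological_local_structure X" and sfo: "square_field_operator X"
  and closX: "closable m (core X) (pre_form X)" and denseX: "L2_dense m (core X)"
  using X unfolding topological_local_diffusion_space_def by auto

lemma space_m: "space m = pts X" and borel_sub: "sets (borel_of (topo X)) \<subseteq> sets m"
  and sub_completion: "sets m \<subseteq> sets (completion (restr_to_subalg m (borel_of (topo X))))"
  and sf_m: "sigma_finite_measure m" and loc_ring: "localizing_ring X"
  using tls unfolding topological_local_structure_def by auto

lemma lring_sets: "E \<in> lring X \<Longrightarrow> E \<in> sets m"
  and lring_finite: "E \<in> lring X \<Longrightarrow> emeasure m E < \<infinity>"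
  and lring_Un: "E \<in> lring X \<Longrightarrow> F \<in> lring X \<Longrightarrow> E \<union> F \<in> lring X"
  and lring_Int: "A \<in> sets m \<Longrightarrow> E \<in> lring X \<Longrightarrow> A \<inter> E \<in> lring X"
  using loc_ring unfolding localizing_ring_def by auto

lemma exhaustion:
  obtains Eh :: "nat \<Rightarrow> 'a set" where "incseq Eh" "(\<Union>h. Eh h) = pts X" "\<And>h. Eh h \<in> lring X"
    "\<And>E. E \<in> lring X \<Longrightarrow> \<exists>h. E \<subseteq> Eh h"
proof -
  obtain Eh :: "nat \<Rightarrow> 'a set" where *: "incseq Eh" "(\<Union>h. Eh h) = pts X"
    "\<And>h. Eh h \<in> sets m" "lring X = (\<Union>h. {A \<inter> Eh h | A. A \<in> sets m})"
    using loc_ring unfolding localizing_ring_def by auto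
  have "Eh h = Eh h \<inter> Eh h" for h by simp
  then have "Eh h \<in> lring X" for h unfolding *(4) using *(3) by blast
  moreover have "\<exists>h. E \<subseteq> Eh h" if "E \<in> lring X" for E using that unfolding *(4) by auto
  ultimately show ?thesis using that * by blast
qed

lemma empty_lring: "{} \<in> lring X"
proof -
  obtain Eh :: "nat \<Rightarrow> 'a set" where "\<And>h. Eh h \<in> lring X" using exhaustion by metis
  then show ?thesis using lring_Int[of "{}" "Eh 0"] by auto
qed

lemma core_C0: "f \<in> core X \<Longrightarrow> f \<in> C0_ring X"
  using sfo unfolding square_field_operator_def by auto

lemma core_bounded: "f \<in> core X \<Longrightarrow> \<exists>B>0. \<forall>x. \<bar>f x\<bar> \<le> B"
  using core_C0 unfolding C0_ring_def bounded_pos by auto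

lemma core_support: "f \<in> core X \<Longrightarrow> \<exists>E\<in>lring X. \<forall>x. x \<notin> E \<longrightarrow> f x = 0"
  using core_C0 unfolding C0_ring_def by auto

lemma core_continuous: "f \<in> core X \<Longrightarrow> continuous_map (topo X) euclideanreal f"
  using core_C0 unfolding C0_ring_def by auto

lemma continuous_measurable: "continuous_map (topo X) euclideanreal f \<Longrightarrow> f \<in> borel_measurable m"
  using continuous_map_measurable[OF _ space_m borel_sub, of euclideanreal f]
  by (simp add: measurable_borel_of_euclidean)

lemma core_measurable: "f \<in> core X \<Longrightarrow> f \<in> borel_measurable m"
  by (rule continuous_measurable[OF core_continuous])

lemma core_bounded_support:
  assumes "f \<in> core X" shows "\<exists>B E. B > 0 \<and> E \<in> lring X \<and> (\<forall>x. \<bar>f x\<bar> \<le> B * indicator E x)"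
proof -
  obtain B where B: "B > 0" "\<And>x. \<bar>f x\<bar> \<le> B" using core_bounded[OF assms] by blast
  obtain E where E: "E \<in> lring X" "\<And>x. x \<notin> E \<Longrightarrow> f x = 0" using core_support[OF assms] by blast
  have "\<bar>f x\<bar> \<le> B * indicator E x" for x using B(2)[of x] E(2)[of x] by (auto split: split_indicator)
  then show ?thesis using B(1) E(1) by blast
qed

lemma core_L2: assumes "f \<in> core X" shows "f \<in> L2 m"
proof -
  note core_measurable[OF assms, measurable]
  obtain B E where B: "B > 0" "E \<in> lring X" "\<And>x. \<bar>f x\<bar> \<le> B * indicator E x" using core_bounded_support[OF assms] by blast
  have "integrable m (\<lambda>x. (f x)\<^sup>2)"
  proof (rule integrable_AE_bounded_support[of _ _ E "B\<^sup>2"])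
    show "AE x in m. \<bar>(f x)\<^sup>2\<bar> \<le> B\<^sup>2 * indicator E x"
    proof (rule AE_I2)
      fix x show "\<bar>(f x)\<^sup>2\<bar> \<le> B\<^sup>2 * indicator E x"
        using power_mono[OF B(3)[of x] abs_ge_zero, of 2] by (auto split: split_indicator_asm)
    qed
  qed (use lring_sets[OF B(2)] lring_finite[OF B(2)] in auto)
  then show ?thesis unfolding L2_def using core_measurable[OF assms] by simp
qed

lemma sqf_Sb: "f \<in> core X \<Longrightarrow> g \<in> core X \<Longrightarrow> \<exists>h\<in>Sb_ring X. AE x in m. sqf X f g x = h x"
  and sqf_measurable: "f \<in> core X \<Longrightarrow> g \<in> core X \<Longrightarrow> sqf X f g \<in> borel_measurable m"
  using sfo unfolding square_field_operator_def by auto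

lemma Sb_bounded_support:
  assumes "f \<in> Sb_ring X" shows "\<exists>B E. B > 0 \<and> E \<in> lring X \<and> (\<forall>x. \<bar>f x\<bar> \<le> B * indicator E x)"
proof -
  obtain B where B: "B > 0" "\<And>x. \<bar>f x\<bar> \<le> B" using assms unfolding Sb_ring_def bounded_pos by auto
  obtain E where E: "E \<in> lring X" "\<And>x. x \<notin> E \<Longrightarrow> f x = 0" using assms unfolding Sb_ring_def by auto
  have "\<bar>f x\<bar> \<le> B * indicator E x" for x using B(2)[of x] E(2)[of x] by (auto split: split_indicator)
  then show ?thesis using B(1) E(1) by blast
qed

lemma sqf_bounded_support:
  assumes "f \<in> core X" "g \<in> core X"
  shows "\<exists>B E. B > 0 \<and> E \<in> lring X \<and> (AE x in m. \<bar>sqf X f g x\<bar> \<le> B * indicator E x)"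
proof -
  obtain h where h: "h \<in> Sb_ring X" "AE x in m. sqf X f g x = h x" using sqf_Sb[OF assms] by blast
  obtain B E where B: "B > 0" "E \<in> lring X" "\<And>x. \<bar>h x\<bar> \<le> B * indicator E x" using Sb_bounded_support[OF h(1)] by blast
  have "AE x in m. \<bar>sqf X f g x\<bar> \<le> B * indicator E x" using h(2) by eventually_elim (simp add: B(3))
  with B show ?thesis by blast
qed

lemma sqf_integrable: assumes "f \<in> core X" "g \<in> core X" shows "integrable m (sqf X f g)"
proof -
  obtain B E where B: "B > 0" "E \<in> lring X" "AE x in m. \<bar>sqf X f g x\<bar> \<le> B * indicator E x"
    using sqf_bounded_support[OF assms] by blast
  show ?thesis
    by (rule integrable_AE_bounded_support[OF sqf_measurable[OF assms] lring_sets[OF B(2)] lring_finite[OF B(2)] B(3)])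
qed

lemma sqf_Linf: assumes "f \<in> core X" "g \<in> core X" shows "sqf X f g \<in> Linf m"
proof -
  obtain B E where B: "B > 0" "E \<in> lring X" "AE x in m. \<bar>sqf X f g x\<bar> \<le> B * indicator E x" using sqf_bounded_support[OF assms] by blast
  have "AE x in m. \<bar>sqf X f g x\<bar> \<le> B" using B(3)
    by eventually_elim (use B(1) in \<open>auto split: split_indicator_asm\<close>)
  then show ?thesis unfolding Linf_def ess_bounded_def using sqf_measurable[OF assms] by blast
qed

lemma core_zero: "(\<lambda>_. 0) \<in> core X"
  and core_add: "f \<in> core X \<Longrightarrow> g \<in> core X \<Longrightarrow> (\<lambda>x. f x + g x) \<in> core X"
  and core_mult: "f \<in> core X \<Longrightarrow> g \<in> core X \<Longrightarrow> (\<lambda>x. f x * g x) \<in> core X"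
  and core_scale: "f \<in> core X \<Longrightarrow> (\<lambda>x. c * f x) \<in> core X"
  and core_comp: "\<phi> \<in> Cb_smooth k \<Longrightarrow> (\<And>i. i < k \<Longrightarrow> fs i \<in> core X) \<Longrightarrow> (\<lambda>x. \<phi> (\<lambda>i. fs i x) - \<phi> (\<lambda>_. 0)) \<in> core X"
  using sfo unfolding square_field_operator_def by auto

lemma sqf_chain:
  assumes "\<phi> \<in> Cb_smooth k" "\<psi> \<in> Cb_smooth l" "\<And>i. i < k \<Longrightarrow> fs i \<in> core X" "\<And>i. i < l \<Longrightarrow> gs i \<in> core X"
  shows "AE x in m. sqf X (\<lambda>x. \<phi> (\<lambda>i. fs i x) - \<phi> (\<lambda>_. 0)) (\<lambda>x. \<psi> (\<lambda>j. gs j x) - \<psi> (\<lambda>_. 0)) x =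
    (\<Sum>i<k. \<Sum>j<l. pd i \<phi> (\<lambda>i. fs i x) * pd j \<psi> (\<lambda>j. gs j x) * sqf X (fs i) (gs j) x)"
proof -
  have "\<forall>k l. \<forall>\<phi>\<in>Cb_smooth k. \<forall>\<psi>\<in>Cb_smooth l. \<forall>f g.
        (\<forall>i<k. f i \<in> core X) \<and> (\<forall>j<l. g j \<in> core X) \<longrightarrow>
        (AE x in refm X.
           sqf X (\<lambda>x. \<phi> (\<lambda>i. f i x) - \<phi> (\<lambda>_. 0)) (\<lambda>x. \<psi> (\<lambda>j. g j x) - \<psi> (\<lambda>_. 0)) x =
           (\<Sum>i<k. \<Sum>j<l. pd i \<phi> (\<lambda>i. f i x) * pd j \<psi> (\<lambda>j. g j x) * sqf X (f i) (g j) x))"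
    using sfo unfolding square_field_operator_def by blast
  then show ?thesis using assms by blast
qed

lemma smooth_cutoff_scaled:
  assumes "R > 0" shows "\<exists>\<kappa>. smooth1 \<kappa> \<and> (\<forall>t. \<bar>t\<bar> \<le> R \<longrightarrow> \<kappa> t = t) \<and> (\<forall>t. \<bar>t\<bar> \<le> R \<longrightarrow> deriv \<kappa> t = 1)"
proof -
  obtain \<kappa> where \<kappa>: "smooth1 \<kappa>" "\<And>t. \<bar>t\<bar> \<le> 1 \<Longrightarrow> \<kappa> t = t" "\<And>t. \<bar>t\<bar> \<le> 1 \<Longrightarrow> deriv \<kappa> t = 1"
    using smooth_cutoff_exists by blast
  define \<psi> where "\<psi> = (\<lambda>t. R * \<kappa> ((1 / R) * t + 0))"
  have "deriv \<psi> t = 1" if t: "\<bar>t\<bar> \<le> R" for t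
  proof (rule DERIV_imp_deriv)
    have "(\<kappa> has_real_derivative 1) (at ((1 / R) * t + 0))"
      using smooth1_DERIV[OF \<kappa>(1), of "(1 / R) * t + 0"] \<kappa>(3)[of "(1 / R) * t + 0"] t assms by simp
    then have "((\<lambda>t. \<kappa> ((1 / R) * t + 0)) has_real_derivative 1 * (1 / R)) (at t)"
      by (rule DERIV_chain2) (use assms in \<open>auto intro!: derivative_eq_intros\<close>)
    from DERIV_cmult[OF this, of R] show "(\<psi> has_real_derivative 1) (at t)" unfolding \<psi>_def using assms by simp
  qed
  moreover have "\<psi> t = t" if "\<bar>t\<bar> \<le> R" for t unfolding \<psi>_def using \<kappa>(2)[of "t / R"] that assms by simp
  moreover have "smooth1 \<psi>" unfolding \<psi>_def by (intro smooth1_cmult smooth1_affine \<kappa>)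
  ultimately show ?thesis by blast
qed

text \<open>The chain rule in the first argument; the second one is written as a truncation of itself.\<close>

lemma sqf_chain_left:
  assumes \<phi>: "\<phi> \<in> Cb_smooth k" and fs: "\<And>i. i < k \<Longrightarrow> fs i \<in> core X" and g: "g \<in> core X"
  shows "AE x in m. sqf X (\<lambda>x. \<phi> (\<lambda>i. fs i x) - \<phi> (\<lambda>_. 0)) g x = (\<Sum>i<k. pd i \<phi> (\<lambda>i. fs i x) * sqf X (fs i) g x)"
proof -
  obtain R where R: "R > 0" "\<And>x. \<bar>g x\<bar> \<le> R" using core_bounded[OF g] by blast
  obtain \<kappa> where \<kappa>: "smooth1 \<kappa>" "\<And>t. \<bar>t\<bar> \<le> R \<Longrightarrow> \<kappa> t = t" "\<And>t. \<bar>t\<bar> \<le> R \<Longrightarrow> deriv \<kappa> t = 1"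
    using smooth_cutoff_scaled[OF R(1)] by blast
  have eq: "(\<lambda>x. \<kappa> (g x) - \<kappa> 0) = g" using \<kappa>(2)[OF R(2)] \<kappa>(2)[of 0] R(1) by auto
  have "(\<lambda>y. \<kappa> (y 0)) \<in> Cb_smooth 1" using \<kappa> by (intro Cb_smooth_coord) auto
  from sqf_chain[OF \<phi> this, of fs "\<lambda>_. g"] fs g eq \<kappa>(3)[OF R(2)]
  show ?thesis by (simp add: pd_coord[OF \<kappa>(1)])
qed

lemma sqf_chain1:
  assumes "smooth1 \<phi>" "f \<in> core X" "g \<in> core X"
  shows "AE x in m. sqf X (\<lambda>x. \<phi> (f x) - \<phi> 0) g x = deriv \<phi> (f x) * sqf X f g x"
  using sqf_chain_left[of "\<lambda>y. \<phi> (y 0)" 1 "\<lambda>_. f" g] assms by (simp add: pd_coord Cb_smooth_coord)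

text \<open>
  Products of core functions are the smooth function \<open>\<kappa>(y\<^sub>0) \<kappa>(y\<^sub>1)\<close> of them, where the truncation \<open>\<kappa>\<close> is the
  identity on their ranges; it is needed because \<open>y\<^sub>0 y\<^sub>1\<close> is not bounded.
\<close>

lemma sqf_Leibniz:
  assumes f: "f \<in> core X" and g: "g \<in> core X" and h: "h \<in> core X"
  shows "AE x in m. sqf X (\<lambda>x. f x * g x) h x = f x * sqf X g h x + g x * sqf X f h x"
proof -
  obtain R1 R2 where R12: "R1 > 0" "\<And>x. \<bar>f x\<bar> \<le> R1" "\<And>x. \<bar>g x\<bar> \<le> R2"
    using core_bounded[OF f] core_bounded[OF g] by blast
  define R where "R = max R1 R2"
  have R: "R > 0" "\<And>x. \<bar>f x\<bar> \<le> R" "\<And>x. \<bar>g x\<bar> \<le> R"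
    using R12 by (auto simp: R_def less_max_iff_disj le_max_iff_disj)
  obtain \<kappa> where \<kappa>: "smooth1 \<kappa>" "\<And>t. \<bar>t\<bar> \<le> R \<Longrightarrow> \<kappa> t = t" "\<And>t. \<bar>t\<bar> \<le> R \<Longrightarrow> deriv \<kappa> t = 1"
    using smooth_cutoff_scaled[OF R(1)] by blast
  have c: "(\<lambda>y. \<kappa> (y 0)) \<in> Cb_smooth 2" "(\<lambda>y. \<kappa> (y 1)) \<in> Cb_smooth 2" using \<kappa> by (auto intro: Cb_smooth_coord)
  have \<kappa>0: "\<kappa> 0 = 0" using \<kappa>(2)[of 0] R(1) by simp
  define \<phi> where "\<phi> = (\<lambda>y::nat \<Rightarrow> real. \<kappa> (y 0) * \<kappa> (y 1))"
  have \<phi>: "\<phi> \<in> Cb_smooth 2" unfolding \<phi>_def by (rule Cb_smooth_mult[OF c])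
  define fs where "fs i = (if i = 0 then f else g)" for i :: nat
  have eq: "(\<lambda>x. \<phi> (\<lambda>i. fs i x) - \<phi> (\<lambda>_. 0)) = (\<lambda>x. f x * g x)"
    unfolding \<phi>_def fs_def using \<kappa>(2)[OF R(2)] \<kappa>(2)[OF R(3)] \<kappa>0 by simp
  have p: "pd 0 \<phi> (\<lambda>i. fs i x) = g x" "pd 1 \<phi> (\<lambda>i. fs i x) = f x" for x
    unfolding \<phi>_def pd_mult[OF c] using \<kappa>(2)[OF R(2)] \<kappa>(2)[OF R(3)] \<kappa>(3)[OF R(2)] \<kappa>(3)[OF R(3)]
    by (simp_all add: pd_coord[OF \<kappa>(1)] fs_def)
  have "AE x in m. sqf X (\<lambda>x. \<phi> (\<lambda>i. fs i x) - \<phi> (\<lambda>_. 0)) h x = (\<Sum>i<2. pd i \<phi> (\<lambda>i. fs i x) * sqf X (fs i) h x)"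
    by (rule sqf_chain_left[OF \<phi> _ h]) (use f g in \<open>auto simp: fs_def\<close>)
  then show ?thesis unfolding eq
  proof eventually_elim
    case (elim x)
    have "{..<2} = {0, 1::nat}" by auto
    then show ?case unfolding elim using p[of x] by (simp add: fs_def)
  qed
qed

text \<open>Uniformly bounded approximation of indicator functions by elements of the core.\<close>

lemma core_approx_indicator:
  assumes A: "A \<in> sets m" "emeasure m A < \<infinity>"
  shows "\<exists>e B. (\<forall>n. e n \<in> core X) \<and> (\<forall>n x. \<bar>e n x\<bar> \<le> B) \<and> (AE x in m. (\<lambda>n. e n x) \<longlonglongrightarrow> indicator A x)"
proof -
  have i: "indicator A \<in> L2 m"
  proof -
    have "(indicator A x :: real)\<^sup>2 = indicator A x" for x by (auto split: split_indicator)
    then show ?thesis unfolding L2_def using A by simp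
  qed
  have "\<exists>h. h \<in> core X \<and> (LINT x|m. (indicator A x - h x)\<^sup>2) < (1 / 2) ^ n" for n
    using denseX i unfolding L2_dense_def by (metis zero_less_power zero_less_divide_1_iff zero_less_numeral)
  then obtain h where h: "\<And>n. h n \<in> core X" "\<And>n. (LINT x|m. (indicator A x - h n x)\<^sup>2) < (1 / 2) ^ n" by metis
  have "AE x in m. (\<lambda>n. indicator A x - h n x) \<longlonglongrightarrow> 0"
    by (rule L2_fast_AE_tendsto_0[OF L2_diff[OF i core_L2[OF h(1)]] h(2)])
  then have lim: "AE x in m. (\<lambda>n. h n x) \<longlonglongrightarrow> indicator A x"
  proof eventually_elim
    case (elim x)
    from tendsto_diff[OF tendsto_const elim, of "indicator A x"] show ?case by simp
  qed
  obtain \<kappa> where \<kappa>: "smooth1 \<kappa>" "\<And>t. \<bar>t\<bar> \<le> 1 \<Longrightarrow> \<kappa> t = t" using smooth_cutoff_scaled[OF zero_less_one] by blast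
  obtain B where B: "\<And>t. \<bar>\<kappa> t\<bar> \<le> B" using smooth1_bound[OF \<kappa>(1)] by blast
  have \<kappa>0: "\<kappa> 0 = 0" using \<kappa>(2)[of 0] by simp
  show ?thesis
  proof (intro exI[of _ "\<lambda>n x. \<kappa> (h n x) - \<kappa> 0"] exI[of _ B] conjI allI)
    show "(\<lambda>x. \<kappa> (h n x) - \<kappa> 0) \<in> core X" for n
      using core_comp[of "\<lambda>y. \<kappa> (y 0)" 1 "\<lambda>_. h n"] h(1) \<kappa>(1) by (simp add: Cb_smooth_coord)
    show "\<bar>\<kappa> (h n x) - \<kappa> 0\<bar> \<le> B" for n x using B[of "h n x"] \<kappa>0 by simp
    show "AE x in m. (\<lambda>n. \<kappa> (h n x) - \<kappa> 0) \<longlonglongrightarrow> indicator A x"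
      using lim
    proof eventually_elim
      case (elim x)
      have "(\<lambda>n. \<kappa> (h n x)) \<longlonglongrightarrow> \<kappa> (indicator A x)"
        by (rule continuous_on_tendsto_compose[OF smooth1_continuous[OF \<kappa>(1)] elim]) auto
      then show ?case using \<kappa>0 \<kappa>(2)[of "indicator A x"] by (simp split: split_indicator_asm)
    qed
  qed
qed

lemma core_separating:
  assumes w: "integrable m w" and 0: "\<And>h. h \<in> core X \<Longrightarrow> (LINT x|m. h x * w x) = 0"
  shows "AE x in m. w x = 0"
proof -
  interpret sigma_finite_measure m by (rule sf_m)
  have [measurable]: "w \<in> borel_measurable m" using w by auto
  have zero: "(LINT x|m. indicator A x * w x) = 0" if A: "A \<in> sets m" "emeasure m A < \<infinity>" for A
  proof -
    obtain e B where e: "\<And>n. e n \<in> core X" "\<And>n x. \<bar>e n x\<bar> \<le> B" "AE x in m. (\<lambda>n. e n x) \<longlonglongrightarrow> indicator A x"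
      using core_approx_indicator[OF A] by blast
    note core_measurable[OF e(1), measurable]
    have "(\<lambda>n. LINT x|m. e n x * w x) \<longlonglongrightarrow> (LINT x|m. indicator A x * w x)"
    proof (rule integral_dominated_convergence)
      show "integrable m (\<lambda>x. B * \<bar>w x\<bar>)" using w by simp
      show "AE x in m. (\<lambda>n. e n x * w x) \<longlonglongrightarrow> indicator A x * w x"
        using e(3) by eventually_elim (intro tendsto_intros)
      show "AE x in m. norm (e n x * w x) \<le> B * \<bar>w x\<bar>" for n
        using e(2) by (intro AE_I2) (simp add: abs_mult mult_right_mono)
    qed (use A in measurable)
    from LIMSEQ_unique[OF this[unfolded 0[OF e(1)]] tendsto_const] show ?thesis .
  qed
  obtain Eh :: "nat \<Rightarrow> 'a set" where Eh: "(\<Union>h. Eh h) = pts X" "\<And>h. Eh h \<in> lring X" using exhaustion by metis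
  have Em: "Eh h \<in> sets m" "emeasure m (Eh h) < \<infinity>" for h using lring_sets[OF Eh(2)] lring_finite[OF Eh(2)] by auto
  have "AE x in m. indicator (Eh h) x * w x = 0" for h
  proof (rule density_zero)
    show "integrable m (\<lambda>x. indicator (Eh h) x * w x)" using integrable_mult_indicator[OF Em(1) w, of h] by simp
    fix A assume A: "A \<in> sets m"
    have "emeasure m (A \<inter> Eh h) \<le> emeasure m (Eh h)" using Em(1) by (intro emeasure_mono) auto
    then have "emeasure m (A \<inter> Eh h) < \<infinity>" using Em(2)[of h] by (rule le_less_trans)
    then show "set_lebesgue_integral m A (\<lambda>x. indicator (Eh h) x * w x) = 0"
      using zero[of "A \<inter> Eh h"] A Em(1)[of h] by (simp add: set_lebesgue_integral_def indicator_inter_arith mult.assoc)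
  qed
  then have "AE x in m. \<forall>h. indicator (Eh h) x * w x = 0" unfolding AE_all_countable by (intro allI)
  then show ?thesis using AE_space
  proof eventually_elim
    case (elim x)
    then obtain h where "x \<in> Eh h" using Eh(1) space_m by blast
    with elim(1)[rule_format, of h] show ?case by simp
  qed
qed

lemma pre_form_eq: "pre_form X = (\<lambda>f g. LINT x|m. sqf X f g x)"
  by (intro ext) (simp add: pre_form_def)

sublocale base: square_field_form m "core X" "sqf X"
proof
  have s: "(\<forall>f\<in>core X. \<forall>g\<in>core X. AE x in refm X. sqf X f g x = sqf X g f x)"
     "(\<forall>f\<in>core X. \<forall>g\<in>core X. \<forall>h\<in>core X.
        AE x in refm X. sqf X (\<lambda>x. f x + g x) h x = sqf X f h x + sqf X g h x)"
     "(\<forall>f\<in>core X. \<forall>g\<in>core X. \<forall>c.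
        AE x in refm X. sqf X (\<lambda>x. c * f x) g x = c * sqf X f g x)"
     "(\<forall>f\<in>core X. AE x in refm X. 0 \<le> sqf X f f x)"
    using sfo unfolding square_field_operator_def by simp_all
  fix f g h :: "'a \<Rightarrow> real" and c :: real and \<phi> :: "real \<Rightarrow> real"
  show "f \<in> core X \<Longrightarrow> g \<in> core X \<Longrightarrow> AE x in m. sqf X f g x = sqf X g f x"
    "f \<in> core X \<Longrightarrow> g \<in> core X \<Longrightarrow> h \<in> core X \<Longrightarrow> AE x in m. sqf X (\<lambda>x. f x + g x) h x = sqf X f h x + sqf X g h x"
    "f \<in> core X \<Longrightarrow> g \<in> core X \<Longrightarrow> AE x in m. sqf X (\<lambda>x. c * f x) g x = c * sqf X f g x"
    "f \<in> core X \<Longrightarrow> AE x in m. 0 \<le> sqf X f f x"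
    using s by blast+
  show "f \<in> core X \<Longrightarrow> smooth1 \<phi> \<Longrightarrow> (\<lambda>x. \<phi> (f x) - \<phi> 0) \<in> core X"
    using core_comp[of "\<lambda>y. \<phi> (y 0)" 1 "\<lambda>_. f"] by (simp add: Cb_smooth_coord)
  show "f \<in> core X \<Longrightarrow> \<exists>B. \<forall>x\<in>space m. \<bar>f x\<bar> \<le> B" using core_bounded by blast
  show "closable m (core X) (\<lambda>f g. LINT x|m. sqf X f g x)" using closX unfolding pre_form_eq .
qed (rule core_zero core_add core_mult core_scale core_L2 sqf_integrable sqf_chain1 sqf_Leibniz core_separating; assumption)+

lemma X_dom_eq: "X_dom X = base.D" and X_form_eq: "X_form X = base.E"
  unfolding X_dom_def X_form_def pre_form_eq by simp_all

text \<open>The square field of functions of the form \<open>\<phi> \<circ> f\<close>, up to additive constants.\<close>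

lemma X_gamma_core:
  assumes f: "f \<in> core X" and h: "AE x in m. h x = f x + c" "ess_bounded m h"
  shows "h \<in> X_gamma_dom X" "AE x in m. X_gamma X h x = sqf X f f x" "X_gamma X h \<in> borel_measurable m"
proof -
  note e = base.ext_value_C[OF f h(1)]
  show "h \<in> X_gamma_dom X" unfolding X_gamma_dom_def X_dom_eq X_form_eq by (rule base.ext_domI[OF h(2) e(2)])
  have x: "base.ext_value h (X_gamma X h)"
    unfolding X_gamma_def X_dom_eq X_form_eq by (rule base.ext_value_square_field[OF e(2)])
  show "AE x in m. X_gamma X h x = sqf X f f x" by (rule base.ext_value_unique[OF x e(1)])
  show "X_gamma X h \<in> borel_measurable m" using x unfolding base.ext_value_def by auto
qed

lemma X_gamma_ext_value: "f \<in> X_gamma_dom X \<Longrightarrow> base.ext_value f (X_gamma X f)"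
  unfolding X_gamma_dom_def X_gamma_def X_dom_eq X_form_eq
  using base.ext_dom_approx base.ext_value_square_field by blast

lemma X_gamma_diff:
  assumes f: "f \<in> X_gamma_dom X" and h: "h \<in> X_gamma_dom X"
  shows "(\<lambda>x. f x - h x) \<in> X_gamma_dom X"
    and "AE x in m. \<bar>sqrt (X_gamma X f x) - sqrt (X_gamma X h x)\<bar> \<le> sqrt (X_gamma X (\<lambda>x. f x - h x) x)"
    and "AE x in m. sqrt (X_gamma X (\<lambda>x. f x - h x) x) \<le> sqrt (X_gamma X f x) + sqrt (X_gamma X h x)"
proof -
  obtain j where j: "base.ext_value (\<lambda>x. f x - h x) j"
    "AE x in m. \<bar>sqrt (X_gamma X f x) - sqrt (X_gamma X h x)\<bar> \<le> sqrt (j x) \<and> sqrt (j x) \<le> sqrt (X_gamma X f x) + sqrt (X_gamma X h x)"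
    using base.ext_value_diff[OF X_gamma_ext_value[OF f] X_gamma_ext_value[OF h]] by blast
  obtain hs where hs: "base.ext_approx (\<lambda>x. f x - h x) hs" using j(1) unfolding base.ext_value_def by blast
  obtain B1 B2 where "AE x in m. \<bar>f x\<bar> \<le> B1" "AE x in m. \<bar>h x\<bar> \<le> B2"
    using f h unfolding X_gamma_dom_def ext_square_field_dom_def ess_bounded_def by blast
  then have "AE x in m. \<bar>f x - h x\<bar> \<le> B1 + B2" by eventually_elim linarith
  then have b: "ess_bounded m (\<lambda>x. f x - h x)" unfolding ess_bounded_def by blast
  show d: "(\<lambda>x. f x - h x) \<in> X_gamma_dom X"
    unfolding X_gamma_dom_def X_dom_eq X_form_eq by (rule base.ext_domI[OF b hs])
  note u = base.ext_value_unique[OF X_gamma_ext_value[OF d] j(1)]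
  show "AE x in m. \<bar>sqrt (X_gamma X f x) - sqrt (X_gamma X h x)\<bar> \<le> sqrt (X_gamma X (\<lambda>x. f x - h x) x)"
    using j(2) u by eventually_elim simp
  show "AE x in m. sqrt (X_gamma X (\<lambda>x. f x - h x) x) \<le> sqrt (X_gamma X f x) + sqrt (X_gamma X h x)"
    using j(2) u by eventually_elim simp
qed

lemma X_gamma_nonneg: "f \<in> X_gamma_dom X \<Longrightarrow> AE x in m. 0 \<le> X_gamma X f x"
  using base.ext_value_nonneg[OF X_gamma_ext_value] .

lemma X_gamma_measurable: "f \<in> X_gamma_dom X \<Longrightarrow> X_gamma X f \<in> borel_measurable m"
  using X_gamma_ext_value unfolding base.ext_value_def by auto

lemma X_gamma_dom_zero: "(\<lambda>_. c) \<in> X_gamma_dom X" and X_gamma_zero: "AE x in m. X_gamma X (\<lambda>_. c) x = 0"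
proof -
  have "ess_bounded m (\<lambda>_. c)" unfolding ess_bounded_def by auto
  note * = X_gamma_core[OF core_zero, of "\<lambda>_. c" c, OF _ this]
  show "(\<lambda>_. c) \<in> X_gamma_dom X" using * by simp
  have "AE x in m. sqf X (\<lambda>x. 0 * (0::real)) (\<lambda>_. 0) x = 0 * sqf X (\<lambda>_. 0) (\<lambda>_. 0) x"
    by (rule base.G_scale[OF core_zero core_zero])
  with *(2) show "AE x in m. X_gamma X (\<lambda>_. c) x = 0" by (auto elim!: AE_mp)
qed

end

section \<open>Configurations\<close>

lemma ennreal_of_enat_le_iff_count:
  "ennreal_of_enat n \<le> emeasure (count_space UNIV) (idx N) \<longleftrightarrow> n \<le> N"
proof -
  have "emeasure (count_space UNIV) (idx N) = ennreal_of_enat N"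
  proof (cases N)
    case (enat k)
    then have "idx N = {..<k}" unfolding idx_def by auto
    then show ?thesis using enat by (simp add: emeasure_count_space_finite ennreal_of_nat_eq_real_of_nat)
  next
    case infinity
    then have "idx N = UNIV" unfolding idx_def by auto
    then show ?thesis using infinity by simp
  qed
  then show ?thesis by simp
qed

lemma idx_mono: "n \<le> N \<Longrightarrow> idx n \<subseteq> idx N"
  unfolding idx_def by (auto dest: order_less_le_trans)

lemma idx_infinity [simp]: "idx \<infinity> = UNIV" unfolding idx_def by auto

context diffusion_space
begin

lemma topspace_seq: "topspace (seq_topology X N) = idx N \<rightarrow>\<^sub>E pts X"
  unfolding seq_topology_def by (simp add: topspace_product_topology)

lemma unlabel_sets: "sets (unlabel X s) = sets m" and unlabel_space: "space (unlabel X s) = pts X"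
  unfolding unlabel_def by (simp_all add: space_m)

lemma seq_measurable: "x \<in> idx N \<rightarrow>\<^sub>E pts X \<Longrightarrow> x \<in> measurable (count_space (idx N)) m"
  by (simp add: space_m PiE_iff Pi_iff)

lemma emeasure_unlabel:
  assumes "x \<in> idx N \<rightarrow>\<^sub>E pts X" "A \<in> sets m"
  shows "emeasure (unlabel X (N, x)) A = emeasure (count_space UNIV) {i \<in> idx N. x i \<in> A}"
proof -
  have "emeasure (unlabel X (N, x)) A = emeasure (count_space (idx N)) {i \<in> idx N. x i \<in> A}"
    unfolding unlabel_def using assms seq_measurable
    by (simp add: emeasure_distr vimage_def Int_def conj_commute)
  then show ?thesis by (simp add: emeasure_count_space)
qed

lemma Configs_cases:
  assumes "\<gamma> \<in> Configs X" shows "\<exists>N x. (N, x) \<in> lcf X \<and> \<gamma> = unlabel X (N, x)"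
proof -
  obtain N x where *: "\<gamma> = unlabel X (N, x)" "x \<in> idx N \<rightarrow>\<^sub>E pts X" "\<And>E. E \<in> lring X \<Longrightarrow> emeasure (unlabel X (N, x)) E < \<infinity>"
    using assms unfolding Configs_def by blast
  have "finite {i \<in> idx N. x i \<in> E}" if "E \<in> lring X" for E
    using *(3)[OF that] unfolding emeasure_unlabel[OF *(2) lring_sets[OF that]]
    by (auto simp: emeasure_count_space split: if_splits)
  then show ?thesis using * unfolding lcf_def by blast
qed

lemma unlabel_Configs: assumes "(N, x) \<in> lcf X" shows "unlabel X (N, x) \<in> Configs X"
proof -
  have x: "x \<in> idx N \<rightarrow>\<^sub>E pts X" "\<And>E. E \<in> lring X \<Longrightarrow> finite {i \<in> idx N. x i \<in> E}" using assms unfolding lcf_def by auto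
  have "emeasure (unlabel X (N, x)) E < \<infinity>" if "E \<in> lring X" for E
    unfolding emeasure_unlabel[OF x(1) lring_sets[OF that]] using x(2)[OF that] by (simp add: emeasure_count_space_finite less_top[symmetric])
  then show ?thesis unfolding Configs_def using x(1) by blast
qed

lemma Configs_sets: "\<gamma> \<in> Configs X \<Longrightarrow> sets \<gamma> = sets m" and Configs_space: "\<gamma> \<in> Configs X \<Longrightarrow> space \<gamma> = pts X"
  and Configs_finite: "\<gamma> \<in> Configs X \<Longrightarrow> E \<in> lring X \<Longrightarrow> emeasure \<gamma> E < \<infinity>"
  unfolding Configs_def using unlabel_sets unlabel_space by auto

lemma lcf_PiE: "(N, x) \<in> lcf X \<Longrightarrow> x \<in> idx N \<rightarrow>\<^sub>E pts X"
  and lcf_finite: "(N, x) \<in> lcf X \<Longrightarrow> E \<in> lring X \<Longrightarrow> finite {i \<in> idx N. x i \<in> E}"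
  unfolding lcf_def by auto

lemma lcf_infD: "x \<in> lcf_inf X \<Longrightarrow> x i \<in> pts X" "x \<in> lcf_inf X \<Longrightarrow> E \<in> lring X \<Longrightarrow> finite {i. x i \<in> E}"
  unfolding lcf_inf_def lcf_def by auto

lemma lcf_inf_Configs: "x \<in> lcf_inf X \<Longrightarrow> unlabel X (\<infinity>, x) \<in> Configs X"
  unfolding lcf_inf_def using unlabel_Configs by auto

lemma Configs_of_nat:
  assumes "\<gamma> \<in> Configs X" "E \<in> lring X" shows "\<exists>n. emeasure \<gamma> E = of_nat n"
proof -
  obtain N x where x: "(N, x) \<in> lcf X" "\<gamma> = unlabel X (N, x)" using Configs_cases[OF assms(1)] by blast
  show ?thesis
    unfolding x(2) emeasure_unlabel[OF lcf_PiE[OF x(1)] lring_sets[OF assms(2)]]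
    using lcf_finite[OF x(1) assms(2)] by (auto simp: emeasure_count_space_finite)
qed

text \<open>Changing one entry of a locally finite sequence preserves local finiteness.\<close>

lemma lcf_inf_upd:
  assumes x: "x \<in> lcf_inf X" and z: "z \<in> pts X" shows "x(p := z) \<in> lcf_inf X"
proof -
  have "finite {i. (x(p := z)) i \<in> E}" if "E \<in> lring X" for E
    using lcf_infD(2)[OF x that] by (rule rev_finite_subset[OF finite.insertI[of _ p]]) auto
  then show ?thesis using lcf_infD(1)[OF x] z unfolding lcf_inf_def lcf_def by auto
qed

lemma star_unlabel:
  assumes x: "x \<in> lcf_inf X" and f: "f \<in> borel_measurable m" and supp: "finite {i. f (x i) \<noteq> 0}"
  shows "star f (unlabel X (\<infinity>, x)) = (\<Sum>i | f (x i) \<noteq> 0. f (x i))"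
proof -
  have xP: "x \<in> idx \<infinity> \<rightarrow>\<^sub>E pts X" using x lcf_PiE unfolding lcf_inf_def by blast
  have "star f (unlabel X (\<infinity>, x)) = (LINT i|count_space UNIV. f (x i))"
    unfolding star_def unlabel_def using integral_distr[OF seq_measurable[OF xP] f] by simp
  also have "\<dots> = (\<Sum>i | f (x i) \<noteq> 0. f (x i))"
    using supp by (subst lebesgue_integral_count_space_finite_support) simp_all
  finally show ?thesis .
qed

lemma Sb_unlabel_finite:
  assumes x: "x \<in> lcf_inf X" and E: "E \<in> lring X" "\<And>z. z \<notin> E \<Longrightarrow> f z = (0::real)"
  shows "finite {i. f (x i) \<noteq> 0}"
  by (rule finite_subset[OF _ lcf_infD(2)[OF x E(1)]]) (use E(2) in auto)

end

locale config_space = diffusion_space X for X :: "'a diffusion_space" +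
  fixes \<mu> :: "'a measure measure"
  assumes prob: "prob_space \<mu>" and sets_\<mu>: "sets \<mu> = sets (config_algebra X)"
    and inf: "AE \<gamma> in \<mu>. emeasure \<gamma> (pts X) = \<infinity>"
    and mac: "marginally_ac X \<mu>"
    and intensity: "\<And>E. E \<in> lring X \<Longrightarrow> (\<integral>\<^sup>+\<gamma>. emeasure \<gamma> E \<partial>\<mu>) < \<infinity>"
begin

sublocale prob_space \<mu> by (rule prob)

lemma sets_\<mu>': "sets \<mu> = sigma_sets (Configs X) {{\<gamma> \<in> Configs X. emeasure \<gamma> E \<in> B} | E B. E \<in> lring X \<and> B \<in> sets borel}"
  unfolding sets_\<mu> config_algebra_def by (rule sets_measure_of) auto

lemma space_\<mu>: "space \<mu> = Configs X"
  using sets_eq_imp_space_eq[OF sets_\<mu>] unfolding config_algebra_def by (subst (asm) space_measure_of) auto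

lemma emeasure_lring_measurable: "E \<in> lring X \<Longrightarrow> (\<lambda>\<gamma>. emeasure \<gamma> E) \<in> borel_measurable \<mu>"
proof (rule measurableI)
  fix B :: "ennreal set" assume "B \<in> sets borel" "E \<in> lring X"
  moreover have "(\<lambda>\<gamma>. emeasure \<gamma> E) -` B \<inter> space \<mu> = {\<gamma> \<in> Configs X. emeasure \<gamma> E \<in> B}" unfolding space_\<mu> by auto
  ultimately show "(\<lambda>\<gamma>. emeasure \<gamma> E) -` B \<inter> space \<mu> \<in> sets \<mu>" unfolding sets_\<mu>' by (auto intro!: sigma_sets.Basic)
qed simp

lemma emeasure_config_measurable: assumes A: "A \<in> sets m" shows "(\<lambda>\<gamma>. emeasure \<gamma> A) \<in> borel_measurable \<mu>"
proof -
  obtain Eh :: "nat \<Rightarrow> 'a set" where Eh: "incseq Eh" "(\<Union>h. Eh h) = pts X" "\<And>h. Eh h \<in> lring X"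
    using exhaustion by metis
  have "(\<lambda>\<gamma>. SUP h. emeasure \<gamma> (A \<inter> Eh h)) \<in> borel_measurable \<mu>"
    by (intro borel_measurable_SUP emeasure_lring_measurable lring_Int A Eh) simp
  moreover have "(SUP h. emeasure \<gamma> (A \<inter> Eh h)) = emeasure \<gamma> A" if "\<gamma> \<in> space \<mu>" for \<gamma>
  proof -
    have "range (\<lambda>h. A \<inter> Eh h) \<subseteq> sets \<gamma>"
      using that lring_sets[OF Eh(3)] A Configs_sets unfolding space_\<mu> by auto
    moreover have "incseq (\<lambda>h. A \<inter> Eh h)" using Eh(1) unfolding incseq_def by blast
    moreover have "(\<Union>h. A \<inter> Eh h) = A" using Eh(2) sets.sets_into_space[OF A] space_m by auto
    ultimately show ?thesis using SUP_emeasure_incseq[of "\<lambda>h. A \<inter> Eh h" \<gamma>] by simp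
  qed
  ultimately show ?thesis by (subst measurable_cong[of _ _ "\<lambda>\<gamma>. SUP h. emeasure \<gamma> (A \<inter> Eh h)"]) auto
qed

lemma nn_integral_config_measurable:
  assumes "g \<in> borel_measurable m" shows "(\<lambda>\<gamma>. \<integral>\<^sup>+z. g z \<partial>\<gamma>) \<in> borel_measurable \<mu>"
  using assms
proof (induction g rule: borel_measurable_induct)
  case (cong f g)
  have "(\<integral>\<^sup>+z. f z \<partial>\<gamma>) = (\<integral>\<^sup>+z. g z \<partial>\<gamma>)" if "\<gamma> \<in> space \<mu>" for \<gamma>
    using that cong Configs_space space_m unfolding space_\<mu> by (intro nn_integral_cong) auto
  then show ?case using cong by (subst measurable_cong[of _ _ "\<lambda>\<gamma>. \<integral>\<^sup>+z. g z \<partial>\<gamma>"]) auto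
next
  case (set A)
  have "(\<integral>\<^sup>+z. indicator A z \<partial>\<gamma>) = emeasure \<gamma> A" if "\<gamma> \<in> space \<mu>" for \<gamma>
    using that set Configs_sets unfolding space_\<mu> by (intro nn_integral_indicator) auto
  then show ?case using emeasure_config_measurable[OF set] by (subst measurable_cong) auto
next
  case (mult u c)
  have "(\<integral>\<^sup>+z. c * u z \<partial>\<gamma>) = c * (\<integral>\<^sup>+z. u z \<partial>\<gamma>)" if "\<gamma> \<in> space \<mu>" for \<gamma>
    using that mult Configs_sets unfolding space_\<mu> by (intro nn_integral_cmult) (simp cong: measurable_cong_sets)
  then show ?case using mult by (subst measurable_cong[of _ _ "\<lambda>\<gamma>. c * (\<integral>\<^sup>+z. u z \<partial>\<gamma>)"]) auto
next
  case (add u v)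
  have "(\<integral>\<^sup>+z. v z + u z \<partial>\<gamma>) = (\<integral>\<^sup>+z. v z \<partial>\<gamma>) + (\<integral>\<^sup>+z. u z \<partial>\<gamma>)" if "\<gamma> \<in> space \<mu>" for \<gamma>
    using that add Configs_sets unfolding space_\<mu> by (intro nn_integral_add) (simp_all cong: measurable_cong_sets)
  then show ?case using add by (subst measurable_cong[of _ _ "\<lambda>\<gamma>. (\<integral>\<^sup>+z. v z \<partial>\<gamma>) + (\<integral>\<^sup>+z. u z \<partial>\<gamma>)"]) auto
next
  case (seq U)
  have S: "\<Squnion> (range U) = (\<lambda>z. SUP i. U i z)" by (auto simp: fun_eq_iff SUP_apply image_comp)
  have eq: "(\<integral>\<^sup>+z. (\<Squnion> (range U)) z \<partial>\<gamma>) = (SUP i. \<integral>\<^sup>+z. U i z \<partial>\<gamma>)" if "\<gamma> \<in> space \<mu>" for \<gamma>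
    using that seq Configs_sets unfolding space_\<mu> S
    by (intro nn_integral_monotone_convergence_SUP) (simp_all cong: measurable_cong_sets)
  have "(\<lambda>\<gamma>. SUP i. \<integral>\<^sup>+z. U i z \<partial>\<gamma>) \<in> borel_measurable \<mu>"
    by (intro borel_measurable_SUP seq) simp
  then show ?case by (subst measurable_cong[OF eq])
qed

lemma star_measurable: assumes g: "g \<in> borel_measurable m" shows "star g \<in> borel_measurable \<mu>"
proof -
  define P where "P \<gamma> = (\<integral>\<^sup>+z. ennreal (norm (g z)) \<partial>\<gamma>)" for \<gamma>
  have [measurable]: "(\<lambda>\<gamma>. P \<gamma>) \<in> borel_measurable \<mu>" unfolding P_def by (rule nn_integral_config_measurable) (use g in measurable)
  have [measurable]: "(\<lambda>\<gamma>. \<integral>\<^sup>+z. ennreal (g z) \<partial>\<gamma>) \<in> borel_measurable \<mu>" "(\<lambda>\<gamma>. \<integral>\<^sup>+z. ennreal (- g z) \<partial>\<gamma>) \<in> borel_measurable \<mu>"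
    by (rule nn_integral_config_measurable; use g in measurable)+
  have eq: "star g \<gamma> = (if P \<gamma> < \<infinity> then enn2real (\<integral>\<^sup>+z. ennreal (g z) \<partial>\<gamma>) - enn2real (\<integral>\<^sup>+z. ennreal (- g z) \<partial>\<gamma>) else 0)"
    if "\<gamma> \<in> space \<mu>" for \<gamma>
  proof -
    have gm: "g \<in> borel_measurable \<gamma>" using g that Configs_sets unfolding space_\<mu> by (simp cong: measurable_cong_sets)
    then have "integrable \<gamma> g \<longleftrightarrow> P \<gamma> < \<infinity>" unfolding P_def integrable_iff_bounded by simp
    then show ?thesis unfolding star_def using real_lebesgue_integral_def[of \<gamma> g] not_integrable_integral_eq[of \<gamma> g] by auto
  qed
  show ?thesis by (subst measurable_cong[OF eq]) (simp, measurable)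
qed

subsection \<open>Labelings\<close>

lemma labelingD:
  assumes l: "labeling_map X \<mu> l" and \<gamma>: "\<gamma> \<in> Configs X"
  shows "l \<gamma> \<in> lcf X" "unlabel X (l \<gamma>) = \<gamma>"
proof -
  have "l \<in> space (completion \<mu>) \<rightarrow> space (borel_of (lcf_topology X))"
    using l unfolding labeling_map_def measurable_def by blast
  then have "l \<gamma> \<in> topspace (lcf_topology X)" using \<gamma> by (auto simp: space_\<mu> space_borel_of)
  then show "l \<gamma> \<in> lcf X" unfolding lcf_topology_def by simp
  show "unlabel X (l \<gamma>) = \<gamma>" using l \<gamma> unfolding labeling_map_def by blast
qed

lemma labeling_length:
  assumes l: "labeling_map X \<mu> l" and \<gamma>: "\<gamma> \<in> Configs X"
  shows "ennreal_of_enat n \<le> emeasure \<gamma> (pts X) \<longleftrightarrow> n \<le> fst (l \<gamma>)"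
proof -
  obtain N x where Nx: "l \<gamma> = (N, x)" by (cases "l \<gamma>") auto
  have x: "x \<in> idx N \<rightarrow>\<^sub>E pts X" using labelingD(1)[OF l \<gamma>] lcf_PiE unfolding Nx by blast
  have "emeasure \<gamma> (pts X) = emeasure (unlabel X (N, x)) (pts X)" using labelingD(2)[OF l \<gamma>] Nx by simp
  also have "\<dots> = emeasure (count_space UNIV) {i \<in> idx N. x i \<in> pts X}"
    by (rule emeasure_unlabel[OF x]) (use sets.top[of m] space_m in simp)
  also have "{i \<in> idx N. x i \<in> pts X} = idx N" using x by auto
  finally show ?thesis using ennreal_of_enat_le_iff_count Nx by simp
qed

text \<open>
  The configurations with at least \<open>n\<close> points, on which the truncated labels are defined.
\<close>

definition at_least :: "enat \<Rightarrow> 'a measure set" where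
  "at_least n = {\<gamma>. ennreal_of_enat n \<le> emeasure \<gamma> (pts X)}"

lemma pts_sets: "pts X \<in> sets m" using sets.top[of m] space_m by simp

lemma at_least_sets: "at_least n \<inter> space \<mu> \<in> sets \<mu>"
proof -
  note emeasure_config_measurable[OF pts_sets, measurable]
  have "{\<gamma> \<in> space \<mu>. ennreal_of_enat n \<le> emeasure \<gamma> (pts X)} \<in> sets \<mu>" by measurable
  then show ?thesis by (simp add: at_least_def Int_def conj_commute)
qed

abbreviation \<mu>r :: "enat \<Rightarrow> 'a measure measure" where "\<mu>r n \<equiv> restrict_space (completion \<mu>) (at_least n)"

lemma space_\<mu>r: "space (\<mu>r n) = at_least n \<inter> Configs X"
  by (simp add: space_restrict_space space_\<mu>)

lemma label_measurable:
  assumes l: "labeling_map X \<mu> l"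
  shows "(\<lambda>\<gamma>. restrict (snd (l \<gamma>)) (idx n)) \<in> measurable (\<mu>r n) (borel_of (seq_topology X n))"
proof (rule measurable_borel_ofI)
  show "(\<lambda>\<gamma>. restrict (snd (l \<gamma>)) (idx n)) \<in> space (\<mu>r n) \<rightarrow> topspace (seq_topology X n)"
  proof
    fix \<gamma> assume "\<gamma> \<in> space (\<mu>r n)"
    then have \<gamma>: "\<gamma> \<in> Configs X" "n \<le> fst (l \<gamma>)" using labeling_length[OF l] unfolding space_\<mu>r unfolding at_least_def by auto
    have "snd (l \<gamma>) \<in> idx (fst (l \<gamma>)) \<rightarrow>\<^sub>E pts X" using labelingD(1)[OF l \<gamma>(1)] lcf_PiE[of "fst (l \<gamma>)" "snd (l \<gamma>)"] by simp
    then show "restrict (snd (l \<gamma>)) (idx n) \<in> topspace (seq_topology X n)"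
      unfolding topspace_seq using idx_mono[OF \<gamma>(2)] by (auto simp: PiE_iff)
  qed
  fix U assume U: "openin (seq_topology X n) U"
  define V where "V = {(N, x). n \<le> N \<and> x \<in> idx N \<rightarrow>\<^sub>E pts X \<and> restrict x (idx n) \<in> U}"
  have "openin (sum_topology (seq_topology X) UNIV) V"
    unfolding openin_sum_topology
  proof (intro conjI ballI)
    show "V \<subseteq> Sigma UNIV (topspace \<circ> seq_topology X)" unfolding V_def by (auto simp: topspace_seq)
    fix N :: enat
    show "openin (seq_topology X N) {x. (N, x) \<in> V}"
    proof (cases "n \<le> N")
      case True
      have "continuous_map (seq_topology X N) (seq_topology X n) (\<lambda>x. restrict x (idx n))"
        unfolding seq_topology_def by (rule continuous_on_restrict[OF idx_mono[OF True]])
      from openin_continuous_map_preimage[OF this U]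
      show ?thesis using True unfolding V_def topspace_seq by simp
    next
      case False
      then show ?thesis unfolding V_def by simp
    qed
  qed
  then have "openin (lcf_topology X) (V \<inter> lcf X)"
    unfolding lcf_topology_def openin_subtopology by blast
  then have "l -` (V \<inter> lcf X) \<inter> space (completion \<mu>) \<in> sets (completion \<mu>)"
    using l openin_borel_of unfolding labeling_map_def by (intro measurable_sets) auto
  then have "at_least n \<inter> (l -` (V \<inter> lcf X) \<inter> space (completion \<mu>)) \<in> sets (\<mu>r n)"
    unfolding sets_restrict_space by blast
  also have "at_least n \<inter> (l -` (V \<inter> lcf X) \<inter> space (completion \<mu>)) = (\<lambda>\<gamma>. restrict (snd (l \<gamma>)) (idx n)) -` U \<inter> space (\<mu>r n)"
  proof -
    have "(l \<gamma> \<in> V \<inter> lcf X) = (restrict (snd (l \<gamma>)) (idx n) \<in> U)" if "\<gamma> \<in> Configs X" "\<gamma> \<in> at_least n" for \<gamma>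
    proof -
      have "n \<le> fst (l \<gamma>)" using labeling_length[OF l that(1)] that(2) by (auto simp: at_least_def)
      moreover have "l \<gamma> \<in> lcf X" by (rule labelingD(1)[OF l that(1)])
      ultimately show ?thesis using lcf_PiE[of "fst (l \<gamma>)" "snd (l \<gamma>)"] unfolding V_def by (cases "l \<gamma>") auto
    qed
    then have "\<gamma> \<in> at_least n \<inter> (l -` (V \<inter> lcf X) \<inter> space (completion \<mu>)) \<longleftrightarrow>
        \<gamma> \<in> (\<lambda>\<gamma>. restrict (snd (l \<gamma>)) (idx n)) -` U \<inter> space (\<mu>r n)" for \<gamma>
      unfolding space_\<mu>r by (cases "\<gamma> \<in> Configs X \<and> \<gamma> \<in> at_least n") (simp_all add: space_\<mu>, blast)
    then show ?thesis by (rule set_eqI)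
  qed
  finally show "(\<lambda>\<gamma>. restrict (snd (l \<gamma>)) (idx n)) -` U \<inter> space (\<mu>r n) \<in> sets (\<mu>r n)" .
qed

lemma label_law_eq: "label_law X \<mu> l n = distr (\<mu>r n) (borel_of (seq_topology X n)) (\<lambda>\<gamma>. restrict (snd (l \<gamma>)) (idx n))"
  unfolding label_law_def at_least_def ..

text \<open>Null sets of the reference measure are covered by Borel null sets.\<close>

lemma null_set_Borel_cover:
  assumes N: "N \<in> null_sets m"
  shows "\<exists>B. B \<in> sets (borel_of (topo X)) \<and> B \<in> null_sets m \<and> N \<subseteq> B"
proof -
  let ?B = "restr_to_subalg m (borel_of (topo X))"
  have sub: "subalgebra m (borel_of (topo X))"
    unfolding subalgebra_def using borel_sub space_m by (simp add: space_borel_of)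
  note sB = sets_restr_to_subalg[OF sub]
  have "N \<in> sets (completion ?B)" using N sub_completion by auto
  then obtain S N' N'' where *: "N = S \<union> N'" "N' \<subseteq> N''" "N'' \<in> null_sets ?B" "S \<in> sets ?B"
    by (rule sets_completionE) blast
  have N'': "N'' \<in> sets (borel_of (topo X))" "N'' \<in> null_sets m"
    using *(3) null_sets_restr_to_subalg[OF sub] sB by (auto simp: null_sets_def)
  have S: "S \<in> sets (borel_of (topo X))" using *(4) sB by simp
  have "S \<in> null_sets m" using S borel_sub *(1) N by (intro null_sets_subset[OF N]) auto
  then show ?thesis using * S N'' by (intro exI[of _ "S \<union> N''"]) auto
qed

text \<open>Marginal absolute continuity: a null set carries no point of almost every configuration.\<close>

lemma AE_no_point_in_null_set:
  assumes l: "labeling_map X \<mu> l" and N: "N \<in> null_sets m"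
  shows "AE \<gamma> in \<mu>. emeasure \<gamma> N = 0"
proof -
  obtain B where B: "B \<in> sets (borel_of (topo X))" "B \<in> null_sets m" "N \<subseteq> B" using null_set_Borel_cover[OF N] by blast
  have "AE \<gamma> in completion \<mu>. emeasure \<gamma> (pts X) = \<infinity> \<longrightarrow> snd (l \<gamma>) p \<notin> B" for p
  proof -
    define n where "n = enat (Suc p)"
    have p: "p \<in> idx n" unfolding n_def idx_def by simp
    have fin: "finite (idx n)" unfolding n_def idx_def by simp
    define A where "A = {y \<in> topspace (seq_topology X n). y p \<in> B}"
    have "(\<lambda>y. y p) \<in> measurable (borel_of (seq_topology X n)) (borel_of (topo X))"
      using continuous_map_product_coordinates[OF p, of "\<lambda>_. topo X"]
      by (intro continuous_map_measurable[of "seq_topology X n"]) (auto simp: seq_topology_def space_borel_of)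
    from measurable_sets[OF this B(1)]
    have A: "A \<in> sets (borel_of (seq_topology X n))" unfolding A_def space_borel_of by (simp add: vimage_def Int_def conj_commute)
    have A_eq: "A = Pi\<^sub>E (idx n) (\<lambda>i. if i = p then B else space m)"
    proof (rule set_eqI)
      fix y
      have "B \<subseteq> pts X" using sets.sets_into_space[OF B(1)] by (simp add: space_borel_of)
      then show "y \<in> A \<longleftrightarrow> y \<in> Pi\<^sub>E (idx n) (\<lambda>i. if i = p then B else space m)"
        using p unfolding A_def topspace_seq space_m mem_Collect_eq PiE_iff by (metis (full_types) subsetD)
    qed
    interpret product_sigma_finite "\<lambda>_::nat. m" using sf_m by (simp add: product_sigma_finite_def)
    have "A \<in> sets (PiM (idx n) (\<lambda>_. m))" unfolding A_eq using B(2) fin by (intro sets_PiM_I_finite) auto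
    moreover have "emeasure (PiM (idx n) (\<lambda>_. m)) A = 0"
    proof -
      have "emeasure (PiM (idx n) (\<lambda>_. m)) A = (\<Prod>i\<in>idx n. emeasure m (if i = p then B else space m))"
        unfolding A_eq using B(2) fin by (intro emeasure_PiM) auto
      also have "\<dots> = 0" using fin p B(2) by (intro prod_zero) auto
      finally show ?thesis .
    qed
    ultimately have "A \<in> null_sets (PiM (idx n) (\<lambda>_. m))" by (simp add: null_sets_def)
    then have "A \<in> null_sets (label_law X \<mu> l n)" using mac l A unfolding marginally_ac_def n_def by blast
    then have "AE y in label_law X \<mu> l n. y \<notin> A" by (rule AE_not_in)
    then have "AE \<gamma> in \<mu>r n. restrict (snd (l \<gamma>)) (idx n) \<notin> A"
      unfolding label_law_eq by (rule AE_distrD[OF label_measurable[OF l]])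
    then have "AE \<gamma> in completion \<mu>. \<gamma> \<in> at_least n \<longrightarrow> restrict (snd (l \<gamma>)) (idx n) \<notin> A"
      using at_least_sets by (subst (asm) AE_restrict_space_iff) auto
    then show ?thesis using AE_space
    proof eventually_elim
      case (elim \<gamma>)
      show ?case
      proof
        assume "emeasure \<gamma> (pts X) = \<infinity>"
        then have a: "\<gamma> \<in> at_least n" and \<gamma>: "\<gamma> \<in> space (\<mu>r n)" using elim(2) unfolding space_\<mu>r by (auto simp: space_\<mu>) (simp_all add: at_least_def)
        then have "restrict (snd (l \<gamma>)) (idx n) \<notin> A" using elim(1) by blast
        moreover have "restrict (snd (l \<gamma>)) (idx n) \<in> topspace (seq_topology X n)"
          using measurable_space[OF label_measurable[OF l] \<gamma>] by (simp add: space_borel_of)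
        ultimately show "snd (l \<gamma>) p \<notin> B" unfolding A_def using p by auto
      qed
    qed
  qed
  then have "AE \<gamma> in completion \<mu>. \<forall>p. emeasure \<gamma> (pts X) = \<infinity> \<longrightarrow> snd (l \<gamma>) p \<notin> B"
    unfolding AE_all_countable by blast
  then have "AE \<gamma> in completion \<mu>. emeasure \<gamma> N = 0"
    using AE_completion[OF inf] AE_space
  proof eventually_elim
    case (elim \<gamma>)
    then have \<gamma>: "\<gamma> \<in> Configs X" by (simp add: space_\<mu>)
    obtain M x where Mx: "l \<gamma> = (M, x)" by (cases "l \<gamma>") auto
    have x: "x \<in> idx M \<rightarrow>\<^sub>E pts X" using labelingD(1)[OF l \<gamma>] lcf_PiE unfolding Mx by blast
    have "emeasure \<gamma> N = emeasure (unlabel X (M, x)) N" using labelingD(2)[OF l \<gamma>] Mx by simp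
    also have "\<dots> = emeasure (count_space UNIV) {i \<in> idx M. x i \<in> N}"
      by (rule emeasure_unlabel[OF x]) (use N in auto)
    also have "{i \<in> idx M. x i \<in> N} = {}" using elim(1,2) B(3) Mx by auto
    finally show ?case by simp
  qed
  then show ?thesis by (simp add: AE_completion_iff)
qed

end

subsection \<open>The labeled law and the unlabeling map\<close>

locale labeled_config_space = config_space X \<mu> for X :: "'a diffusion_space" and \<mu> +
  fixes l :: "'a labeling"
  assumes lab: "labeling_map X \<mu> l"
begin

lemma restrict_UNIV_eq: "restrict g UNIV = g" by (auto simp: restrict_def)

text \<open>
  \<open>lpt\<close> is the labeling map on infinite configurations, \<open>Pl\<close> the labeled law on the Borel sets of the
  product, and \<open>Plc\<close> its completion.
\<close>

abbreviation lpt where "lpt \<equiv> (\<lambda>\<gamma>. snd (l \<gamma>))"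
abbreviation Pl where "Pl \<equiv> label_law X \<mu> l \<infinity>"
abbreviation Plc where "Plc \<equiv> completion Pl"

lemma f_measurable: "lpt \<in> measurable (\<mu>r \<infinity>) (borel_of (seq_topology X \<infinity>))"
  using label_measurable[OF lab, of \<infinity>] by (simp add: restrict_UNIV_eq)

lemma P_eq: "Pl = distr (\<mu>r \<infinity>) (borel_of (seq_topology X \<infinity>)) lpt"
  using label_law_eq[of l \<infinity>] by (simp add: restrict_UNIV_eq)

lemma sets_P: "sets Pl = sets (borel_of (seq_topology X \<infinity>))" and space_P: "space Pl = {x. \<forall>i. x i \<in> pts X}"
  unfolding P_eq by (auto simp: space_borel_of topspace_seq PiE_iff extensional_def)

lemma completion_sets: "at_least n \<inter> space (completion \<mu>) \<in> sets (completion \<mu>)"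
  using at_least_sets[of n] by auto

lemma null_sets_\<mu>r: "B \<in> null_sets (\<mu>r n) \<longleftrightarrow> B \<subseteq> at_least n \<and> B \<in> null_sets (completion \<mu>)"
  unfolding null_sets_def
  using emeasure_restrict_space[OF completion_sets] sets_restrict_space_iff[OF completion_sets] by auto

lemma complete_\<mu>r: "complete_measure (\<mu>r n)"
proof
  fix A B assume AB: "A \<subseteq> B" "B \<in> null_sets (\<mu>r n)"
  then have "B \<in> null_sets (completion \<mu>)" "B \<subseteq> at_least n" by (auto simp: null_sets_\<mu>r)
  then show "A \<in> sets (\<mu>r n)"
    using AB(1) null_sets_completion_subset[of A B \<mu>] by (subst sets_restrict_space_iff[OF completion_sets]) auto
qed

lemma Pc_distr: "Plc = distr (\<mu>r \<infinity>) Plc lpt" and f_measurable_Pc: "lpt \<in> measurable (\<mu>r \<infinity>) Plc"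
proof -
  interpret c: complete_measure "\<mu>r \<infinity>" by (rule complete_\<mu>r)
  have lpt: "lpt \<in> measurable (\<mu>r \<infinity>) Pl" using f_measurable by (simp cong: measurable_cong_sets add: sets_P)
  have eq: "distr (\<mu>r \<infinity>) Pl lpt = Pl"
    unfolding P_eq by (intro distr_cong) auto
  show "Plc = distr (\<mu>r \<infinity>) Plc lpt"
    using c.completion_distr_eq[OF lpt] unfolding eq by simp
  show "lpt \<in> measurable (\<mu>r \<infinity>) Plc"
    by (rule c.measurable_completion2[OF lpt]) (simp add: eq)
qed

lemma space_\<mu>r_inf: "\<gamma> \<in> space (\<mu>r \<infinity>) \<longleftrightarrow> \<gamma> \<in> Configs X \<and> emeasure \<gamma> (pts X) = \<infinity>"
  unfolding space_\<mu>r unfolding at_least_def by (auto simp: top_unique)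

lemma f_lcf_inf:
  assumes "\<gamma> \<in> space (\<mu>r \<infinity>)" shows "lpt \<gamma> \<in> lcf_inf X" "unlabel X (\<infinity>, lpt \<gamma>) = \<gamma>"
proof -
  have \<gamma>: "\<gamma> \<in> Configs X" using assms by (simp add: space_\<mu>r_inf)
  have "fst (l \<gamma>) = \<infinity>" using labeling_length[OF lab \<gamma>, of \<infinity>] assms unfolding space_\<mu>r unfolding at_least_def by auto
  then have "l \<gamma> = (\<infinity>, lpt \<gamma>)" by (cases "l \<gamma>") auto
  then show "lpt \<gamma> \<in> lcf_inf X" "unlabel X (\<infinity>, lpt \<gamma>) = \<gamma>"
    using labelingD[OF lab \<gamma>] unfolding lcf_inf_def by auto
qed

lemma AE_\<mu>r: "(AE \<gamma> in \<mu>r \<infinity>. Q \<gamma>) \<longleftrightarrow> (AE \<gamma> in \<mu>. Q \<gamma>)"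
proof -
  have "(AE \<gamma> in \<mu>r \<infinity>. Q \<gamma>) \<longleftrightarrow> (AE \<gamma> in completion \<mu>. \<gamma> \<in> at_least \<infinity> \<longrightarrow> Q \<gamma>)"
    by (rule AE_restrict_space_iff[OF completion_sets])
  also have "\<dots> \<longleftrightarrow> (AE \<gamma> in completion \<mu>. Q \<gamma>)"
  proof (rule eventually_subst)
    show "AE \<gamma> in completion \<mu>. (\<gamma> \<in> at_least \<infinity> \<longrightarrow> Q \<gamma>) = Q \<gamma>"
      using AE_completion[OF inf] by eventually_elim (simp add: at_least_def)
  qed
  finally show ?thesis by (simp add: AE_completion_iff)
qed

lemma AE_no_point: "N \<in> null_sets m \<Longrightarrow> AE \<gamma> in \<mu>. emeasure \<gamma> N = 0"
  by (rule AE_no_point_in_null_set[OF lab])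

lemma AE_f_notin: assumes N: "N \<in> null_sets m" shows "AE \<gamma> in \<mu>r \<infinity>. lpt \<gamma> p \<notin> N"
proof -
  have "AE \<gamma> in \<mu>r \<infinity>. emeasure \<gamma> N = 0" unfolding AE_\<mu>r by (rule AE_no_point[OF N])
  then show ?thesis using AE_space
  proof eventually_elim
    case (elim \<gamma>)
    note fg = f_lcf_inf[OF elim(2)]
    have xP: "lpt \<gamma> \<in> idx \<infinity> \<rightarrow>\<^sub>E pts X" using fg(1) lcf_PiE unfolding lcf_inf_def by blast
    have "emeasure \<gamma> N = emeasure (count_space UNIV) {i \<in> idx \<infinity>. lpt \<gamma> i \<in> N}"
      using emeasure_unlabel[OF xP null_setsD2[OF N]] fg(2) by simp
    with elim(1) have "{i. lpt \<gamma> i \<in> N} = {}" by (auto simp: emeasure_count_space split: if_splits)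
    then show ?case by auto
  qed
qed

lemma coordinate_sets:
  assumes A: "A \<in> sets m" shows "{x \<in> space Plc. x p \<in> A} \<in> sets Plc"
proof -
  let ?B = "restr_to_subalg m (borel_of (topo X))"
  have sub: "subalgebra m (borel_of (topo X))"
    unfolding subalgebra_def using borel_sub space_m by (simp add: space_borel_of)
  have coord: "{x \<in> space Pl. x p \<in> S} \<in> sets Pl" if S: "S \<in> sets (borel_of (topo X))" for S
  proof -
    have "(\<lambda>y. y p) \<in> measurable (borel_of (seq_topology X \<infinity>)) (borel_of (topo X))"
      using continuous_map_product_coordinates[of p UNIV "\<lambda>_. topo X"]
      by (intro continuous_map_measurable[of "seq_topology X \<infinity>"]) (auto simp: seq_topology_def space_borel_of)
    from measurable_sets[OF this S] show ?thesis
      unfolding P_eq by (simp add: vimage_def Int_def conj_commute)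
  qed
  have "A \<in> sets (completion ?B)" using A sub_completion by auto
  then obtain S N' N'' where *: "A = S \<union> N'" "N' \<subseteq> N''" "N'' \<in> null_sets ?B" "S \<in> sets ?B"
    by (rule sets_completionE) blast
  have N'': "N'' \<in> sets (borel_of (topo X))" "N'' \<in> null_sets m"
    using *(3) null_sets_restr_to_subalg[OF sub] sets_restr_to_subalg[OF sub] by (auto simp: null_sets_def)
  have S: "S \<in> sets (borel_of (topo X))" using *(4) sets_restr_to_subalg[OF sub] by simp
  have null: "{x \<in> space Pl. x p \<in> N''} \<in> null_sets Pl"
  proof -
    have c: "{x \<in> space Pl. \<not> (x p \<in> N'')} \<in> sets Pl" by (rule sets.sets_Collect_neg[OF coord[OF N''(1)]])
    have "AE \<gamma> in \<mu>r \<infinity>. lpt \<gamma> p \<notin> N''" by (rule AE_f_notin[OF N''(2)])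
    then have "AE x in Pl. \<not> (x p \<in> N'')"
      using c AE_distr_iff[OF f_measurable, of "\<lambda>x. \<not> (x p \<in> N'')"] unfolding P_eq by simp
    then show ?thesis using coord[OF N''(1)] by (subst (asm) AE_iff_null) auto
  qed
  have "{x \<in> space Pl. x p \<in> A} = {x \<in> space Pl. x p \<in> S} \<union> {x \<in> space Pl. x p \<in> N'}" using *(1) by auto
  then show ?thesis
    using coord[OF S] null *(2) by (simp, intro sets_completionI[of _ "{x \<in> space Pl. x p \<in> S}" "{x \<in> space Pl. x p \<in> N'}" "{x \<in> space Pl. x p \<in> N''}"]) auto
qed

lemma lcf_inf_eq:
  obtains Eh :: "nat \<Rightarrow> 'a set" where "\<And>h. Eh h \<in> lring X" "lcf_inf X = {x \<in> space Plc. \<forall>h. \<exists>n. \<forall>i. n \<le> i \<longrightarrow> x i \<notin> Eh h}"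
proof -
  obtain Eh :: "nat \<Rightarrow> 'a set" where Eh: "\<And>h. Eh h \<in> lring X" "\<And>E. E \<in> lring X \<Longrightarrow> \<exists>h. E \<subseteq> Eh h" using exhaustion by metis
  have fin: "finite {i. x i \<in> E} \<longleftrightarrow> (\<exists>n. \<forall>i. n \<le> i \<longrightarrow> x i \<notin> E)" for x :: "nat \<Rightarrow> 'a" and E
    unfolding finite_nat_set_iff_bounded by (auto simp: not_le[symmetric])
  have "(\<forall>E\<in>lring X. finite {i. x i \<in> E}) \<longleftrightarrow> (\<forall>h. finite {i. x i \<in> Eh h})" for x :: "nat \<Rightarrow> 'a"
  proof
    assume a: "\<forall>h. finite {i. x i \<in> Eh h}"
    show "\<forall>E\<in>lring X. finite {i. x i \<in> E}"
    proof
      fix E assume "E \<in> lring X"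
      then obtain h where "E \<subseteq> Eh h" using Eh(2) by blast
      then show "finite {i. x i \<in> E}" using a[rule_format, of h] by (elim rev_finite_subset) auto
    qed
  qed (use Eh(1) in blast)
  then have "lcf_inf X = {x \<in> space Plc. \<forall>h. \<exists>n. \<forall>i. n \<le> i \<longrightarrow> x i \<notin> Eh h}"
    unfolding lcf_inf_def lcf_def fin[symmetric] by (auto simp: space_P PiE_iff extensional_def)
  with Eh(1) show ?thesis by (rule that)
qed

lemma lcf_inf_sets: "lcf_inf X \<in> sets Plc"
proof -
  obtain Eh :: "nat \<Rightarrow> 'a set" where Eh: "\<And>h. Eh h \<in> lring X" "lcf_inf X = {x \<in> space Plc. \<forall>h. \<exists>n. \<forall>i. n \<le> i \<longrightarrow> x i \<notin> Eh h}"
    by (rule lcf_inf_eq) blast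
  note [measurable] = coordinate_sets[OF lring_sets[OF Eh(1)]]
  show ?thesis unfolding Eh(2) by measurable
qed

lemma AE_Pc: "(AE x in Plc. Q x) \<longleftrightarrow> (AE x in Pl. Q x)" by (rule AE_completion_iff)

lemma AE_lcf_inf: "AE x in Plc. x \<in> lcf_inf X"
proof -
  have "lcf_inf X = {x \<in> space Plc. x \<in> lcf_inf X}" using sets.sets_into_space[OF lcf_inf_sets] by auto
  then have s: "{x \<in> space Plc. x \<in> lcf_inf X} \<in> sets Plc" using lcf_inf_sets by simp
  have "AE x in distr (\<mu>r \<infinity>) Plc lpt. x \<in> lcf_inf X"
    using f_measurable_Pc s by (subst AE_distr_iff) (auto intro!: AE_I2 f_lcf_inf)
  then show ?thesis using Pc_distr by metis
qed

text \<open>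
  The map \<open>\<LL>\<close> as a total function; the value off the locally finite sequences (the empty
  configuration) is irrelevant, as these have full measure.
\<close>

definition T :: "(nat \<Rightarrow> 'a) \<Rightarrow> 'a measure" where
  "T x = (if x \<in> lcf_inf X then unlabel X (\<infinity>, x) else unlabel X (0, \<lambda>_. undefined))"

lemma T_Configs: "T x \<in> Configs X"
proof -
  have "(0, \<lambda>_. undefined) \<in> lcf X" unfolding lcf_def idx_def by auto
  then show ?thesis unfolding T_def using lcf_inf_Configs unlabel_Configs by auto
qed

lemma T_f: "\<gamma> \<in> space (\<mu>r \<infinity>) \<Longrightarrow> T (lpt \<gamma>) = \<gamma>"
  unfolding T_def using f_lcf_inf by simp

lemma T_measurable: "T \<in> measurable Plc \<mu>"
proof (rule measurable_sigma_sets[OF sets_\<mu>'])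
  show "T \<in> space Plc \<rightarrow> Configs X" using T_Configs by auto
  show "{{\<gamma> \<in> Configs X. emeasure \<gamma> E \<in> B} | E B. E \<in> lring X \<and> B \<in> sets borel} \<subseteq> Pow (Configs X)" by auto
  fix S assume "S \<in> {{\<gamma> \<in> Configs X. emeasure \<gamma> E \<in> B} | E B. E \<in> lring X \<and> B \<in> sets borel}"
  then obtain E B where S: "S = {\<gamma> \<in> Configs X. emeasure \<gamma> E \<in> B}" and E: "E \<in> lring X" and B: "B \<in> sets borel" by blast
  note [measurable] = coordinate_sets[OF lring_sets[OF E]] lcf_inf_sets
  have eq: "emeasure (T x) E = (if x \<in> lcf_inf X then (\<Sum>i. indicator {x \<in> space Plc. x i \<in> E} x) else 0)" if "x \<in> space Plc" for x
  proof (cases "x \<in> lcf_inf X")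
    case True
    then have xP: "x \<in> idx \<infinity> \<rightarrow>\<^sub>E pts X" using lcf_PiE unfolding lcf_inf_def by blast
    have "emeasure (T x) E = emeasure (count_space UNIV) {i. x i \<in> E}"
      unfolding T_def using True emeasure_unlabel[OF xP lring_sets[OF E]] by simp
    also have "\<dots> = (\<integral>\<^sup>+i. indicator {i. x i \<in> E} i \<partial>count_space UNIV)" by simp
    also have "\<dots> = (\<Sum>i. indicator {i. x i \<in> E} i)" by (rule nn_integral_count_space_nat)
    also have "\<dots> = (\<Sum>i. indicator {x \<in> space Plc. x i \<in> E} x)"
      using that by (intro suminf_cong) (auto split: split_indicator)
    finally show ?thesis using True by simp
  next
    case False
    have "emeasure (unlabel X (0, \<lambda>_. undefined)) E = emeasure (count_space UNIV) {i \<in> idx 0. undefined \<in> E}"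
      by (rule emeasure_unlabel[OF _ lring_sets[OF E]]) (auto simp: idx_def)
    then show ?thesis using False unfolding T_def by (simp add: idx_def)
  qed
  have "(\<lambda>x. emeasure (T x) E) \<in> borel_measurable Plc"
    by (subst measurable_cong[OF eq]) (simp, measurable)
  from measurable_sets[OF this B]
  show "T -` S \<inter> space Plc \<in> sets Plc" unfolding S using T_Configs by (simp add: vimage_def)
qed

text \<open>
  The unlabeling map is measure preserving.
\<close>

lemma T_distr: "distr Plc \<mu> T = \<mu>"
proof (rule measure_eqI)
  fix A assume "A \<in> sets (distr Plc \<mu> T)"
  then have A: "A \<in> sets \<mu>" by simp
  have "emeasure (distr Plc \<mu> T) A = emeasure Plc (T -` A \<inter> space Plc)"
    by (rule emeasure_distr[OF T_measurable A])
  also have "\<dots> = emeasure (distr (\<mu>r \<infinity>) Plc lpt) (T -` A \<inter> space Plc)" using Pc_distr by metis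
  also have "\<dots> = emeasure (\<mu>r \<infinity>) (lpt -` (T -` A \<inter> space Plc) \<inter> space (\<mu>r \<infinity>))"
    by (rule emeasure_distr[OF f_measurable_Pc measurable_sets[OF T_measurable A]])
  also have "lpt -` (T -` A \<inter> space Plc) \<inter> space (\<mu>r \<infinity>) = at_least \<infinity> \<inter> A"
    using T_f measurable_space[OF f_measurable_Pc] sets.sets_into_space[OF A] by (auto simp: space_\<mu>r space_\<mu>)
  also have "emeasure (\<mu>r \<infinity>) (at_least \<infinity> \<inter> A) = emeasure (completion \<mu>) (at_least \<infinity> \<inter> A)"
    by (rule emeasure_restrict_space[OF completion_sets]) auto
  also have "at_least \<infinity> \<inter> A = (at_least \<infinity> \<inter> space \<mu>) \<inter> A" using sets.sets_into_space[OF A] by auto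
  also have "emeasure (completion \<mu>) \<dots> = emeasure \<mu> \<dots>" using at_least_sets A by simp
  also have "\<dots> = emeasure \<mu> A"
  proof (rule emeasure_eq_AE)
    show "AE \<gamma> in \<mu>. (\<gamma> \<in> (at_least \<infinity> \<inter> space \<mu>) \<inter> A) = (\<gamma> \<in> A)"
      using inf AE_space by eventually_elim (simp add: at_least_def)
  qed (use at_least_sets A in auto)
  finally show "emeasure (distr Plc \<mu> T) A = emeasure \<mu> A" .
qed simp

lemma AE_T: "(AE \<gamma> in \<mu>. Q \<gamma>) \<Longrightarrow> (AE x in Plc. Q (T x))"
  using AE_distrD[OF T_measurable, of Q] unfolding T_distr by simp

lemma AE_T_lcf: "(AE \<gamma> in \<mu>. Q \<gamma>) \<Longrightarrow> (AE x in Plc. x \<in> lcf_inf X \<and> Q (unlabel X (\<infinity>, x)))"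
  using AE_T[of Q] AE_lcf_inf by (auto elim!: AE_mp simp: T_def)

lemma integral_T: "(g :: _ \<Rightarrow> real) \<in> borel_measurable \<mu> \<Longrightarrow> (LINT x|Plc. g (T x)) = (LINT \<gamma>|\<mu>. g \<gamma>)"
  using integral_distr[OF T_measurable, of g] unfolding T_distr by simp

lemma integrable_T: "(g :: _ \<Rightarrow> real) \<in> borel_measurable \<mu> \<Longrightarrow> integrable Plc (\<lambda>x. g (T x)) \<longleftrightarrow> integrable \<mu> g"
  using integrable_distr_eq[OF T_measurable, of g] unfolding T_distr by simp

subsection \<open>Linear statistics\<close>

lemma AE_AE_config: assumes "AE z in m. Q z" shows "AE \<gamma> in \<mu>. AE z in \<gamma>. Q z"
proof -
  obtain N where N: "N \<in> null_sets m" "{z \<in> space m. \<not> Q z} \<subseteq> N"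
    using assms unfolding eventually_ae_filter by blast
  show ?thesis
    using AE_no_point[OF N(1)] AE_space
  proof eventually_elim
    case (elim \<gamma>)
    then have \<gamma>: "\<gamma> \<in> Configs X" by (simp add: space_\<mu>)
    have "N \<in> null_sets \<gamma>" using elim(1) N(1) Configs_sets[OF \<gamma>] by (simp add: null_sets_def)
    moreover have "{z \<in> space \<gamma>. \<not> Q z} \<subseteq> N" using N(2) Configs_space[OF \<gamma>] space_m by simp
    ultimately show ?case unfolding eventually_ae_filter by blast
  qed
qed

lemma config_measurable: "\<gamma> \<in> Configs X \<Longrightarrow> g \<in> borel_measurable m \<Longrightarrow> g \<in> borel_measurable \<gamma>"
  using Configs_sets by (simp cong: measurable_cong_sets)

lemma star_cong_AE:
  assumes "g \<in> borel_measurable m" "h \<in> borel_measurable m" "AE z in m. g z = (h z :: real)"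
  shows "AE \<gamma> in \<mu>. star g \<gamma> = star h \<gamma>"
  using AE_AE_config[OF assms(3)] AE_space
proof eventually_elim
  case (elim \<gamma>)
  then show ?case unfolding star_def using assms config_measurable by (intro integral_cong_AE) (auto simp: space_\<mu>)
qed

lemma star_bounded:
  assumes g: "g \<in> borel_measurable m" and E: "E \<in> lring X" and B: "AE z in m. \<bar>g z\<bar> \<le> B * indicator E z"
  shows "AE \<gamma> in \<mu>. integrable \<gamma> g \<and> \<bar>star g \<gamma>\<bar> \<le> B * enn2real (emeasure \<gamma> E)"
  using AE_AE_config[OF B] AE_space
proof eventually_elim
  case (elim \<gamma>)
  then have \<gamma>: "\<gamma> \<in> Configs X" by (simp add: space_\<mu>)
  have Es: "E \<in> sets \<gamma>" using lring_sets[OF E] Configs_sets[OF \<gamma>] by simp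
  have i: "integrable \<gamma> (\<lambda>z. B * indicator E z)"
    using Es Configs_finite[OF \<gamma> E] by (intro integrable_mult_right integrable_real_indicator) auto
  have gi: "integrable \<gamma> g"
    by (rule integrable_AE_bounded_support[OF config_measurable[OF \<gamma> g] Es Configs_finite[OF \<gamma> E] elim(1)])
  have "\<bar>star g \<gamma>\<bar> \<le> (LINT z|\<gamma>. \<bar>g z\<bar>)" unfolding star_def using integral_norm_bound[of \<gamma> g] by simp
  also have "\<dots> \<le> (LINT z|\<gamma>. B * indicator E z)" using gi i elim(1) by (intro integral_mono_AE) auto
  also have "\<dots> = B * enn2real (emeasure \<gamma> E)" using Es by (simp add: measure_def)
  finally show ?case using gi by simp
qed

lemma count_integrable: assumes E: "E \<in> lring X" shows "integrable \<mu> (\<lambda>\<gamma>. enn2real (emeasure \<gamma> E))"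
proof (rule integrableI_bounded)
  show "(\<lambda>\<gamma>. enn2real (emeasure \<gamma> E)) \<in> borel_measurable \<mu>" using emeasure_lring_measurable[OF E] by measurable
  have "(\<integral>\<^sup>+\<gamma>. ennreal (norm (enn2real (emeasure \<gamma> E))) \<partial>\<mu>) \<le> (\<integral>\<^sup>+\<gamma>. emeasure \<gamma> E \<partial>\<mu>)"
    by (intro nn_integral_mono) (simp add: ennreal_enn2real_if)
  then show "(\<integral>\<^sup>+\<gamma>. ennreal (norm (enn2real (emeasure \<gamma> E))) \<partial>\<mu>) < \<infinity>"
    using intensity[OF E] by (rule le_less_trans)
qed

lemma star_integrable:
  assumes g: "g \<in> borel_measurable m" and E: "E \<in> lring X" and B: "AE z in m. \<bar>g z\<bar> \<le> B * indicator E z"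
  shows "integrable \<mu> (star g)"
proof (rule Bochner_Integration.integrable_bound)
  show "integrable \<mu> (\<lambda>\<gamma>. B * enn2real (emeasure \<gamma> E))" using count_integrable[OF E] by simp
  show "AE \<gamma> in \<mu>. norm (star g \<gamma>) \<le> norm (B * enn2real (emeasure \<gamma> E))"
    using star_bounded[OF assms] by eventually_elim auto
qed (rule star_measurable[OF g])

text \<open>
  Almost every configuration has finitely many points in \<open>E\<close>, so that almost everywhere convergence on
  the base space gives convergence of the linear statistics.
\<close>

lemma star_dominated:
  assumes gs: "\<And>n. gs n \<in> borel_measurable m" and g: "g \<in> borel_measurable m" and E: "E \<in> lring X"
    and B: "\<And>n. AE z in m. \<bar>gs n z\<bar> \<le> B * indicator E z" and lim: "AE z in m. (\<lambda>n. gs n z) \<longlonglongrightarrow> g z"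
  shows "AE \<gamma> in \<mu>. (\<lambda>n. star (gs n) \<gamma>) \<longlonglongrightarrow> star g \<gamma>"
proof -
  have "AE z in m. \<forall>n. \<bar>gs n z\<bar> \<le> B * indicator E z" using B by (simp add: AE_all_countable)
  from AE_AE_config[OF this] AE_AE_config[OF lim] AE_space
  show ?thesis
  proof eventually_elim
    case (elim \<gamma>)
    then have \<gamma>: "\<gamma> \<in> Configs X" by (simp add: space_\<mu>)
    have Es: "E \<in> sets \<gamma>" using lring_sets[OF E] Configs_sets[OF \<gamma>] by simp
    show ?case unfolding star_def
    proof (rule integral_dominated_convergence)
      show "integrable \<gamma> (\<lambda>z. B * indicator E z)"
        using Es Configs_finite[OF \<gamma> E] by (intro integrable_mult_right integrable_real_indicator) auto
      show "AE z in \<gamma>. norm (gs n z) \<le> B * indicator E z" for n using elim(1) by eventually_elim simp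
    qed (use elim(2) config_measurable[OF \<gamma>] gs g in auto)
  qed
qed

lemma star_add: 
  assumes "integrable \<gamma> g" "integrable \<gamma> h" shows "star (\<lambda>z. g z + h z) \<gamma> = star g \<gamma> + star h \<gamma>"
  unfolding star_def using assms by simp

lemma star_cmult: "star (\<lambda>z. c * g z) \<gamma> = c * star g \<gamma>"
  unfolding star_def by simp

lemma star_indicator: "\<gamma> \<in> Configs X \<Longrightarrow> E \<in> lring X \<Longrightarrow> star (indicator E) \<gamma> = enn2real (emeasure \<gamma> E)"
  unfolding star_def using lring_sets Configs_sets by (simp add: measure_def)

end

section \<open>Cylinder functions\<close>

lemma sum_lessThan_add: "(\<Sum>i<k + n. t i) = (\<Sum>i<k. t i) + (\<Sum>i<n. t (k + i))" for t :: "nat \<Rightarrow> real"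
  by (induction n) (simp_all add: add.assoc)

text \<open>
  Consequences of the axioms of a strong lifting, for functions in \<open>L\<^sup>\<infinity>\<close>.
\<close>

locale lifting = diffusion_space X for X :: "'a diffusion_space" +
  fixes L :: "('a \<Rightarrow> real) \<Rightarrow> 'a \<Rightarrow> real"
  assumes lifting: "strong_lifting X L"
begin

lemma lift_measurable: "f \<in> Linf m \<Longrightarrow> L f \<in> borel_measurable m"
  and lift_AE: "f \<in> Linf m \<Longrightarrow> AE x in m. L f x = f x"
  and lift_cong: "f \<in> Linf m \<Longrightarrow> g \<in> Linf m \<Longrightarrow> (AE x in m. f x = g x) \<Longrightarrow> x \<in> pts X \<Longrightarrow> L f x = L g x"
  and lift_add: "f \<in> Linf m \<Longrightarrow> g \<in> Linf m \<Longrightarrow> x \<in> pts X \<Longrightarrow> L (\<lambda>y. f y + g y) x = L f x + L g x"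
  and lift_mult: "f \<in> Linf m \<Longrightarrow> g \<in> Linf m \<Longrightarrow> x \<in> pts X \<Longrightarrow> L (\<lambda>y. f y * g y) x = L f x * L g x"
  and lift_cmult: "f \<in> Linf m \<Longrightarrow> x \<in> pts X \<Longrightarrow> L (\<lambda>y. c * f y) x = c * L f x"
  and lift_mono: "f \<in> Linf m \<Longrightarrow> g \<in> Linf m \<Longrightarrow> (AE x in m. f x \<le> g x) \<Longrightarrow> x \<in> pts X \<Longrightarrow> L f x \<le> L g x"
  and lift_continuous: "continuous_map (topo X) euclideanreal \<phi> \<Longrightarrow> bounded (\<phi> ` pts X) \<Longrightarrow> x \<in> pts X \<Longrightarrow> L \<phi> x = \<phi> x"
proof -
  note q1 = lifting[unfolded strong_lifting_def]
  note q2 = q1[THEN conjunct2] note q3 = q2[THEN conjunct2] note q4 = q3[THEN conjunct2]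
  note q5 = q4[THEN conjunct2] note q6 = q5[THEN conjunct2]
  note p = q1[THEN conjunct1] q2[THEN conjunct1] q3[THEN conjunct1] q4[THEN conjunct1] q5[THEN conjunct1] q6[THEN conjunct2]
  show "f \<in> Linf m \<Longrightarrow> L f \<in> borel_measurable m" "f \<in> Linf m \<Longrightarrow> AE x in m. L f x = f x" using p(1) by blast+
  show "f \<in> Linf m \<Longrightarrow> g \<in> Linf m \<Longrightarrow> (AE x in m. f x = g x) \<Longrightarrow> x \<in> pts X \<Longrightarrow> L f x = L g x"
    by (rule p(2)[rule_format])
  show "f \<in> Linf m \<Longrightarrow> g \<in> Linf m \<Longrightarrow> x \<in> pts X \<Longrightarrow> L (\<lambda>y. f y + g y) x = L f x + L g x"
    by (rule p(3)[rule_format, THEN conjunct1])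
  show "f \<in> Linf m \<Longrightarrow> g \<in> Linf m \<Longrightarrow> x \<in> pts X \<Longrightarrow> L (\<lambda>y. f y * g y) x = L f x * L g x"
    by (rule p(3)[rule_format, THEN conjunct2])
  show "f \<in> Linf m \<Longrightarrow> x \<in> pts X \<Longrightarrow> L (\<lambda>y. c * f y) x = c * L f x" by (rule p(4)[rule_format])
  show "f \<in> Linf m \<Longrightarrow> g \<in> Linf m \<Longrightarrow> (AE x in m. f x \<le> g x) \<Longrightarrow> x \<in> pts X \<Longrightarrow> L f x \<le> L g x"
    by (rule p(5)[rule_format])
  show "continuous_map (topo X) euclideanreal \<phi> \<Longrightarrow> bounded (\<phi> ` pts X) \<Longrightarrow> x \<in> pts X \<Longrightarrow> L \<phi> x = \<phi> x"
    by (rule p(6)[rule_format, OF conjI])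
qed

lemma Linf_const: "(\<lambda>_. c) \<in> Linf m"
  unfolding Linf_def ess_bounded_def by auto

lemma Linf_add: "f \<in> Linf m \<Longrightarrow> g \<in> Linf m \<Longrightarrow> (\<lambda>y. f y + g y) \<in> Linf m"
proof -
  assume "f \<in> Linf m" "g \<in> Linf m"
  then obtain A B where *: "f \<in> borel_measurable m" "g \<in> borel_measurable m" "AE x in m. \<bar>f x\<bar> \<le> A" "AE x in m. \<bar>g x\<bar> \<le> B"
    unfolding Linf_def ess_bounded_def by auto
  have "AE x in m. \<bar>f x + g x\<bar> \<le> A + B" using *(3,4) by eventually_elim linarith
  with * show ?thesis unfolding Linf_def ess_bounded_def by auto
qed

lemma Linf_mult: "f \<in> Linf m \<Longrightarrow> g \<in> Linf m \<Longrightarrow> (\<lambda>y. f y * g y) \<in> Linf m"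
proof -
  assume "f \<in> Linf m" "g \<in> Linf m"
  then obtain A B where *: "f \<in> borel_measurable m" "g \<in> borel_measurable m" "AE x in m. \<bar>f x\<bar> \<le> A" "AE x in m. \<bar>g x\<bar> \<le> B"
    unfolding Linf_def ess_bounded_def by auto
  have "AE x in m. \<bar>f x * g x\<bar> \<le> A * B" using *(3,4) by eventually_elim (simp add: abs_mult mult_mono')
  with * show ?thesis unfolding Linf_def ess_bounded_def by auto
qed

lemma Linf_sum: "finite I \<Longrightarrow> (\<And>i. i \<in> I \<Longrightarrow> f i \<in> Linf m) \<Longrightarrow> (\<lambda>y. \<Sum>i\<in>I. f i y) \<in> Linf m"
  by (induction I rule: finite_induct) (auto intro: Linf_const Linf_add)

lemma lift_zero: "x \<in> pts X \<Longrightarrow> L (\<lambda>_. 0) x = 0"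
  using lift_cmult[OF Linf_const[of 0], of x 0] by simp

lemma lift_sum: "finite I \<Longrightarrow> (\<And>i. i \<in> I \<Longrightarrow> f i \<in> Linf m) \<Longrightarrow> x \<in> pts X \<Longrightarrow> L (\<lambda>y. \<Sum>i\<in>I. f i y) x = (\<Sum>i\<in>I. L (f i) x)"
proof (induction I rule: finite_induct)
  case (insert i I)
  then have "L (\<lambda>y. f i y + (\<Sum>i\<in>I. f i y)) x = L (f i) x + L (\<lambda>y. \<Sum>i\<in>I. f i y) x"
    by (intro lift_add Linf_sum) auto
  then show ?case using insert by simp
qed (simp add: lift_zero)

lemma lift_nonneg: "f \<in> Linf m \<Longrightarrow> (AE x in m. 0 \<le> f x) \<Longrightarrow> x \<in> pts X \<Longrightarrow> 0 \<le> L f x"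
  using lift_mono[OF Linf_const[of 0], of f x] lift_zero[of x] by simp

text \<open>
  Lifting the square field of a smooth function of core functions.  The derivatives are bounded
  continuous functions, which a strong lifting leaves unchanged.
\<close>

lemma lift_gamma_smooth:
  assumes F: "F \<in> Cb_smooth k" and f: "\<And>i. i < k \<Longrightarrow> f i \<in> core X" and x: "x \<in> pts X"
    and h: "AE z in m. h z = F (\<lambda>i. f i z + s i)"
  shows "h \<in> X_gamma_dom X" "ess_bounded m (X_gamma X h)"
    "L (X_gamma X h) x = (\<Sum>i<k. \<Sum>j<k. pd i F (\<lambda>i. f i x + s i) * pd j F (\<lambda>i. f i x + s i) * L (sqf X (f i) (f j)) x)"
proof -
  define \<phi> where "\<phi> = (\<lambda>y. F (\<lambda>i. y (id i) + s i))"
  have \<phi>: "\<phi> \<in> Cb_smooth k" unfolding \<phi>_def by (rule Cb_smooth_subst[OF F]) auto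
  have pd: "pd i \<phi> y = pd i F (\<lambda>i. y i + s i)" if "i < k" for i y
    using pd_subst[OF F, of id i s y] that unfolding \<phi>_def by simp
  define c where "c = (\<lambda>z. \<phi> (\<lambda>i. f i z) - \<phi> (\<lambda>_. 0))"
  have c: "c \<in> core X" unfolding c_def by (rule core_comp[OF \<phi> f])
  obtain B where B: "\<And>y. \<bar>F y\<bar> \<le> B" using Cb_smooth_bound[OF F] by blast
  have hb: "ess_bounded m h"
  proof -
    have "AE z in m. \<bar>h z\<bar> \<le> B" using h by eventually_elim (simp add: B)
    then show ?thesis unfolding ess_bounded_def by blast
  qed
  have hc: "AE z in m. h z = c z + \<phi> (\<lambda>_. 0)"
    using h by eventually_elim (simp add: c_def \<phi>_def)
  note g = X_gamma_core[OF c hc hb]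
  show "h \<in> X_gamma_dom X" by (rule g(1))
  define D where "D i = (\<lambda>z. pd i \<phi> (\<lambda>i. if i < k then f i z else 0))" for i
  have D_eq: "D i z = pd i \<phi> (\<lambda>i. f i z)" if "i < k" for i z
    unfolding D_def by (rule Cb_smooth_cong[OF Cb_smooth_pd[OF \<phi> that]]) simp
  have Dc: "continuous_map (topo X) euclideanreal (D i)" if "i < k" for i
  proof -
    have "continuous_map (topo X) (euclidean :: (nat \<Rightarrow> real) topology) (\<lambda>z i. if i < k then f i z else 0)"
      unfolding euclidean_product_topology[symmetric]
    proof (rule continuous_map_coordinatewise_then_product)
      fix i show "continuous_map (topo X) euclideanreal (\<lambda>z. if i < k then f i z else 0)"
        by (cases "i < k") (simp_all add: core_continuous f)
    qed auto
    moreover have "continuous_map euclidean euclideanreal (pd i \<phi>)"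
      using Cb_smooth_continuous[OF Cb_smooth_pd[OF \<phi> that]] by simp
    ultimately have "continuous_map (topo X) euclideanreal (pd i \<phi> \<circ> (\<lambda>z i. if i < k then f i z else 0))"
      by (rule continuous_map_compose)
    then show ?thesis unfolding D_def o_def .
  qed
  have Db: "bounded (D i ` pts X)" if "i < k" for i
    by (rule bounded_subset[OF Cb_smooth_bounded[OF Cb_smooth_pd[OF \<phi> that]]]) (auto simp: D_def)
  have DL: "D i \<in> Linf m" if i: "i < k" for i
  proof -
    obtain B where "\<And>y. \<bar>pd i \<phi> y\<bar> \<le> B" using Cb_smooth_bound[OF Cb_smooth_pd[OF \<phi> i]] by blast
    then have "AE z in m. \<bar>D i z\<bar> \<le> B" unfolding D_def by simp
    then show ?thesis unfolding Linf_def ess_bounded_def using continuous_measurable[OF Dc[OF i]] by blast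
  qed
  define S where "S = (\<lambda>z. \<Sum>i<k. \<Sum>j<k. D i z * D j z * sqf X (f i) (f j) z)"
  have tm: "(\<lambda>z. D i z * D j z * sqf X (f i) (f j) z) \<in> Linf m" if "i < k" "j < k" for i j
    using that by (intro Linf_mult DL sqf_Linf f)
  have SL: "S \<in> Linf m" unfolding S_def by (intro Linf_sum tm) auto
  have ch: "AE z in m. sqf X c c z = (\<Sum>i<k. \<Sum>j<k. pd i \<phi> (\<lambda>i. f i z) * pd j \<phi> (\<lambda>j. f j z) * sqf X (f i) (f j) z)"
    unfolding c_def by (rule sqf_chain[OF \<phi> \<phi> f f])
  have XS: "AE z in m. X_gamma X h z = S z"
    using g(2) ch
  proof eventually_elim
    case (elim z)
    then show ?case unfolding S_def by (simp add: D_eq)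
  qed
  show Xb: "ess_bounded m (X_gamma X h)"
  proof -
    obtain B where "AE z in m. \<bar>S z\<bar> \<le> B" using SL unfolding Linf_def ess_bounded_def by blast
    then have "AE z in m. \<bar>X_gamma X h z\<bar> \<le> B" using XS by eventually_elim simp
    then show ?thesis unfolding ess_bounded_def by blast
  qed
  have XL: "X_gamma X h \<in> Linf m" using g(3) Xb unfolding Linf_def by simp
  have "L (X_gamma X h) x = L S x" by (rule lift_cong[OF XL SL XS x])
  also have "\<dots> = (\<Sum>i<k. L (\<lambda>z. \<Sum>j<k. D i z * D j z * sqf X (f i) (f j) z) x)"
    unfolding S_def by (intro lift_sum Linf_sum tm x) auto
  also have "\<dots> = (\<Sum>i<k. \<Sum>j<k. L (\<lambda>z. D i z * D j z * sqf X (f i) (f j) z) x)"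
    by (intro sum.cong refl lift_sum tm x) auto
  also have "\<dots> = (\<Sum>i<k. \<Sum>j<k. pd i F (\<lambda>i. f i x + s i) * pd j F (\<lambda>i. f i x + s i) * L (sqf X (f i) (f j)) x)"
  proof (intro sum.cong refl)
    fix i j assume ij: "i \<in> {..<k}" "j \<in> {..<k}"
    then have "L (\<lambda>z. (D i z * D j z) * sqf X (f i) (f j) z) x = L (\<lambda>z. D i z * D j z) x * L (sqf X (f i) (f j)) x"
      by (intro lift_mult Linf_mult DL sqf_Linf f x) auto
    also have "L (\<lambda>z. D i z * D j z) x = L (D i) x * L (D j) x" using ij by (intro lift_mult DL x) auto
    also have "L (D i) x = D i x" using ij by (intro lift_continuous Dc Db x) auto
    also have "L (D j) x = D j x" using ij by (intro lift_continuous Dc Db x) auto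
    finally show "L (\<lambda>z. D i z * D j z * sqf X (f i) (f j) z) x =
      pd i F (\<lambda>i. f i x + s i) * pd j F (\<lambda>i. f i x + s i) * L (sqf X (f i) (f j)) x"
      using ij by (simp add: D_eq pd)
  qed
  finally show "L (X_gamma X h) x = (\<Sum>i<k. \<Sum>j<k. pd i F (\<lambda>i. f i x + s i) * pd j F (\<lambda>i. f i x + s i) * L (sqf X (f i) (f j)) x)" .
qed

end

context diffusion_space
begin

lemma star_finite_superset:
  assumes x: "x \<in> lcf_inf X" and f: "f \<in> borel_measurable m" and S: "finite S" "{i. f (x i) \<noteq> 0} \<subseteq> S"
  shows "star f (unlabel X (\<infinity>, x)) = (\<Sum>i\<in>S. f (x i))"
  unfolding star_unlabel[OF x f finite_subset[OF S(2,1)]] using S by (intro sum.mono_neutral_left) auto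

lemma star_upd:
  assumes x: "x \<in> lcf_inf X" and z: "z \<in> pts X" and f: "f \<in> core X"
  shows "star f (unlabel X (\<infinity>, x(p := z))) = f z + (star f (unlabel X (\<infinity>, x)) - f (x p))"
proof -
  obtain E where E: "E \<in> lring X" "\<And>z. z \<notin> E \<Longrightarrow> f z = 0" using core_support[OF f] by blast
  define S where "S = insert p {i. f (x i) \<noteq> 0}"
  have fin: "finite S" unfolding S_def using Sb_unlabel_finite[OF x E] by simp
  have "star f (unlabel X (\<infinity>, x(p := z))) = (\<Sum>i\<in>S. f ((x(p := z)) i))"
    by (rule star_finite_superset[OF lcf_inf_upd[OF x z] core_measurable[OF f] fin]) (auto simp: S_def split: if_splits)
  also have "\<dots> = f z + (\<Sum>i\<in>S - {p}. f (x i))"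
    using fin by (subst sum.remove[of S p]) (auto simp: S_def intro!: sum.cong)
  also have "(\<Sum>i\<in>S - {p}. f (x i)) = (\<Sum>i\<in>S. f (x i)) - f (x p)"
    using sum.remove[OF fin, of p "\<lambda>i. f (x i)"] by (simp add: S_def)
  also have "(\<Sum>i\<in>S. f (x i)) = star f (unlabel X (\<infinity>, x))"
    by (rule star_finite_superset[OF x core_measurable[OF f] fin, symmetric]) (auto simp: S_def)
  finally show ?thesis .
qed

lemma cyl_repD:
  assumes "cyl_rep X u (k, F, f)"
  shows "F \<in> Cb_smooth k" "\<And>i. i < k \<Longrightarrow> f i \<in> core X" "\<And>\<gamma>. \<gamma> \<in> Configs X \<Longrightarrow> u \<gamma> = F (\<lambda>i. star (f i) \<gamma>)"
  using assms unfolding cyl_rep_def by auto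

lemma cyl_repI:
  "F \<in> Cb_smooth k \<Longrightarrow> (\<And>i. i < k \<Longrightarrow> f i \<in> core X) \<Longrightarrow> (\<And>\<gamma>. \<gamma> \<in> Configs X \<Longrightarrow> u \<gamma> = F (\<lambda>i. star (f i) \<gamma>)) \<Longrightarrow> cyl_rep X u (k, F, f)"
  unfolding cyl_rep_def by auto

end

context lifting
begin

text \<open>The one-particle sections of a cylinder function and their square fields.\<close>

lemma section_gamma:
  assumes u: "cyl_rep X u (k, F, f)" and x: "x \<in> lcf_inf X"
  defines "h \<equiv> (\<lambda>p z. pull_back X u (x(p := z)))"
  shows "h p \<in> X_gamma_dom X" "ess_bounded m (X_gamma X (h p))"
    "L (X_gamma X (h p)) (x p) = (\<Sum>i<k. \<Sum>j<k. pd i F (\<lambda>i. star (f i) (unlabel X (\<infinity>, x))) *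
       pd j F (\<lambda>i. star (f i) (unlabel X (\<infinity>, x))) * L (sqf X (f i) (f j)) (x p))"
proof -
  note F = cyl_repD(1)[OF u] and f = cyl_repD(2)[OF u]
  let ?\<gamma> = "unlabel X (\<infinity>, x)"
  define s where "s i = star (f i) ?\<gamma> - f i (x p)" for i
  have xp: "x p \<in> pts X" using lcf_infD(1)[OF x] .
  have "AE z in m. h p z = F (\<lambda>i. f i z + s i)"
    using AE_space
  proof eventually_elim
    case (elim z)
    then have z: "z \<in> pts X" using space_m by simp
    have "h p z = F (\<lambda>i. star (f i) (unlabel X (\<infinity>, x(p := z))))"
      unfolding h_def pull_back_def by (rule cyl_repD(3)[OF u lcf_inf_Configs[OF lcf_inf_upd[OF x z]]])
    also have "\<dots> = F (\<lambda>i. f i z + s i)"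
      by (rule Cb_smooth_cong[OF F]) (simp add: star_upd[OF x z f] s_def)
    finally show ?case .
  qed
  note g = lift_gamma_smooth[OF F f xp this]
  show "h p \<in> X_gamma_dom X" "ess_bounded m (X_gamma X (h p))" using g(1,2) by blast+
  show "L (X_gamma X (h p)) (x p) = (\<Sum>i<k. \<Sum>j<k. pd i F (\<lambda>i. star (f i) ?\<gamma>) * pd j F (\<lambda>i. star (f i) ?\<gamma>) * L (sqf X (f i) (f j)) (x p))"
    using g(3) by (simp add: s_def)
qed

end

locale lifted_config_space = labeled_config_space X \<mu> l + lifting X L for X :: "'a diffusion_space" and \<mu> l L
begin

lemma lift_sqf_support:
  assumes "f \<in> core X" "g \<in> core X"
  shows "\<exists>B E. E \<in> lring X \<and> (AE z in m. \<bar>L (sqf X f g) z\<bar> \<le> B * indicator E z)"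
proof -
  obtain B E where "E \<in> lring X" "AE z in m. \<bar>sqf X f g z\<bar> \<le> B * indicator E z" using sqf_bounded_support[OF assms] by blast
  moreover have "AE z in m. L (sqf X f g) z = sqf X f g z" by (rule lift_AE[OF sqf_Linf[OF assms]])
  ultimately show ?thesis by (intro exI[of _ B] exI[of _ E]) (auto elim: AE_mp)
qed

lemma AE_lift_finite:
  assumes "f \<in> core X" "g \<in> core X"
  shows "AE \<gamma> in \<mu>. \<forall>x\<in>lcf_inf X. unlabel X (\<infinity>, x) = \<gamma> \<longrightarrow> finite {p. L (sqf X f g) (x p) \<noteq> 0}"
proof -
  obtain B E where E: "E \<in> lring X" and B: "AE z in m. \<bar>L (sqf X f g) z\<bar> \<le> B * indicator E z"
    using lift_sqf_support[OF assms] by blast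
  obtain N where N: "N \<in> null_sets m" "{z \<in> space m. \<not> (\<bar>L (sqf X f g) z\<bar> \<le> B * indicator E z)} \<subseteq> N"
    using B unfolding eventually_ae_filter by blast
  show ?thesis
    using AE_no_point[OF N(1)]
  proof (eventually_elim, intro ballI impI)
    fix \<gamma> x assume \<gamma>: "emeasure \<gamma> N = 0" and x: "x \<in> lcf_inf X" "unlabel X (\<infinity>, x) = \<gamma>"
    have xP: "x \<in> idx \<infinity> \<rightarrow>\<^sub>E pts X" using x lcf_PiE unfolding lcf_inf_def by blast
    have "emeasure (count_space UNIV) {i. x i \<in> N} = 0"
      using emeasure_unlabel[OF xP null_setsD2[OF N(1)]] \<gamma> x(2) by simp
    then have noN: "x p \<notin> N" for p by (auto simp: emeasure_count_space split: if_splits)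
    have "\<bar>L (sqf X f g) (x p)\<bar> \<le> B * indicator E (x p)" for p
      using noN[of p] N(2) lcf_infD(1)[OF x(1), of p] space_m by blast
    then have "{p. L (sqf X f g) (x p) \<noteq> 0} \<subseteq> {p. x p \<in> E}" by (force split: split_indicator_asm)
    then show "finite {p. L (sqf X f g) (x p) \<noteq> 0}" using lcf_infD(2)[OF x(1) E] by (rule finite_subset)
  qed
qed

text \<open>Summing the sections over the particles gives the square field of a cylinder function.\<close>

lemma lab_gamma_cyl:
  assumes u: "cyl_rep X u (k, F, f)"
  shows "AE \<gamma> in \<mu>. \<forall>x\<in>lcf_inf X. unlabel X (\<infinity>, x) = \<gamma> \<longrightarrow> lab_gamma_defined X L (pull_back X u) x \<and>
    lab_gamma X L (pull_back X u) x = cyl_gamma_rep X L (k, F, f) (k, F, f) \<gamma>"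
proof -
  note F = cyl_repD(1)[OF u] and f = cyl_repD(2)[OF u]
  have "AE \<gamma> in \<mu>. \<forall>ij\<in>{..<k} \<times> {..<k}. \<forall>x\<in>lcf_inf X. unlabel X (\<infinity>, x) = \<gamma> \<longrightarrow>
      finite {p. L (sqf X (f (fst ij)) (f (snd ij))) (x p) \<noteq> 0}"
    by (intro AE_finite_allI AE_lift_finite f) auto
  then show ?thesis
  proof (eventually_elim, intro ballI impI)
    fix \<gamma> x assume fin0: "\<forall>ij\<in>{..<k} \<times> {..<k}. \<forall>x\<in>lcf_inf X. unlabel X (\<infinity>, x) = \<gamma> \<longrightarrow>
      finite {p. L (sqf X (f (fst ij)) (f (snd ij))) (x p) \<noteq> 0}" and x: "x \<in> lcf_inf X" "unlabel X (\<infinity>, x) = \<gamma>"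
    have fin: "finite {p. L (sqf X (f i) (f j)) (x p) \<noteq> 0}" if "i < k" "j < k" for i j
      using fin0[rule_format, of "(i, j)" x] x that by simp
    note sec = section_gamma[OF u x(1)]
    have sums: "(\<lambda>p. L (sqf X (f i) (f j)) (x p)) sums star (L (sqf X (f i) (f j))) \<gamma>" if "i < k" "j < k" for i j
      using star_unlabel[OF x(1) lift_measurable[OF sqf_Linf[OF f[OF that(1)] f[OF that(2)]]] fin[OF that]] sums_finite[OF fin[OF that], of "\<lambda>p. L (sqf X (f i) (f j)) (x p)"] x(2)
      by simp
    have S: "(\<lambda>p. L (X_gamma X (\<lambda>z. pull_back X u (x(p := z)))) (x p)) sums cyl_gamma_rep X L (k, F, f) (k, F, f) \<gamma>"
      unfolding sec(3) cyl_gamma_rep_def prod.case x(2) by (intro sums_sum sums_mult sums) auto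
    show "lab_gamma_defined X L (pull_back X u) x \<and> lab_gamma X L (pull_back X u) x = cyl_gamma_rep X L (k, F, f) (k, F, f) \<gamma>"
      unfolding lab_gamma_defined_def lab_gamma_def using sec(1,2) sums_summable[OF S] sums_unique[OF S] by simp
  qed
qed

end

context lifting
begin

lemma lab_gamma_nonneg:
  assumes "lab_gamma_defined X L U x" "x \<in> lcf_inf X" shows "0 \<le> lab_gamma X L U x"
  unfolding lab_gamma_def
proof (rule suminf_nonneg)
  show "summable (\<lambda>p. L (X_gamma X (\<lambda>z. U (x(p := z)))) (x p))" using assms unfolding lab_gamma_defined_def by blast
  fix p
  have *: "(\<lambda>z. U (x(p := z))) \<in> X_gamma_dom X" "ess_bounded m (X_gamma X (\<lambda>z. U (x(p := z))))"
    using assms unfolding lab_gamma_defined_def by blast+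
  then have "X_gamma X (\<lambda>z. U (x(p := z))) \<in> Linf m" unfolding Linf_def using X_gamma_measurable by blast
  then show "0 \<le> L (X_gamma X (\<lambda>z. U (x(p := z)))) (x p)"
    by (rule lift_nonneg[OF _ X_gamma_nonneg[OF *(1)] lcf_infD(1)[OF assms(2)]])
qed

end

context lifting
begin

lemma cyl_gamma_rep_eq:
  "cyl_gamma_rep X L (k, F, f) (n, G, g) \<gamma> = (\<Sum>i<k. \<Sum>j<n. pd i F (\<lambda>i. star (f i) \<gamma>) * pd j G (\<lambda>j. star (g j) \<gamma>) *
       star (L (sqf X (f i) (g j))) \<gamma>)"
  by (simp add: cyl_gamma_rep_def)

lemma star_lift_sym:
  assumes "f \<in> core X" "g \<in> core X" "\<gamma> \<in> Configs X"
  shows "star (L (sqf X f g)) \<gamma> = star (L (sqf X g f)) \<gamma>"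
  unfolding star_def
  using lift_cong[OF sqf_Linf[OF assms(1,2)] sqf_Linf[OF assms(2,1)] base.G_sym[OF assms(1,2)]] Configs_space[OF assms(3)]
  by (intro Bochner_Integration.integral_cong) auto

lemma cyl_gamma_rep_sym:
  assumes "\<And>i. i < k \<Longrightarrow> f i \<in> core X" "\<And>i. i < n \<Longrightarrow> g i \<in> core X" "\<gamma> \<in> Configs X"
  shows "cyl_gamma_rep X L (k, F, f) (n, G, g) \<gamma> = cyl_gamma_rep X L (n, G, g) (k, F, f) \<gamma>"
  unfolding cyl_gamma_rep_eq sum.swap[of _ "{..<n}" "{..<k}"]
  by (intro sum.cong refl) (simp add: star_lift_sym[OF assms(1) assms(2) assms(3)])

text \<open>
  Two cylinder functions are brought over a common family of core functions: \<open>join\<close> concatenates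
  the families, \<open>right k G\<close> reads the variables of \<open>G\<close> after the first \<open>k\<close> ones.
\<close>

definition join :: "nat \<Rightarrow> (nat \<Rightarrow> 'a \<Rightarrow> real) \<Rightarrow> (nat \<Rightarrow> 'a \<Rightarrow> real) \<Rightarrow> nat \<Rightarrow> 'a \<Rightarrow> real" where
  "join k f g i = (if i < k then f i else g (i - k))"

definition right :: "nat \<Rightarrow> ((nat \<Rightarrow> real) \<Rightarrow> real) \<Rightarrow> (nat \<Rightarrow> real) \<Rightarrow> real" where
  "right k G y = G (\<lambda>i. y (k + i))"

lemma join_core: "(\<And>i. i < k \<Longrightarrow> f i \<in> core X) \<Longrightarrow> (\<And>i. i < n \<Longrightarrow> g i \<in> core X) \<Longrightarrow> i < k + n \<Longrightarrow> join k f g i \<in> core X"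
  by (auto simp: join_def)

lemma left_smooth: "F \<in> Cb_smooth k \<Longrightarrow> F \<in> Cb_smooth (k + n)"
  using Cb_smooth_subst[of F k "\<lambda>i. i" "k + n" "\<lambda>_. 0", OF _ inj_on_id2] by auto

lemma join_simps: "i < k \<Longrightarrow> join k f g i = f i" "join k f g (k + i) = g i"
  by (auto simp: join_def)

lemma right_smooth: assumes "G \<in> Cb_smooth n" shows "right k G \<in> Cb_smooth (k + n)"
proof -
  have "inj_on (\<lambda>i. k + i) {..<n}" "(\<lambda>i. k + i) ` {..<n} \<subseteq> {..<k + n}" by auto
  from Cb_smooth_subst[OF assms this, of "\<lambda>_. 0"] show ?thesis unfolding right_def[abs_def] by simp
qed

lemma pd_right: "G \<in> Cb_smooth n \<Longrightarrow> j < n \<Longrightarrow> pd (k + j) (right k G) y = pd j G (\<lambda>i. y (k + i))"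
  using pd_subst[of G n "\<lambda>i. k + i" j "\<lambda>_. 0" y, OF _ inj_on_add] unfolding right_def[abs_def] by simp

lemma pd_right_0: "G \<in> Cb_smooth n \<Longrightarrow> i < k \<Longrightarrow> pd i (right k G) y = 0"
  using pd_subst_0[of G n i "\<lambda>i. k + i" "\<lambda>_. 0" y] unfolding right_def[abs_def]
  by auto

lemma left_eval: "F \<in> Cb_smooth k \<Longrightarrow> F (\<lambda>i. star (join k f g i) \<gamma>) = F (\<lambda>i. star (f i) \<gamma>)"
  by (erule Cb_smooth_cong) (simp add: join_def)

lemma right_eval: "right k G (\<lambda>i. star (join k f g i) \<gamma>) = G (\<lambda>i. star (g i) \<gamma>)"
  by (simp add: right_def join_def)

lemma rep_combine:
  assumes F: "F \<in> Cb_smooth k" and G: "G \<in> Cb_smooth n"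
    and H: "\<And>i. pd i H (\<lambda>i. star (join k f g i) \<gamma>) =
      A * pd i F (\<lambda>i. star (join k f g i) \<gamma>) + B * pd i (right k G) (\<lambda>i. star (join k f g i) \<gamma>)"
  shows "cyl_gamma_rep X L (k + n, H, join k f g) e \<gamma> =
    A * cyl_gamma_rep X L (k, F, f) e \<gamma> + B * cyl_gamma_rep X L (n, G, g) e \<gamma>"
proof -
  obtain n' G' g' where e: "e = (n', G', g')" by (metis prod_cases3)
  let ?y = "\<lambda>i. star (join k f g i) \<gamma>"
  have 1: "pd i H ?y = A * pd i F (\<lambda>i. star (f i) \<gamma>)" if "i < k" for i
    using H[of i] pd_right_0[OF G that] left_eval[OF Cb_smooth_pd[OF F that]] by simp
  have 2: "pd (k + i) H ?y = B * pd i G (\<lambda>i. star (g i) \<gamma>)" if "i < n" for i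
    using H[of "k + i"] pd_right[OF G that, of k ?y] Cb_smooth_pd_eq_0[OF F, of "k + i"] by (simp add: join_simps)
  have "cyl_gamma_rep X L (k + n, H, join k f g) e \<gamma> =
      (\<Sum>i<k. A * (\<Sum>j<n'. pd i F (\<lambda>i. star (f i) \<gamma>) * pd j G' (\<lambda>j. star (g' j) \<gamma>) * star (L (sqf X (f i) (g' j))) \<gamma>)) +
      (\<Sum>i<n. B * (\<Sum>j<n'. pd i G (\<lambda>i. star (g i) \<gamma>) * pd j G' (\<lambda>j. star (g' j) \<gamma>) * star (L (sqf X (g i) (g' j))) \<gamma>))"
    unfolding e cyl_gamma_rep_eq sum_lessThan_add
    by (intro arg_cong2[where f = "(+)"] sum.cong refl) (simp_all add: 1 2 join_simps sum_distrib_left mult.assoc)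
  then show ?thesis unfolding e cyl_gamma_rep_eq by (simp add: sum_distrib_left)
qed

lemma rep_outer:
  assumes F: "F \<in> Cb_smooth k" and H: "\<And>i. i < k \<Longrightarrow> pd i H (\<lambda>i. star (f i) \<gamma>) = A * pd i F (\<lambda>i. star (f i) \<gamma>)"
  shows "cyl_gamma_rep X L (k, H, f) e \<gamma> = A * cyl_gamma_rep X L (k, F, f) e \<gamma>"
proof -
  obtain n' G' g' where e: "e = (n', G', g')" by (metis prod_cases3)
  show ?thesis unfolding e cyl_gamma_rep_eq by (simp add: H sum_distrib_left mult.assoc)
qed

lemma cyl_rep_add:
  assumes u: "cyl_rep X u (k, F, f)" and v: "cyl_rep X v (n, G, g)"
  shows "cyl_rep X (\<lambda>\<gamma>. u \<gamma> + c * v \<gamma>) (k + n, \<lambda>y. F y + c * right k G y, join k f g)"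
proof (rule cyl_repI)
  show "(\<lambda>y. F y + c * right k G y) \<in> Cb_smooth (k + n)"
    by (rule Cb_smooth_add[OF left_smooth[OF cyl_repD(1)[OF u]] Cb_smooth_cmult[OF right_smooth[OF cyl_repD(1)[OF v]]]])
qed (use join_core[of k f n g] cyl_repD[OF u] cyl_repD[OF v] in \<open>auto simp: left_eval right_eval\<close>)

lemma gamma_add_left:
  assumes u: "cyl_rep X u (k, F, f)" and v: "cyl_rep X v (n, G, g)"
  shows "cyl_gamma_rep X L (k + n, \<lambda>y. F y + c * right k G y, join k f g) e \<gamma> =
    cyl_gamma_rep X L (k, F, f) e \<gamma> + c * cyl_gamma_rep X L (n, G, g) e \<gamma>"
proof -
  have "pd i (\<lambda>y. F y + c * right k G y) y = 1 * pd i F y + c * pd i (right k G) y" for i y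
    using pd_add[OF left_smooth[OF cyl_repD(1)[OF u], of n] Cb_smooth_cmult[OF right_smooth[OF cyl_repD(1)[OF v], of k], of c], of i y]
      pd_cmult[OF right_smooth[OF cyl_repD(1)[OF v], of k], of i c y] by linarith
  then have "cyl_gamma_rep X L (k + n, \<lambda>y. F y + c * right k G y, join k f g) e \<gamma> =
    1 * cyl_gamma_rep X L (k, F, f) e \<gamma> + c * cyl_gamma_rep X L (n, G, g) e \<gamma>"
    by (rule rep_combine[OF cyl_repD(1)[OF u] cyl_repD(1)[OF v]])
  then show ?thesis by simp
qed

text \<open>Polarization: the mixed term is determined by the diagonal ones.\<close>

lemma gamma_polarize:
  assumes u: "cyl_rep X u (k, F, f)" and v: "cyl_rep X v (n, G, g)" and \<gamma>: "\<gamma> \<in> Configs X"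
  defines "d c \<equiv> (k + n, \<lambda>y. F y + c * right k G y, join k f g)"
  shows "4 * cyl_gamma_rep X L (k, F, f) (n, G, g) \<gamma> = cyl_gamma_rep X L (d 1) (d 1) \<gamma> - cyl_gamma_rep X L (d (-1)) (d (-1)) \<gamma>"
proof -
  have ru: "cyl_gamma_rep X L (d c) (k, F, f) \<gamma> = cyl_gamma_rep X L (k, F, f) (d c) \<gamma>"
    and rv: "cyl_gamma_rep X L (d c) (n, G, g) \<gamma> = cyl_gamma_rep X L (n, G, g) (d c) \<gamma>" for c
    unfolding d_def by (rule cyl_gamma_rep_sym; use cyl_repD(2)[OF u] cyl_repD(2)[OF v] join_core \<gamma> in blast)+
  have s: "cyl_gamma_rep X L (n, G, g) (k, F, f) \<gamma> = cyl_gamma_rep X L (k, F, f) (n, G, g) \<gamma>"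
    by (rule cyl_gamma_rep_sym[OF cyl_repD(2)[OF v] cyl_repD(2)[OF u] \<gamma>])
  note a = gamma_add_left[OF u v, folded d_def]
  show ?thesis
    using a[of 1 "d 1"] a[of "-1" "d (-1)"] a[of 1 "(k, F, f)"] a[of 1 "(n, G, g)"] a[of "-1" "(k, F, f)"] a[of "-1" "(n, G, g)"]
      ru[of 1] ru[of "-1"] rv[of 1] rv[of "-1"] s by simp
qed

end

context lifted_config_space
begin

lemma AE_labeled: "AE \<gamma> in \<mu>. \<gamma> \<in> Configs X \<and> (\<exists>x\<in>lcf_inf X. unlabel X (\<infinity>, x) = \<gamma>)"
  using inf AE_space
proof eventually_elim
  case (elim \<gamma>)
  then have "\<gamma> \<in> space (\<mu>r \<infinity>)" using space_\<mu>r_inf space_\<mu> by blast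
  from f_lcf_inf[OF this] elim(2) show ?case unfolding space_\<mu> by blast
qed

lemma AE_labeledI:
  assumes "AE \<gamma> in \<mu>. \<forall>x\<in>lcf_inf X. unlabel X (\<infinity>, x) = \<gamma> \<longrightarrow> Q \<gamma>" shows "AE \<gamma> in \<mu>. Q \<gamma>"
  using assms AE_labeled 
proof eventually_elim
  case (elim \<gamma>)
  from elim(2) obtain x where x: "x \<in> lcf_inf X" "unlabel X (\<infinity>, x) = \<gamma>" by (elim conjE bexE)
  from elim(1)[rule_format, OF x] show ?case .
qed

text \<open>
  The square field does not depend on the representation of the cylinder functions: the diagonal
  values agree with \<open>\<Gamma>\<^sup>[\<^sup>\<infinity>\<^sup>]\<close> of the pull-back, which makes no reference to representations.
\<close>

lemma cyl_gamma_rep_unique: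
  assumes "cyl_rep X u d" "cyl_rep X u d'" "cyl_rep X v e" "cyl_rep X v e'"
  shows "AE \<gamma> in \<mu>. cyl_gamma_rep X L d e \<gamma> = cyl_gamma_rep X L d' e' \<gamma>"
proof -
  obtain k F f where d: "d = (k, F, f)" by (metis prod_cases3)
  obtain k' F' f' where d': "d' = (k', F', f')" by (metis prod_cases3)
  obtain n G g where e: "e = (n, G, g)" by (metis prod_cases3)
  obtain n' G' g' where e': "e' = (n', G', g')" by (metis prod_cases3)
  note r = assms[unfolded d d' e e']
  note p = lab_gamma_cyl[OF cyl_rep_add[OF r(1,3), of 1]] lab_gamma_cyl[OF cyl_rep_add[OF r(1,3), of "-1"]]
    lab_gamma_cyl[OF cyl_rep_add[OF r(2,4), of 1]] lab_gamma_cyl[OF cyl_rep_add[OF r(2,4), of "-1"]]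
  show ?thesis unfolding d d' e e'
    using p AE_labeled
  proof eventually_elim
    case (elim \<gamma>)
    then obtain x where x: "x \<in> lcf_inf X" "unlabel X (\<infinity>, x) = \<gamma>" and \<gamma>: "\<gamma> \<in> Configs X" by blast
    have "4 * cyl_gamma_rep X L (k, F, f) (n, G, g) \<gamma> = 4 * cyl_gamma_rep X L (k', F', f') (n', G', g') \<gamma>"
      unfolding gamma_polarize[OF r(1,3) \<gamma>] gamma_polarize[OF r(2,4) \<gamma>]
      using elim(1)[rule_format, OF x] elim(2)[rule_format, OF x] elim(3)[rule_format, OF x] elim(4)[rule_format, OF x] by simp
    then show ?case by simp
  qed
qed

lemma Cyl_some_rep: "u \<in> Cyl X \<Longrightarrow> cyl_rep X u (SOME d. cyl_rep X u d)"
  unfolding Cyl_def mem_Collect_eq by (rule someI_ex)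

lemma CylI: "cyl_rep X u d \<Longrightarrow> u \<in> Cyl X" unfolding Cyl_def by blast

lemma CylE: assumes "u \<in> Cyl X" obtains k F f where "cyl_rep X u (k, F, f)"
proof -
  from assms obtain d where d: "cyl_rep X u d" unfolding Cyl_def by blast
  obtain k F f where "d = (k, F, f)" by (metis prod_cases3)
  with d show ?thesis using that by blast
qed

lemma cyl_gamma_AE:
  assumes "cyl_rep X u d" "cyl_rep X v e" shows "AE \<gamma> in \<mu>. cyl_gamma X L u v \<gamma> = cyl_gamma_rep X L d e \<gamma>"
  unfolding cyl_gamma_def
  by (rule cyl_gamma_rep_unique[OF Cyl_some_rep[OF CylI[OF assms(1)]] assms(1) Cyl_some_rep[OF CylI[OF assms(2)]] assms(2)])

text \<open>
  The identity of the square fields for cylinder functions.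
\<close>

lemma lab_gamma_cyl_gamma:
  assumes "u \<in> Cyl X"
  shows "AE \<gamma> in \<mu>. \<forall>x\<in>lcf_inf X. unlabel X (\<infinity>, x) = \<gamma> \<longrightarrow> lab_gamma_defined X L (pull_back X u) x \<and>
    lab_gamma X L (pull_back X u) x = cyl_gamma X L u u \<gamma> \<and> 0 \<le> cyl_gamma X L u u \<gamma>"
proof -
  obtain k F f where u: "cyl_rep X u (k, F, f)" using CylE[OF assms] .
  show ?thesis
    using lab_gamma_cyl[OF u] cyl_gamma_AE[OF u u]
  proof eventually_elim
    case (elim \<gamma>)
    show ?case
    proof (intro ballI impI)
      fix x assume x: "x \<in> lcf_inf X" "unlabel X (\<infinity>, x) = \<gamma>"
      from elim(1)[rule_format, OF x] elim(2) lab_gamma_nonneg[OF _ x(1), of "pull_back X u"]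
      show "lab_gamma_defined X L (pull_back X u) x \<and> lab_gamma X L (pull_back X u) x = cyl_gamma X L u u \<gamma> \<and>
        0 \<le> cyl_gamma X L u u \<gamma>" by auto
    qed
  qed
qed

lemma statistics_measurable:
  assumes f: "\<And>i. i < k \<Longrightarrow> f i \<in> core X" and F: "F \<in> Cb_smooth k"
  shows "(\<lambda>\<gamma>. F (\<lambda>i. star (f i) \<gamma>)) \<in> borel_measurable \<mu>"
proof -
  have "(\<lambda>\<gamma> i. if i < k then star (f i) \<gamma> else 0) \<in> borel_measurable \<mu>"
  proof (rule measurable_coordinatewise_then_product)
    fix i show "(\<lambda>\<gamma>. if i < k then star (f i) \<gamma> else 0) \<in> borel_measurable \<mu>"
      using star_measurable[OF core_measurable[OF f]] by (cases "i < k") auto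
  qed
  from measurable_compose[OF this borel_measurable_continuous_onI[OF Cb_smooth_continuous[OF F]]]
  have "(\<lambda>\<gamma>. F (\<lambda>i. if i < k then star (f i) \<gamma> else 0)) \<in> borel_measurable \<mu>" .
  moreover have "F (\<lambda>i. if i < k then star (f i) \<gamma> else 0) = F (\<lambda>i. star (f i) \<gamma>)" for \<gamma>
    by (rule Cb_smooth_cong[OF F]) simp
  ultimately show ?thesis by simp
qed

lemma Cyl_measurable: assumes "u \<in> Cyl X" shows "u \<in> borel_measurable \<mu>"
proof -
  obtain k F f where u: "cyl_rep X u (k, F, f)" using CylE[OF assms] .
  show ?thesis
    using statistics_measurable[OF cyl_repD(2,1)[OF u]] cyl_repD(3)[OF u]
    by (subst measurable_cong[of _ _ "\<lambda>\<gamma>. F (\<lambda>i. star (f i) \<gamma>)"]) (auto simp: space_\<mu>)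
qed

lemma Cyl_bounded: assumes "u \<in> Cyl X" shows "\<exists>B. \<forall>\<gamma>\<in>Configs X. \<bar>u \<gamma>\<bar> \<le> B"
proof -
  obtain k F f where u: "cyl_rep X u (k, F, f)" using CylE[OF assms] .
  obtain B where "\<And>y. \<bar>F y\<bar> \<le> B" using Cb_smooth_bound[OF cyl_repD(1)[OF u]] by blast
  then show ?thesis using cyl_repD(3)[OF u] by auto
qed

lemma cyl_gamma_rep_integrable:
  assumes u: "cyl_rep X u (k, F, f)" and v: "cyl_rep X v (n, G, g)"
  shows "integrable \<mu> (cyl_gamma_rep X L (k, F, f) (n, G, g))"
proof -
  note F = cyl_repD(1,2)[OF u] and G = cyl_repD(1,2)[OF v]
  have "integrable \<mu> (\<lambda>\<gamma>. pd i F (\<lambda>i. star (f i) \<gamma>) * pd j G (\<lambda>j. star (g j) \<gamma>) * star (L (sqf X (f i) (g j))) \<gamma>)"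
    if ij: "i < k" "j < n" for i j
  proof -
    obtain B1 where B1: "\<And>y. \<bar>pd i F y\<bar> \<le> B1" using Cb_smooth_bound[OF Cb_smooth_pd[OF F(1) ij(1)]] by blast
    obtain B2 where B2: "\<And>y. \<bar>pd j G y\<bar> \<le> B2" using Cb_smooth_bound[OF Cb_smooth_pd[OF G(1) ij(2)]] by blast
    obtain B E where E: "E \<in> lring X" "AE z in m. \<bar>L (sqf X (f i) (g j)) z\<bar> \<le> B * indicator E z"
      using lift_sqf_support[OF F(2)[OF ij(1)] G(2)[OF ij(2)]] by blast
    have Lm: "L (sqf X (f i) (g j)) \<in> borel_measurable m" by (rule lift_measurable[OF sqf_Linf[OF F(2)[OF ij(1)] G(2)[OF ij(2)]]])
    have S: "integrable \<mu> (star (L (sqf X (f i) (g j))))" by (rule star_integrable[OF Lm E])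
    show ?thesis
    proof (rule Bochner_Integration.integrable_bound)
      show "integrable \<mu> (\<lambda>\<gamma>. (B1 * B2) * star (L (sqf X (f i) (g j))) \<gamma>)" using S by simp
      show "(\<lambda>\<gamma>. pd i F (\<lambda>i. star (f i) \<gamma>) * pd j G (\<lambda>j. star (g j) \<gamma>) * star (L (sqf X (f i) (g j))) \<gamma>) \<in> borel_measurable \<mu>"
        by (intro borel_measurable_times statistics_measurable[OF F(2) Cb_smooth_pd[OF F(1) ij(1)]]
            statistics_measurable[OF G(2) Cb_smooth_pd[OF G(1) ij(2)]] star_measurable[OF Lm])
      show "AE \<gamma> in \<mu>. norm (pd i F (\<lambda>i. star (f i) \<gamma>) * pd j G (\<lambda>j. star (g j) \<gamma>) * star (L (sqf X (f i) (g j))) \<gamma>) \<le>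
          norm ((B1 * B2) * star (L (sqf X (f i) (g j))) \<gamma>)"
      proof (rule AE_I2)
        fix \<gamma>
        have "\<bar>pd i F (\<lambda>i. star (f i) \<gamma>)\<bar> * \<bar>pd j G (\<lambda>j. star (g j) \<gamma>)\<bar> \<le> B1 * B2" using B1 B2 by (intro mult_mono') auto
        also have "\<dots> \<le> \<bar>B1 * B2\<bar>" by simp
        finally show "norm (pd i F (\<lambda>i. star (f i) \<gamma>) * pd j G (\<lambda>j. star (g j) \<gamma>) * star (L (sqf X (f i) (g j))) \<gamma>) \<le>
          norm ((B1 * B2) * star (L (sqf X (f i) (g j))) \<gamma>)"
          unfolding real_norm_def abs_mult[of _ "star (L (sqf X (f i) (g j))) \<gamma>"] abs_mult[of "pd i F _"] by (intro mult_right_mono) auto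
      qed
    qed
  qed
  then show ?thesis unfolding cyl_gamma_rep_eq[abs_def] by (intro Bochner_Integration.integrable_sum) auto
qed

lemma cyl_gamma_integrable: assumes "u \<in> Cyl X" "v \<in> Cyl X" shows "integrable \<mu> (cyl_gamma X L u v)"
proof -
  obtain k F f where d: "(SOME d. cyl_rep X u d) = (k, F, f)" by (metis prod_cases3)
  obtain n G g where e: "(SOME d. cyl_rep X v d) = (n, G, g)" by (metis prod_cases3)
  show ?thesis
    using cyl_gamma_rep_integrable[OF Cyl_some_rep[OF assms(1), unfolded d] Cyl_some_rep[OF assms(2), unfolded e]]
    unfolding cyl_gamma_def[abs_def] d e .
qed

lemma Cyl_add_scaled: assumes "u \<in> Cyl X" "v \<in> Cyl X" shows "(\<lambda>\<gamma>. u \<gamma> + c * v \<gamma>) \<in> Cyl X"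
proof -
  obtain k F f where u: "cyl_rep X u (k, F, f)" using CylE[OF assms(1)] .
  obtain n G g where v: "cyl_rep X v (n, G, g)" using CylE[OF assms(2)] .
  show ?thesis by (rule CylI[OF cyl_rep_add[OF u v]])
qed

lemma cyl_rep_mult:
  assumes u: "cyl_rep X u (k, F, f)" and v: "cyl_rep X v (n, G, g)"
  shows "cyl_rep X (\<lambda>\<gamma>. u \<gamma> * v \<gamma>) (k + n, \<lambda>y. F y * right k G y, join k f g)"
proof (rule cyl_repI)
  show "(\<lambda>y. F y * right k G y) \<in> Cb_smooth (k + n)"
    by (rule Cb_smooth_mult[OF left_smooth[OF cyl_repD(1)[OF u]] right_smooth[OF cyl_repD(1)[OF v]]])
qed (use join_core[of k f n g] cyl_repD[OF u] cyl_repD[OF v] in \<open>auto simp: left_eval right_eval\<close>)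

lemma cyl_rep_comp:
  assumes u: "cyl_rep X u (k, F, f)" and \<phi>: "smooth1 \<phi>"
  shows "cyl_rep X (\<lambda>\<gamma>. \<phi> (u \<gamma>) + c) (k, \<lambda>y. \<phi> (F y) + c, f)"
proof (rule cyl_repI)
  show "(\<lambda>y. \<phi> (F y) + c) \<in> Cb_smooth k"
    by (rule Cb_smooth_add[OF Cb_smooth_comp[OF cyl_repD(1)[OF u] \<phi>] Cb_smooth_const])
qed (simp_all add: cyl_repD[OF u])

lemma Cyl_const: "(\<lambda>_. c) \<in> Cyl X"
proof (rule CylI, rule cyl_repI)
  show "(\<lambda>_. c) \<in> Cb_smooth 0" by (rule Cb_smooth_const)
qed simp_all

lemma Cyl_sin: assumes "g \<in> core X" shows "(\<lambda>\<gamma>. sin (star g \<gamma> + b)) \<in> Cyl X"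
proof (rule CylI, rule cyl_repI)
  show "(\<lambda>y. sin (y 0 + b)) \<in> Cb_smooth 1" by (rule Cb_smooth_coord[OF smooth1_sin]) simp
  show "\<And>i. i < 1 \<Longrightarrow> (\<lambda>_. g) i \<in> core X" by (rule assms)
qed simp

lemma cyl_gamma_sym: assumes "u \<in> Cyl X" "v \<in> Cyl X" shows "AE \<gamma> in \<mu>. cyl_gamma X L u v \<gamma> = cyl_gamma X L v u \<gamma>"
proof -
  obtain k F f where u: "cyl_rep X u (k, F, f)" using CylE[OF assms(1)] .
  obtain n G g where v: "cyl_rep X v (n, G, g)" using CylE[OF assms(2)] .
  show ?thesis
    using cyl_gamma_AE[OF u v] cyl_gamma_AE[OF v u] AE_space
    by eventually_elim (use cyl_gamma_rep_sym[OF cyl_repD(2)[OF u] cyl_repD(2)[OF v]] in \<open>simp add: space_\<mu>\<close>)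
qed

lemma cyl_gamma_add_scaled:
  assumes "u \<in> Cyl X" "v \<in> Cyl X" "w \<in> Cyl X"
  shows "AE \<gamma> in \<mu>. cyl_gamma X L (\<lambda>\<gamma>. u \<gamma> + c * v \<gamma>) w \<gamma> = cyl_gamma X L u w \<gamma> + c * cyl_gamma X L v w \<gamma>"
proof -
  obtain k F f where u: "cyl_rep X u (k, F, f)" using CylE[OF assms(1)] .
  obtain n G g where v: "cyl_rep X v (n, G, g)" using CylE[OF assms(2)] .
  obtain n' G' g' where w: "cyl_rep X w (n', G', g')" using CylE[OF assms(3)] .
  show ?thesis
    using cyl_gamma_AE[OF cyl_rep_add[OF u v, of c] w] cyl_gamma_AE[OF u w] cyl_gamma_AE[OF v w]
    by eventually_elim (simp add: gamma_add_left[OF u v])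
qed

lemma cyl_gamma_Leibniz:
  assumes "u \<in> Cyl X" "v \<in> Cyl X" "w \<in> Cyl X"
  shows "AE \<gamma> in \<mu>. cyl_gamma X L (\<lambda>\<gamma>. u \<gamma> * v \<gamma>) w \<gamma> = u \<gamma> * cyl_gamma X L v w \<gamma> + v \<gamma> * cyl_gamma X L u w \<gamma>"
proof -
  obtain k F f where u: "cyl_rep X u (k, F, f)" using CylE[OF assms(1)] .
  obtain n G g where v: "cyl_rep X v (n, G, g)" using CylE[OF assms(2)] .
  obtain n' G' g' where w: "cyl_rep X w (n', G', g')" using CylE[OF assms(3)] .
  note F = cyl_repD(1)[OF u] and G = cyl_repD(1)[OF v]
  have *: "cyl_gamma_rep X L (k + n, \<lambda>y. F y * right k G y, join k f g) e \<gamma> =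
    v \<gamma> * cyl_gamma_rep X L (k, F, f) e \<gamma> + u \<gamma> * cyl_gamma_rep X L (n, G, g) e \<gamma>" if "\<gamma> \<in> Configs X" for e \<gamma>
    by (rule rep_combine[OF F G])
      (simp add: pd_mult[OF left_smooth[OF F, of n] right_smooth[OF G, of k]] left_eval[OF F] right_eval
        cyl_repD(3)[OF u that] cyl_repD(3)[OF v that] mult.commute)
  show ?thesis
    using cyl_gamma_AE[OF cyl_rep_mult[OF u v] w] cyl_gamma_AE[OF u w] cyl_gamma_AE[OF v w] AE_space
    by eventually_elim (simp add: * space_\<mu>)
qed

lemma cyl_gamma_chain:
  assumes "u \<in> Cyl X" "w \<in> Cyl X" "smooth1 \<phi>"
  shows "AE \<gamma> in \<mu>. cyl_gamma X L (\<lambda>\<gamma>. \<phi> (u \<gamma>) + c) w \<gamma> = deriv \<phi> (u \<gamma>) * cyl_gamma X L u w \<gamma>"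
proof -
  obtain k F f where u: "cyl_rep X u (k, F, f)" using CylE[OF assms(1)] .
  obtain n' G' g' where w: "cyl_rep X w (n', G', g')" using CylE[OF assms(2)] .
  note F = cyl_repD(1)[OF u]
  have pc: "pd i (\<lambda>_. c) y = 0" for i y by (rule pd_eqI) simp
  have *: "cyl_gamma_rep X L (k, \<lambda>y. \<phi> (F y) + c, f) e \<gamma> = deriv \<phi> (u \<gamma>) * cyl_gamma_rep X L (k, F, f) e \<gamma>" if "\<gamma> \<in> Configs X" for e \<gamma>
    by (rule rep_outer[OF F])
      (simp add: pd_add[OF Cb_smooth_comp[OF F assms(3)] Cb_smooth_const[of c k]] pd_comp[OF F assms(3)] pc cyl_repD(3)[OF u that])
  show ?thesis
    using cyl_gamma_AE[OF cyl_rep_comp[OF u assms(3), of c] w] cyl_gamma_AE[OF u w] AE_space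
    by eventually_elim (simp add: * space_\<mu>)
qed

end

section \<open>Cylinder functions separate integrable functions\<close>

lemma prod_cos_eq_0:
  fixes k :: int
  assumes "k \<noteq> 0"
  shows "\<exists>a. \<forall>J\<ge>a. (\<Prod>i<J. cos (pi * of_int k / 2 ^ Suc i)) = 0"
proof -
  have "\<exists>a. cos (pi * of_int k / 2 ^ Suc a) = 0"
    using assms
  proof (induction "nat \<bar>k\<bar>" arbitrary: k rule: less_induct)
    case less
    show ?case
    proof (cases "even k")
      case True
      then obtain j where j: "k = 2 * j" by blast
      then have "nat \<bar>j\<bar> < nat \<bar>k\<bar>" "j \<noteq> 0" using less.prems by auto
      from less.hyps[OF this] obtain a where "cos (pi * of_int j / 2 ^ Suc a) = 0" by blast
      then have "cos (pi * of_int k / 2 ^ Suc (Suc a)) = 0" using j by simp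
      then show ?thesis by blast
    next
      case False
      then have "cos (of_int k * (pi / 2)) = 0" unfolding cos_zero_iff_int by blast
      then have "cos (pi * of_int k / 2 ^ Suc 0) = 0" by (simp add: mult.commute)
      then show ?thesis by blast
    qed
  qed
  then obtain a where a: "cos (pi * of_int k / 2 ^ Suc a) = 0" by blast
  have "(\<Prod>i<J. cos (pi * of_int k / 2 ^ Suc i)) = 0" if "Suc a \<le> J" for J
    using a that by (intro prod_zero) (auto intro!: bexI[of _ a])
  then show ?thesis by blast
qed

context lifted_config_space
begin

text \<open>
  Measurable functions, bounded and supported in a set of the localizing ring up to a null set, that
  are limits of bounded sequences of core functions.  The supports of the core functions need not lie
  in a common set of the ring.
\<close>

definition reach :: "('a \<Rightarrow> real) set" where
  "reach = {g \<in> borel_measurable m. (\<exists>E\<in>lring X. \<exists>B. AE x in m. \<bar>g x\<bar> \<le> B * indicator E x) \<and>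
     (\<exists>e B. (\<forall>n. e n \<in> core X) \<and> (\<forall>n x. \<bar>e n x\<bar> \<le> B) \<and> (AE x in m. (\<lambda>n. e n x) \<longlonglongrightarrow> g x))}"

lemma reach_zero: "(\<lambda>_. 0) \<in> reach"
  unfolding reach_def using core_zero empty_lring by (auto intro!: bexI[of _ "{}"] exI[of _ "0::real"] exI[of _ "\<lambda>_ _. 0::real"])

lemma reach_add_indicator:
  assumes g: "g \<in> reach" and E: "E \<in> lring X" shows "(\<lambda>x. g x + c * indicator E x) \<in> reach"
proof -
  from g obtain E' B where 1: "E' \<in> lring X" "AE x in m. \<bar>g x\<bar> \<le> B * indicator E' x" unfolding reach_def by blast
  from g obtain e B' where e: "\<And>n. e n \<in> core X" "\<And>n x. \<bar>e n x\<bar> \<le> B'" "AE x in m. (\<lambda>n. e n x) \<longlonglongrightarrow> g x"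
    unfolding reach_def by blast
  have Em: "E \<in> sets m" "emeasure m E < \<infinity>" using lring_sets[OF E] lring_finite[OF E] by auto
  obtain e' B'' where e': "\<And>n. e' n \<in> core X" "\<And>n x. \<bar>e' n x\<bar> \<le> B''" "AE x in m. (\<lambda>n. e' n x) \<longlonglongrightarrow> indicator E x"
    using core_approx_indicator[OF Em] by blast
  have [measurable]: "g \<in> borel_measurable m" using g unfolding reach_def by blast
  note Em(1)[measurable]
  have "(\<lambda>x. g x + c * indicator E x) \<in> borel_measurable m" by measurable
  moreover have "AE x in m. \<bar>g x + c * indicator E x\<bar> \<le> (\<bar>B\<bar> + \<bar>c\<bar>) * indicator (E' \<union> E) x"
    using 1(2) by eventually_elim (auto split: split_indicator split_indicator_asm)
  moreover have "E' \<union> E \<in> lring X" by (rule lring_Un[OF 1(1) E])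
  moreover have "\<forall>n. (\<lambda>x. e n x + c * e' n x) \<in> core X" using core_add core_scale e(1) e'(1) by blast
  moreover have "\<forall>n x. \<bar>e n x + c * e' n x\<bar> \<le> B' + \<bar>c\<bar> * B''"
  proof (intro allI)
    fix n x
    have "\<bar>c * e' n x\<bar> \<le> \<bar>c\<bar> * B''" unfolding abs_mult using e'(2) by (rule mult_left_mono) simp
    then show "\<bar>e n x + c * e' n x\<bar> \<le> B' + \<bar>c\<bar> * B''" using e(2)[of n x] by linarith
  qed
  moreover have "AE x in m. (\<lambda>n. e n x + c * e' n x) \<longlonglongrightarrow> g x + c * indicator E x"
    using e(3) e'(3) by eventually_elim (intro tendsto_intros)
  ultimately show ?thesis unfolding reach_def mem_Collect_eq
    by (intro conjI bexI[of _ "E' \<union> E"] exI[of _ "\<bar>B\<bar> + \<bar>c\<bar>"] exI[of _ "\<lambda>n x. e n x + c * e' n x"] exI[of _ "B' + \<bar>c\<bar> * B''"])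
qed

text \<open>
  Core functions with values in \<open>[0,1]\<close>; almost every point lies in all but finitely many of their positivity sets.
\<close>

lemma core_exhausting:
  "\<exists>F. (\<forall>K. F K \<in> core X) \<and> (\<forall>K x. 0 \<le> F K x \<and> F K x \<le> 1) \<and> (AE x in m. \<forall>\<^sub>F K in sequentially. 0 < F K x)"
proof -
  obtain Eh :: "nat \<Rightarrow> 'a set" where Eh: "(\<Union>h. Eh h) = pts X" "\<And>h. Eh h \<in> lring X" using exhaustion by metis
  have "\<exists>e. (\<forall>n. e n \<in> core X) \<and> (AE x in m. (\<lambda>n. e n x) \<longlonglongrightarrow> indicator (Eh h) x)" for h
    using core_approx_indicator[of "Eh h"] lring_sets[OF Eh(2)] lring_finite[OF Eh(2)] by blast
  then obtain e where e: "\<And>h n. e h n \<in> core X" "\<And>h. AE x in m. (\<lambda>n. e h n x) \<longlonglongrightarrow> indicator (Eh h) x" by metis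
  define f where "f i = (case prod_decode i of (h, n) \<Rightarrow> e h n)" for i
  have f: "f i \<in> core X" for i unfolding f_def using e(1) by (simp split: prod.split)
  define q where "q K x = (\<Sum>i<K. f i x * f i x)" for K :: nat and x
  have q: "q K \<in> core X" for K
  proof (induction K)
    case 0 show ?case using core_zero by (simp add: q_def[abs_def])
  next
    case (Suc K)
    have "q (Suc K) = (\<lambda>x. q K x + f K x * f K x)" by (simp add: q_def[abs_def])
    then show ?case using core_add[OF Suc core_mult[OF f f]] by simp
  qed
  have "\<exists>R>0. \<forall>x. q K x \<le> R" for K using core_bounded[OF q[of K]] by (meson abs_le_D1)
  then obtain R where R: "\<And>K. R K > 0" "\<And>K x. q K x \<le> R K" by metis
  define F where "F K = (\<lambda>x. inverse (R K) * q K x)" for K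
  have "F K \<in> core X" for K unfolding F_def by (rule core_scale[OF q])
  moreover have "0 \<le> F K x \<and> F K x \<le> 1" for K x
    using R[of K] by (auto simp: F_def q_def field_simps intro!: divide_nonneg_pos sum_nonneg)
  moreover have "AE x in m. \<forall>\<^sub>F K in sequentially. 0 < F K x"
  proof -
    have "AE x in m. \<forall>h. (\<lambda>n. e h n x) \<longlonglongrightarrow> indicator (Eh h) x" unfolding AE_all_countable using e(2) by blast
    then show ?thesis using AE_space
    proof eventually_elim
      case (elim x)
      then obtain h where h: "x \<in> Eh h" using Eh(1) space_m by blast
      with elim(1) have "(\<lambda>n. e h n x) \<longlonglongrightarrow> 1" by (metis indicator_simps(1))
      then have "\<forall>\<^sub>F n in sequentially. 0 < e h n x" by (rule order_tendstoD) simp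
      then obtain n where n: "0 < e h n x" by (auto simp: eventually_sequentially)
      have "0 < F K x" if "prod_encode (h, n) < K" for K
      proof -
        have "0 < q K x" unfolding q_def
          using n that by (intro sum_pos2[of _ "prod_encode (h, n)"]) (auto simp: f_def)
        then show ?thesis unfolding F_def using R(1)[of K] by simp
      qed
      then show ?case by (intro eventually_sequentiallyI[of "Suc (prod_encode (h, n))"]) simp
    qed
  qed
  ultimately show ?thesis by blast
qed

text \<open>
  \<open>orth w\<close> says that \<open>w\<close> is orthogonal to all \<open>sin (g\<^sup>\<star> + b)\<close> with \<open>g\<close> in \<open>reach\<close>.  The phase \<open>b\<close> makes this
  include \<open>cos (g\<^sup>\<star>)\<close> and, for \<open>g = 0\<close>, the constants.
\<close>

definition orth :: "('a measure \<Rightarrow> real) \<Rightarrow> bool" where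
  "orth w \<longleftrightarrow> integrable \<mu> w \<and> (\<forall>g\<in>reach. \<forall>b. (LINT \<gamma>|\<mu>. w \<gamma> * sin (star g \<gamma> + b)) = 0)"

lemma integrable_times_bounded:
  assumes "integrable \<mu> w" "h \<in> borel_measurable \<mu>" "\<And>\<gamma>. \<bar>h \<gamma>\<bar> \<le> 1"
  shows "integrable \<mu> (\<lambda>\<gamma>. w \<gamma> * h \<gamma> :: real)"
proof (rule Bochner_Integration.integrable_bound[OF assms(1)])
  show "(\<lambda>\<gamma>. w \<gamma> * h \<gamma>) \<in> borel_measurable \<mu>" using assms(1,2) by (intro borel_measurable_times) auto
  show "AE \<gamma> in \<mu>. norm (w \<gamma> * h \<gamma>) \<le> norm (w \<gamma>)"
    using assms(3) by (intro AE_I2) (simp add: abs_mult mult_left_le)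
qed

lemma reach_measurable: "g \<in> reach \<Longrightarrow> star g \<in> borel_measurable \<mu>"
  unfolding reach_def using star_measurable by blast

lemma sin_star_measurable: "star g \<in> borel_measurable \<mu> \<Longrightarrow> (\<lambda>\<gamma>. sin (star g \<gamma> + b)) \<in> borel_measurable \<mu>"
  by (rule measurable_compose[of "star g" \<mu> borel "\<lambda>t. sin (t + b)"])
    (auto intro!: borel_measurable_continuous_onI continuous_intros)

lemma trig_limit:
  assumes w: "integrable \<mu> w"
    and gs: "\<And>n. gs n \<in> borel_measurable m" and g: "g \<in> borel_measurable m" and E: "E \<in> lring X"
    and B: "\<And>n. AE z in m. \<bar>gs n z\<bar> \<le> B * indicator E z" and lim: "AE z in m. (\<lambda>n. gs n z) \<longlonglongrightarrow> g z"
    and 0: "\<And>n b. (LINT \<gamma>|\<mu>. w \<gamma> * sin (star (gs n) \<gamma> + b)) = 0"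
  shows "(LINT \<gamma>|\<mu>. w \<gamma> * sin (star g \<gamma> + b)) = 0"
proof -
  have "(\<lambda>n. LINT \<gamma>|\<mu>. w \<gamma> * sin (star (gs n) \<gamma> + b)) \<longlonglongrightarrow> (LINT \<gamma>|\<mu>. w \<gamma> * sin (star g \<gamma> + b))"
  proof (rule integral_dominated_convergence)
    show "integrable \<mu> (\<lambda>\<gamma>. \<bar>w \<gamma>\<bar>)" using w by simp
    show "AE \<gamma> in \<mu>. (\<lambda>n. w \<gamma> * sin (star (gs n) \<gamma> + b)) \<longlonglongrightarrow> w \<gamma> * sin (star g \<gamma> + b)"
      using star_dominated[OF gs g E B lim] by eventually_elim (intro tendsto_intros)
    show "AE \<gamma> in \<mu>. norm (w \<gamma> * sin (star (gs n) \<gamma> + b)) \<le> \<bar>w \<gamma>\<bar>" for n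
      by (intro AE_I2) (simp add: abs_mult mult_left_le)
  qed (use w sin_star_measurable[OF star_measurable] gs g in \<open>auto intro!: borel_measurable_times\<close>)
  then show ?thesis unfolding 0 using LIMSEQ_unique tendsto_const by metis
qed

text \<open>
  Trigonometric functions of \<open>e\<^sup>\<star>\<close> with \<open>e\<close> in the core are cylinder functions.  To reach \<open>g\<close>, with
  approximants \<open>e\<^sub>n\<close>, domination by a multiple of the indicator of one set of the ring is needed in
  each limit.  Therefore \<open>e\<^sub>n\<close> is multiplied by \<open>P\<^sub>K\<^sub>,\<^sub>j = 1 - (1 - F\<^sub>K)\<^sup>j\<close>, which lies in the core,
  vanishes where \<open>F\<^sub>K\<close> does, and increases with \<open>j\<close> to the indicator of \<open>{F\<^sub>K > 0}\<close>; the limits are taken in the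
  order \<open>n\<close>, \<open>j\<close>, \<open>K\<close>.
\<close>

lemma orthI:
  assumes w: "integrable \<mu> w" and 0: "\<And>h. h \<in> Cyl X \<Longrightarrow> (LINT \<gamma>|\<mu>. h \<gamma> * w \<gamma>) = 0"
  shows "orth w"
proof -
  have core: "(LINT \<gamma>|\<mu>. w \<gamma> * sin (star g \<gamma> + b)) = 0" if "g \<in> core X" for g b
    using 0[OF Cyl_sin[OF that, of b]] by (simp add: mult.commute)
  have "(LINT \<gamma>|\<mu>. w \<gamma> * sin (star g \<gamma> + b)) = 0" if g: "g \<in> reach" for g b
  proof -
    from g obtain E B where E: "E \<in> lring X" "AE x in m. \<bar>g x\<bar> \<le> B * indicator E x" unfolding reach_def by blast
    from g obtain e B' where e: "\<And>n. e n \<in> core X" "\<And>n x. \<bar>e n x\<bar> \<le> B'" "AE x in m. (\<lambda>n. e n x) \<longlonglongrightarrow> g x"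
      unfolding reach_def by blast
    have gm [measurable]: "g \<in> borel_measurable m" using g unfolding reach_def by blast
    obtain F where F: "\<And>K. F K \<in> core X" "\<And>K x. 0 \<le> F K x" "\<And>K x. F K x \<le> 1"
      "AE x in m. \<forall>\<^sub>F K in sequentially. 0 < F K x" using core_exhausting by blast
    note core_measurable[OF F(1), measurable] core_measurable[OF e(1), measurable]
    define P where "P K j = (\<lambda>x. 1 - (1 - F K x) ^ j)" for K and j :: nat
    have Pc: "P K j \<in> core X" for K j
    proof (induction j)
      case 0 show ?case using core_zero by (simp add: P_def)
    next
      case (Suc j)
      have "P K (Suc j) = (\<lambda>x. P K j x + (F K x + (-1) * (F K x * P K j x)))"
        by (simp add: P_def fun_eq_iff algebra_simps)
      then show ?case using core_add[OF Suc core_add[OF F(1)[of K] core_scale[OF core_mult[OF F(1)[of K] Suc], of "-1"]]] by simp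
    qed
    have P01: "0 \<le> P K j x" "P K j x \<le> 1" for K j x
      unfolding P_def using F(2,3)[of K x] by (auto intro: power_le_one)
    have P0: "P K j x = 0" if "F K x = 0" for K j x using that by (simp add: P_def)
    have Pm [measurable]: "P K j \<in> borel_measurable m" for K j by (rule core_measurable[OF Pc])
    have Plim: "(\<lambda>j. P K j x) \<longlonglongrightarrow> (if 0 < F K x then 1 else 0)" for K x
    proof (cases "0 < F K x")
      case True
      then have "(\<lambda>j. 1 - (1 - F K x) ^ j) \<longlonglongrightarrow> 1 - 0"
        using F(3)[of K x] by (intro tendsto_intros LIMSEQ_power_zero) auto
      then show ?thesis using True by (simp add: P_def)
    next
      case False
      then have "F K x = 0" using F(2)[of K x] by simp
      then show ?thesis using P0 by simp
    qed
    have bdd: "AE x in m. \<bar>g x * t x\<bar> \<le> B * indicator E x" if "\<And>x. 0 \<le> t x" "\<And>x. t x \<le> 1" for t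
      using E(2)
    proof eventually_elim
      case (elim x)
      have "\<bar>g x * t x\<bar> \<le> \<bar>g x\<bar>" unfolding abs_mult using that[of x] by (simp add: mult_left_le)
      with elim show ?case by linarith
    qed
    have 1: "(LINT \<gamma>|\<mu>. w \<gamma> * sin (star (\<lambda>x. g x * P K j x) \<gamma> + b)) = 0" for K j b
    proof -
      obtain EK where EK: "EK \<in> lring X" "\<And>x. x \<notin> EK \<Longrightarrow> F K x = 0" using core_support[OF F(1)[of K]] by blast
      show ?thesis
      proof (rule trig_limit[OF w _ _ EK(1), where gs = "\<lambda>n x. e n x * P K j x"])
        show "AE z in m. \<bar>e n z * P K j z\<bar> \<le> B' * indicator EK z" for n
        proof (rule AE_I2)
          fix z
          have "\<bar>e n z * P K j z\<bar> \<le> \<bar>e n z\<bar>" unfolding abs_mult using P01[of K j z] by (simp add: mult_left_le)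
          then show "\<bar>e n z * P K j z\<bar> \<le> B' * indicator EK z"
            using e(2)[of n z] P0[OF EK(2), of z j] by (cases "z \<in> EK") auto
        qed
        show "AE z in m. (\<lambda>n. e n z * P K j z) \<longlonglongrightarrow> g z * P K j z" using e(3) by eventually_elim (intro tendsto_intros)
        show "(LINT \<gamma>|\<mu>. w \<gamma> * sin (star (\<lambda>x. e n x * P K j x) \<gamma> + b)) = 0" for n b
          by (rule core[OF core_mult[OF e(1) Pc]])
      qed measurable
    qed
    have 2: "(LINT \<gamma>|\<mu>. w \<gamma> * sin (star (\<lambda>x. g x * (if 0 < F K x then 1 else 0)) \<gamma> + b)) = 0" for K b
    proof (rule trig_limit[OF w _ _ E(1), where gs = "\<lambda>j x. g x * P K j x"])
      show "AE z in m. \<bar>g z * P K j z\<bar> \<le> B * indicator E z" for j by (rule bdd) (rule P01)+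
      show "AE z in m. (\<lambda>j. g z * P K j z) \<longlonglongrightarrow> g z * (if 0 < F K z then 1 else 0)"
        by (intro AE_I2 tendsto_mult tendsto_const Plim)
    qed (use 1 in measurable)
    show ?thesis
    proof (rule trig_limit[OF w _ _ E(1), where gs = "\<lambda>K x. g x * (if 0 < F K x then 1 else 0)"])
      show "AE z in m. \<bar>g z * (if 0 < F K z then 1 else 0)\<bar> \<le> B * indicator E z" for K by (rule bdd) auto
      show "AE z in m. (\<lambda>K. g z * (if 0 < F K z then 1 else 0)) \<longlonglongrightarrow> g z"
        using F(4) by eventually_elim (rule tendsto_eventually, erule eventually_mono, simp)
    qed (use 2 in measurable)
  qed
  then show ?thesis unfolding orth_def using w by blast
qed

lemma orthD: "orth w \<Longrightarrow> integrable \<mu> w" "orth w \<Longrightarrow> g \<in> reach \<Longrightarrow> (LINT \<gamma>|\<mu>. w \<gamma> * sin (star g \<gamma> + b)) = 0"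
  unfolding orth_def by auto

lemma orth_sin_integrable: "orth w \<Longrightarrow> g \<in> reach \<Longrightarrow> integrable \<mu> (\<lambda>\<gamma>. w \<gamma> * sin (star g \<gamma> + b))"
  by (rule integrable_times_bounded[OF orthD(1) sin_star_measurable[OF reach_measurable]]) auto

lemma orth_add_scaled: assumes "orth v" "orth w" shows "orth (\<lambda>\<gamma>. v \<gamma> + c * w \<gamma>)"
  unfolding orth_def
proof (intro conjI ballI allI)
  show "integrable \<mu> (\<lambda>\<gamma>. v \<gamma> + c * w \<gamma>)" using orthD(1)[OF assms(1)] orthD(1)[OF assms(2)] by simp
  fix g b assume g: "g \<in> reach"
  show "(LINT \<gamma>|\<mu>. (v \<gamma> + c * w \<gamma>) * sin (star g \<gamma> + b)) = 0"
    using orth_sin_integrable[OF assms(1) g, of b] orth_sin_integrable[OF assms(2) g, of b] orthD(2)[OF assms(1) g, of b]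
      orthD(2)[OF assms(2) g, of b] by (simp add: distrib_right mult.assoc)
qed

lemma orth_limit:
  assumes ws: "\<And>n. orth (ws n)" and v: "integrable \<mu> v" and b: "\<And>n \<gamma>. \<bar>ws n \<gamma>\<bar> \<le> v \<gamma>"
    and lim: "AE \<gamma> in \<mu>. (\<lambda>n. ws n \<gamma>) \<longlonglongrightarrow> w \<gamma>" and w: "w \<in> borel_measurable \<mu>"
  shows "orth w"
  unfolding orth_def
proof (intro conjI ballI allI)
  show "integrable \<mu> w"
    by (rule integrable_dominated_convergence[OF w _ v lim]) (use b orthD(1)[OF ws] in auto)
  fix g b' assume g: "g \<in> reach"
  have "(\<lambda>n. LINT \<gamma>|\<mu>. ws n \<gamma> * sin (star g \<gamma> + b')) \<longlonglongrightarrow> (LINT \<gamma>|\<mu>. w \<gamma> * sin (star g \<gamma> + b'))"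
  proof (rule integral_dominated_convergence[OF _ _ v])
    show "AE \<gamma> in \<mu>. (\<lambda>n. ws n \<gamma> * sin (star g \<gamma> + b')) \<longlonglongrightarrow> w \<gamma> * sin (star g \<gamma> + b')"
      using lim by eventually_elim (intro tendsto_intros)
    show "AE \<gamma> in \<mu>. norm (ws n \<gamma> * sin (star g \<gamma> + b')) \<le> v \<gamma>" for n
    proof (rule AE_I2)
      fix \<gamma>
      have "\<bar>ws n \<gamma>\<bar> * \<bar>sin (star g \<gamma> + b')\<bar> \<le> \<bar>ws n \<gamma>\<bar>" by (simp add: mult_left_le)
      then show "norm (ws n \<gamma> * sin (star g \<gamma> + b')) \<le> v \<gamma>" using b[of n \<gamma>] by (simp add: abs_mult)
    qed
    show "(\<lambda>\<gamma>. w \<gamma> * sin (star g \<gamma> + b')) \<in> borel_measurable \<mu>"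
      by (intro borel_measurable_times w sin_star_measurable reach_measurable g)
    show "(\<lambda>\<gamma>. ws n \<gamma> * sin (star g \<gamma> + b')) \<in> borel_measurable \<mu>" for n
      using orth_sin_integrable[OF ws g] by auto
  qed
  then show "(LINT \<gamma>|\<mu>. w \<gamma> * sin (star g \<gamma> + b')) = 0" unfolding orthD(2)[OF ws g]
    using LIMSEQ_unique tendsto_const by metis
qed

lemma orth_cong: assumes "orth v" "AE \<gamma> in \<mu>. v \<gamma> = w \<gamma>" "w \<in> borel_measurable \<mu>" shows "orth w"
  by (rule orth_limit[of "\<lambda>_. v" "\<lambda>\<gamma>. \<bar>v \<gamma>\<bar>"])
    (use assms orthD(1)[OF assms(1)] in \<open>auto intro: tendsto_const elim!: eventually_mono\<close>)

abbreviation count :: "'a set \<Rightarrow> 'a measure \<Rightarrow> real" where "count E \<gamma> \<equiv> enn2real (emeasure \<gamma> E)"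

lemma count_measurable: "E \<in> lring X \<Longrightarrow> count E \<in> borel_measurable \<mu>"
  using count_integrable by blast

text \<open>
  The product-to-sum formula; \<open>reach\<close> is closed under adding multiples of the indicator of \<open>E\<close>.
\<close>

lemma orth_cos:
  assumes w: "orth w" and E: "E \<in> lring X" shows "orth (\<lambda>\<gamma>. w \<gamma> * cos (c * count E \<gamma> + d))"
  unfolding orth_def
proof (intro conjI ballI allI)
  note count_measurable[OF E, measurable]
  show "integrable \<mu> (\<lambda>\<gamma>. w \<gamma> * cos (c * count E \<gamma> + d))"
    by (rule integrable_times_bounded[OF orthD(1)[OF w]]) auto
  fix g b assume g: "g \<in> reach"
  let ?g = "\<lambda>c x. g x + c * indicator E x"
  have *: "AE \<gamma> in \<mu>. \<forall>c\<in>{c, - c}. star (?g c) \<gamma> = star g \<gamma> + c * count E \<gamma>"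
  proof -
    from g obtain E' B where 1: "E' \<in> lring X" "AE x in m. \<bar>g x\<bar> \<le> B * indicator E' x" unfolding reach_def by blast
    have gm: "g \<in> borel_measurable m" using g unfolding reach_def by blast
    have Em: "indicator E \<in> borel_measurable m" using lring_sets[OF E] by simp
    have Eb: "AE z in m. \<bar>indicator E z :: real\<bar> \<le> 1 * indicator E z" by simp
    show ?thesis
      using star_bounded[OF gm 1] star_bounded[OF Em E Eb] AE_space
    proof eventually_elim
      case (elim \<gamma>)
      then have i: "integrable \<gamma> g" "integrable \<gamma> (indicator E :: _ \<Rightarrow> real)" and "\<gamma> \<in> Configs X" by (auto simp: space_\<mu>)
      have "star (?g c) \<gamma> = star g \<gamma> + c * count E \<gamma>" for c
        using star_add[of \<gamma> g "\<lambda>x. c * indicator E x"] i star_cmult[of c "indicator E" \<gamma>] star_indicator[OF \<open>\<gamma> \<in> Configs X\<close> E] by simp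
      then show ?case by simp
    qed
  qed
  have "(LINT \<gamma>|\<mu>. w \<gamma> * cos (c * count E \<gamma> + d) * sin (star g \<gamma> + b)) =
    (LINT \<gamma>|\<mu>. w \<gamma> * sin (star (?g c) \<gamma> + (b + d)) / 2 + w \<gamma> * sin (star (?g (- c)) \<gamma> + (b - d)) / 2)"
  proof (rule integral_cong_AE)
    note [measurable] = reach_measurable[OF reach_add_indicator[OF g E]] reach_measurable[OF g]
    have [measurable]: "w \<in> borel_measurable \<mu>" using orthD(1)[OF w] by auto
    show "(\<lambda>\<gamma>. w \<gamma> * cos (c * count E \<gamma> + d) * sin (star g \<gamma> + b)) \<in> borel_measurable \<mu>" by measurable
    show "(\<lambda>\<gamma>. w \<gamma> * sin (star (?g c) \<gamma> + (b + d)) / 2 + w \<gamma> * sin (star (?g (- c)) \<gamma> + (b - d)) / 2) \<in> borel_measurable \<mu>"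
      by measurable
    show "AE \<gamma> in \<mu>. w \<gamma> * cos (c * count E \<gamma> + d) * sin (star g \<gamma> + b) =
      w \<gamma> * sin (star (?g c) \<gamma> + (b + d)) / 2 + w \<gamma> * sin (star (?g (- c)) \<gamma> + (b - d)) / 2"
      using *
    proof eventually_elim
      case (elim \<gamma>)
      have trig: "cos t * sin s = sin (s + t) / 2 + sin (s - t) / 2" for s t :: real by (simp add: sin_add sin_diff field_simps)
      have e: "star (?g c) \<gamma> + (b + d) = star g \<gamma> + b + (c * count E \<gamma> + d)"
        "star (?g (- c)) \<gamma> + (b - d) = star g \<gamma> + b - (c * count E \<gamma> + d)" using elim by auto
      show ?case unfolding e mult.assoc trig by (simp add: distrib_left)
    qed
  qed
  also have "\<dots> = 0"
    using orth_sin_integrable[OF w reach_add_indicator[OF g E, of c], of "b + d"]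
      orth_sin_integrable[OF w reach_add_indicator[OF g E, of "- c"], of "b - d"]
      orthD(2)[OF w reach_add_indicator[OF g E, of c], of "b + d"]
      orthD(2)[OF w reach_add_indicator[OF g E, of "- c"], of "b - d"] by simp
  finally show "(LINT \<gamma>|\<mu>. w \<gamma> * cos (c * count E \<gamma> + d) * sin (star g \<gamma> + b)) = 0" .
qed

text \<open>
  The product of \<open>cos (\<pi> (N - n) / 2 ^ i)\<close> for \<open>1 \<le> i \<le> J\<close> is 1 for \<open>N = n\<close>, and for any other
  integer \<open>N\<close> it vanishes for large \<open>J\<close>.
\<close>

lemma orth_count:
  assumes w: "orth w" and E: "E \<in> lring X"
  shows "orth (\<lambda>\<gamma>. w \<gamma> * (if emeasure \<gamma> E = of_nat n then 1 else 0))"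
proof -
  define c where "c i \<gamma> = cos (pi / 2 ^ Suc i * count E \<gamma> + - (pi / 2 ^ Suc i * real n))" for i \<gamma>
  have wm [measurable]: "w \<in> borel_measurable \<mu>" using orthD(1)[OF w] by auto
  note emeasure_lring_measurable[OF E, measurable]
  show ?thesis
  proof (rule orth_limit[where ws = "\<lambda>J \<gamma>. w \<gamma> * (\<Prod>i<J. c i \<gamma>)"])
    show "orth (\<lambda>\<gamma>. w \<gamma> * (\<Prod>i<J. c i \<gamma>))" for J
    proof (induction J)
      case (Suc J)
      have eq: "(\<lambda>\<gamma>. w \<gamma> * (\<Prod>i<Suc J. c i \<gamma>)) = (\<lambda>\<gamma>. (w \<gamma> * (\<Prod>i<J. c i \<gamma>)) * c J \<gamma>)" by (simp add: mult.assoc)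
      show ?case unfolding eq c_def[of J] by (rule orth_cos[OF Suc E])
    qed (use w in simp)
    show "integrable \<mu> (\<lambda>\<gamma>. \<bar>w \<gamma>\<bar>)" using orthD(1)[OF w] by simp
    show "\<bar>w \<gamma> * (\<Prod>i<J. c i \<gamma>)\<bar> \<le> \<bar>w \<gamma>\<bar>" for J \<gamma>
    proof -
      have "(\<Prod>i<J. \<bar>c i \<gamma>\<bar>) \<le> 1" by (rule prod_le_1) (auto simp: c_def)
      then show ?thesis unfolding abs_mult abs_prod by (simp add: mult_left_le)
    qed
    show "AE \<gamma> in \<mu>. (\<lambda>J. w \<gamma> * (\<Prod>i<J. c i \<gamma>)) \<longlonglongrightarrow> w \<gamma> * (if emeasure \<gamma> E = of_nat n then 1 else 0)"
      using AE_space
    proof eventually_elim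
      case (elim \<gamma>)
      then obtain N where N: "emeasure \<gamma> E = of_nat N" using Configs_of_nat[OF _ E] space_\<mu> by blast
      have c: "c i \<gamma> = cos (pi * of_int (int N - int n) / 2 ^ Suc i)" for i
        by (simp add: c_def N diff_divide_distrib right_diff_distrib)
      show ?case
      proof (cases "N = n")
        case True
        then show ?thesis using c N by simp
      next
        case False
        then obtain a where a: "\<forall>J\<ge>a. (\<Prod>i<J. c i \<gamma>) = 0" using prod_cos_eq_0[of "int N - int n"] unfolding c by auto
        have "\<forall>\<^sub>F J in sequentially. w \<gamma> * (\<Prod>i<J. c i \<gamma>) = 0"
          by (rule eventually_sequentiallyI[of a]) (use a in auto)
        then show ?thesis using False N by (simp add: tendsto_eventually)
      qed
    qed
    show "(\<lambda>\<gamma>. w \<gamma> * (if emeasure \<gamma> E = of_nat n then 1 else 0)) \<in> borel_measurable \<mu>" by measurable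
  qed
qed

text \<open>
  Sets whose indicator preserves \<open>orth\<close>, for all \<open>w\<close> at once, are closed under intersection, hence form
  a \<open>\<sigma>\<close>-algebra.
\<close>

lemma orth_indicator:
  assumes "A \<in> sets \<mu>" and "orth w" shows "orth (\<lambda>\<gamma>. w \<gamma> * indicator A \<gamma>)"
proof -
  have Un: "orth (\<lambda>\<gamma>. w \<gamma> * indicator (\<Union>i. A i) \<gamma>)"
    if w: "orth w" and A: "\<And>i w. orth w \<Longrightarrow> orth (\<lambda>\<gamma>. w \<gamma> * indicator (A i) \<gamma>)" and Am: "\<And>i. A i \<in> sets \<mu>"
    for w and A :: "nat \<Rightarrow> 'a measure set"
  proof (rule orth_limit[where ws = "\<lambda>n \<gamma>. w \<gamma> * indicator (\<Union>i<n. A i) \<gamma>"])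
    show "orth (\<lambda>\<gamma>. w \<gamma> * indicator (\<Union>i<n. A i) \<gamma>)" for n
    proof (induction n)
      case 0 show ?case using orth_add_scaled[OF w w, of "-1"] by simp
    next
      case (Suc n)
      have "(\<lambda>\<gamma>. w \<gamma> * indicator (\<Union>i<Suc n. A i) \<gamma>) = (\<lambda>\<gamma>. (w \<gamma> * indicator (\<Union>i<n. A i) \<gamma> + 1 * (w \<gamma> * indicator (A n) \<gamma>)) +
        (-1) * (w \<gamma> * indicator (\<Union>i<n. A i) \<gamma> * indicator (A n) \<gamma>))"
        by (auto simp: fun_eq_iff lessThan_Suc split: split_indicator)
      then show ?case using orth_add_scaled[OF orth_add_scaled[OF Suc A[OF w, of n], of 1] A[OF Suc, of n], of "-1"] by simp
    qed
    show "integrable \<mu> (\<lambda>\<gamma>. \<bar>w \<gamma>\<bar>)" using orthD(1)[OF w] by simp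
    show "\<bar>w \<gamma> * indicator (\<Union>i<n. A i) \<gamma>\<bar> \<le> \<bar>w \<gamma>\<bar>" for n \<gamma> by (auto split: split_indicator)
    show "AE \<gamma> in \<mu>. (\<lambda>n. w \<gamma> * indicator (\<Union>i<n. A i) \<gamma>) \<longlonglongrightarrow> w \<gamma> * indicator (\<Union>i. A i) \<gamma>"
      by (intro AE_I2 tendsto_mult tendsto_const LIMSEQ_indicator_UN)
    show "(\<lambda>\<gamma>. w \<gamma> * indicator (\<Union>i. A i) \<gamma>) \<in> borel_measurable \<mu>"
      using orthD(1)[OF w] Am by (intro borel_measurable_times borel_measurable_indicator sets.countable_nat_UN) auto
  qed
  have "\<forall>w. orth w \<longrightarrow> orth (\<lambda>\<gamma>. w \<gamma> * indicator A \<gamma>)"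
    using assms(1)[unfolded sets_\<mu>']
  proof (induction A rule: sigma_sets.induct)
    case (Basic A)
    then obtain E B where E: "E \<in> lring X" and A: "A = {\<gamma> \<in> Configs X. emeasure \<gamma> E \<in> B}" and B: "B \<in> sets borel" by blast
    define S where "S n = {\<gamma> \<in> space \<mu>. of_nat n \<in> B \<and> emeasure \<gamma> E = of_nat n}" for n :: nat
    have AS: "A = (\<Union>n. S n)" unfolding A S_def using Configs_of_nat[OF _ E] space_\<mu> by fastforce
    note emeasure_lring_measurable[OF E, measurable]
    have Sm: "S n \<in> sets \<mu>" for n unfolding S_def by measurable
    have "orth (\<lambda>\<gamma>. w \<gamma> * indicator (S n) \<gamma>)" if w: "orth w" for w n
    proof (cases "of_nat n \<in> B")
      case True
      show ?thesis
        by (rule orth_cong[OF orth_count[OF w E, of n]])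
          (use True Sm orthD(1)[OF w] in \<open>auto simp: S_def intro!: AE_I2 borel_measurable_times split: split_indicator\<close>)
    next
      case False
      then have "S n = {}" unfolding S_def by blast
      then show ?thesis using orth_add_scaled[OF w w, of "-1"] by simp
    qed
    from Un[OF _ this Sm] show ?case unfolding AS by (intro allI impI)
  next
    case Empty
    have "orth (\<lambda>\<gamma>. w \<gamma> * indicator {} \<gamma>)" if w: "orth w" for w using orth_add_scaled[OF w w, of "-1"] by simp
    then show ?case by (intro allI impI)
  next
    case (Compl A)
    show ?case
    proof (intro allI impI)
      fix w assume w: "orth w"
      have Am: "A \<in> sets \<mu>" using Compl.hyps by (simp add: sets_\<mu>')
      show "orth (\<lambda>\<gamma>. w \<gamma> * indicator (Configs X - A) \<gamma>)"
        by (rule orth_cong[OF orth_add_scaled[OF w Compl.IH[rule_format, OF w], of "-1"]])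
          (use Am orthD(1)[OF w] sets.top[of \<mu>] in \<open>auto simp: space_\<mu> intro!: AE_I2 borel_measurable_times split: split_indicator\<close>)
    qed
  next
    case (Union A)
    have "A i \<in> sets \<mu>" for i using Union.hyps by (simp add: sets_\<mu>')
    from Un[OF _ Union.IH[rule_format] this] show ?case by (intro allI impI)
  qed
  then show ?thesis using assms(2) by (elim allE[of _ w] mp)
qed

lemma Cyl_separating:
  assumes w: "integrable \<mu> w" and 0: "\<And>h. h \<in> Cyl X \<Longrightarrow> (LINT \<gamma>|\<mu>. h \<gamma> * w \<gamma>) = 0"
  shows "AE \<gamma> in \<mu>. w \<gamma> = 0"
proof (rule density_zero[OF w])
  fix A assume "A \<in> sets \<mu>"
  from orthD(2)[OF orth_indicator[OF this orthI[OF assms]] reach_zero, of "pi / 2"]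
  show "set_lebesgue_integral \<mu> A w = 0" by (simp add: star_def set_lebesgue_integral_def mult.commute)
qed

end

section \<open>The closed form on configurations\<close>

locale closable_config_space = lifted_config_space X \<mu> l L for X :: "'a diffusion_space" and \<mu> l L +
  assumes clos: "closable \<mu> (Cyl X) (cyl_form X L \<mu>)"
begin

sublocale conf: square_field_form \<mu> "Cyl X" "cyl_gamma X L"
proof
  show "(\<lambda>_. 0) \<in> Cyl X" by (rule Cyl_const)
  fix f g h and c :: real and \<phi> assume f: "f \<in> Cyl X"
  show "(\<lambda>x. c * f x) \<in> Cyl X" using Cyl_add_scaled[OF Cyl_const[of 0] f, of c] by simp
  show "\<exists>B. \<forall>x\<in>space \<mu>. \<bar>f x\<bar> \<le> B" using Cyl_bounded[OF f] space_\<mu> by simp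
  then obtain B where B: "\<And>x. x \<in> space \<mu> \<Longrightarrow> \<bar>f x\<bar> \<le> B" by blast
  show "f \<in> L2 \<mu>"
  proof -
    have "integrable \<mu> (\<lambda>x. (f x)\<^sup>2)"
    proof (rule integrable_const_bound[of _ "B\<^sup>2"])
      show "AE x in \<mu>. norm ((f x)\<^sup>2) \<le> B\<^sup>2"
        using AE_space by eventually_elim (use B abs_le_square_iff in \<open>fastforce simp: abs_le_square_iff\<close>)
      show "(\<lambda>x. (f x)\<^sup>2) \<in> borel_measurable \<mu>" by (rule borel_measurable_power[OF Cyl_measurable[OF f]])
    qed
    then show ?thesis unfolding L2_def using Cyl_measurable[OF f] by simp
  qed
  show "AE x in \<mu>. 0 \<le> cyl_gamma X L f f x"
    by (rule AE_labeledI) (use lab_gamma_cyl_gamma[OF f] in \<open>eventually_elim, blast\<close>)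
  assume g: "g \<in> Cyl X"
  show "(\<lambda>x. f x + g x) \<in> Cyl X" using Cyl_add_scaled[OF f g, of 1] by simp
  show "(\<lambda>x. f x * g x) \<in> Cyl X"
  proof -
    obtain k F f' where u: "cyl_rep X f (k, F, f')" using CylE[OF f] .
    obtain n G g' where v: "cyl_rep X g (n, G, g')" using CylE[OF g] .
    show ?thesis by (rule CylI[OF cyl_rep_mult[OF u v]])
  qed
  show "integrable \<mu> (cyl_gamma X L f g)" by (rule cyl_gamma_integrable[OF f g])
  show "AE x in \<mu>. cyl_gamma X L f g x = cyl_gamma X L g f x" by (rule cyl_gamma_sym[OF f g])
  show "AE x in \<mu>. cyl_gamma X L (\<lambda>x. c * f x) g x = c * cyl_gamma X L f g x"
  proof -
    have 0: "(\<lambda>_. 0) \<in> Cyl X" by (rule Cyl_const)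
    have "AE x in \<mu>. cyl_gamma X L (\<lambda>_. 0) g x = 0" using cyl_gamma_add_scaled[OF 0 0 g, of "-2"] by eventually_elim simp
    moreover have "AE x in \<mu>. cyl_gamma X L (\<lambda>x. 0 + c * f x) g x = cyl_gamma X L (\<lambda>_. 0) g x + c * cyl_gamma X L f g x"
      by (rule cyl_gamma_add_scaled[OF 0 f g])
    ultimately show ?thesis by eventually_elim simp
  qed
  {
    assume \<phi>: "smooth1 \<phi>"
    show "AE x in \<mu>. cyl_gamma X L (\<lambda>x. \<phi> (f x) - \<phi> 0) g x = deriv \<phi> (f x) * cyl_gamma X L f g x"
      using cyl_gamma_chain[OF f g \<phi>, of "- \<phi> 0"] by simp
  }
  assume h: "h \<in> Cyl X"
  show "AE x in \<mu>. cyl_gamma X L (\<lambda>x. f x + g x) h x = cyl_gamma X L f h x + cyl_gamma X L g h x"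
    using cyl_gamma_add_scaled[OF f g h, of 1] by simp
  show "AE x in \<mu>. cyl_gamma X L (\<lambda>x. f x * g x) h x = f x * cyl_gamma X L g h x + g x * cyl_gamma X L f h x"
    by (rule cyl_gamma_Leibniz[OF f g h])
next
  fix f \<phi> assume f: "f \<in> Cyl X" and \<phi>: "smooth1 \<phi>"
  obtain k F f' where u: "cyl_rep X f (k, F, f')" using CylE[OF f] .
  show "(\<lambda>x. \<phi> (f x) - \<phi> 0) \<in> Cyl X" using CylI[OF cyl_rep_comp[OF u \<phi>, of "- \<phi> 0"]] by simp
next
  show "closable \<mu> (Cyl X) (\<lambda>f g. LINT x|\<mu>. cyl_gamma X L f g x)"
    using clos unfolding cyl_form_def[abs_def] .
next
  fix w :: "'a measure \<Rightarrow> real" assume "integrable \<mu> w" "\<And>h. h \<in> Cyl X \<Longrightarrow> (LINT x|\<mu>. h x * w x) = 0"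
  then show "AE x in \<mu>. w x = 0" by (rule Cyl_separating)
qed

lemma cyl_form_eq: "cyl_form X L \<mu> = conf.Q"
  by (intro ext) (simp add: cyl_form_def)

lemma U_dom_eq: "U_dom X L \<mu> = conf.D" and U_form_eq: "U_form X L \<mu> = conf.E"
  unfolding U_dom_def U_form_def cyl_form_eq by simp_all

lemma U_gamma_eq:
  assumes "u \<in> U_dom X L \<mu>" "ess_bounded \<mu> u" "conf.G_value u g"
  shows "AE \<gamma> in \<mu>. U_gamma X L \<mu> u \<gamma> = g \<gamma>"
  unfolding U_gamma_def U_dom_eq U_form_eq using conf.square_field_eq[OF assms(1)[unfolded U_dom_eq] assms(2,3)] by blast

end

section \<open>Seminorms on labeled functions\<close>

lemma minkowski_suminf:
  fixes a b c :: "nat \<Rightarrow> real"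
  assumes nn: "\<And>p. 0 \<le> a p" "\<And>p. 0 \<le> b p" "\<And>p. 0 \<le> c p" and s: "summable a" "summable b"
    and le: "\<And>p. sqrt (c p) \<le> sqrt (a p) + sqrt (b p)"
  shows "summable c" "sqrt (suminf c) \<le> sqrt (suminf a) + sqrt (suminf b)"
proof -
  have "c p \<le> 2 * a p + 2 * b p" for p
  proof -
    have "c p = (sqrt (c p))\<^sup>2" using nn by simp
    also have "\<dots> \<le> (sqrt (a p) + sqrt (b p))\<^sup>2" using le[of p] nn(3)[of p] by (intro power_mono) auto
    also have "\<dots> \<le> 2 * a p + 2 * b p" using sq_sum_le[of "sqrt (a p)" "sqrt (b p)"] nn by simp
    finally show ?thesis .
  qed
  moreover have "summable (\<lambda>p. 2 * a p + 2 * b p)" using s by (intro summable_add summable_mult)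
  ultimately show c: "summable c" using nn(3) by (intro summable_comparison_test'[of _ 0 c]) auto
  have fin: "sqrt (\<Sum>p<n. c p) \<le> sqrt (suminf a) + sqrt (suminf b)" for n
  proof -
    have "sqrt (\<Sum>p<n. c p) \<le> sqrt (\<Sum>p<n. (sqrt (a p) + sqrt (b p))\<^sup>2)"
    proof (intro real_sqrt_le_mono sum_mono)
      fix p
      have "c p = (sqrt (c p))\<^sup>2" using nn by simp
      also have "\<dots> \<le> (sqrt (a p) + sqrt (b p))\<^sup>2" using le[of p] nn(3)[of p] by (intro power_mono) auto
      finally show "c p \<le> (sqrt (a p) + sqrt (b p))\<^sup>2" .
    qed
    also have "\<dots> \<le> sqrt (\<Sum>p<n. a p) + sqrt (\<Sum>p<n. b p)"
      using L2_set_triangle_ineq[of "\<lambda>p. sqrt (a p)" "\<lambda>p. sqrt (b p)" "{..<n}"] nn unfolding L2_set_def by simp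
    also have "\<dots> \<le> sqrt (suminf a) + sqrt (suminf b)"
      using s nn by (intro add_mono real_sqrt_le_mono sum_le_suminf) auto
    finally show ?thesis .
  qed
  have "(\<lambda>n. sqrt (\<Sum>p<n. c p)) \<longlonglongrightarrow> sqrt (suminf c)" by (intro tendsto_real_sqrt summable_LIMSEQ c)
  then show "sqrt (suminf c) \<le> sqrt (suminf a) + sqrt (suminf b)" by (rule LIMSEQ_le_const2) (use fin in blast)
qed

lemma L2_triangle:
  assumes "f \<in> L2 M" "g \<in> L2 M"
  shows "sqrt (LINT x|M. (f x + g x)\<^sup>2) \<le> sqrt (LINT x|M. (f x)\<^sup>2) + sqrt (LINT x|M. (g x)\<^sup>2)"
proof -
  have m: "f \<in> borel_measurable M" "g \<in> borel_measurable M" and i: "integrable M (\<lambda>x. (f x)\<^sup>2)" "integrable M (\<lambda>x. (g x)\<^sup>2)"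
    using assms unfolding L2_def by auto
  note CS = integral_Cauchy_Schwarz[OF m i]
  have "(LINT x|M. f x * g x) \<le> (LINT x|M. \<bar>f x * g x\<bar>)" using CS(1) by (intro integral_mono) auto
  also have "\<dots> \<le> sqrt (LINT x|M. (f x)\<^sup>2) * sqrt (LINT x|M. (g x)\<^sup>2)"
    using real_sqrt_le_mono[OF CS(2)] by (simp add: real_sqrt_mult)
  finally have "(LINT x|M. (f x + g x)\<^sup>2) \<le>
      (LINT x|M. (f x)\<^sup>2) + 2 * (sqrt (LINT x|M. (f x)\<^sup>2) * sqrt (LINT x|M. (g x)\<^sup>2)) + (LINT x|M. (g x)\<^sup>2)"
    using i CS(1) by (simp add: power2_sum mult.assoc)
  also have "\<dots> = (sqrt (LINT x|M. (f x)\<^sup>2) + sqrt (LINT x|M. (g x)\<^sup>2))\<^sup>2" by (simp add: power2_sum)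
  finally show ?thesis by (intro real_le_lsqrt) auto
qed

lemma upper_integral_le:
  assumes "integrable M g" "AE x in M. 0 \<le> g x" "AE x in M. f x \<le> ennreal (g x)"
  shows "upper_integral M f < \<infinity>" "enn2real (upper_integral M f) \<le> (LINT x|M. g x)"
proof -
  have "upper_integral M f \<le> (\<integral>\<^sup>+x. ennreal (g x) \<partial>M)"
    unfolding upper_integral_def using assms by (intro INF_lower) auto
  also have "\<dots> = ennreal (LINT x|M. g x)" by (rule nn_integral_eq_integral[OF assms(1,2)])
  finally have le: "upper_integral M f \<le> ennreal (LINT x|M. g x)" .
  then show "upper_integral M f < \<infinity>" by (rule le_less_trans) simp
  show "enn2real (upper_integral M f) \<le> (LINT x|M. g x)"
    using le integral_nonneg_AE[OF assms(2)] by (intro enn2real_leI)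
qed

text \<open>The infimum in the upper integral is attained.\<close>

lemma upper_integral_attained:
  assumes fin: "upper_integral M f < \<infinity>"
  shows "\<exists>g. integrable M g \<and> (\<forall>x. 0 \<le> g x) \<and> (AE x in M. f x \<le> ennreal (g x)) \<and>
    (LINT x|M. g x) = enn2real (upper_integral M f)"
proof -
  let ?G = "{g \<in> borel_measurable M. AE x in M. f x \<le> g x}"
  have "(\<lambda>_. top) \<in> ?G" by simp
  then have "(\<lambda>g. \<integral>\<^sup>+x. g x \<partial>M) ` ?G \<noteq> {}" by blast
  from ennreal_Inf_countable_INF[OF this]
  obtain I :: "nat \<Rightarrow> ennreal" where I: "range I \<subseteq> (\<lambda>g. \<integral>\<^sup>+x. g x \<partial>M) ` ?G" "upper_integral M f = (INF i. I i)"
    unfolding upper_integral_def by blast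
  then have "\<forall>i. \<exists>g. g \<in> ?G \<and> I i = (\<integral>\<^sup>+x. g x \<partial>M)" by blast
  then obtain g where g: "\<And>i. g i \<in> ?G" "\<And>i. I i = (\<integral>\<^sup>+x. g i x \<partial>M)" by metis
  define h where "h x = (INF i. g i x)" for x
  have hm: "h \<in> borel_measurable M" unfolding h_def using g(1) by (intro borel_measurable_INF) auto
  have "AE x in M. \<forall>i. f x \<le> g i x" unfolding AE_all_countable using g(1) by blast
  then have hf: "AE x in M. f x \<le> h x" by eventually_elim (auto simp: h_def intro: INF_greatest)
  have int: "(\<integral>\<^sup>+x. h x \<partial>M) = upper_integral M f"
  proof (rule antisym)
    show "(\<integral>\<^sup>+x. h x \<partial>M) \<le> upper_integral M f"
      unfolding I(2) g(2) h_def by (intro INF_greatest nn_integral_mono INF_lower) auto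
    show "upper_integral M f \<le> (\<integral>\<^sup>+x. h x \<partial>M)" unfolding upper_integral_def using hm hf by (intro INF_lower) simp
  qed
  have "AE x in M. h x \<noteq> \<infinity>" using nn_integral_noteq_infinite[OF hm] int fin by auto
  then have hr: "AE x in M. h x = ennreal (enn2real (h x))" by eventually_elim (simp add: less_top)
  have "(\<integral>\<^sup>+x. ennreal (enn2real (h x)) \<partial>M) = upper_integral M f"
    unfolding int[symmetric] by (rule nn_integral_cong_AE) (use hr in \<open>eventually_elim, simp\<close>)
  then have n: "(\<integral>\<^sup>+x. ennreal (enn2real (h x)) \<partial>M) = ennreal (enn2real (upper_integral M f))" using fin by (simp add: less_top)
  have i: "integrable M (\<lambda>x. enn2real (h x))" and "(LINT x|M. enn2real (h x)) = enn2real (upper_integral M f)"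
    using nn_integral_eq_integrable[of "\<lambda>x. enn2real (h x)" M "enn2real (upper_integral M f)"] n hm by auto
  moreover have "AE x in M. f x \<le> ennreal (enn2real (h x))" using hf hr by eventually_elim simp
  ultimately show ?thesis by (intro exI[of _ "\<lambda>x. enn2real (h x)"]) simp
qed

lemma upper_integral_integrable:
  assumes "integrable M h" "AE x in M. 0 \<le> h x"
  shows "upper_integral M (\<lambda>x. ennreal (h x)) < \<infinity>" "enn2real (upper_integral M (\<lambda>x. ennreal (h x))) = (LINT x|M. h x)"
proof -
  note u = upper_integral_le[OF assms, of "\<lambda>x. ennreal (h x)", simplified]
  then show fin: "upper_integral M (\<lambda>x. ennreal (h x)) < \<infinity>" by simp
  obtain g where g: "integrable M g" "\<And>x. 0 \<le> g x" "AE x in M. ennreal (h x) \<le> ennreal (g x)"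
    "(LINT x|M. g x) = enn2real (upper_integral M (\<lambda>x. ennreal (h x)))"
    using upper_integral_attained[OF fin] by blast
  have "AE x in M. h x \<le> g x" using g(3) by eventually_elim (use g(2) in simp)
  from integral_mono_AE[OF assms(1) g(1) this] u(2) show "enn2real (upper_integral M (\<lambda>x. ennreal (h x))) = (LINT x|M. h x)"
    unfolding g(4) by simp
qed

lemma upper_integral_triangle:
  assumes fin: "upper_integral M (\<lambda>x. ennreal (a x)) < \<infinity>" "upper_integral M (\<lambda>x. ennreal (b x)) < \<infinity>"
    and le: "AE x in M. 0 \<le> a x \<and> 0 \<le> b x \<and> 0 \<le> c x \<and> sqrt (c x) \<le> sqrt (a x) + sqrt (b x)"
  shows "upper_integral M (\<lambda>x. ennreal (c x)) < \<infinity>"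
    "sqrt (enn2real (upper_integral M (\<lambda>x. ennreal (c x)))) \<le>
      sqrt (enn2real (upper_integral M (\<lambda>x. ennreal (a x)))) + sqrt (enn2real (upper_integral M (\<lambda>x. ennreal (b x))))"
proof -
  obtain A where A: "integrable M A" "\<And>x. 0 \<le> A x" "AE x in M. ennreal (a x) \<le> ennreal (A x)"
    "(LINT x|M. A x) = enn2real (upper_integral M (\<lambda>x. ennreal (a x)))" using upper_integral_attained[OF fin(1)] by blast
  obtain B where B: "integrable M B" "\<And>x. 0 \<le> B x" "AE x in M. ennreal (b x) \<le> ennreal (B x)"
    "(LINT x|M. B x) = enn2real (upper_integral M (\<lambda>x. ennreal (b x)))" using upper_integral_attained[OF fin(2)] by blast
  have L: "(\<lambda>x. sqrt (A x)) \<in> L2 M" "(\<lambda>x. sqrt (B x)) \<in> L2 M" unfolding L2_def using A(1,2) B(1,2) by auto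
  have i: "integrable M (\<lambda>x. (sqrt (A x) + sqrt (B x))\<^sup>2)" using L2_add[OF L] unfolding L2_def by simp
  have c: "AE x in M. ennreal (c x) \<le> ennreal ((sqrt (A x) + sqrt (B x))\<^sup>2)"
    using le A(3) B(3)
  proof eventually_elim
    case (elim x)
    then have "a x \<le> A x" "b x \<le> B x" using A(2) B(2) by auto
    then have "sqrt (c x) \<le> sqrt (A x) + sqrt (B x)" using elim real_sqrt_le_mono[of "a x" "A x"] real_sqrt_le_mono[of "b x" "B x"] by linarith
    then have "(sqrt (c x))\<^sup>2 \<le> (sqrt (A x) + sqrt (B x))\<^sup>2" using elim by (intro power_mono) auto
    then show ?case using elim by (intro ennreal_leI) simp
  qed
  have nn: "AE x in M. 0 \<le> (sqrt (A x) + sqrt (B x))\<^sup>2" by simp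
  note u = upper_integral_le[OF i nn c]
  show "upper_integral M (\<lambda>x. ennreal (c x)) < \<infinity>" by (rule u(1))
  show "sqrt (enn2real (upper_integral M (\<lambda>x. ennreal (c x)))) \<le>
      sqrt (enn2real (upper_integral M (\<lambda>x. ennreal (a x)))) + sqrt (enn2real (upper_integral M (\<lambda>x. ennreal (b x))))"
    using order_trans[OF real_sqrt_le_mono[OF u(2)] L2_triangle[OF L]] A(2,4) B(2,4) by simp
qed

context lifting
begin

lemma Linf_sqrt: assumes F: "F \<in> Linf m" shows "(\<lambda>z. sqrt (F z)) \<in> Linf m"
proof -
  obtain B where B: "AE z in m. \<bar>F z\<bar> \<le> B" and Fm: "F \<in> borel_measurable m" using F unfolding Linf_def ess_bounded_def by auto
  have "AE z in m. \<bar>sqrt (F z)\<bar> \<le> sqrt B" using B by eventually_elim (simp add: sqrt_def real_root_abs[symmetric])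
  then show ?thesis unfolding Linf_def ess_bounded_def using Fm by auto
qed

text \<open>
  Multiplicativity lets the lifting commute with square roots.
\<close>

lemma lift_sqrt:
  assumes F: "F \<in> Linf m" and nn: "AE z in m. 0 \<le> F z" and y: "y \<in> pts X"
  shows "sqrt (L F y) = L (\<lambda>z. sqrt (F z)) y"
proof -
  note S = Linf_sqrt[OF F]
  have "L F y = L (\<lambda>z. sqrt (F z) * sqrt (F z)) y"
    using nn by (intro lift_cong[OF F Linf_mult[OF S S] _ y]) (auto elim!: eventually_mono)
  also have "\<dots> = (L (\<lambda>z. sqrt (F z)) y)\<^sup>2" using lift_mult[OF S S y] by (simp add: power2_eq_square)
  finally show ?thesis
    using lift_nonneg[OF S _ y] nn by (simp add: eventually_mono)
qed

lemma lift_sqrt_triangle: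
  assumes "F \<in> Linf m" "H \<in> Linf m" "K \<in> Linf m" "AE z in m. 0 \<le> F z" "AE z in m. 0 \<le> H z" "AE z in m. 0 \<le> K z"
    and le: "AE z in m. sqrt (K z) \<le> sqrt (F z) + sqrt (H z)" and y: "y \<in> pts X"
  shows "sqrt (L K y) \<le> sqrt (L F y) + sqrt (L H y)"
  unfolding lift_sqrt[OF assms(1,4) y] lift_sqrt[OF assms(2,5) y] lift_sqrt[OF assms(3,6) y]
    lift_add[OF Linf_sqrt[OF assms(1)] Linf_sqrt[OF assms(2)] y, symmetric]
  by (rule lift_mono[OF Linf_sqrt[OF assms(3)] Linf_add[OF Linf_sqrt[OF assms(1)] Linf_sqrt[OF assms(2)]] le y])

lemma lab_gamma_section:
  assumes "lab_gamma_defined X L U x" "\<And>p. x p \<in> pts X"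
  shows "X_gamma X (\<lambda>z. U (x(p := z))) \<in> Linf m" "AE z in m. 0 \<le> X_gamma X (\<lambda>z. U (x(p := z))) z"
    "0 \<le> L (X_gamma X (\<lambda>z. U (x(p := z)))) (x p)"
proof -
  have d: "(\<lambda>z. U (x(p := z))) \<in> X_gamma_dom X" "ess_bounded m (X_gamma X (\<lambda>z. U (x(p := z))))"
    using assms(1) unfolding lab_gamma_defined_def by auto
  show L: "X_gamma X (\<lambda>z. U (x(p := z))) \<in> Linf m" unfolding Linf_def using X_gamma_measurable[OF d(1)] d(2) by simp
  show nn: "AE z in m. 0 \<le> X_gamma X (\<lambda>z. U (x(p := z))) z" by (rule X_gamma_nonneg[OF d(1)])
  show "0 \<le> L (X_gamma X (\<lambda>z. U (x(p := z)))) (x p)" by (rule lift_nonneg[OF L nn assms(2)])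
qed

text \<open>The square root of \<open>\<Gamma>\<^sup>[\<^sup>\<infinity>\<^sup>]\<close> is a seminorm at every point at which it is defined.\<close>

lemma lab_gamma_diff:
  assumes U: "lab_gamma_defined X L U x" and V: "lab_gamma_defined X L V x" and x: "\<And>p. x p \<in> pts X"
  shows "lab_gamma_defined X L (U - V) x"
    "sqrt (lab_gamma X L (U - V) x) \<le> sqrt (lab_gamma X L U x) + sqrt (lab_gamma X L V x)"
    "\<bar>sqrt (lab_gamma X L U x) - sqrt (lab_gamma X L V x)\<bar> \<le> sqrt (lab_gamma X L (U - V) x)"
    "0 \<le> lab_gamma X L (U - V) x"
proof -
  let ?G = "\<lambda>W p. X_gamma X (\<lambda>z. W (x(p := z)))"
  note u = lab_gamma_section[OF U x] and v = lab_gamma_section[OF V x]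
  have s: "summable (\<lambda>p. L (?G U p) (x p))" "summable (\<lambda>p. L (?G V p) (x p))"
    using U V unfolding lab_gamma_defined_def by auto
  have dU: "(\<lambda>z. U (x(p := z))) \<in> X_gamma_dom X" and dV: "(\<lambda>z. V (x(p := z))) \<in> X_gamma_dom X" for p
    using U V unfolding lab_gamma_defined_def by auto
  have e: "(\<lambda>z. (U - V) (x(p := z))) = (\<lambda>z. U (x(p := z)) - V (x(p := z)))" for p by simp
  have g: "(\<lambda>z. (U - V) (x(p := z))) \<in> X_gamma_dom X"
    "AE z in m. \<bar>sqrt (?G U p z) - sqrt (?G V p z)\<bar> \<le> sqrt (?G (U - V) p z)"
    "AE z in m. sqrt (?G (U - V) p z) \<le> sqrt (?G U p z) + sqrt (?G V p z)" for p
    unfolding e by (rule X_gamma_diff[OF dU dV])+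
  have nn: "AE z in m. 0 \<le> ?G (U - V) p z" for p by (rule X_gamma_nonneg[OF g(1)])
  have b: "ess_bounded m (?G (U - V) p)" for p
  proof -
    obtain A where A: "AE z in m. \<bar>?G U p z\<bar> \<le> A" using u(1)[of p] unfolding Linf_def ess_bounded_def by auto
    obtain B where B: "AE z in m. \<bar>?G V p z\<bar> \<le> B" using v(1)[of p] unfolding Linf_def ess_bounded_def by auto
    have "AE z in m. \<bar>?G (U - V) p z\<bar> \<le> 2 * A + 2 * B"
      using g(3)[of p] nn[of p] u(2)[of p] v(2)[of p] A B
    proof eventually_elim
      case (elim z)
      have "?G (U - V) p z = (sqrt (?G (U - V) p z))\<^sup>2" using elim(2) by simp
      also have "\<dots> \<le> (sqrt (?G U p z) + sqrt (?G V p z))\<^sup>2" using elim by (intro power_mono) auto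
      also have "\<dots> \<le> 2 * ?G U p z + 2 * ?G V p z" using sq_sum_le[of "sqrt (?G U p z)" "sqrt (?G V p z)"] elim(3,4) by simp
      finally show ?case using elim(2,5,6) by linarith
    qed
    then show ?thesis unfolding ess_bounded_def by blast
  qed
  have W: "?G (U - V) p \<in> Linf m" for p unfolding Linf_def using X_gamma_measurable[OF g(1)] b by simp
  have pos: "0 \<le> L (?G (U - V) p) (x p)" for p by (rule lift_nonneg[OF W nn x])
  have 1: "sqrt (L (?G (U - V) p) (x p)) \<le> sqrt (L (?G U p) (x p)) + sqrt (L (?G V p) (x p))" for p
    by (rule lift_sqrt_triangle[OF u(1) v(1) W u(2) v(2) nn g(3) x])
  have 2: "sqrt (L (?G U p) (x p)) \<le> sqrt (L (?G V p) (x p)) + sqrt (L (?G (U - V) p) (x p))" for p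
    by (rule lift_sqrt_triangle[OF v(1) W u(1) v(2) nn u(2) _ x]) (use g(2)[of p] in \<open>eventually_elim, linarith\<close>)
  have 3: "sqrt (L (?G V p) (x p)) \<le> sqrt (L (?G U p) (x p)) + sqrt (L (?G (U - V) p) (x p))" for p
    by (rule lift_sqrt_triangle[OF u(1) W v(1) u(2) nn v(2) _ x]) (use g(2)[of p] in \<open>eventually_elim, linarith\<close>)
  note M1 = minkowski_suminf[OF u(3) v(3) pos s 1]
  show "lab_gamma_defined X L (U - V) x" unfolding lab_gamma_defined_def using g(1) b M1(1) by blast
  show "sqrt (lab_gamma X L (U - V) x) \<le> sqrt (lab_gamma X L U x) + sqrt (lab_gamma X L V x)"
    unfolding lab_gamma_def by (rule M1(2))
  show "\<bar>sqrt (lab_gamma X L U x) - sqrt (lab_gamma X L V x)\<bar> \<le> sqrt (lab_gamma X L (U - V) x)"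
    using minkowski_suminf(2)[OF v(3) pos u(3) s(2) M1(1) 2] minkowski_suminf(2)[OF u(3) pos v(3) s(1) M1(1) 3]
    unfolding lab_gamma_def by linarith
  show "0 \<le> lab_gamma X L (U - V) x" unfolding lab_gamma_def by (rule suminf_nonneg[OF M1(1) pos])
qed

lemma lab_gamma_self: assumes x: "\<And>p. x p \<in> pts X" shows "lab_gamma X L (U - U) x = 0"
proof -
  have z: "X_gamma X (\<lambda>_. 0) \<in> Linf m"
    unfolding Linf_def ess_bounded_def using X_gamma_measurable[OF X_gamma_dom_zero, of 0] X_gamma_zero[of 0]
    by (auto intro!: exI[of _ "0::real"])
  have "L (X_gamma X (\<lambda>_. 0)) (x p) = 0" for p
    using lift_cong[OF z Linf_const X_gamma_zero x] lift_zero[OF x] by simp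
  then show ?thesis unfolding lab_gamma_def by simp
qed

end

context lifted_config_space
begin

text \<open>The functions to which the norm of pre-Sobolev functions extends as a seminorm.\<close>

definition good :: "((nat \<Rightarrow> 'a) \<Rightarrow> real) \<Rightarrow> bool" where
  "good U \<longleftrightarrow> (AE x in Plc. lab_gamma_defined X L U x) \<and> U \<in> L2 Plc \<and>
     upper_integral Plc (\<lambda>x. ennreal (lab_gamma X L U x)) < \<infinity>"

abbreviation form :: "((nat \<Rightarrow> 'a) \<Rightarrow> real) \<Rightarrow> real" where "form \<equiv> lab_form X \<mu> L l"
abbreviation nrm :: "((nat \<Rightarrow> 'a) \<Rightarrow> real) \<Rightarrow> real" where "nrm \<equiv> lab_norm X \<mu> L l"

lemma form_nonneg: "0 \<le> form U" unfolding lab_form_def by simp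

lemma nrm_nonneg: "0 \<le> nrm U" unfolding lab_norm_def using form_nonneg by simp

lemma form_le_nrm: "sqrt (form U) \<le> nrm U" unfolding lab_norm_def by (intro real_sqrt_le_mono) simp

lemma good_diff:
  assumes U: "good U" and V: "good V"
  shows "good (U - V)" "sqrt (form (U - V)) \<le> sqrt (form U) + sqrt (form V)" "nrm (U - V) \<le> nrm U + nrm V"
proof -
  have a: "AE x in Plc. lab_gamma_defined X L U x" "AE x in Plc. lab_gamma_defined X L V x" using U V unfolding good_def by auto
  have d: "AE x in Plc. lab_gamma_defined X L (U - V) x"
    using a AE_lcf_inf by eventually_elim (rule lab_gamma_diff(1), assumption+, rule lcf_infD(1))
  have t: "AE x in Plc. 0 \<le> lab_gamma X L U x \<and> 0 \<le> lab_gamma X L V x \<and> 0 \<le> lab_gamma X L (U - V) x \<and>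
      sqrt (lab_gamma X L (U - V) x) \<le> sqrt (lab_gamma X L U x) + sqrt (lab_gamma X L V x)"
    using a AE_lcf_inf
  proof eventually_elim
    case (elim x)
    note x = lcf_infD(1)[OF elim(3)]
    show ?case
      using lab_gamma_nonneg[OF elim(1,3)] lab_gamma_nonneg[OF elim(2,3)] lab_gamma_diff(2,4)[OF elim(1,2) x] by blast
  qed
  have f: "upper_integral Plc (\<lambda>x. ennreal (lab_gamma X L U x)) < \<infinity>" "upper_integral Plc (\<lambda>x. ennreal (lab_gamma X L V x)) < \<infinity>"
    and L: "U \<in> L2 Plc" "V \<in> L2 Plc" using U V unfolding good_def by auto
  note u = upper_integral_triangle[OF f t]
  have L': "(\<lambda>x. - V x) \<in> L2 Plc" using L2_cmult[OF L(2), of "-1"] by simp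
  have D: "U - V \<in> L2 Plc" using L2_diff[OF L] by (simp add: fun_diff_def)
  show "good (U - V)" unfolding good_def using d u(1) D by blast
  show s: "sqrt (form (U - V)) \<le> sqrt (form U) + sqrt (form V)" unfolding lab_form_def by (rule u(2))
  have s2: "sqrt (LINT x|Plc. ((U - V) x)\<^sup>2) \<le> sqrt (LINT x|Plc. (U x)\<^sup>2) + sqrt (LINT x|Plc. (V x)\<^sup>2)"
    using L2_triangle[OF L(1) L'] by simp
  have nn: "0 \<le> (LINT x|Plc. (W x)\<^sup>2)" for W :: "(nat \<Rightarrow> 'a) \<Rightarrow> real" by simp
  have e: "nrm W = sqrt ((sqrt (form W))\<^sup>2 + (sqrt (LINT x|Plc. (W x)\<^sup>2))\<^sup>2)" for W
    unfolding lab_norm_def using form_nonneg by simp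
  have "nrm (U - V) \<le> sqrt ((sqrt (form U) + sqrt (form V))\<^sup>2 + (sqrt (LINT x|Plc. (U x)\<^sup>2) + sqrt (LINT x|Plc. (V x)\<^sup>2))\<^sup>2)"
    unfolding e[of "U - V"] using s s2 form_nonneg nn by (intro real_sqrt_le_mono add_mono power_mono real_sqrt_ge_zero)
  also have "\<dots> \<le> nrm U + nrm V" unfolding e[of U] e[of V] by (rule real_sqrt_sum_squares_triangle_ineq)
  finally show "nrm (U - V) \<le> nrm U + nrm V" .
qed

lemma nrm_self: assumes "good U" shows "nrm (U - U) = 0"
proof -
  have "AE x in Plc. ennreal (lab_gamma X L (U - U) x) \<le> ennreal 0"
    using AE_lcf_inf
  proof eventually_elim
    case (elim x)
    show ?case using lab_gamma_self[OF lcf_infD(1)[OF elim], of U] by simp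
  qed
  from upper_integral_le(2)[OF integrable_zero _ this] have "form (U - U) \<le> 0" unfolding lab_form_def by simp
  then show ?thesis unfolding lab_norm_def using form_nonneg[of "U - U"] by simp
qed

lemma nrm_sym: assumes "good U" "good V" shows "nrm (U - V) = nrm (V - U)"
proof -
  have "nrm (V - U) \<le> nrm (U - V)" if U: "good U" and V: "good V" for U V
  proof -
    have e: "V - U = (U - U) - (U - V)" by (simp add: fun_eq_iff)
    show ?thesis unfolding e using good_diff(3)[OF good_diff(1)[OF U U] good_diff(1)[OF U V]] nrm_self[OF U] by simp
  qed
  from this[OF assms] this[OF assms(2,1)] show ?thesis by simp
qed

lemma nrm_triangle: assumes "good U" "good V" "good W" shows "nrm (U - W) \<le> nrm (U - V) + nrm (V - W)"
proof -
  have e: "U - W = (U - V) - (W - V)" by (simp add: fun_eq_iff)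
  show ?thesis unfolding e nrm_sym[OF assms(2,3)]
    by (rule good_diff(3)[OF good_diff(1)[OF assms(1,2)] good_diff(1)[OF assms(3,2)]])
qed

lemma sqrt_form_triangle: assumes "good U" "good V" shows "sqrt (form V) \<le> sqrt (form U) + sqrt (form (U - V))"
proof -
  have e: "V = U - (U - V)" by (simp add: fun_eq_iff)
  show ?thesis using good_diff(2)[OF assms(1) good_diff(1)[OF assms]] unfolding e[symmetric] .
qed

text \<open>
  The measure is complete.
\<close>

lemma Plc_measurable_AE:
  assumes f: "f \<in> borel_measurable Plc" and ae: "AE x in Plc. f x = (g x :: real)" shows "g \<in> borel_measurable Plc"
proof (rule measurableI)
  fix A :: "real set" assume A: "A \<in> sets borel"
  show "g -` A \<inter> space Plc \<in> sets Plc"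
  proof (rule completion.in_sets_AE)
    show "AE x in Plc. x \<in> f -` A \<inter> space Plc \<longleftrightarrow> x \<in> g -` A \<inter> space Plc" using ae by eventually_elim auto
    show "f -` A \<inter> space Plc \<in> sets Plc" by (rule measurable_sets[OF f A])
  qed auto
qed simp

lemma pre_sobolev_good:
  assumes U: "pre_sobolev X \<mu> L U"
  shows "good U" "integrable Plc (lab_gamma X L U)" "AE x in Plc. 0 \<le> lab_gamma X L U x"
    "form U = (LINT x|Plc. lab_gamma X L U x)"
proof -
  obtain B where B: "\<And>x. x \<in> lcf_inf X \<Longrightarrow> \<bar>U x\<bar> \<le> B" using U unfolding pre_sobolev_def bounded_real by auto
  have Ur: "U \<in> borel_measurable (restrict_space Plc (lcf_inf X))" using U lab unfolding pre_sobolev_def by blast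
  obtain K where K: "AE x in Pl. lab_gamma_defined X L U x" "(\<lambda>x. \<bar>U x\<bar> + sqrt (lab_gamma X L U x)) \<in> L2 Plc"
    using U lab unfolding pre_sobolev_def by blast
  have d: "AE x in Plc. lab_gamma_defined X L U x" using K(1) by (simp add: AE_Pc)
  show nn: "AE x in Plc. 0 \<le> lab_gamma X L U x" using d AE_lcf_inf by eventually_elim (rule lab_gamma_nonneg)
  have Um: "U \<in> borel_measurable Plc"
  proof (rule Plc_measurable_AE)
    show "(\<lambda>x. if x \<in> lcf_inf X then U x else 0) \<in> borel_measurable Plc"
      using Ur lcf_inf_sets sets.sets_into_space[OF lcf_inf_sets]
      by (subst measurable_If_restrict_space_iff[where P = "\<lambda>x. x \<in> lcf_inf X"]) (auto simp: Int_absorb2 Int_def[symmetric] Collect_conj_eq)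
    show "AE x in Plc. (if x \<in> lcf_inf X then U x else 0) = U x" using AE_lcf_inf by eventually_elim simp
  qed
  have Sm: "(\<lambda>x. \<bar>U x\<bar> + sqrt (lab_gamma X L U x)) \<in> borel_measurable Plc" and
    Si: "integrable Plc (\<lambda>x. (\<bar>U x\<bar> + sqrt (lab_gamma X L U x))\<^sup>2)" using K(2) unfolding L2_def by auto
  have "(\<lambda>x. (\<bar>U x\<bar> + sqrt (lab_gamma X L U x)) - \<bar>U x\<bar>) \<in> borel_measurable Plc" using Sm Um by (intro borel_measurable_diff) auto
  then have sm: "(\<lambda>x. sqrt (lab_gamma X L U x)) \<in> borel_measurable Plc" by simp
  have Gm: "lab_gamma X L U \<in> borel_measurable Plc"
    by (rule Plc_measurable_AE[OF borel_measurable_power[OF sm, of 2]]) (use nn in \<open>eventually_elim, simp\<close>)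
  show Gi: "integrable Plc (lab_gamma X L U)"
  proof (rule Bochner_Integration.integrable_bound[OF Si Gm])
    show "AE x in Plc. norm (lab_gamma X L U x) \<le> norm ((\<bar>U x\<bar> + sqrt (lab_gamma X L U x))\<^sup>2)"
      using nn by eventually_elim (simp add: power2_sum)
  qed
  note u = upper_integral_integrable[OF Gi nn]
  show "form U = (LINT x|Plc. lab_gamma X L U x)" unfolding lab_form_def by (rule u(2))
  have "integrable Plc (\<lambda>x. (U x)\<^sup>2)"
  proof (rule Bochner_Integration.integrable_bound[OF Si borel_measurable_power[OF Um]])
    show "AE x in Plc. norm ((U x)\<^sup>2) \<le> norm ((\<bar>U x\<bar> + sqrt (lab_gamma X L U x))\<^sup>2)"
      using nn by eventually_elim (simp add: power2_sum)
  qed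
  then show "good U" unfolding good_def L2_def using d Um u(1) by simp
qed

lemma lab_gamma_L1_diff:
  assumes U: "pre_sobolev X \<mu> L U" and V: "pre_sobolev X \<mu> L V"
  shows "(LINT x|Plc. \<bar>lab_gamma X L U x - lab_gamma X L V x\<bar>) \<le> sqrt (form (U - V)) * (sqrt (form U) + sqrt (form V))"
proof -
  note u = pre_sobolev_good[OF U] and v = pre_sobolev_good[OF V]
  let ?a = "\<lambda>x. sqrt (lab_gamma X L U x)" and ?b = "\<lambda>x. sqrt (lab_gamma X L V x)"
  have L: "?a \<in> L2 Plc" "?b \<in> L2 Plc"
  proof -
    have "(\<lambda>x. sqrt (lab_gamma X L W x)) \<in> L2 Plc" if W: "pre_sobolev X \<mu> L W" for W
    proof -
      note w = pre_sobolev_good[OF W]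
      have "integrable Plc (\<lambda>x. (sqrt (lab_gamma X L W x))\<^sup>2)"
        by (rule iffD1[OF integrable_cong_AE w(2)]) (use w(2,3) in \<open>auto elim!: eventually_mono\<close>)
      then show ?thesis unfolding L2_def using w(2) by auto
    qed
    then show "?a \<in> L2 Plc" "?b \<in> L2 Plc" using U V by auto
  qed
  have sq: "(LINT x|Plc. (?a x)\<^sup>2) = form U" "(LINT x|Plc. (?b x)\<^sup>2) = form V"
    unfolding u(4) v(4) by (rule integral_cong_AE; use u(2,3) v(2,3) in \<open>auto elim!: eventually_mono\<close>)+
  have gd: "good (U - V)" by (rule good_diff(1)[OF u(1) v(1)])
  obtain g where g: "integrable Plc g" "\<And>x. 0 \<le> g x" "AE x in Plc. ennreal (lab_gamma X L (U - V) x) \<le> ennreal (g x)"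
    "(LINT x|Plc. g x) = form (U - V)"
    using upper_integral_attained[of Plc "\<lambda>x. ennreal (lab_gamma X L (U - V) x)"] gd unfolding good_def lab_form_def by blast
  have D: "(\<lambda>x. ?a x - ?b x) \<in> L2 Plc" and S: "(\<lambda>x. ?a x + ?b x) \<in> L2 Plc" by (rule L2_diff[OF L] L2_add[OF L])+
  have d: "(LINT x|Plc. (?a x - ?b x)\<^sup>2) \<le> form (U - V)"
    unfolding g(4)[symmetric]
  proof (rule integral_mono_AE)
    show "integrable Plc (\<lambda>x. (?a x - ?b x)\<^sup>2)" using D unfolding L2_def by simp
    show "AE x in Plc. (?a x - ?b x)\<^sup>2 \<le> g x"
    proof -
      have "AE x in Plc. lab_gamma_defined X L U x" "AE x in Plc. lab_gamma_defined X L V x" using u(1) v(1) unfolding good_def by auto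
      then show ?thesis using g(3) AE_lcf_inf
      proof eventually_elim
        case (elim x)
        note n = lab_gamma_diff(3,4)[OF elim(1,2) lcf_infD(1)[OF elim(4)]]
        have "\<bar>?a x - ?b x\<bar>\<^sup>2 \<le> (sqrt (lab_gamma X L (U - V) x))\<^sup>2" using n(1) by (intro power_mono) auto
        also have "\<dots> \<le> g x" using elim(3) n(2) g(2)[of x] by simp
        finally show ?case by simp
      qed
    qed
  qed (rule g(1))
  have dm: "(\<lambda>x. ?a x - ?b x) \<in> borel_measurable Plc" "(\<lambda>x. ?a x + ?b x) \<in> borel_measurable Plc"
    and di: "integrable Plc (\<lambda>x. (?a x - ?b x)\<^sup>2)" "integrable Plc (\<lambda>x. (?a x + ?b x)\<^sup>2)" using D S unfolding L2_def by auto
  have "(LINT x|Plc. \<bar>lab_gamma X L U x - lab_gamma X L V x\<bar>) = (LINT x|Plc. \<bar>(?a x - ?b x) * (?a x + ?b x)\<bar>)"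
  proof (rule integral_cong_AE)
    show "AE x in Plc. \<bar>lab_gamma X L U x - lab_gamma X L V x\<bar> = \<bar>(?a x - ?b x) * (?a x + ?b x)\<bar>"
      using u(3) v(3) by eventually_elim (simp add: algebra_simps)
  qed (use u(2) v(2) in \<open>auto intro!: borel_measurable_times borel_measurable_diff borel_measurable_add\<close>)
  also have "\<dots> \<le> sqrt (LINT x|Plc. (?a x - ?b x)\<^sup>2) * sqrt (LINT x|Plc. (?a x + ?b x)\<^sup>2)"
    using real_sqrt_le_mono[OF integral_Cauchy_Schwarz(2)[OF dm di]] by (simp add: real_sqrt_mult)
  also have "\<dots> \<le> sqrt (form (U - V)) * (sqrt (form U) + sqrt (form V))"
    using real_sqrt_le_mono[OF d] L2_triangle[OF L] unfolding sq by (intro mult_mono) (auto simp: form_nonneg)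
  finally show ?thesis .
qed

end

section \<open>Pulling back cylinder functions\<close>

context lifted_config_space
begin

lemma pull_back_AE:
  assumes u: "u \<in> Cyl X"
  shows "AE x in Plc. lab_gamma_defined X L (pull_back X u) x \<and> lab_gamma X L (pull_back X u) x = cyl_gamma X L u u (T x) \<and>
    0 \<le> cyl_gamma X L u u (T x) \<and> pull_back X u x = u (T x)"
  using AE_T_lcf[OF lab_gamma_cyl_gamma[OF u]]
proof eventually_elim
  case (elim x)
  then have x: "x \<in> lcf_inf X" by blast
  have T: "T x = unlabel X (\<infinity>, x)" unfolding T_def using x by simp
  from elim x show ?case unfolding T pull_back_def by blast
qed

text \<open>
  The value of the last integral is the same for all labeling maps; this is the uniform bound in the
  definition of pre-Sobolev functions.
\<close>

lemma pull_back_bounds: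
  assumes u: "u \<in> Cyl X"
  shows "pull_back X u \<in> borel_measurable (restrict_space Plc (lcf_inf X))"
    "AE x in Pl. lab_gamma_defined X L (pull_back X u) x"
    "(\<lambda>x. \<bar>pull_back X u x\<bar> + sqrt (lab_gamma X L (pull_back X u) x)) \<in> L2 Plc"
    "(LINT x|Plc. (\<bar>pull_back X u x\<bar> + sqrt (lab_gamma X L (pull_back X u) x))\<^sup>2) =
      (LINT \<gamma>|\<mu>. (\<bar>u \<gamma>\<bar> + sqrt (cyl_gamma X L u u \<gamma>))\<^sup>2)"
proof -
  let ?U = "pull_back X u" and ?G = "cyl_gamma X L u u"
  note um = Cyl_measurable[OF u] and Gi = cyl_gamma_integrable[OF u u] and AE = pull_back_AE[OF u]
  have "(\<lambda>x. u (T x)) \<in> borel_measurable (restrict_space Plc (lcf_inf X))"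
    by (rule measurable_restrict_space1[OF measurable_compose[OF T_measurable um]])
  then show "?U \<in> borel_measurable (restrict_space Plc (lcf_inf X))"
    by (rule measurable_cong[THEN iffD1, rotated]) (auto simp: space_restrict_space T_def pull_back_def)
  have "AE x in Plc. lab_gamma_defined X L ?U x" using AE by eventually_elim simp
  then show "AE x in Pl. lab_gamma_defined X L ?U x" by (simp add: AE_Pc)
  have nn: "AE \<gamma> in \<mu>. 0 \<le> ?G \<gamma>"
    by (rule AE_labeledI) (use lab_gamma_cyl_gamma[OF u] in \<open>eventually_elim, blast\<close>)
  obtain B where B: "\<And>\<gamma>. \<gamma> \<in> Configs X \<Longrightarrow> \<bar>u \<gamma>\<bar> \<le> B" using Cyl_bounded[OF u] by blast
  have ui: "integrable \<mu> (\<lambda>\<gamma>. \<bar>u \<gamma>\<bar>\<^sup>2)"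
  proof (rule integrable_const_bound[of _ "B\<^sup>2"])
    show "AE \<gamma> in \<mu>. norm (\<bar>u \<gamma>\<bar>\<^sup>2) \<le> B\<^sup>2"
      using AE_space
    proof eventually_elim
      case (elim \<gamma>)
      then have "\<bar>u \<gamma>\<bar>\<^sup>2 \<le> B\<^sup>2" using B space_\<mu> by (intro power_mono) auto
      then show ?case by simp
    qed
    show "(\<lambda>\<gamma>. \<bar>u \<gamma>\<bar>\<^sup>2) \<in> borel_measurable \<mu>" using um by (intro borel_measurable_power borel_measurable_abs)
  qed
  have Gm: "?G \<in> borel_measurable \<mu>" using Gi by auto
  have "integrable \<mu> (\<lambda>\<gamma>. (sqrt (?G \<gamma>))\<^sup>2)"
    by (rule iffD1[OF integrable_cong_AE Gi]) (use Gm nn in \<open>auto elim!: eventually_mono\<close>)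
  then have L: "(\<lambda>\<gamma>. \<bar>u \<gamma>\<bar> + sqrt (?G \<gamma>)) \<in> L2 \<mu>" using ui um Gm by (intro L2_add) (auto simp: L2_def)
  then have hm: "(\<lambda>\<gamma>. \<bar>u \<gamma>\<bar> + sqrt (?G \<gamma>)) \<in> borel_measurable \<mu>"
    and hi: "integrable \<mu> (\<lambda>\<gamma>. (\<bar>u \<gamma>\<bar> + sqrt (?G \<gamma>))\<^sup>2)" unfolding L2_def by auto
  have e: "AE x in Plc. \<bar>u (T x)\<bar> + sqrt (?G (T x)) = \<bar>?U x\<bar> + sqrt (lab_gamma X L ?U x)" using AE by eventually_elim simp
  then have e2: "AE x in Plc. (\<bar>u (T x)\<bar> + sqrt (?G (T x)))\<^sup>2 = (\<bar>?U x\<bar> + sqrt (lab_gamma X L ?U x))\<^sup>2" by eventually_elim simp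
  have m: "(\<lambda>x. \<bar>?U x\<bar> + sqrt (lab_gamma X L ?U x)) \<in> borel_measurable Plc"
    by (rule Plc_measurable_AE[OF measurable_compose[OF T_measurable hm] e])
  have Ti: "integrable Plc (\<lambda>x. (\<bar>u (T x)\<bar> + sqrt (?G (T x)))\<^sup>2)"
    using integrable_T[of "\<lambda>\<gamma>. (\<bar>u \<gamma>\<bar> + sqrt (?G \<gamma>))\<^sup>2"] hi by auto
  have "integrable Plc (\<lambda>x. (\<bar>?U x\<bar> + sqrt (lab_gamma X L ?U x))\<^sup>2)"
    by (rule iffD1[OF integrable_cong_AE Ti]) (use Ti m e2 in auto)
  then show "(\<lambda>x. \<bar>?U x\<bar> + sqrt (lab_gamma X L ?U x)) \<in> L2 Plc" unfolding L2_def using m by simp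
  have "(LINT x|Plc. (\<bar>?U x\<bar> + sqrt (lab_gamma X L ?U x))\<^sup>2) = (LINT x|Plc. (\<bar>u (T x)\<bar> + sqrt (?G (T x)))\<^sup>2)"
    by (rule integral_cong_AE) (use Ti m e2 in \<open>auto elim!: eventually_mono\<close>)
  also have "\<dots> = (LINT \<gamma>|\<mu>. (\<bar>u \<gamma>\<bar> + sqrt (?G \<gamma>))\<^sup>2)" by (rule integral_T) (use hi in auto)
  finally show "(LINT x|Plc. (\<bar>?U x\<bar> + sqrt (lab_gamma X L ?U x))\<^sup>2) = (LINT \<gamma>|\<mu>. (\<bar>u \<gamma>\<bar> + sqrt (?G \<gamma>))\<^sup>2)" .
qed

lemma pull_back_pre_sobolev: assumes u: "u \<in> Cyl X" shows "pre_sobolev X \<mu> L (pull_back X u)"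
proof -
  obtain B where B: "\<And>\<gamma>. \<gamma> \<in> Configs X \<Longrightarrow> \<bar>u \<gamma>\<bar> \<le> B" using Cyl_bounded[OF u] by blast
  have "bounded (pull_back X u ` lcf_inf X)"
    unfolding bounded_real using B lcf_inf_Configs by (auto simp: pull_back_def)
  moreover have "lifted_config_space X \<mu> l' L" if "labeling_map X \<mu> l'" for l' by unfold_locales (rule that)
  note b = lifted_config_space.pull_back_bounds[OF this u]
  ultimately show ?thesis unfolding pre_sobolev_def
    using b(1,2,3) eq_refl[OF arg_cong[OF b(4), where f = sqrt]]
    by (intro conjI allI impI exI[of _ "sqrt (LINT \<gamma>|\<mu>. (\<bar>u \<gamma>\<bar> + sqrt (cyl_gamma X L u u \<gamma>))\<^sup>2)"])
qed

lemma nrm_pull_back: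
  assumes u: "u \<in> Cyl X"
  shows "form (pull_back X u) = (LINT \<gamma>|\<mu>. cyl_gamma X L u u \<gamma>)"
    "nrm (pull_back X u) = sqrt ((LINT \<gamma>|\<mu>. cyl_gamma X L u u \<gamma>) + (LINT \<gamma>|\<mu>. (u \<gamma>)\<^sup>2))"
proof -
  note p = pre_sobolev_good[OF pull_back_pre_sobolev[OF u]] and um = Cyl_measurable[OF u] and AE = pull_back_AE[OF u]
  have Gm: "cyl_gamma X L u u \<in> borel_measurable \<mu>" using cyl_gamma_integrable[OF u u] by auto
  have "(LINT x|Plc. lab_gamma X L (pull_back X u) x) = (LINT x|Plc. cyl_gamma X L u u (T x))"
    by (rule integral_cong_AE)
      (use p(2) measurable_compose[OF T_measurable Gm] AE in \<open>auto elim!: eventually_mono\<close>)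
  then show 1: "form (pull_back X u) = (LINT \<gamma>|\<mu>. cyl_gamma X L u u \<gamma>)" unfolding p(4) integral_T[OF Gm] .
  have "pull_back X u \<in> L2 Plc" using p(1) unfolding good_def by simp
  then have "(\<lambda>x. (pull_back X u x)\<^sup>2) \<in> borel_measurable Plc" unfolding L2_def by auto
  moreover have "AE x in Plc. (pull_back X u x)\<^sup>2 = (u (T x))\<^sup>2" using AE by eventually_elim simp
  ultimately have "(LINT x|Plc. (pull_back X u x)\<^sup>2) = (LINT x|Plc. (u (T x))\<^sup>2)"
    by (intro integral_cong_AE measurable_compose[OF T_measurable borel_measurable_power[OF um]])
  also have "\<dots> = (LINT \<gamma>|\<mu>. (u \<gamma>)\<^sup>2)" by (rule integral_T[OF borel_measurable_power[OF um]])
  finally show "nrm (pull_back X u) = sqrt ((LINT \<gamma>|\<mu>. cyl_gamma X L u u \<gamma>) + (LINT \<gamma>|\<mu>. (u \<gamma>)\<^sup>2))"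
    unfolding lab_norm_def 1 by simp
qed

abbreviation null_rel :: "((nat \<Rightarrow> (nat \<Rightarrow> 'a) \<Rightarrow> real) \<times> (nat \<Rightarrow> (nat \<Rightarrow> 'a) \<Rightarrow> real)) set" where
  "null_rel \<equiv> {(Us, Vs). Us \<in> lab_cauchy X \<mu> L l \<and> Vs \<in> lab_cauchy X \<mu> L l \<and> (\<lambda>n. nrm (Us n - Vs n)) \<longlonglongrightarrow> 0}"

lemma lab_cauchy_good: "Us \<in> lab_cauchy X \<mu> L l \<Longrightarrow> good (Us n)"
  unfolding lab_cauchy_def using pre_sobolev_good(1) by blast

lemma equiv_null_rel: "equiv (lab_cauchy X \<mu> L l) null_rel"
proof (rule equivI)
  show "null_rel \<subseteq> lab_cauchy X \<mu> L l \<times> lab_cauchy X \<mu> L l" by blast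
  show "refl_on (lab_cauchy X \<mu> L l) null_rel"
    unfolding refl_on_def using nrm_self[OF lab_cauchy_good] by auto
  show "sym null_rel"
    unfolding sym_def using nrm_sym[OF lab_cauchy_good lab_cauchy_good] by simp
  show "trans null_rel"
  proof (rule transI)
    fix Us Vs Ws assume "(Us, Vs) \<in> null_rel" "(Vs, Ws) \<in> null_rel"
    then have c: "Us \<in> lab_cauchy X \<mu> L l" "Vs \<in> lab_cauchy X \<mu> L l" "Ws \<in> lab_cauchy X \<mu> L l"
      and "(\<lambda>n. nrm (Us n - Vs n)) \<longlonglongrightarrow> 0" "(\<lambda>n. nrm (Vs n - Ws n)) \<longlonglongrightarrow> 0" by auto
    then have lim: "(\<lambda>n. nrm (Us n - Vs n) + nrm (Vs n - Ws n)) \<longlonglongrightarrow> 0" by (intro tendsto_add_zero)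
    have "(\<lambda>n. nrm (Us n - Ws n)) \<longlonglongrightarrow> 0"
    proof (rule tendsto_sandwich[OF _ _ tendsto_const lim])
      show "\<forall>\<^sub>F n in sequentially. 0 \<le> nrm (Us n - Ws n)" using nrm_nonneg by simp
      show "\<forall>\<^sub>F n in sequentially. nrm (Us n - Ws n) \<le> nrm (Us n - Vs n) + nrm (Vs n - Ws n)"
        using nrm_triangle[OF lab_cauchy_good[OF c(1)] lab_cauchy_good[OF c(2)] lab_cauchy_good[OF c(3)]] by simp
    qed
    then show "(Us, Ws) \<in> null_rel" using c by simp
  qed
qed

end

section \<open>Independence of the lifting and the isometry\<close>

text \<open>
  The lifting \<open>L0\<close> defines the form on configurations, \<open>L\<close> the one on labeled configurations; facts on the
  latter carry the prefix \<open>K\<close>.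
\<close>

locale two_liftings = closable_config_space X \<mu> l L0 + K: lifted_config_space X \<mu> l L
  for X :: "'a diffusion_space" and \<mu> l L0 L
begin

lemma star_lift_indep:
  assumes f: "f \<in> core X" "g \<in> core X" shows "AE \<gamma> in \<mu>. star (L (sqf X f g)) \<gamma> = star (L0 (sqf X f g)) \<gamma>"
proof (rule star_cong_AE)
  note F = sqf_Linf[OF f]
  show "L (sqf X f g) \<in> borel_measurable m" "L0 (sqf X f g) \<in> borel_measurable m"
    by (rule K.lift_measurable[OF F] lift_measurable[OF F])+
  show "AE z in m. L (sqf X f g) z = L0 (sqf X f g) z"
    using K.lift_AE[OF F] lift_AE[OF F] by eventually_elim simp
qed

lemma cyl_gamma_indep: assumes "u \<in> Cyl X" shows "AE \<gamma> in \<mu>. cyl_gamma X L u u \<gamma> = cyl_gamma X L0 u u \<gamma>"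
proof -
  obtain k F f where d: "(SOME d. cyl_rep X u d) = (k, F, f)" by (metis prod_cases3)
  have f: "\<And>i. i < k \<Longrightarrow> f i \<in> core X" using cyl_repD(2)[OF Cyl_some_rep[OF assms, unfolded d]] by blast
  have "AE \<gamma> in \<mu>. \<forall>i\<in>{..<k}. \<forall>j\<in>{..<k}. star (L (sqf X (f i) (f j))) \<gamma> = star (L0 (sqf X (f i) (f j))) \<gamma>"
    using f star_lift_indep by (intro AE_finite_allI) auto
  then show ?thesis unfolding cyl_gamma_def d cyl_gamma_rep_eq K.cyl_gamma_rep_eq
    by eventually_elim (intro sum.cong, auto)
qed

lemma pull_back_norm:
  assumes u: "u \<in> Cyl X"
  shows "K.form (pull_back X u) = conf.Q u u" "K.nrm (pull_back X u) = sqrt (conf.Q u u + (LINT \<gamma>|\<mu>. (u \<gamma>)\<^sup>2))"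
proof -
  have "(LINT \<gamma>|\<mu>. cyl_gamma X L u u \<gamma>) = conf.Q u u"
    by (rule integral_cong_AE) (use K.cyl_gamma_integrable[OF u u] cyl_gamma_integrable[OF u u] cyl_gamma_indep[OF u] in auto)
  then show "K.form (pull_back X u) = conf.Q u u" "K.nrm (pull_back X u) = sqrt (conf.Q u u + (LINT \<gamma>|\<mu>. (u \<gamma>)\<^sup>2))"
    using K.nrm_pull_back[OF u] by simp_all
qed

lemma pull_back_diff: "pull_back X u - pull_back X v = pull_back X (u - v)"
  by (simp add: fun_eq_iff pull_back_def)

lemma pull_back_diff_tendsto:
  assumes u: "u \<in> L2 \<mu>" and us: "conf.approx u us" and vs: "conf.approx u vs"
  shows "(\<lambda>n. K.nrm (pull_back X (us n) - pull_back X (vs n))) \<longlonglongrightarrow> 0"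
proof -
  note C = conf.approxD(1)[OF us] conf.approxD(1)[OF vs]
  note d = conf.C_diff[OF C]
  have "(\<lambda>n. conf.Q (us n - vs n) (us n - vs n)) \<longlonglongrightarrow> 0"
    using tendsto_power[OF conf.approx_unique[OF u us vs], of 2] conf.Q_nonneg[OF d] by (simp add: conf.N_def)
  moreover have "L2_tendsto \<mu> (\<lambda>n x. us n x - vs n x) (\<lambda>x. u x - u x)"
    by (rule L2_tendsto_diff[OF conf.C_L2[OF C(1)] u conf.C_L2[OF C(2)] u conf.approxD(3)[OF us] conf.approxD(3)[OF vs]])
  ultimately have "(\<lambda>n. sqrt (conf.Q (us n - vs n) (us n - vs n) + (LINT \<gamma>|\<mu>. ((us n - vs n) \<gamma>)\<^sup>2))) \<longlonglongrightarrow> sqrt (0 + 0)"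
    by (intro tendsto_intros) (simp_all add: L2_tendsto_def)
  then show ?thesis unfolding pull_back_diff pull_back_norm(2)[OF d] by simp
qed

lemma pull_back_cauchy:
  assumes u: "u \<in> L2 \<mu>" and us: "conf.approx u us" shows "(\<lambda>n. pull_back X (us n)) \<in> lab_cauchy X \<mu> L l"
proof -
  note C = conf.approxD(1)[OF us]
  have "\<exists>n0. \<forall>i\<ge>n0. \<forall>j\<ge>n0. K.nrm (pull_back X (us i) - pull_back X (us j)) < e" if e: "e > 0" for e
  proof -
    have e2: "e\<^sup>2 / 8 > 0" using e by simp
    obtain n1 where n1: "\<And>i j. i \<ge> n1 \<Longrightarrow> j \<ge> n1 \<Longrightarrow> conf.Q (us i - us j) (us i - us j) < e\<^sup>2 / 8"
      using conf.approxD(2)[OF us] e2 unfolding form_cauchy_def by blast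
    obtain n2 where n2: "\<And>i. i \<ge> n2 \<Longrightarrow> (LINT \<gamma>|\<mu>. (us i \<gamma> - u \<gamma>)\<^sup>2) < e\<^sup>2 / 8"
      using order_tendstoD(2)[OF conf.approxD(3)[OF us, unfolded L2_tendsto_def] e2] unfolding eventually_sequentially by blast
    have "K.nrm (pull_back X (us i) - pull_back X (us j)) < e" if i: "i \<ge> max n1 n2" and j: "j \<ge> max n1 n2" for i j
    proof -
      have a: "(\<lambda>\<gamma>. us i \<gamma> - u \<gamma>) \<in> L2 \<mu>" "(\<lambda>\<gamma>. u \<gamma> - us j \<gamma>) \<in> L2 \<mu>" by (rule L2_diff conf.C_L2[OF C] u)+
      have "(LINT \<gamma>|\<mu>. ((us i - us j) \<gamma>)\<^sup>2) \<le> 2 * (LINT \<gamma>|\<mu>. (us i \<gamma> - u \<gamma>)\<^sup>2) + 2 * (LINT \<gamma>|\<mu>. (us j \<gamma> - u \<gamma>)\<^sup>2)"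
        using L2_sq_sum_le[OF a] by (simp add: power2_commute)
      then have "conf.Q (us i - us j) (us i - us j) + (LINT \<gamma>|\<mu>. ((us i - us j) \<gamma>)\<^sup>2) < e\<^sup>2"
        using n1[of i j] n2[of i] n2[of j] i j e2 unfolding max.bounded_iff by linarith
      then have "sqrt (conf.Q (us i - us j) (us i - us j) + (LINT \<gamma>|\<mu>. ((us i - us j) \<gamma>)\<^sup>2)) < sqrt (e\<^sup>2)" by (rule real_sqrt_less_mono)
      then show ?thesis unfolding pull_back_diff pull_back_norm(2)[OF conf.C_diff[OF C C]] using e by simp
    qed
    then show ?thesis by blast
  qed
  then show ?thesis unfolding lab_cauchy_def using K.pull_back_pre_sobolev[OF C] by blast
qed

text \<open>The element of the completion determined by an approximating sequence of cylinder functions.\<close>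

lemma lift_star_eq:
  assumes u: "u \<in> L2 \<mu>" and us: "conf.approx u us"
  shows "lift_star X \<mu> L0 L l u = K.null_rel `` {\<lambda>n. pull_back X (us n)}"
  unfolding lift_star_def cyl_form_eq
proof (rule the_equality)
  let ?Us = "\<lambda>n. pull_back X (us n)"
  have c: "?Us \<in> lab_cauchy X \<mu> L l" by (rule pull_back_cauchy[OF u us])
  have cl: "K.null_rel `` {?Us} \<in> K_inf X \<mu> L l" unfolding K_inf_def by (rule quotientI[OF c])
  have "(\<lambda>n. pull_back X (vs n)) \<in> K.null_rel `` {?Us}" if vs: "conf.approx u vs" for vs
    using c pull_back_cauchy[OF u vs] pull_back_diff_tendsto[OF u us vs] by simp
  with cl show "K.null_rel `` {?Us} \<in> K_inf X \<mu> L l \<and>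
      (\<forall>vs. conf.approx u vs \<longrightarrow> (\<lambda>n. pull_back X (vs n)) \<in> K.null_rel `` {?Us})" by blast
  fix \<kappa> assume \<kappa>: "\<kappa> \<in> K_inf X \<mu> L l \<and> (\<forall>vs. conf.approx u vs \<longrightarrow> (\<lambda>n. pull_back X (vs n)) \<in> \<kappa>)"
  then have "?Us \<in> \<kappa>" using us by blast
  moreover have "?Us \<in> K.null_rel `` {?Us}" by (rule equiv_class_self[OF K.equiv_null_rel c])
  ultimately show "\<kappa> = K.null_rel `` {?Us}"
    using quotient_disj[OF K.equiv_null_rel, of \<kappa> "K.null_rel `` {?Us}"] \<kappa> cl unfolding K_inf_def by blast
qed

text \<open>
  Along every representing sequence of the extended pull-back of \<open>u\<close>, the square fields converge
  to the square field of \<open>u\<close>.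
\<close>

lemma lift_star_gamma:
  assumes u: "u \<in> conf.D" and g: "conf.G_value u g" and Us: "Us \<in> lift_star X \<mu> L0 L l u"
  shows "\<And>n. pre_sobolev X \<mu> L (Us n)" "L1_tendsto Plc (\<lambda>n. lab_gamma X L (Us n)) (\<lambda>x. g (T x))"
proof -
  obtain us where us: "conf.approx u us" using conf.D_approx[OF u] by blast
  note uL = conf.D_L2[OF u] and C = conf.approxD(1)[OF us]
  let ?Vs = "\<lambda>n. pull_back X (us n)"
  have c: "Us \<in> lab_cauchy X \<mu> L l" "?Vs \<in> lab_cauchy X \<mu> L l" and d: "(\<lambda>n. K.nrm (?Vs n - Us n)) \<longlonglongrightarrow> 0"
    using Us unfolding lift_star_eq[OF uL us] by auto
  show pU: "\<And>n. pre_sobolev X \<mu> L (Us n)" using c(1) unfolding lab_cauchy_def by blast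
  have pV: "\<And>n. pre_sobolev X \<mu> L (?Vs n)" using c(2) unfolding lab_cauchy_def by blast
  note gU = K.pre_sobolev_good[OF pU] and gV = K.pre_sobolev_good[OF pV]
  have gi: "integrable \<mu> g" using g unfolding conf.G_value_def by blast
  then have gm: "g \<in> borel_measurable \<mu>" by auto
  have gT: "integrable Plc (\<lambda>x. g (T x))" using integrable_T[OF gm] gi by simp
  have lim: "L1_tendsto \<mu> (\<lambda>n. cyl_gamma X L0 (us n) (us n)) g" by (rule conf.G_value_tendsto[OF u g us])
  have 1: "L1_tendsto Plc (\<lambda>n. lab_gamma X L (?Vs n)) (\<lambda>x. g (T x))"
  proof -
    have "(LINT x|Plc. \<bar>lab_gamma X L (?Vs n) x - g (T x)\<bar>) = (LINT \<gamma>|\<mu>. \<bar>cyl_gamma X L0 (us n) (us n) \<gamma> - g \<gamma>\<bar>)" for n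
    proof -
      have hm: "(\<lambda>\<gamma>. \<bar>cyl_gamma X L0 (us n) (us n) \<gamma> - g \<gamma>\<bar>) \<in> borel_measurable \<mu>"
        using cyl_gamma_integrable[OF C[of n] C[of n]] gm by auto
      have "AE x in Plc. lab_gamma X L (?Vs n) x = cyl_gamma X L0 (us n) (us n) (T x)"
        using K.pull_back_AE[OF C[of n]] AE_T[OF cyl_gamma_indep[OF C[of n]]] by eventually_elim simp
      then have "(LINT x|Plc. \<bar>lab_gamma X L (?Vs n) x - g (T x)\<bar>) = (LINT x|Plc. \<bar>cyl_gamma X L0 (us n) (us n) (T x) - g (T x)\<bar>)"
        by (intro integral_cong_AE)
          (use gV(2)[of n] gT measurable_compose[OF T_measurable hm] in \<open>auto elim!: eventually_mono\<close>)
      also have "\<dots> = (LINT \<gamma>|\<mu>. \<bar>cyl_gamma X L0 (us n) (us n) \<gamma> - g \<gamma>\<bar>)" by (rule integral_T[OF hm])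
      finally show ?thesis .
    qed
    then show ?thesis using lim unfolding L1_tendsto_def by simp
  qed
  show "L1_tendsto Plc (\<lambda>n. lab_gamma X L (Us n)) (\<lambda>x. g (T x))"
  proof (rule L1_tendsto_trans[OF gV(2) gU(2) gT 1])
    let ?a = "\<lambda>n. sqrt (K.form (?Vs n))" and ?d = "\<lambda>n. sqrt (K.form (?Vs n - Us n))"
    have dl: "?d \<longlonglongrightarrow> 0"
      by (rule tendsto_sandwich[OF _ _ tendsto_const d]) (simp_all add: K.form_nonneg K.form_le_nrm)
    have "(\<lambda>n. LINT x|Plc. lab_gamma X L (?Vs n) x) \<longlonglongrightarrow> (LINT x|Plc. g (T x))"
      by (rule L1_tendsto_integral[OF gV(2) gT 1])
    then have al: "?a \<longlonglongrightarrow> sqrt (LINT x|Plc. g (T x))" unfolding gV(4) by (rule tendsto_real_sqrt)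
    have "(\<lambda>n. ?d n * (?a n + (?a n + ?d n))) \<longlonglongrightarrow> 0 * (sqrt (LINT x|Plc. g (T x)) + (sqrt (LINT x|Plc. g (T x)) + 0))"
      by (intro tendsto_intros dl al)
    then have z: "(\<lambda>n. ?d n * (?a n + (?a n + ?d n))) \<longlonglongrightarrow> 0" by simp
    show "(\<lambda>n. LINT x|Plc. \<bar>lab_gamma X L (?Vs n) x - lab_gamma X L (Us n) x\<bar>) \<longlonglongrightarrow> 0"
    proof (rule tendsto_sandwich[OF _ _ tendsto_const z])
      show "\<forall>\<^sub>F n in sequentially. 0 \<le> (LINT x|Plc. \<bar>lab_gamma X L (?Vs n) x - lab_gamma X L (Us n) x\<bar>)" by simp
      show "\<forall>\<^sub>F n in sequentially. (LINT x|Plc. \<bar>lab_gamma X L (?Vs n) x - lab_gamma X L (Us n) x\<bar>) \<le> ?d n * (?a n + (?a n + ?d n))"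
      proof (intro always_eventually allI)
        fix n
        have "(LINT x|Plc. \<bar>lab_gamma X L (?Vs n) x - lab_gamma X L (Us n) x\<bar>) \<le> ?d n * (?a n + sqrt (K.form (Us n)))"
          by (rule K.lab_gamma_L1_diff[OF pV pU])
        also have "\<dots> \<le> ?d n * (?a n + (?a n + ?d n))"
          using K.sqrt_form_triangle[OF gV(1)[of n] gU(1)[of n]] K.form_nonneg by (intro mult_left_mono add_left_mono) auto
        finally show "(LINT x|Plc. \<bar>lab_gamma X L (?Vs n) x - lab_gamma X L (Us n) x\<bar>) \<le> ?d n * (?a n + (?a n + ?d n))" .
      qed
    qed
  qed
qed

lemma lift_star_nonempty: assumes u: "u \<in> conf.D" shows "\<exists>Us. Us \<in> lift_star X \<mu> L0 L l u"
proof -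
  obtain us where us: "conf.approx u us" using conf.D_approx[OF u] by blast
  note uL = conf.D_L2[OF u]
  show ?thesis unfolding lift_star_eq[OF uL us] using equiv_class_self[OF K.equiv_null_rel pull_back_cauchy[OF uL us]] by blast
qed

lemma K_gamma_lift_star:
  assumes u: "u \<in> conf.D" and g: "conf.G_value u g"
  shows "AE x in Plc. K_gamma X \<mu> L l (lift_star X \<mu> L0 L l u) x = g (T x)"
proof -
  let ?\<kappa> = "lift_star X \<mu> L0 L l u"
  let ?P = "\<lambda>h. integrable Plc h \<and> (\<forall>Us\<in>?\<kappa>. L1_tendsto Plc (\<lambda>n. lab_gamma X L (Us n)) h)"
  have gi: "integrable \<mu> g" using g unfolding conf.G_value_def by blast
  then have gT: "integrable Plc (\<lambda>x. g (T x))" using integrable_T[of g] by auto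
  have "?P (\<lambda>x. g (T x))" using gT lift_star_gamma(2)[OF u g] by blast
  then have s: "?P (K_gamma X \<mu> L l ?\<kappa>)" unfolding K_gamma_def by (rule someI[of ?P])
  obtain Us where Us: "Us \<in> ?\<kappa>" using lift_star_nonempty[OF u] by blast
  show ?thesis
    by (rule L1_tendsto_unique[OF K.pre_sobolev_good(2)[OF lift_star_gamma(1)[OF u g Us]] _ gT _ lift_star_gamma(2)[OF u g Us]])
      (use s Us in blast)+
qed

lemma K_form_lift_star:
  assumes u: "u \<in> conf.D" shows "K_form X \<mu> L l (lift_star X \<mu> L0 L l u) = conf.E u u"
proof -
  let ?\<kappa> = "lift_star X \<mu> L0 L l u"
  obtain g where g: "conf.G_value u g" using conf.G_value_exists[OF u] by blast
  have gi: "integrable \<mu> g" using g unfolding conf.G_value_def by blast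
  then have gT: "integrable Plc (\<lambda>x. g (T x))" "(LINT x|Plc. g (T x)) = conf.E u u"
    using integrable_T[of g] integral_T[of g] conf.G_value_integral[OF u g] by auto
  have lim: "(\<lambda>n. K.form (Us n)) \<longlonglongrightarrow> conf.E u u" if Us: "Us \<in> ?\<kappa>" for Us
  proof -
    note s = lift_star_gamma[OF u g Us]
    note p = K.pre_sobolev_good[OF s(1)]
    show ?thesis unfolding p(4) gT(2)[symmetric] by (rule L1_tendsto_integral[OF p(2) gT(1) s(2)])
  qed
  obtain Us where Us: "Us \<in> ?\<kappa>" using lift_star_nonempty[OF u] by blast
  show ?thesis unfolding K_form_def
  proof (rule the_equality)
    show "\<forall>Us\<in>?\<kappa>. (\<lambda>n. K.form (Us n)) \<longlonglongrightarrow> conf.E u u" using lim by blast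
    fix r assume "\<forall>Us\<in>?\<kappa>. (\<lambda>n. K.form (Us n)) \<longlonglongrightarrow> r"
    then show "r = conf.E u u" using lim[OF Us] Us LIMSEQ_unique by blast
  qed
qed

lemma square_field_pull_back:
  assumes u: "u \<in> U_dom X L0 \<mu>" "ess_bounded \<mu> u"
  shows "AE x in Pl. U_gamma X L0 \<mu> u (unlabel X (\<infinity>, x)) = K_gamma X \<mu> L l (lift_star X \<mu> L0 L l u) x"
proof -
  have D: "u \<in> conf.D" using u(1) unfolding U_dom_eq .
  obtain g where g: "conf.G_value u g" using conf.G_value_exists[OF D] by blast
  show ?thesis unfolding AE_Pc[symmetric]
    using AE_T_lcf[OF U_gamma_eq[OF u g]] K_gamma_lift_star[OF D g]
  proof eventually_elim
    case (elim x)
    then show ?case unfolding T_def by simp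
  qed
qed

end

theorem corollary3p61:
  fixes X :: "'a diffusion_space"
    and \<mu> :: "'a measure measure"
    and l :: "'a labeling"
    and L0 :: "('a \<Rightarrow> real) \<Rightarrow> 'a \<Rightarrow> real"
  assumes "topological_local_diffusion_space X"
    and "prob_space \<mu>" and "sets \<mu> = sets (config_algebra X)"
    and "AE \<gamma> in \<mu>. emeasure \<gamma> (pts X) = \<infinity>"
    and "marginally_ac X \<mu>"
    and "strong_lifting X L0" and "closability_assumption X L0 \<mu>"
    and "labeling_map X \<mu> l"
  shows "\<forall>L. strong_lifting X L \<longrightarrow>
      (\<forall>u\<in>U_dom X L0 \<mu>. ess_bounded \<mu> u \<longrightarrow>
         (AE x in label_law X \<mu> l \<infinity>.
            U_gamma X L0 \<mu> u (unlabel X (\<infinity>, x)) =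
            K_gamma X \<mu> L l (lift_star X \<mu> L0 L l u) x)) \<and>
      (\<forall>u\<in>U_dom X L0 \<mu>.
         U_form X L0 \<mu> u u = K_form X \<mu> L l (lift_star X \<mu> L0 L l u))"
proof (intro allI impI conjI ballI)
  fix L assume L: "strong_lifting X L"
  have "\<And>E. E \<in> lring X \<Longrightarrow> (\<integral>\<^sup>+\<gamma>. emeasure \<gamma> E \<partial>\<mu>) < \<infinity>" "closable \<mu> (Cyl X) (cyl_form X L0 \<mu>)"
    using assms(7) unfolding closability_assumption_def by auto
  then interpret two_liftings X \<mu> l L0 L
    using assms(1-6,8) L unfolding two_liftings_def closable_config_space_def closable_config_space_axioms_def
      lifted_config_space_def labeled_config_space_def labeled_config_space_axioms_def config_space_def config_space_axioms_def
      lifting_def lifting_axioms_def diffusion_space_def by blast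
  fix u assume u: "u \<in> U_dom X L0 \<mu>"
  show "AE x in label_law X \<mu> l \<infinity>. U_gamma X L0 \<mu> u (unlabel X (\<infinity>, x)) = K_gamma X \<mu> L l (lift_star X \<mu> L0 L l u) x"
    if "ess_bounded \<mu> u" by (rule square_field_pull_back[OF u that])
  show "U_form X L0 \<mu> u u = K_form X \<mu> L l (lift_star X \<mu> L0 L l u)"
    unfolding U_form_eq using K_form_lift_star u U_dom_eq by simp
qed

end
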